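(* Let $\mathbb G\cong(\mathbb R^n,* )$ be a Carnot group, $\{e_1,\dots,e_{n_1}\}$ an orthonormal basis of its first layer $V_1$, and $\mu$ a Radon measure on $\mathbb G$. Suppose that there are countably many disjoint Borel sets $\{U_i\}_{i\in\mathbb N}$ of $\mathbb G$ covering $\mu$-almost all of $\mathbb G$ and such that for any $i\in\mathbb N$ and any $j=1,\dots,n_1$ there is a $1$-dimensional horizontal normal current $\mathbf T_{i,j}=\tau_{i,j}\eta_{i,j}$ with $\partial\mathbf T_{i,j}=0$, $\mu\llcorner U_i\ll\eta_{i,j}$ and $\tau_{i,j}(x)=\mathscr C(x)[e_j]$ for $\mu$-almost every $x\in U_i$. Then $\mu\ll\mathscr L^n$.
   Context: A Carnot group $\mathbb G$ is a connected, simply connected Lie group with stratified Lie algebra $\mathfrak g=V_1\oplus\dots\oplus V_{\mathfrak s}$ ($[V_1,V_i]=V_{i+1}$ for $i<\mathfrak s$, $[V_1,V_{\mathfrak s}]=\{0\}$), $n_1=\dim V_1$, identified through $\exp$ with $\mathfrak g\cong\mathbb R^n$ endowed with the Baker–Campbell–Hausdorff law $*$; its Haar measure is the Lebesgue measure $\mathscr L^n$. $X_i$ is the left-invariant vector field with $X_i(0)=e_i$, $\mathscr C(x):V_1\to\mathbb R^n$ is the linear map with $\mathscr C(x)[e_i]=X_i(x)$, and $H\mathbb G(x)=\mathrm{span}(X_1(x),\dots,X_{n_1}(x))=\mathscr C(x)[V_1]$. $1$-currents of finite mass on $\mathbb R^n$ are finite $\mathbb R^n$-valued measures, written $\mathbf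 T=\tau\eta$ with $\eta$ a finite positive measure, $\tau\in L^1(\eta;\mathbb R^n)$ and $\tau\ne0$ $\eta$-a.e.; $\langle\mathbf T;\omega\rangle=\int\langle\tau(x);\omega(x)\rangle\,d\eta(x)$ for smooth compactly supported $1$-forms $\omega$, and $\langle\partial\mathbf T;\varphi\rangle=\langle\mathbf T;d\varphi\rangle$ for $\varphi\in C_c^\infty(\mathbb R^n)$. $\mathbf T$ is normal if $\mathbf T$ and $\partial\mathbf T$ have finite mass, and horizontal if $\tau(x)\in H\mathbb G(x)$ for $\eta$-a.e. $x$. *)

theory Defs
  imports "HOL-Analysis.Analysis"
begin

section \<open>The Baker--Campbell--Hausdorff law\<close>

locale lie_bracket =
  fixes br :: "'a::euclidean_space \<Rightarrow> 'a \<Rightarrow> 'a"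
  assumes bilinear_br: "bilinear br"
    and alternating: "br x x = 0"
    and jacobi: "br x (br y z) + br y (br z x) + br z (br x y) = 0"

fun nested_bracket :: "('a::zero \<Rightarrow> 'a \<Rightarrow> 'a) \<Rightarrow> 'a list \<Rightarrow> 'a" where
  "nested_bracket br [] = 0"
| "nested_bracket br [a] = a"
| "nested_bracket br (a # b # w) = br a (nested_bracket br (b # w))"

text \<open>
  The index set of Dynkin's formula: the \<open>k\<close>-tuples of pairs \<open>(p\<^sub>i, q\<^sub>i)\<close> with \<open>p\<^sub>i + q\<^sub>i > 0\<close>,
  of total degree at most \<open>s\<close>.
\<close>

definition dynkin_tuples :: "nat \<Rightarrow> nat \<Rightarrow> (nat \<times> nat) list set" where
  "dynkin_tuples s k =
     {ps. length ps = k \<and> (\<forall>(p, q) \<in> set ps. p + q > 0) \<and> (\<Sum>(p, q) \<leftarrow> ps. p + q) \<le> s}"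

lemma finite_dynkin_tuples: "finite (dynkin_tuples s k)"
proof (rule finite_subset)
  show "dynkin_tuples s k \<subseteq> {ps. set ps \<subseteq> {..s} \<times> {..s} \<and> length ps = k}"
  proof
    fix ps assume ps: "ps \<in> dynkin_tuples s k"
    have "p \<le> s \<and> q \<le> s" if "(p, q) \<in> set ps" for p q
    proof -
      have "p + q \<le> (\<Sum>(p, q) \<leftarrow> ps. p + q)"
        using that by (intro member_le_sum_list) (force, simp)
      then show ?thesis using ps by (auto simp: dynkin_tuples_def)
    qed
    then show "ps \<in> {ps. set ps \<subseteq> {..s} \<times> {..s} \<and> length ps = k}"
      using ps by (auto simp: dynkin_tuples_def)
  qed
qed (auto intro: finite_lists_length_eq)

text \<open>
  Dynkin's form of the Baker--Campbell--Hausdorff series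
  \<open>log (exp x exp y) = x + y + [x, y] / 2 + \<dots>\<close>.  In a Lie algebra of step \<open>s\<close> the brackets of
  more than \<open>s\<close> factors vanish, so truncating at total degree \<open>s\<close> loses nothing.
\<close>

definition bch :: "('a::real_vector \<Rightarrow> 'a \<Rightarrow> 'a) \<Rightarrow> nat \<Rightarrow> 'a \<Rightarrow> 'a \<Rightarrow> 'a" where
  "bch br s x y =
     (\<Sum>k\<in>{1..s}. ((- 1) ^ (k - 1) / real k) *\<^sub>R
       (\<Sum>ps\<in>dynkin_tuples s k.
          (1 / (real (\<Sum>(p, q) \<leftarrow> ps. p + q) * (\<Prod>(p, q) \<leftarrow> ps. fact p * fact q))) *\<^sub>R
          nested_bracket br (concat (map (\<lambda>(p, q). replicate p x @ replicate q y) ps))))"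


section \<open>Carnot groups in exponential coordinates\<close>

text \<open>
  The layers are \<open>V 1, \<dots>, V s\<close>.  The group axioms (with neutral element \<open>0\<close> and inverse \<open>- x\<close>) belong
  to the notion of a Lie group and are listed for that reason; for the Baker--Campbell--Hausdorff
  law of a nilpotent Lie algebra they hold automatically, so they exclude nothing.  Smoothness of
  the operations is not listed because \<open>bch\<close> is polynomial.
\<close>

locale carnot_group = lie_bracket br + group gmult "0" uminus
  for br :: "'a::euclidean_space \<Rightarrow> 'a \<Rightarrow> 'a" and gmult :: "'a \<Rightarrow> 'a \<Rightarrow> 'a" +
  fixes V :: "nat \<Rightarrow> 'a set" and s :: nat
  assumes step_pos: "1 \<le> s"
    and subspace_layer: "i \<in> {1..s} \<Longrightarrow> subspace (V i)"
    and direct_sum: "\<exists>!v. v \<in> Pi\<^sub>E {1..s} V \<and> x = (\<Sum>i\<in>{1..s}. v i)"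
    and bracket_layer: "i \<in> {1..<s} \<Longrightarrow> span {br a b | a b. a \<in> V 1 \<and> b \<in> V i} = V (Suc i)"
    and bracket_last: "a \<in> V 1 \<Longrightarrow> b \<in> V s \<Longrightarrow> br a b = 0"
    and gmult_bch: "gmult x y = bch br s x y"

definition left_invariant :: "('a::real_normed_vector \<Rightarrow> 'a \<Rightarrow> 'a) \<Rightarrow> ('a \<Rightarrow> 'a) \<Rightarrow> bool" where
  "left_invariant gmult X \<longleftrightarrow>
     (\<forall>x y. frechet_derivative (\<lambda>z. gmult x z) (at y) (X y) = X (gmult x y))"

text \<open>
  The left-invariant vector field with value \<open>v\<close> at the neutral element \<open>0\<close>; the name is justified by
  \<open>left_field_unique\<close> below.
\<close>

definition left_field :: "('a::real_normed_vector \<Rightarrow> 'a \<Rightarrow> 'a) \<Rightarrow> 'a \<Rightarrow> 'a \<Rightarrow> 'a" where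
  "left_field gmult v x = frechet_derivative (\<lambda>z. gmult x z) (at 0) v"

lemma nested_bracket_differentiable:
  fixes br :: "'a::euclidean_space \<Rightarrow> 'a \<Rightarrow> 'a" and fs :: "('a \<Rightarrow> 'a) list"
  assumes "bilinear br" and "\<And>f. f \<in> set fs \<Longrightarrow> f differentiable (at z)"
  shows "(\<lambda>z. nested_bracket br (map (\<lambda>f. f z) fs)) differentiable (at z)"
  using assms(2)
proof (induction fs rule: induct_list012)
  case (3 f g fs)
  interpret bounded_bilinear br
    using assms(1) by (simp add: bilinear_conv_bounded_bilinear)
  have "(\<lambda>z. nested_bracket br (map (\<lambda>f. f z) (g # fs))) differentiable (at z)"
    using 3 by simp
  moreover have "f differentiable (at z)" using 3 by simp
  ultimately have "(\<lambda>z. br (f z) (nested_bracket br (map (\<lambda>f. f z) (g # fs)))) differentiable (at z)"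
    using FDERIV unfolding differentiable_def by blast
  then show ?case by simp
qed auto

context carnot_group
begin

lemma gmult_differentiable: "(\<lambda>z. gmult x z) differentiable (at z)"
proof -
  have "(\<lambda>z. nested_bracket br (concat (map (\<lambda>(p, q). replicate p x @ replicate q z) ps)))
          differentiable (at z)" for ps :: "(nat \<times> nat) list"
  proof -
    define fs where "fs = concat (map (\<lambda>(p, q). replicate p (\<lambda>_. x) @ replicate q (\<lambda>z. z)) ps)"
    have "concat (map (\<lambda>(p, q). replicate p x @ replicate q z) ps) = map (\<lambda>f. f z) fs" for z
      by (auto simp: fs_def map_concat o_def case_prod_unfold)
    moreover have "f differentiable (at z)" if "f \<in> set fs" for f
      using that by (auto simp: fs_def)
    ultimately show ?thesis
      using nested_bracket_differentiable[OF bilinear_br, of fs z] by simp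
  qed
  then show ?thesis
    unfolding gmult_bch bch_def
    by (intro differentiable_sum differentiable_scaleR differentiable_const ballI)
      (auto simp: finite_dynkin_tuples)
qed

lemma left_field_unique: "left_invariant gmult X \<and> X 0 = v \<longleftrightarrow> X = left_field gmult v"
proof
  assume X: "left_invariant gmult X \<and> X 0 = v"
  then have "frechet_derivative (\<lambda>z. gmult x z) (at 0) (X 0) = X (gmult x 0)" for x
    unfolding left_invariant_def by blast
  then show "X = left_field gmult v"
    using X by (auto simp: left_field_def)
next
  assume X: "X = left_field gmult v"
  have "frechet_derivative (\<lambda>z. gmult x z) (at y) (left_field gmult v y) = left_field gmult v (gmult x y)"
    for x y
  proof -
    have "(\<lambda>z. gmult (gmult x y) z) = (\<lambda>z. gmult x z) \<circ> (\<lambda>z. gmult y z)"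
      by (auto simp: assoc)
    then have "frechet_derivative (\<lambda>z. gmult (gmult x y) z) (at 0) =
        frechet_derivative (\<lambda>z. gmult x z) (at y) \<circ> frechet_derivative (\<lambda>z. gmult y z) (at 0)"
      using frechet_derivative_compose[of "\<lambda>z. gmult y z" 0 "\<lambda>z. gmult x z"] gmult_differentiable
      by (metis right_neutral)
    then show ?thesis by (simp add: left_field_def)
  qed
  moreover have "(\<lambda>z. gmult 0 z) = (\<lambda>z. z)" by auto
  then have "left_field gmult v 0 = v" by (simp add: left_field_def)
  ultimately show "left_invariant gmult X \<and> X 0 = v"
    by (simp add: X left_invariant_def)
qed

end

text \<open>
  \<open>e 1, \<dots>, e m\<close> is an orthonormal basis of \<open>W\<close>.
\<close>

definition orthonormal_basis_of :: "'a::euclidean_space set \<Rightarrow> nat \<Rightarrow> (nat \<Rightarrow> 'a) \<Rightarrow> bool" where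
  "orthonormal_basis_of W m e \<longleftrightarrow>
     (\<forall>i\<in>{1..m}. \<forall>j\<in>{1..m}. e i \<bullet> e j = (if i = j then 1 else 0)) \<and> span (e ` {1..m}) = W"

text \<open>
  The linear map \<open>C x\<close> on the first layer with \<open>C x (e i) = X\<^sub>i x\<close>, for an orthonormal basis
  \<open>e 1, \<dots>, e m\<close> of that layer; arguments outside the layer are first projected orthogonally.
\<close>

definition horizontal_map ::
    "('a::euclidean_space \<Rightarrow> 'a \<Rightarrow> 'a) \<Rightarrow> nat \<Rightarrow> (nat \<Rightarrow> 'a) \<Rightarrow> 'a \<Rightarrow> 'a \<Rightarrow> 'a" where
  "horizontal_map gmult m e x v = (\<Sum>i\<in>{1..m}. (v \<bullet> e i) *\<^sub>R left_field gmult (e i) x)"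

lemma horizontal_map_basis:
  assumes "orthonormal_basis_of W m e" and "j \<in> {1..m}"
  shows "horizontal_map gmult m e x (e j) = left_field gmult (e j) x"
proof -
  have "horizontal_map gmult m e x (e j) =
      (\<Sum>i\<in>{1..m}. if i = j then left_field gmult (e i) x else 0)"
    unfolding horizontal_map_def using assms
    by (intro sum.cong) (auto simp: orthonormal_basis_of_def)
  then show ?thesis using assms(2) by simp
qed

definition horizontal_space ::
    "('a::euclidean_space \<Rightarrow> 'a \<Rightarrow> 'a) \<Rightarrow> nat \<Rightarrow> (nat \<Rightarrow> 'a) \<Rightarrow> 'a \<Rightarrow> 'a set" where
  "horizontal_space gmult m e x = span ((\<lambda>i. left_field gmult (e i) x) ` {1..m})"


section \<open>One-dimensional currents\<close>

text \<open>
  \<open>C\<^sup>k\<close> on a finite-dimensional space, through iterated directional derivatives.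
\<close>

primrec continuously_differentiable ::
    "nat \<Rightarrow> ('a::euclidean_space \<Rightarrow> 'b::real_normed_vector) \<Rightarrow> bool" where
  "continuously_differentiable 0 f \<longleftrightarrow> continuous_on UNIV f"
| "continuously_differentiable (Suc k) f \<longleftrightarrow>
     (\<forall>x. f differentiable (at x)) \<and>
     (\<forall>v. continuously_differentiable k (\<lambda>x. frechet_derivative f (at x) v))"

text \<open>
  \<open>test_functions\<close> serves both for \<open>0\<close>-forms (\<open>'b = real\<close>) and for \<open>1\<close>-forms
  (\<open>'b = 'a \<Rightarrow>\<^sub>L real\<close>, whose operator norm is the comass of covectors).
\<close>

definition test_functions :: "('a::euclidean_space \<Rightarrow> 'b::real_normed_vector) set" where
  "test_functions =
     {f. (\<forall>k. continuously_differentiable k f) \<and> compact (closure {x. f x \<noteq> 0})}"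

definition exterior_derivative ::
    "('a::euclidean_space \<Rightarrow> real) \<Rightarrow> 'a \<Rightarrow> 'a \<Rightarrow>\<^sub>L real" where
  "exterior_derivative \<phi> x = Blinfun (frechet_derivative \<phi> (at x))"

text \<open>
  The current \<open>\<tau>\<eta>\<close> and boundaries are represented by the linear functionals they define on test forms.
\<close>

definition current ::
    "('a::euclidean_space \<Rightarrow> 'a) \<Rightarrow> 'a measure \<Rightarrow> ('a \<Rightarrow> 'a \<Rightarrow>\<^sub>L real) \<Rightarrow> real" where
  "current \<tau> \<eta> \<omega> = (\<integral>x. blinfun_apply (\<omega> x) (\<tau> x) \<partial>\<eta>)"

definition boundary ::
    "(('a::euclidean_space \<Rightarrow> 'a \<Rightarrow>\<^sub>L real) \<Rightarrow> real) \<Rightarrow> ('a \<Rightarrow> real) \<Rightarrow> real" where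
  "boundary T \<phi> = T (exterior_derivative \<phi>)"

definition mass :: "(('a::euclidean_space \<Rightarrow> 'b::real_normed_vector) \<Rightarrow> real) \<Rightarrow> ereal" where
  "mass T = (SUP \<omega>\<in>{\<omega> \<in> test_functions. \<forall>x. norm (\<omega> x) \<le> 1}. ereal (T \<omega>))"

definition finite_mass_current :: "('a::euclidean_space \<Rightarrow> 'a) \<Rightarrow> 'a measure \<Rightarrow> bool" where
  "finite_mass_current \<tau> \<eta> \<longleftrightarrow>
     finite_measure \<eta> \<and> sets \<eta> = sets borel \<and> integrable \<eta> \<tau> \<and> (AE x in \<eta>. \<tau> x \<noteq> 0)"

definition normal_current :: "('a::euclidean_space \<Rightarrow> 'a) \<Rightarrow> 'a measure \<Rightarrow> bool" where
  "normal_current \<tau> \<eta> \<longleftrightarrow>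
     finite_mass_current \<tau> \<eta> \<and> mass (current \<tau> \<eta>) < \<infinity> \<and> mass (boundary (current \<tau> \<eta>)) < \<infinity>"

definition horizontal_current ::
    "('a::euclidean_space \<Rightarrow> 'a \<Rightarrow> 'a) \<Rightarrow> nat \<Rightarrow> (nat \<Rightarrow> 'a) \<Rightarrow> ('a \<Rightarrow> 'a) \<Rightarrow> 'a measure \<Rightarrow> bool" where
  "horizontal_current gmult m e \<tau> \<eta> \<longleftrightarrow> (AE x in \<eta>. \<tau> x \<in> horizontal_space gmult m e x)"


section \<open>Radon measures\<close>

text \<open>
  On \<open>\<real>\<^sup>n\<close> the regularity of a Borel measure that is finite on compact sets is automatic.
\<close>

definition radon_measure :: "'a::euclidean_space measure \<Rightarrow> bool" where
  "radon_measure \<mu> \<longleftrightarrow> sets \<mu> = sets borel \<and> (\<forall>K. compact K \<longrightarrow> emeasure \<mu> K < \<infinity>)"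

definition measure_restr :: "'a measure \<Rightarrow> 'a set \<Rightarrow> 'a measure" where
  "measure_restr \<mu> U = density \<mu> (indicator U)"

end

theory Submission imports Defs "HOL-Probability.Probability" begin

text \<open>
  Projected to the first layer, the currents attached to one cell become \<open>r\<^sub>j w\<close> with a common finite
  measure \<open>w\<close> and bounded horizontal densities \<open>r\<^sub>j\<close> whose left-invariant divergences vanish; on the cell
  the \<open>r\<^sub>j\<close> span \<open>V 1\<close>, that is, \<open>\<psi>(r) = min {\<Sum>\<^sub>j (r\<^sub>j \<bullet> v)\<^sup>2 | v \<in> V 1, |v| = 1} > 0\<close>.

  Mollify \<open>w\<close> and \<open>r\<^sub>j w\<close> at the scales \<open>\<theta>\<^sup>i\<close> with the limit law of a self-similar random walk, so that the
  averages at one scale are averages of those at the next. With densities \<open>u\<^sub>i\<close> and mean directions \<open>h\<^sub>i\<close>,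
  the energies \<open>\<integral> u\<^sub>i |h\<^sub>i|\<^sup>2\<close> increase with \<open>i\<close> and stay bounded, so the directions are almost constant on
  most scales. Where they are constant, the divergence constraints annihilate the mollified derivatives
  of \<open>w\<close> along the \<open>h\<^sub>i\<close>. Since \<open>V 1\<close> generates the Lie algebra, it follows that \<open>\<psi>(h\<^sub>i)\<close> times the squared oscillation
  of the density at scale \<open>i\<close> is at most \<open>u\<^sub>i\<close> times an increment of energy.

  Hence \<open>\<Phi>\<^sub>i = \<integral> B\<^sub>c(u\<^sub>i) \<psi>(h\<^sub>i)\<close> with \<open>B\<^sub>c(u) = u\<^sup>2 / (u + c)\<close> grows from scale to scale by summable amounts
  that do not depend on \<open>c\<close>. If \<open>w\<close> charged a Lebesgue null set on which \<open>\<psi>(r) > 0\<close>, then \<open>\<Phi>\<^sub>i\<close> would stay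
  bounded below as \<open>i \<rightarrow> \<infinity>\<close>, uniformly in \<open>c\<close>; but \<open>\<Phi>\<^sub>K \<rightarrow> 0\<close> as \<open>c \<rightarrow> \<infinity>\<close> for each fixed \<open>K\<close>.
\<close>

subsection \<open>Smooth functions\<close>

text \<open>The measures \<open>r j w\<close> point in directions that vary with the point, so the
  constraints are not equations with constant coefficients. Freezing each direction at its mean near
  \<open>x\<close> costs a conditional variance, and with geometric weights these variances sum over
  all scales to a multiple of the total mass. The rest is linear algebra: pairing \<open>w\<close>
  with \<open>LX b\<close> of a test function is linear in \<open>b\<close> and small at the mean
  directions, hence small on all of \<open>V 1\<close> once these span it, which \<open>psi\<close>
  measures. The obstacle is that finer densities are compared with the coarser
  \<open>dens w i\<close>, which may be far larger; runs of such drops need a separate bound. The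
  damping \<open>damp c\<close> serves two ends: its remainder at \<open>M\<close>, multiplied by
  \<open>M\<close>, is at most the squared increment whatever \<open>c\<close> is, so the growth of
  the functional is uniform in \<open>c\<close>; and at a fixed scale it is at most the squared
  density over \<open>c\<close>. Its loss of at most \<open>c\<close> is paid only on neighbourhoods
  of a null set, whose volume tends to zero before \<open>c\<close> grows.\<close>

definition smooth :: "('a::euclidean_space \<Rightarrow> 'b::real_normed_vector) \<Rightarrow> bool" where
  "smooth f \<longleftrightarrow> (\<forall>k. continuously_differentiable k f)"

lemma cdiff_imp_continuous: "continuously_differentiable k f \<Longrightarrow> continuous_on UNIV f"
  by (cases k) (auto simp: continuous_on_eq_continuous_within differentiable_imp_continuous_within)

lemma smooth_differentiable: "smooth f \<Longrightarrow> f differentiable (at x)"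
  unfolding smooth_def by (metis continuously_differentiable.simps(2))

lemma smooth_has_derivative: "smooth f \<Longrightarrow> (f has_derivative frechet_derivative f (at x)) (at x)"
  using smooth_differentiable frechet_derivative_works by blast

lemma smooth_deriv: "smooth f \<Longrightarrow> smooth (\<lambda>x. frechet_derivative f (at x) v)"
  unfolding smooth_def by (metis continuously_differentiable.simps(2))

lemma smooth_continuous_on: "smooth f \<Longrightarrow> continuous_on S f"
  unfolding smooth_def by (metis continuously_differentiable.simps(1) continuous_on_subset subset_UNIV)

lemma smooth_continuous_compose:
  "smooth f \<Longrightarrow> continuous_on S g \<Longrightarrow> continuous_on S (\<lambda>x. f (g x))"
  using continuous_on_compose2[OF smooth_continuous_on[of f UNIV], of S g] by auto

text \<open>Induction on the order, uniformly over the class \<open>S\<close>. It gives smoothness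
  of functions whose derivatives stay in an explicit family, without computing higher
  derivatives.\<close>

lemma smooth_coinduct:
  assumes "f \<in> S"
    and S: "\<And>g x. g \<in> S \<Longrightarrow> g differentiable (at x)"
      "\<And>g v. g \<in> S \<Longrightarrow> (\<lambda>x. frechet_derivative g (at x) v) \<in> S"
  shows "smooth f"
proof -
  have "\<forall>f\<in>S. continuously_differentiable k f" for k
  proof (induction k)
    case 0
    then show ?case
      using S(1) by (auto simp: continuous_on_eq_continuous_within differentiable_imp_continuous_within)
  next
    case (Suc k)
    then show ?case using S by auto
  qed
  then show ?thesis using assms(1) by (auto simp: smooth_def)
qed

lemma cdiff_Suc_imp: "continuously_differentiable (Suc k) f \<Longrightarrow> continuously_differentiable k f"
proof (induction k arbitrary: f)
  case 0
  then show ?case using cdiff_imp_continuous[OF 0] by simp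
next
  case (Suc k)
  then show ?case by (metis continuously_differentiable.simps(2))
qed

lemma frechet_derivative_eqI:
  "(f has_derivative f') (at x) \<Longrightarrow> frechet_derivative f (at x) = f'"
  using frechet_derivative_at by metis

lemma cdiff_SucI:
  assumes "\<And>x. (f has_derivative f' x) (at x)"
    and "\<And>v. continuously_differentiable k (\<lambda>x. f' x v)"
  shows "continuously_differentiable (Suc k) f"
  using assms frechet_derivative_eqI[OF assms(1)] by (auto simp: differentiable_def)

lemma cdiff_add:
  "continuously_differentiable k f \<Longrightarrow> continuously_differentiable k g \<Longrightarrow>
    continuously_differentiable k (\<lambda>x. f x + g x)"
proof (induction k arbitrary: f g)
  case 0
  then show ?case by (auto intro: continuous_intros)
next
  case (Suc k)
  show ?case
  proof (rule cdiff_SucI)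
    fix x show "((\<lambda>x. f x + g x) has_derivative
        (\<lambda>v. frechet_derivative f (at x) v + frechet_derivative g (at x) v)) (at x)"
      using Suc.prems by (auto intro!: has_derivative_add simp: frechet_derivative_works)
  qed (use Suc in auto)
qed

lemma cdiff_const: "continuously_differentiable k (\<lambda>x. c)"
  by (induction k arbitrary: c) auto

lemma cdiff_sum:
  assumes "\<And>i. i \<in> I \<Longrightarrow> continuously_differentiable k (f i)"
  shows "continuously_differentiable k (\<lambda>x. \<Sum>i\<in>I. f i x)"
  using assms by (induction I rule: infinite_finite_induct) (auto intro: cdiff_add cdiff_const)

lemma cdiff_bilinear:
  assumes "bounded_bilinear B"
  shows "continuously_differentiable k f \<Longrightarrow> continuously_differentiable k g \<Longrightarrow>
    continuously_differentiable k (\<lambda>x. B (f x) (g x))"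
proof (induction k arbitrary: f g)
  case 0
  then show ?case using bounded_bilinear.continuous_on[OF assms] by auto
next
  case (Suc k)
  show ?case
  proof (rule cdiff_SucI)
    fix x show "((\<lambda>x. B (f x) (g x)) has_derivative
        (\<lambda>v. B (f x) (frechet_derivative g (at x) v) + B (frechet_derivative f (at x) v) (g x))) (at x)"
      using Suc.prems by (auto intro!: bounded_bilinear.FDERIV[OF assms] simp: frechet_derivative_works)
  next
    fix v show "continuously_differentiable k
        (\<lambda>x. B (f x) (frechet_derivative g (at x) v) + B (frechet_derivative f (at x) v) (g x))"
      using Suc.prems cdiff_Suc_imp[OF Suc.prems(1)] cdiff_Suc_imp[OF Suc.prems(2)]
      by (intro cdiff_add Suc.IH) auto
  qed
qed

lemma smooth_const [simp, intro]: "smooth (\<lambda>x. c)"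
  by (simp add: smooth_def cdiff_const)

lemma smooth_bounded_linear: "bounded_linear f \<Longrightarrow> smooth f"
proof (rule smooth_coinduct[where S = "{f} \<union> range (\<lambda>c _. c)"])
  fix g v assume f: "bounded_linear f" and "g \<in> {f} \<union> range (\<lambda>c _. c)"
  then show "(\<lambda>x. frechet_derivative g (at x) v) \<in> {f} \<union> range (\<lambda>c _. c)"
    using frechet_derivative_eqI[OF bounded_linear_imp_has_derivative[OF f]] by auto
qed (auto intro: bounded_linear_imp_differentiable)

lemma smooth_ident [simp, intro]: "smooth (\<lambda>x. x)"
  using smooth_bounded_linear[OF bounded_linear_ident] by simp

lemma smooth_add: "smooth f \<Longrightarrow> smooth g \<Longrightarrow> smooth (\<lambda>x. f x + g x)"
  by (simp add: smooth_def cdiff_add)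

lemma smooth_sum: "(\<And>i. i \<in> I \<Longrightarrow> smooth (f i)) \<Longrightarrow> smooth (\<lambda>x. \<Sum>i\<in>I. f i x)"
  by (simp add: smooth_def cdiff_sum)

lemma smooth_bilinear:
  "bounded_bilinear B \<Longrightarrow> smooth f \<Longrightarrow> smooth g \<Longrightarrow> smooth (\<lambda>x. B (f x) (g x))"
  by (simp add: smooth_def cdiff_bilinear)

lemmas smooth_scaleR = smooth_bilinear[OF bounded_bilinear_scaleR]
  and smooth_mult = smooth_bilinear[OF bounded_bilinear_mult]
  and smooth_inner = smooth_bilinear[OF bounded_bilinear_inner]

lemma smooth_uminus: "smooth f \<Longrightarrow> smooth (\<lambda>x. - f x)"
  using smooth_scaleR[OF smooth_const[of "-1"], of f] by simp

lemma smooth_diff: "smooth f \<Longrightarrow> smooth g \<Longrightarrow> smooth (\<lambda>x. f x - g x)"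
  using smooth_add[OF _ smooth_uminus, of f g] by simp

lemma linear_euclidean_expansion:
  fixes f :: "'a::euclidean_space \<Rightarrow> 'b::real_vector"
  assumes "linear f" shows "f x = (\<Sum>i\<in>Basis. (x \<bullet> i) *\<^sub>R f i)"
proof -
  have "f x = f (\<Sum>i\<in>Basis. (x \<bullet> i) *\<^sub>R i)" by (simp add: euclidean_representation)
  then show ?thesis by (simp add: linear_sum[OF assms] linear_scale[OF assms])
qed

lemma smooth_compose:
  fixes f :: "'b::euclidean_space \<Rightarrow> 'c::real_normed_vector" and g :: "'a::euclidean_space \<Rightarrow> 'b"
  assumes "smooth f" "smooth g" shows "smooth (\<lambda>x. f (g x))"
proof -
  have "continuously_differentiable k (\<lambda>x. f (g x))" if "smooth f" for k f
    using that
  proof (induction k arbitrary: f)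
    case 0
    then show ?case
      using smooth_continuous_compose[OF 0 smooth_continuous_on[OF assms(2)]] by simp
  next
    case (Suc k)
    \<comment> \<open>The derivative is expanded in a basis so that it becomes a finite sum of
      products. The induction generalises \<open>f\<close> while \<open>g\<close> stays fixed, so it
      applies to the partial derivatives of \<open>f\<close> composed with \<open>g\<close>.\<close>
    let ?f' = "\<lambda>x v. \<Sum>i\<in>Basis. (frechet_derivative g (at x) v \<bullet> i) *\<^sub>R frechet_derivative f (at (g x)) i"
    show ?case
    proof (rule cdiff_SucI)
      fix x
      have "((\<lambda>x. f (g x)) has_derivative (\<lambda>v. frechet_derivative f (at (g x)) (frechet_derivative g (at x) v))) (at x)"
        using has_derivative_compose[OF smooth_has_derivative[OF assms(2)] smooth_has_derivative[OF Suc.prems]] .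
      moreover have "linear (frechet_derivative f (at (g x)))"
        by (simp add: Suc.prems linear_frechet_derivative smooth_differentiable)
      ultimately show "((\<lambda>x. f (g x)) has_derivative ?f' x) (at x)"
        by (subst (asm) linear_euclidean_expansion)
    next
      fix v
      show "continuously_differentiable k (\<lambda>x. ?f' x v)"
      proof (intro cdiff_sum cdiff_bilinear[OF bounded_bilinear_scaleR] Suc.IH)
        fix i :: 'b
        show "continuously_differentiable k (\<lambda>x. frechet_derivative g (at x) v \<bullet> i)"
          using smooth_inner[OF smooth_deriv[OF assms(2)] smooth_const] by (simp add: smooth_def)
        show "smooth (\<lambda>x. frechet_derivative f (at x) i)"
          using smooth_deriv[OF Suc.prems] .
      qed
    qed
  qed
  then show ?thesis using assms(1) unfolding smooth_def[of "\<lambda>x. f (g x)"] by blast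
qed

lemma smooth_linear_compose: "bounded_linear L \<Longrightarrow> smooth f \<Longrightarrow> smooth (\<lambda>x. L (f x))"
  for f :: "'a::euclidean_space \<Rightarrow> 'b::euclidean_space"
  by (rule smooth_compose[OF smooth_bounded_linear])

lemma smooth_Pair: "smooth f \<Longrightarrow> smooth g \<Longrightarrow> smooth (\<lambda>x. (f x, g x))"
  for f :: "'a::euclidean_space \<Rightarrow> 'b::euclidean_space" and g :: "'a::euclidean_space \<Rightarrow> 'c::euclidean_space"
  using smooth_add[OF smooth_linear_compose[of "\<lambda>y. (y, 0)" f] smooth_linear_compose[of "\<lambda>y. (0, y)" g]]
  by (simp add: bounded_linear_Pair bounded_linear_ident bounded_linear_zero)

lemma smooth_fst [simp, intro]: "smooth (fst :: 'a::euclidean_space \<times> 'b::euclidean_space \<Rightarrow> 'a)"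
  and smooth_snd [simp, intro]: "smooth (snd :: 'a \<times> 'b \<Rightarrow> 'b)"
  by (auto intro: smooth_bounded_linear bounded_linear_fst bounded_linear_snd)

lemma frechet_derivative_linear: "smooth f \<Longrightarrow> linear (frechet_derivative f (at x))"
  by (simp add: linear_frechet_derivative smooth_differentiable)

lemma smooth_frechet_apply:
  fixes f :: "'a::euclidean_space \<Rightarrow> 'b::real_normed_vector"
  assumes "smooth f" "smooth g" "smooth h"
  shows "smooth (\<lambda>x. frechet_derivative f (at (g x)) (h x))"
proof -
  have "(\<lambda>x. frechet_derivative f (at (g x)) (h x)) =
      (\<lambda>x. \<Sum>i\<in>Basis. (h x \<bullet> i) *\<^sub>R frechet_derivative f (at (g x)) i)"
    by (rule ext) (rule linear_euclidean_expansion[OF frechet_derivative_linear[OF assms(1)]])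
  moreover have "smooth (\<lambda>x. \<Sum>i\<in>Basis. (h x \<bullet> i) *\<^sub>R frechet_derivative f (at (g x)) i)"
    using assms by (intro smooth_sum smooth_scaleR smooth_inner smooth_const
      smooth_compose[OF smooth_deriv]) auto
  ultimately show ?thesis by simp
qed

lemma frechet_derivative_chain:
  assumes "smooth f" "smooth g"
  shows "frechet_derivative (\<lambda>x. f (g x)) (at x) v = frechet_derivative f (at (g x)) (frechet_derivative g (at x) v)"
  using frechet_derivative_eqI[OF has_derivative_compose[OF smooth_has_derivative[OF assms(2)] smooth_has_derivative[OF assms(1)]]]
  by metis

section \<open>Differentiation of integrals that depend on a parameter\<close>

lemma smooth_uniform_linearization:
  fixes F :: "'a::euclidean_space \<Rightarrow> 'b::real_normed_vector"
  assumes "smooth F" "compact K" "e > 0"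
  shows "\<exists>d>0. \<forall>x\<in>K. \<forall>h. norm h < d \<longrightarrow> norm (F (x + h) - F x - frechet_derivative F (at x) h) \<le> e * norm h"
proof -
  obtain R where R: "\<And>x. x \<in> K \<Longrightarrow> norm x \<le> R"
    using compact_imp_bounded[OF assms(2)] bounded_iff by metis
  \<comment> \<open>Enlarging the radius by 1 leaves room for increments shorter than
    \<open>d0\<close>, which is at most 1; on this larger ball the partial derivatives are uniformly
    continuous.\<close>
  define K' where "K' = cball (0::'a) (R + 1)"
  define D where "D = (\<lambda>x v. frechet_derivative F (at x) v)"
  define N where "N = real (DIM('a))"
  have N: "N > 0" by (simp add: N_def)
  have "\<exists>d>0. \<forall>x\<in>K'. \<forall>y\<in>K'. dist y x < d \<longrightarrow> dist (D y i) (D x i) < e / N" for i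
    using compact_uniformly_continuous[OF smooth_continuous_on[OF smooth_deriv[OF assms(1)]], of K' i] N assms(3)
    unfolding uniformly_continuous_on_def D_def K'_def by auto
  then obtain d where d: "\<And>i. d i > 0"
      "\<And>i x y. x \<in> K' \<Longrightarrow> y \<in> K' \<Longrightarrow> dist y x < d i \<Longrightarrow> dist (D y i) (D x i) < e / N"
    by metis
  define d0 where "d0 = Min (insert 1 (d ` Basis))"
  have d0: "d0 > 0" "d0 \<le> 1" "\<And>i. i \<in> Basis \<Longrightarrow> d0 \<le> d i"
    using d(1) unfolding d0_def by (auto simp del: Min_insert intro: Min_le)
  show ?thesis
  proof (intro exI[of _ d0] conjI ballI allI impI)
    fix x h :: 'a assume x: "x \<in> K" and h: "norm h < d0"
    define S where "S = ball x d0"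
    have S: "y \<in> K'" if "y \<in> S" for y
    proof -
      have "norm y \<le> norm x + dist x y" by (metis dist_norm norm_minus_commute norm_triangle_sub)
      then show ?thesis using R[OF x] that d0(2) by (auto simp: S_def K'_def)
    qed
    have "norm (F (x + h) - F x - D x (x + h - x)) \<le> norm (x + h - x) * e"
    proof (rule differentiable_bound_linearization[where S = S and f' = D])
      show "x + t *\<^sub>R (x + h - x) \<in> S" if "t \<in> {0..1}" for t
      proof -
        have "norm (t *\<^sub>R h) \<le> 1 * norm h" using that by (simp add: mult_left_le_one_le)
        then show ?thesis using h by (simp add: S_def dist_norm)
      qed
      show "(F has_derivative D y) (at y within S)" for y
        using smooth_has_derivative[OF assms(1)] has_derivative_at_withinI unfolding D_def by blast
      show "x \<in> S" using d0 by (simp add: S_def)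
      fix y assume y: "y \<in> S"
      have "bounded_linear (\<lambda>v. D y v - D x v)"
        unfolding D_def by (intro bounded_linear_sub)
          (auto intro: has_derivative_bounded_linear smooth_has_derivative[OF assms(1)])
      then have "onorm (\<lambda>v. D y v - D x v) \<le> (\<Sum>i\<in>Basis. norm (D y i - D x i))"
        by (rule onorm_componentwise)
      also have "\<dots> \<le> (\<Sum>i\<in>(Basis::'a set). e / N)"
      proof (rule sum_mono)
        fix i :: 'a assume i: "i \<in> Basis"
        have "dist y x < d i" using y d0(3)[OF i] by (auto simp: S_def dist_commute)
        then show "norm (D y i - D x i) \<le> e / N"
          using d(2)[OF S[OF \<open>x \<in> S\<close>] S[OF y], of i] by (simp add: dist_norm less_imp_le)
      qed
      also have "\<dots> = e" using N by (simp add: N_def)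
      finally show "onorm (D y - D x) \<le> e" by (simp add: fun_diff_def)
    qed
    then show "norm (F (x + h) - F x - frechet_derivative F (at x) h) \<le> e * norm h"
      by (simp add: D_def mult.commute)
  qed (use d0 in auto)
qed

text \<open>The functions of this form, for all smooth \<open>F\<close>, are closed under
  directional derivatives, so \<open>smooth_coinduct\<close> applies. Compactness of
  \<open>K\<close> makes the linearisation of \<open>F\<close> uniform in \<open>y\<close>, which
  allows differentiation under the integral.\<close>

lemma smooth_integral:
  fixes F :: "'a::euclidean_space \<times> 'b::euclidean_space \<Rightarrow> real" and m :: "'b measure"
  assumes "smooth F" and m: "finite_measure m" "sets m = sets borel" and K: "compact K" "AE y in m. y \<in> K"
  shows "smooth (\<lambda>v. \<integral>y. F (v, y) \<partial>m)"
proof -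
  interpret finite_measure m by fact
  define S where "S = (\<lambda>F v. \<integral>y. F (v, y) \<partial>m) ` {F :: 'a \<times> 'b \<Rightarrow> real. smooth F}"
  have int: "integrable m (\<lambda>y. F (v, y))" if "smooth F" for F :: "'a \<times> 'b \<Rightarrow> real" and v
  proof -
    have c: "continuous_on UNIV (\<lambda>y. F (v, y))"
      by (intro smooth_continuous_compose[OF that] continuous_intros)
    then obtain B where "\<And>y. y \<in> K \<Longrightarrow> norm (F (v, y)) \<le> B"
      using compact_imp_bounded[OF compact_continuous_image[OF continuous_on_subset[OF c] K(1)]]
      unfolding bounded_iff by auto
    then have "AE y in m. norm (F (v, y)) \<le> B" using K(2) by auto
    moreover have "(\<lambda>y. F (v, y)) \<in> borel_measurable m"
      using borel_measurable_continuous_onI[OF c] unfolding measurable_cong_sets[OF m(2) refl] .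
    ultimately show ?thesis by (intro integrable_const_bound)
  qed
  have der: "((\<lambda>v. \<integral>y. F (v, y) \<partial>m) has_derivative (\<lambda>h. \<integral>y. frechet_derivative F (at (v, y)) (h, 0) \<partial>m)) (at v)"
    if F: "smooth F" for F :: "'a \<times> 'b \<Rightarrow> real" and v
  proof -
    \<comment> \<open>The added 1 keeps the divisor positive when \<open>m\<close> is the zero
      measure.\<close>
    define M where "M = measure m (space m) + 1"
    have M: "M > 0" by (simp add: M_def add_nonneg_pos)
    let ?D = "\<lambda>y h. frechet_derivative F (at (v, y)) (h, 0)"
    have intD: "integrable m (\<lambda>y. ?D y h)" for h
      using int[OF smooth_deriv[OF F, of "(h, 0)"], of v] by simp
    have lin: "linear (\<lambda>h. ?D y h)" for y
      using linear_compose[OF bounded_linear.linear[OF bounded_linear_Pair[OF bounded_linear_ident bounded_linear_zero]]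
          frechet_derivative_linear[OF F]] by (simp add: o_def)
    have bl: "bounded_linear (\<lambda>h. \<integral>y. ?D y h \<partial>m)"
      unfolding linear_conv_bounded_linear[symmetric]
      using intD by (intro linearI) (simp_all add: linear_add[OF lin] linear_scale[OF lin])
    have "\<exists>d>0. \<forall>h. norm h < d \<longrightarrow> norm ((\<integral>y. F (v + h, y) \<partial>m) - (\<integral>y. F (v, y) \<partial>m) - (\<integral>y. ?D y h \<partial>m)) \<le> e * norm h"
      if e: "e > 0" for e
    proof -
      obtain d where d: "d > 0" and dd: "\<And>x h. x \<in> {v} \<times> K \<Longrightarrow> norm h < d \<Longrightarrow>
          norm (F (x + h) - F x - frechet_derivative F (at x) h) \<le> (e / M) * norm h"
        using smooth_uniform_linearization[OF F compact_Times[OF compact_sing[of v] K(1)], of "e / M"] e M by auto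
      show ?thesis
      proof (intro exI[of _ d] conjI allI impI d)
        fix h :: 'a assume h: "norm h < d"
        have b: "norm (F (v + h, y) - F (v, y) - ?D y h) \<le> (e / M) * norm h" if "y \<in> K" for y
          using dd[of "(v, y)" "(h, 0)"] h that by simp
        have "(\<integral>y. F (v + h, y) \<partial>m) - (\<integral>y. F (v, y) \<partial>m) - (\<integral>y. ?D y h \<partial>m) =
            (\<integral>y. F (v + h, y) - F (v, y) - ?D y h \<partial>m)"
          using int[OF F] intD by simp
        also have "norm \<dots> \<le> (\<integral>y. (e / M) * norm h \<partial>m)"
          using K(2) b int[OF F] intD by (intro order_trans[OF integral_norm_bound] integral_mono_AE integrable_norm integrable_diff) auto
        also have "\<dots> = measure m (space m) * ((e / M) * norm h)" by simp
        also have "\<dots> \<le> M * ((e / M) * norm h)"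
          using e M by (intro mult_right_mono) (auto simp: M_def)
        finally show "norm ((\<integral>y. F (v + h, y) \<partial>m) - (\<integral>y. F (v, y) \<partial>m) - (\<integral>y. ?D y h \<partial>m)) \<le> e * norm h"
          using M by simp
      qed
    qed
    then have "\<forall>e>0. \<exists>d>0. \<forall>x'. norm (x' - v) < d \<longrightarrow>
        norm ((\<integral>y. F (x', y) \<partial>m) - (\<integral>y. F (v, y) \<partial>m) - (\<integral>y. ?D y (x' - v) \<partial>m)) \<le> e * norm (x' - v)"
      by (metis add.commute diff_add_cancel)
    then show ?thesis
      unfolding has_derivative_at_alt using bl by blast
  qed
  have "(\<lambda>v. \<integral>y. F (v, y) \<partial>m) \<in> S" using assms(1) by (auto simp: S_def)
  then show ?thesis
  proof (rule smooth_coinduct)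
    fix g assume "g \<in> S"
    then obtain F where F: "smooth F" "g = (\<lambda>v. \<integral>y. F (v, y) \<partial>m)" by (auto simp: S_def)
    show "g differentiable (at x)" for x using der[OF F(1)] F(2) by (auto simp: differentiable_def)
    show "(\<lambda>x. frechet_derivative g (at x) v) \<in> S" for v
    proof -
      have "(\<lambda>x. frechet_derivative g (at x) v) = (\<lambda>x. \<integral>y. frechet_derivative F (at (x, y)) (v, 0) \<partial>m)"
        unfolding F(2) using frechet_derivative_eqI[OF der[OF F(1)]] by auto
      then show ?thesis using smooth_deriv[OF F(1), of "(v, 0)"] unfolding S_def by auto
    qed
  qed
qed

subsection \<open>A smooth bump\<close>

definition flat :: "real \<Rightarrow> real" where "flat t = (if t > 0 then exp (- (1 / t)) else 0)"

text \<open>A polynomial in \<open>1 / t\<close> times \<open>exp (- (1 / t))\<close>, extended by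
  zero to nonpositive \<open>t\<close>, has a derivative of the same form. At 0 everything tends to
  0, because the exponential beats every polynomial in \<open>1 / t\<close>.\<close>

lemma smooth_flat: "smooth flat"
proof -
  define h where "h = (\<lambda>P t. if t > (0::real) then poly P (1 / t) * exp (- (1 / t)) else 0)"
  \<comment> \<open>By the chain rule, differentiating in \<open>t\<close> replaces the polynomial
    \<open>P\<close> in \<open>1 / t\<close> by the difference of \<open>P\<close> and its
    derivative, times the square of the variable.\<close>
  define D where "D = (\<lambda>P::real poly. [:0, 0, 1:] * (P - pderiv P))"
  have lim: "((\<lambda>t. h P t) \<longlongrightarrow> 0) (at_right 0)" for P
  proof -
    have "((\<lambda>x. poly P x / exp x) \<longlongrightarrow> 0) at_top"
    proof -
      have "((\<lambda>x. \<Sum>i\<le>degree P. coeff P i * (x ^ i / exp x)) \<longlongrightarrow> (\<Sum>i\<le>degree P. coeff P i * 0)) at_top"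
        by (intro tendsto_sum tendsto_mult tendsto_const tendsto_power_div_exp_0)
      then show ?thesis by (simp add: poly_altdef sum_divide_distrib)
    qed
    then have "((\<lambda>t. poly P (inverse t) / exp (inverse t)) \<longlongrightarrow> 0) (at_right 0)"
      using filterlim_compose[OF _ filterlim_inverse_at_top_right] by blast
    moreover have "eventually (\<lambda>t. poly P (inverse t) / exp (inverse t) = h P t) (at_right 0)"
      by (auto simp: h_def eventually_at_right_less exp_minus field_simps intro!: eventually_mono[OF eventually_at_right_less])
    ultimately show ?thesis by (rule Lim_transform_eventually)
  qed
  have der: "(h P has_real_derivative h (D P) t) (at t)" for P t
  proof -
    consider "t > 0" | "t < 0" | "t = 0" by linarith
    then show ?thesis
    proof cases
      case 1
      have "((\<lambda>t. poly P (1 / t) * exp (- (1 / t))) has_real_derivative h (D P) t) (at t)"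
        using 1 by (auto intro!: derivative_eq_intros simp: h_def D_def power2_eq_square algebra_simps)
      then show ?thesis
        by (rule has_field_derivative_transform_within_open[of _ _ _ "{0<..}"]) (use 1 in \<open>auto simp: h_def\<close>)
    next
      case 2
      have "((\<lambda>t. 0) has_real_derivative h (D P) t) (at t)"
        using 2 by (simp add: h_def)
      then show ?thesis
        by (rule has_field_derivative_transform_within_open[of _ _ _ "{..<0}"]) (use 2 in \<open>auto simp: h_def\<close>)
    next
      case 3
      \<comment> \<open>Dividing by \<open>y\<close> multiplies the polynomial in
        \<open>1 / y\<close> by its variable, so the difference quotient is again of the form
        \<open>h\<close> and tends to 0.\<close>
      have "((\<lambda>y. (h P y - h P 0) / (y - 0)) \<longlongrightarrow> 0) (at_right 0)"
      proof (rule Lim_transform_eventually[OF lim[of "[:0, 1:] * P"]])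
        show "\<forall>\<^sub>F y in at_right 0. h ([:0, 1:] * P) y = (h P y - h P 0) / (y - 0)"
          by (rule eventually_mono[OF eventually_at_right_less]) (auto simp: h_def)
      qed
      moreover have "((\<lambda>y. (h P y - h P 0) / (y - 0)) \<longlongrightarrow> 0) (at_left 0)"
      proof (rule Lim_transform_eventually[OF tendsto_const])
        show "\<forall>\<^sub>F y in at_left 0. 0 = (h P y - h P 0) / (y - 0)"
          by (auto simp: h_def eventually_at_filter)
      qed
      ultimately show ?thesis
        using 3 by (auto simp: has_field_derivative_iff h_def filterlim_split_at)
    qed
  qed
  have "flat = h 1" by (auto simp: flat_def h_def)
  moreover have "smooth (h 1)"
  proof (rule smooth_coinduct[where S = "{\<lambda>t. c * h P t | c P. True}"])
    show "h 1 \<in> {\<lambda>t. c * h P t | c P. True}" by (auto intro!: exI[of _ 1])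
  next
    fix g :: "real \<Rightarrow> real" assume "g \<in> {\<lambda>t. c * h P t | c P. True}"
    then obtain c P where g: "g = (\<lambda>t. c * h P t)" by auto
    have d: "(g has_derivative (\<lambda>v. (c * v) * h (D P) t)) (at t)" for t
      using der[of P t] unfolding g has_field_derivative_def
      by (auto intro!: derivative_eq_intros simp: algebra_simps)
    show "g differentiable (at x)" for x using d by (auto simp: differentiable_def)
    show "(\<lambda>x. frechet_derivative g (at x) v) \<in> {\<lambda>t. c * h P t | c P. True}" for v
      using frechet_derivative_eqI[OF d] by auto
  qed
  ultimately show ?thesis by simp
qed

definition bump :: "'a::euclidean_space \<Rightarrow> real" where "bump x = flat (1 - x \<bullet> x)"

lemma smooth_bump: "smooth bump"
  unfolding bump_def by (intro smooth_compose[OF smooth_flat] smooth_diff smooth_inner smooth_const smooth_ident)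

lemma bump_nonneg: "bump x \<ge> 0"
  by (simp add: bump_def flat_def)

lemma bump_pos_iff: "bump x > 0 \<longleftrightarrow> norm x < 1"
  by (auto simp: bump_def flat_def power2_norm_eq_inner[symmetric] power_less_one_iff abs_square_less_1)

lemma bump_eq_0: "norm x \<ge> 1 \<Longrightarrow> bump x = 0"
  using bump_pos_iff[of x] bump_nonneg[of x] by linarith

lemma test_functionsI:
  assumes "smooth f" "\<And>x. norm x > R \<Longrightarrow> f x = 0" shows "f \<in> test_functions"
proof -
  have "{x. f x \<noteq> 0} \<subseteq> cball 0 R"
    using assms(2) by (force simp: not_le[symmetric])
  then have "compact (closure {x. f x \<noteq> 0})"
    using bounded_subset[OF bounded_cball] by (simp add: compact_closure)
  then show ?thesis using assms(1) by (simp add: test_functions_def smooth_def)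
qed

lemma test_functions_iff:
  "f \<in> test_functions \<longleftrightarrow> smooth f \<and> (\<exists>R. \<forall>x. norm x > R \<longrightarrow> f x = 0)"
proof
  assume f: "f \<in> test_functions"
  then have "bounded {x. f x \<noteq> 0}" by (simp add: test_functions_def compact_closure)
  then obtain R where "\<forall>x\<in>{x. f x \<noteq> 0}. norm x \<le> R" by (auto simp: bounded_iff)
  then have "\<forall>x. norm x > R \<longrightarrow> f x = 0" by force
  then show "smooth f \<and> (\<exists>R. \<forall>x. norm x > R \<longrightarrow> f x = 0)"
    using f by (auto simp: test_functions_def smooth_def)
qed (auto intro: test_functionsI)

subsection \<open>Gradings and dilations\<close>

locale carnot = carnot_group br gmult V s
  for br gmult :: "real ^ 'n \<Rightarrow> real ^ 'n \<Rightarrow> real ^ 'n" and V s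
begin

lemma br_bilinear: "bounded_bilinear br"
  using bilinear_br bilinear_conv_bounded_bilinear by blast

lemmas br_simps = bounded_bilinear.add_left[OF br_bilinear] bounded_bilinear.add_right[OF br_bilinear]
  bounded_bilinear.scaleR_left[OF br_bilinear] bounded_bilinear.scaleR_right[OF br_bilinear]
  bounded_bilinear.zero_left[OF br_bilinear] bounded_bilinear.zero_right[OF br_bilinear]
  bounded_bilinear.minus_left[OF br_bilinear] bounded_bilinear.minus_right[OF br_bilinear]

lemma br_antisym: "br x y = - br y x"
proof -
  have "br (x + y) (x + y) = 0" by (rule alternating)
  then have "br x x + br y x + (br x y + br y y) = 0" by (simp only: br_simps)
  then have "br x y + br y x = 0" by (simp add: alternating add.commute)
  then show ?thesis by (simp add: eq_neg_iff_add_eq_0)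
qed

lemma linear_br_left: "linear (\<lambda>x. br x y)" and linear_br_right: "linear (br x)"
  by (auto intro!: linearI simp: br_simps)

text \<open>Extending the grading by zero outside \<open>{1..s}\<close> lets brackets add degrees
  without a case distinction on the step.\<close>

definition layer :: "nat \<Rightarrow> (real ^ 'n) set" where
  "layer i = (if i \<in> {1..s} then V i else {0})"

lemma subspace_layer': "subspace (layer i)"
  by (simp add: layer_def subspace_layer subspace_0)

lemma br_V1: "a \<in> layer 1 \<Longrightarrow> b \<in> layer i \<Longrightarrow> br a b \<in> layer (Suc i)"
proof (cases "i \<in> {1..<s}")
  case True
  assume "a \<in> layer 1" "b \<in> layer i"
  then have "br a b \<in> span {br a b | a b. a \<in> V 1 \<and> b \<in> V i}"
    using True by (intro span_base) (auto simp: layer_def)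
  then show ?thesis using bracket_layer[OF True] True by (auto simp: layer_def)
next
  case False
  assume ab: "a \<in> layer 1" "b \<in> layer i"
  have "br a b = 0"
  proof (cases "i = s")
    case True
    then show ?thesis using ab bracket_last step_pos by (auto simp: layer_def)
  next
    case False2: False
    then have "b = 0" using ab False by (auto simp: layer_def split: if_splits)
    then show ?thesis by (simp add: br_simps)
  qed
  then show ?thesis using subspace_layer'[of "Suc i"] subspace_0 by simp
qed

text \<open>The grading axioms give this only for \<open>i = 1\<close>. Higher layers are spanned by
  brackets with a first-layer element, and the Jacobi identity reduces a bracket with such an
  element to brackets from the first layer and the preceding one.\<close>

lemma br_layer: "1 \<le> i \<Longrightarrow> a \<in> layer i \<Longrightarrow> b \<in> layer j \<Longrightarrow> br a b \<in> layer (i + j)"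
proof (induction i arbitrary: a b j rule: dec_induct)
  case base
  then show ?case using br_V1 by simp
next
  case (step i)
  show ?case
  proof (cases "i < s")
    case False
    then have "a = 0" using step by (auto simp: layer_def)
    then show ?thesis using subspace_0[OF subspace_layer'] by (simp add: br_simps)
  next
    case True
    have S: "subspace {a. br a b \<in> layer (Suc i + j)}"
      using linear_subspace_vimage[OF linear_br_left[of b] subspace_layer'[of "Suc i + j"]]
      by (simp add: vimage_def)
    have "{br a c | a c. a \<in> V 1 \<and> c \<in> V i} \<subseteq> {a. br a b \<in> layer (Suc i + j)}"
    proof clarify
      fix x y assume "x \<in> V 1" "y \<in> V i"
      then have xy: "x \<in> layer 1" "y \<in> layer i"
        using True step(1) step_pos by (auto simp: layer_def)
      have "br (br x y) b = br x (br y b) - br y (br x b)"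
        using jacobi[of x y b] br_antisym[of b "br x y"] br_antisym[of b x]
        by (simp add: br_simps algebra_simps)
      moreover have "br x (br y b) \<in> layer (Suc i + j)"
        using br_V1[OF xy(1) step.IH[OF xy(2) step.prems(2)]] by simp
      moreover have "br y (br x b) \<in> layer (Suc i + j)"
        using step.IH[OF xy(2) br_V1[OF xy(1) step.prems(2)]] by simp
      ultimately show "br (br x y) b \<in> layer (Suc i + j)"
        using subspace_diff[OF subspace_layer'] by simp
    qed
    then have "span {br a c | a c. a \<in> V 1 \<and> c \<in> V i} \<subseteq> {a. br a b \<in> layer (Suc i + j)}"
      using S by (rule span_minimal)
    then show ?thesis
      using bracket_layer[of i] True step by (auto simp: layer_def)
  qed
qed

definition part :: "real ^ 'n \<Rightarrow> nat \<Rightarrow> real ^ 'n" where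
  "part x = (THE v. v \<in> Pi\<^sub>E {1..s} V \<and> x = (\<Sum>i\<in>{1..s}. v i))"

lemma part: "part x \<in> Pi\<^sub>E {1..s} V" "x = (\<Sum>i\<in>{1..s}. part x i)"
  using theI'[OF direct_sum[of x]] unfolding part_def by auto

lemma part_layer: "i \<in> {1..s} \<Longrightarrow> part x i \<in> V i"
  using part(1)[of x] by auto

lemma part_eqI:
  assumes "\<And>i. i \<in> {1..s} \<Longrightarrow> v i \<in> V i" "x = (\<Sum>i\<in>{1..s}. v i)" "i \<in> {1..s}"
  shows "part x i = v i"
proof -
  have "restrict v {1..s} \<in> Pi\<^sub>E {1..s} V \<and> x = (\<Sum>i\<in>{1..s}. restrict v {1..s} i)"
    using assms by auto
  then have "part x = restrict v {1..s}"
    using direct_sum[of x] part[of x] by blast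
  then show ?thesis using assms(3) by simp
qed

lemma linear_part:
  assumes "i \<in> {1..s}" shows "linear (\<lambda>x. part x i)"
proof (rule linearI)
  fix x y and c :: real
  show "part (x + y) i = part x i + part y i"
  proof (rule part_eqI)
    show "x + y = (\<Sum>i\<in>{1..s}. part x i + part y i)"
      unfolding sum.distrib using part(2)[of x] part(2)[of y] by argo
  qed (use assms part_layer in \<open>auto intro!: subspace_add subspace_layer\<close>)
  show "part (c *\<^sub>R x) i = c *\<^sub>R part x i"
  proof (rule part_eqI)
    show "c *\<^sub>R x = (\<Sum>i\<in>{1..s}. c *\<^sub>R part x i)"
      unfolding scaleR_sum_right[symmetric] using part(2)[of x] by argo
  qed (use assms part_layer in \<open>auto intro!: subspace_scale subspace_layer\<close>)
qed

lemma part_of_layer: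
  assumes "v \<in> V j" "i \<in> {1..s}" "j \<in> {1..s}" shows "part v i = (if i = j then v else 0)"
  using assms by (intro part_eqI) (auto simp: subspace_0 subspace_layer sum.delta)

definition dil :: "real \<Rightarrow> real ^ 'n \<Rightarrow> real ^ 'n" where
  "dil t x = (\<Sum>i\<in>{1..s}. t ^ i *\<^sub>R part x i)"

lemma linear_dil: "linear (dil t)"
  unfolding dil_def by (intro linear_compose_sum ballI linear_compose_scale_right linear_part)

lemma bounded_linear_dil: "bounded_linear (dil t)"
  using linear_dil linear_conv_bounded_linear by blast

lemmas dil_scaleR = linear_scale[OF linear_dil]
  and dil_zero [simp] = linear_0[OF linear_dil] and dil_neg = linear_neg[OF linear_dil]
  and dil_sum = linear_sum[OF linear_dil]

lemma part_dil: "i \<in> {1..s} \<Longrightarrow> part (dil t x) i = t ^ i *\<^sub>R part x i"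
  by (rule part_eqI) (auto simp: dil_def part_layer intro!: subspace_scale subspace_layer)

lemma dil_dil [simp]: "dil t (dil u x) = dil (t * u) x"
proof -
  have "dil t (dil u x) = (\<Sum>i\<in>{1..s}. t ^ i *\<^sub>R part (dil u x) i)"
    by (rule dil_def)
  also have "\<dots> = (\<Sum>i\<in>{1..s}. (t * u) ^ i *\<^sub>R part x i)"
    by (intro sum.cong refl) (simp add: part_dil power_mult_distrib)
  finally show ?thesis by (simp add: dil_def)
qed

lemma dil_1 [simp]: "dil 1 x = x"
  using part(2)[of x] by (simp add: dil_def)

lemma dil_0 [simp]: "dil 0 x = 0"
  by (auto simp: dil_def power_0_left intro!: sum.neutral)

lemma dil_inverse [simp]: "t \<noteq> 0 \<Longrightarrow> dil (1 / t) (dil t x) = x" "t \<noteq> 0 \<Longrightarrow> dil t (dil (1 / t) x) = x"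
  by auto

lemma dil_layer: "v \<in> layer i \<Longrightarrow> dil t v = t ^ i *\<^sub>R v"
proof (cases "i \<in> {1..s}")
  case True
  assume "v \<in> layer i"
  then have v: "v \<in> V i" using True by (simp add: layer_def)
  have "dil t v = (\<Sum>j\<in>{1..s}. if j = i then t ^ i *\<^sub>R v else 0)"
    unfolding dil_def by (intro sum.cong refl) (use part_of_layer[OF v _ True] in auto)
  then show ?thesis using True by simp
qed (auto simp: layer_def)

lemma norm_dil_le: "\<exists>C\<ge>1. \<forall>t x. 0 \<le> t \<longrightarrow> t \<le> 1 \<longrightarrow> norm (dil t x) \<le> C * t * norm x"
proof -
  have "\<forall>i\<in>{1..s}. \<exists>B. \<forall>x. norm (part x i) \<le> B * norm x"
    using linear_bounded[OF linear_part] by blast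
  then obtain B where B: "\<And>i x. i \<in> {1..s} \<Longrightarrow> norm (part x i) \<le> B i * norm x"
    by metis
  define C where "C = 1 + (\<Sum>i\<in>{1..s}. \<bar>B i\<bar>)"
  have "norm (dil t x) \<le> C * t * norm x" if t: "0 \<le> t" "t \<le> 1" for t x
  proof -
    have "norm (dil t x) \<le> (\<Sum>i\<in>{1..s}. t * (\<bar>B i\<bar> * norm x))"
      unfolding dil_def
    proof (rule sum_norm_le)
      fix i assume i: "i \<in> {1..s}"
      have "t ^ i \<le> t ^ 1" using i t by (intro power_decreasing) auto
      moreover have "norm (part x i) \<le> \<bar>B i\<bar> * norm x"
        by (rule order_trans[OF B[OF i]]) (simp add: mult_right_mono)
      ultimately have "t ^ i * norm (part x i) \<le> t * (\<bar>B i\<bar> * norm x)"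
        using t by (intro mult_mono) auto
      then show "norm (t ^ i *\<^sub>R part x i) \<le> t * (\<bar>B i\<bar> * norm x)"
        using t by simp
    qed
    also have "\<dots> \<le> C * t * norm x"
      using t by (simp add: C_def sum_distrib_left[symmetric] sum_distrib_right[symmetric] algebra_simps)
    finally show ?thesis .
  qed
  moreover have "C \<ge> 1" by (simp add: C_def sum_nonneg)
  ultimately show ?thesis by blast
qed

lemma continuous_on_dil: "continuous_on S (\<lambda>x. dil (f x) (g x))"
  if "continuous_on S f" "continuous_on S g" for f :: "'b::topological_space \<Rightarrow> real"
  unfolding dil_def using that
proof (intro continuous_intros that(1))
  fix i assume "i \<in> {1..s}"
  then show "continuous_on S (\<lambda>x. part (g x) i)"
    using bounded_linear.continuous_on[OF _ that(2), of "\<lambda>x. part x i"] linear_part[of i]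
    by (simp add: linear_conv_bounded_linear)
qed

text \<open>Because brackets add degrees, each dilation is a Lie algebra endomorphism. It is then
  also a homomorphism of the group law, which is built from brackets alone.\<close>

lemma br_dil: "br (dil t x) (dil t y) = dil t (br x y)"
proof -
  have "br (dil t x) (dil t y) = (\<Sum>i\<in>{1..s}. \<Sum>j\<in>{1..s}. t ^ (i + j) *\<^sub>R br (part x i) (part y j))"
    unfolding dil_def linear_sum[OF linear_br_left] linear_sum[OF linear_br_right]
    by (subst sum.swap) (simp add: br_simps power_add mult.commute)
  also have "\<dots> = (\<Sum>i\<in>{1..s}. \<Sum>j\<in>{1..s}. dil t (br (part x i) (part y j)))"
  proof (intro sum.cong refl)
    fix i j assume "i \<in> {1..s}" "j \<in> {1..s}"
    then show "t ^ (i + j) *\<^sub>R br (part x i) (part y j) = dil t (br (part x i) (part y j))"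
      using dil_layer[OF br_layer[of i "part x i" "part y j" j], of t] part_layer by (auto simp: layer_def)
  qed
  also have "\<dots> = dil t (br (\<Sum>i\<in>{1..s}. part x i) (\<Sum>j\<in>{1..s}. part y j))"
    unfolding dil_sum linear_sum[OF linear_br_left] linear_sum[OF linear_br_right] by (rule sum.swap)
  finally show ?thesis using part(2) by metis
qed

lemma nested_bracket_dil: "nested_bracket br (map (dil t) l) = dil t (nested_bracket br l)"
proof (induction l rule: induct_list012)
  case (3 x y zs)
  then show ?case by (simp add: br_dil)
qed auto

lemma gmult_dil: "gmult (dil t x) (dil t y) = dil t (gmult x y)"
proof -
  have "concat (map (\<lambda>(p, q). replicate p (dil t x) @ replicate q (dil t y)) ps) =
      map (dil t) (concat (map (\<lambda>(p, q). replicate p x @ replicate q y) ps))" for ps :: "(nat \<times> nat) list"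
    by (induction ps) auto
  then show ?thesis
    unfolding gmult_bch bch_def by (simp add: nested_bracket_dil dil_sum dil_scaleR)
qed

subsection \<open>The group law\<close>

lemma smooth_nested_bracket:
  fixes fs :: "('c::euclidean_space \<Rightarrow> real ^ 'n) list"
  assumes "\<And>f. f \<in> set fs \<Longrightarrow> smooth f"
  shows "smooth (\<lambda>z. nested_bracket br (map (\<lambda>f. f z) fs))"
  using assms by (induction fs rule: induct_list012) (auto intro: smooth_bilinear[OF br_bilinear])

lemma smooth_gmult:
  fixes f g :: "'c::euclidean_space \<Rightarrow> real ^ 'n"
  assumes "smooth f" "smooth g" shows "smooth (\<lambda>z. gmult (f z) (g z))"
proof -
  have "smooth (\<lambda>z. nested_bracket br (concat (map (\<lambda>(p, q). replicate p (f z) @ replicate q (g z)) ps)))"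
    for ps :: "(nat \<times> nat) list"
  proof -
    define fs where "fs = concat (map (\<lambda>(p, q). replicate p f @ replicate q g) ps)"
    have "concat (map (\<lambda>(p, q). replicate p (f z) @ replicate q (g z)) ps) = map (\<lambda>f. f z) fs" for z
      unfolding fs_def by (induction ps) auto
    moreover have "smooth f" if "f \<in> set fs" for f
      using that assms by (auto simp: fs_def)
    ultimately show ?thesis using smooth_nested_bracket[of fs] by simp
  qed
  then show ?thesis
    unfolding gmult_bch bch_def by (intro smooth_sum smooth_scaleR smooth_const)
qed

lemma continuous_on_gmult:
  "continuous_on S f \<Longrightarrow> continuous_on S g \<Longrightarrow> continuous_on S (\<lambda>z. gmult (f z) (g z))"
  for f :: "'b::topological_space \<Rightarrow> real ^ 'n"
  using smooth_continuous_compose[OF smooth_gmult[OF smooth_fst smooth_snd], of S "\<lambda>z. (f z, g z)"]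
  by (auto intro: continuous_on_Pair)

lemma gmult_borel [measurable (raw)]:
  "f \<in> borel_measurable M \<Longrightarrow> g \<in> borel_measurable M \<Longrightarrow> (\<lambda>z. gmult (f z) (g z)) \<in> borel_measurable M"
proof (erule (1) borel_measurable_continuous_Pair)
  show "continuous_on UNIV (\<lambda>p. gmult (fst p) (snd p))"
    by (intro continuous_on_gmult continuous_intros)
qed

lemma dil_borel [measurable (raw)]: "f \<in> borel_measurable M \<Longrightarrow> (\<lambda>z. dil t (f z)) \<in> borel_measurable M"
  using borel_measurable_continuous_onI[OF linear_continuous_on[OF bounded_linear_dil]] measurable_compose by blast

lemma gmult_inverse [simp]: "gmult (- x) (gmult x y) = y" "gmult x (gmult (- x) y) = y"
  "gmult (gmult y x) (- x) = y" "gmult (gmult y (- x)) x = y"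
proof -
  have r: "gmult x (- x) = 0" using right_inverse .
  show "gmult (- x) (gmult x y) = y" using left_inverse by (simp flip: assoc)
  show "gmult x (gmult (- x) y) = y" using r by (simp flip: assoc)
  show "gmult (gmult y x) (- x) = y" using r by (simp add: assoc)
  show "gmult (gmult y (- x)) x = y" by (simp add: assoc)
qed

lemma neg_gmult: "- gmult x y = gmult (- y) (- x)"
  using inverse_distrib_swap by simp

lemma nested_bracket_parallel:
  assumes "set l \<subseteq> range (\<lambda>c. c *\<^sub>R z)" "length l \<noteq> 1" shows "nested_bracket br l = 0"
  using assms
proof (induction l rule: induct_list012)
  case (3 x y zs)
  then obtain c where x: "x = c *\<^sub>R z" by auto
  show ?case
  proof (cases zs)
    case Nil
    then obtain d where "y = d *\<^sub>R z" using 3(3) by auto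
    then show ?thesis using Nil x by (simp add: br_simps alternating)
  next
    case (Cons a list)
    then show ?thesis using 3 by (simp add: br_simps)
  qed
qed auto

text \<open>On a line all brackets of two or more entries vanish, so the law has the form
  \<open>\<alpha> * a + \<beta> * b\<close> with constants. Their values are read off from the
  neutral element instead of being summed from the series.\<close>

lemma gmult_parallel: "gmult (a *\<^sub>R z) (b *\<^sub>R z) = (a + b) *\<^sub>R z"
proof -
  have sum_list_replicate': "sum_list (replicate n x) = real n *\<^sub>R x" for n and x :: "real ^ 'n"
    by (induction n) (auto simp: algebra_simps)
  define P where "P = (\<lambda>ps :: (nat \<times> nat) list. \<Sum>(p, q)\<leftarrow>ps. p)"
  define Q where "Q = (\<lambda>ps :: (nat \<times> nat) list. \<Sum>(p, q)\<leftarrow>ps. q)"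
  define d where "d = (\<lambda>ps. if P ps + Q ps = 1 then 1 else 0 :: real)"
  have key: "nested_bracket br (concat (map (\<lambda>(p, q). replicate p (a *\<^sub>R z) @ replicate q (b *\<^sub>R z)) ps)) =
      (d ps * (real (P ps) * a + real (Q ps) * b)) *\<^sub>R z" for ps a b
  proof -
    let ?l = "concat (map (\<lambda>(p, q). replicate p (a *\<^sub>R z) @ replicate q (b *\<^sub>R z)) ps)"
    have len: "length ?l = P ps + Q ps"
      by (induction ps) (auto simp: P_def Q_def)
    have sum: "sum_list ?l = (real (P ps) * a + real (Q ps) * b) *\<^sub>R z"
      by (induction ps) (auto simp: P_def Q_def sum_list_replicate' algebra_simps)
    have sub: "set ?l \<subseteq> range (\<lambda>c. c *\<^sub>R z)" by (induction ps) auto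
    show ?thesis
    proof (cases "P ps + Q ps = 1")
      case True
      then obtain x where x: "?l = [x]" using len by (auto simp: length_Suc_conv)
      then show ?thesis using sum True by (simp add: d_def x)
    next
      case False
      then show ?thesis using nested_bracket_parallel[OF sub] len by (simp add: d_def)
    qed
  qed
  define \<alpha> where "\<alpha> = (\<Sum>k\<in>{1..s}. ((- 1) ^ (k - 1) / real k) * (\<Sum>ps\<in>dynkin_tuples s k. 1 / (real (\<Sum>(p, q) \<leftarrow> ps. p + q) * (\<Prod>(p, q) \<leftarrow> ps. fact p * fact q)) * (d ps * real (P ps))))"
  define \<beta> where "\<beta> = (\<Sum>k\<in>{1..s}. ((- 1) ^ (k - 1) / real k) * (\<Sum>ps\<in>dynkin_tuples s k. 1 / (real (\<Sum>(p, q) \<leftarrow> ps. p + q) * (\<Prod>(p, q) \<leftarrow> ps. fact p * fact q)) * (d ps * real (Q ps))))"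
  have *: "gmult (a *\<^sub>R z) (b *\<^sub>R z) = (\<alpha> * a + \<beta> * b) *\<^sub>R z" for a b
    unfolding gmult_bch bch_def key \<alpha>_def \<beta>_def
    by (simp add: scaleR_sum_left[symmetric] sum.distrib sum_distrib_left sum_distrib_right algebra_simps)
  show ?thesis
  proof (cases "z = 0")
    case False
    have "\<alpha> *\<^sub>R z = 1 *\<^sub>R z" using *[of 1 0] by simp
    then have "\<alpha> = 1" using False scaleR_cancel_right by blast
    moreover have "\<beta> *\<^sub>R z = 1 *\<^sub>R z" using *[of 0 1] by simp
    then have "\<beta> = 1" using False scaleR_cancel_right by blast
    ultimately show ?thesis using * by simp
  qed simp
qed

end

subsection \<open>Symmetry of second derivatives\<close>

lemma smooth_line_derivative:
  assumes "smooth f"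
  shows "((\<lambda>t. f (x + t *\<^sub>R a)) has_vector_derivative frechet_derivative f (at (x + t *\<^sub>R a)) a) (at t)"
proof -
  have "((\<lambda>t. f (x + t *\<^sub>R a)) has_derivative (\<lambda>h. frechet_derivative f (at (x + t *\<^sub>R a)) (h *\<^sub>R a))) (at t)"
    by (rule has_derivative_compose[OF _ smooth_has_derivative[OF assms]]) (auto intro!: derivative_eq_intros)
  then show ?thesis
    by (simp add: has_vector_derivative_def linear_scale[OF frechet_derivative_linear[OF assms]])
qed

lemma second_difference:
  fixes f :: "'a::euclidean_space \<Rightarrow> real"
  assumes "smooth f" "h > 0"
  shows "\<exists>\<xi> \<zeta>. 0 < \<xi> \<and> \<xi> < h \<and> 0 < \<zeta> \<and> \<zeta> < h \<and>
    f (x + h *\<^sub>R a + h *\<^sub>R b) - f (x + h *\<^sub>R a) - f (x + h *\<^sub>R b) + f x =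
    h * h * frechet_derivative (\<lambda>v. frechet_derivative f (at v) a) (at (x + \<xi> *\<^sub>R a + \<zeta> *\<^sub>R b)) b"
proof -
  let ?D = "\<lambda>v. frechet_derivative f (at v) a"
  have d1: "((\<lambda>t. f (y + t *\<^sub>R a)) has_real_derivative ?D (y + t *\<^sub>R a)) (at t)" for y t
    using smooth_line_derivative[OF assms(1)] by (simp add: has_real_derivative_iff_has_vector_derivative)
  have "((\<lambda>t. f (x + h *\<^sub>R b + t *\<^sub>R a) - f (x + t *\<^sub>R a)) has_real_derivative
      ?D (x + h *\<^sub>R b + t *\<^sub>R a) - ?D (x + t *\<^sub>R a)) (at t)" for t
    by (intro DERIV_diff d1)
  from MVT2[OF assms(2) this]
  obtain \<xi> where \<xi>: "0 < \<xi>" "\<xi> < h"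
    "f (x + h *\<^sub>R b + h *\<^sub>R a) - f (x + h *\<^sub>R a) - (f (x + h *\<^sub>R b) - f x) =
      h * (?D (x + h *\<^sub>R b + \<xi> *\<^sub>R a) - ?D (x + \<xi> *\<^sub>R a))" by auto
  have "((\<lambda>t. ?D (x + \<xi> *\<^sub>R a + t *\<^sub>R b)) has_real_derivative
      frechet_derivative ?D (at (x + \<xi> *\<^sub>R a + t *\<^sub>R b)) b) (at t)" for t
    using smooth_line_derivative[OF smooth_deriv[OF assms(1)]]
    by (simp add: has_real_derivative_iff_has_vector_derivative)
  from MVT2[OF assms(2) this]
  obtain \<zeta> where \<zeta>: "0 < \<zeta>" "\<zeta> < h"
    "?D (x + \<xi> *\<^sub>R a + h *\<^sub>R b) - ?D (x + \<xi> *\<^sub>R a) =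
      h * frechet_derivative ?D (at (x + \<xi> *\<^sub>R a + \<zeta> *\<^sub>R b)) b" by auto
  have "f (x + h *\<^sub>R a + h *\<^sub>R b) - f (x + h *\<^sub>R a) - f (x + h *\<^sub>R b) + f x =
      h * (h * frechet_derivative ?D (at (x + \<xi> *\<^sub>R a + \<zeta> *\<^sub>R b)) b)"
    using \<xi>(3) \<zeta>(3) by (simp add: algebra_simps)
  then show ?thesis using \<xi> \<zeta> by (intro exI[of _ \<xi>] exI[of _ \<zeta>]) auto
qed

text \<open>The second difference along \<open>a\<close> and \<open>b\<close> is symmetric. By
  \<open>second_difference\<close> it equals, up to the squared step, each of the two mixed
  derivatives at points that converge to \<open>x\<close> with the step.\<close>

lemma second_derivative_symmetric:
  fixes f :: "'a::euclidean_space \<Rightarrow> real"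
  assumes "smooth f"
  shows "frechet_derivative (\<lambda>v. frechet_derivative f (at v) a) (at x) b =
    frechet_derivative (\<lambda>v. frechet_derivative f (at v) b) (at x) a"
proof -
  define K where "K = (\<lambda>a b v. frechet_derivative (\<lambda>v. frechet_derivative f (at v) a) (at v) b)"
  have lim: "((\<lambda>h. K a b (x + \<xi> h *\<^sub>R a + \<zeta> h *\<^sub>R b)) \<longlongrightarrow> K a b x) (at_right 0)"
    if "\<And>h. h > 0 \<Longrightarrow> 0 < \<xi> h \<and> \<xi> h < h \<and> 0 < \<zeta> h \<and> \<zeta> h < h" for \<xi> \<zeta> a b
  proof -
    have e: "eventually (\<lambda>h. h > 0) (at_right (0::real))" by (rule eventually_at_right_less)
    have "(\<xi> \<longlongrightarrow> 0) (at_right 0)" "(\<zeta> \<longlongrightarrow> 0) (at_right 0)"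
      by (rule tendsto_sandwich[of "\<lambda>_. 0" _ _ "\<lambda>h. h"]; use that e in \<open>auto elim!: eventually_mono intro: less_imp_le tendsto_ident_at\<close>)+
    then have "((\<lambda>h. x + \<xi> h *\<^sub>R a + \<zeta> h *\<^sub>R b) \<longlongrightarrow> x + 0 *\<^sub>R a + 0 *\<^sub>R b) (at_right 0)"
      by (intro tendsto_intros)
    moreover have "isCont (K a b) x"
      using smooth_continuous_on[OF smooth_deriv[OF smooth_deriv[OF assms]], of UNIV a b]
      by (simp add: K_def continuous_on_eq_continuous_at)
    ultimately show ?thesis using isCont_tendsto_compose[of x "K a b"] by simp
  qed
  have "\<exists>\<xi> \<zeta>. \<forall>h>0. 0 < \<xi> h \<and> \<xi> h < h \<and> 0 < \<zeta> h \<and> \<zeta> h < h \<and>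
      f (x + h *\<^sub>R a + h *\<^sub>R b) - f (x + h *\<^sub>R a) - f (x + h *\<^sub>R b) + f x = h * h * K a b (x + \<xi> h *\<^sub>R a + \<zeta> h *\<^sub>R b)"
    for a b unfolding K_def using second_difference[OF assms, of _ x a b] by metis
  then obtain \<xi> \<zeta> \<xi>' \<zeta>' where
    1: "\<And>h. h > 0 \<Longrightarrow> 0 < \<xi> h \<and> \<xi> h < h \<and> 0 < \<zeta> h \<and> \<zeta> h < h"
      "\<And>h. h > 0 \<Longrightarrow> f (x + h *\<^sub>R a + h *\<^sub>R b) - f (x + h *\<^sub>R a) - f (x + h *\<^sub>R b) + f x = h * h * K a b (x + \<xi> h *\<^sub>R a + \<zeta> h *\<^sub>R b)"
    and 2: "\<And>h. h > 0 \<Longrightarrow> 0 < \<xi>' h \<and> \<xi>' h < h \<and> 0 < \<zeta>' h \<and> \<zeta>' h < h"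
      "\<And>h. h > 0 \<Longrightarrow> f (x + h *\<^sub>R b + h *\<^sub>R a) - f (x + h *\<^sub>R b) - f (x + h *\<^sub>R a) + f x = h * h * K b a (x + \<xi>' h *\<^sub>R b + \<zeta>' h *\<^sub>R a)"
    by metis
  have "K a b (x + \<xi> h *\<^sub>R a + \<zeta> h *\<^sub>R b) = K b a (x + \<xi>' h *\<^sub>R b + \<zeta>' h *\<^sub>R a)" if "h > 0" for h
  proof -
    have "h * h * K a b (x + \<xi> h *\<^sub>R a + \<zeta> h *\<^sub>R b) = h * h * K b a (x + \<xi>' h *\<^sub>R b + \<zeta>' h *\<^sub>R a)"
      using 1(2)[OF that] 2(2)[OF that] by (simp add: algebra_simps)
    then show ?thesis using that by simp
  qed
  then have "eventually (\<lambda>h. K a b (x + \<xi> h *\<^sub>R a + \<zeta> h *\<^sub>R b) = K b a (x + \<xi>' h *\<^sub>R b + \<zeta>' h *\<^sub>R a)) (at_right 0)"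
    by (auto intro: eventually_mono[OF eventually_at_right_less])
  then have "((\<lambda>h. K b a (x + \<xi>' h *\<^sub>R b + \<zeta>' h *\<^sub>R a)) \<longlongrightarrow> K a b x) (at_right 0)"
    by (rule Lim_transform_eventually[rotated]) (rule lim, use 1(1) in blast)
  then have "K a b x = K b a x"
    using lim[of \<xi>' \<zeta>' b a, OF 2(1)] tendsto_unique[OF trivial_limit_at_right_real] by blast
  then show ?thesis by (simp add: K_def)
qed

subsection \<open>Left- and right-invariant derivatives\<close>

context carnot
begin

section \<open>The part of the group law that is of first order in one factor\<close>

lemma nested_bracket_scale:
  "nested_bracket br (map (\<lambda>(c, v). c *\<^sub>R v) l) = prod_list (map fst l) *\<^sub>R nested_bracket br (map snd l)"
proof (induction l rule: induct_list012)
  case (3 x y zs)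
  then show ?case by (simp add: case_prod_beta br_simps)
qed auto

definition deg1 :: "(nat \<times> nat) list \<Rightarrow> nat" where "deg1 ps = (\<Sum>(p, q)\<leftarrow>ps. p)"
definition deg2 :: "(nat \<times> nat) list \<Rightarrow> nat" where "deg2 ps = (\<Sum>(p, q)\<leftarrow>ps. q)"
definition word :: "'b \<Rightarrow> 'b \<Rightarrow> (nat \<times> nat) list \<Rightarrow> 'b list" where
  "word a b ps = concat (map (\<lambda>(p, q). replicate p a @ replicate q b) ps)"
definition dynkin_coeff :: "nat \<Rightarrow> (nat \<times> nat) list \<Rightarrow> real" where
  "dynkin_coeff k ps = (- 1) ^ (k - 1) / real k *
     (1 / (real (\<Sum>(p, q) \<leftarrow> ps. p + q) * (\<Prod>(p, q) \<leftarrow> ps. fact p * fact q)))"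

lemma gmult_scaled:
  "gmult (r *\<^sub>R a) (t *\<^sub>R b) = (\<Sum>k\<in>{1..s}. \<Sum>ps\<in>dynkin_tuples s k.
     (dynkin_coeff k ps * (r ^ deg1 ps * t ^ deg2 ps)) *\<^sub>R nested_bracket br (word a b ps))"
proof -
  have "nested_bracket br (concat (map (\<lambda>(p, q). replicate p (r *\<^sub>R a) @ replicate q (t *\<^sub>R b)) ps)) =
      (r ^ deg1 ps * t ^ deg2 ps) *\<^sub>R nested_bracket br (word a b ps)" for ps
  proof -
    let ?w = "word (r, a) (t, b) ps"
    have "map (\<lambda>(c, v). c *\<^sub>R v) ?w = concat (map (\<lambda>(p, q). replicate p (r *\<^sub>R a) @ replicate q (t *\<^sub>R b)) ps)"
      and "map snd ?w = word a b ps" and "prod_list (map fst ?w) = r ^ deg1 ps * t ^ deg2 ps"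
      by (induction ps) (auto simp: word_def deg1_def deg2_def power_add prod_list_replicate)
    then show ?thesis using nested_bracket_scale[of ?w] by simp
  qed
  then show ?thesis
    unfolding gmult_bch bch_def dynkin_coeff_def by (simp add: scaleR_sum_right mult.assoc)
qed

text \<open>Differentiating \<open>gmult_scaled\<close> in \<open>t\<close> at 0 keeps exactly the
  words with a single entry \<open>b\<close>.\<close>

lemma left_field_scaled:
  "left_field gmult b (r *\<^sub>R a) = (\<Sum>k\<in>{1..s}. \<Sum>ps\<in>dynkin_tuples s k.
     (dynkin_coeff k ps * (r ^ deg1 ps * (if deg2 ps = 1 then 1 else 0))) *\<^sub>R nested_bracket br (word a b ps))"
proof -
  have "((\<lambda>t. gmult (r *\<^sub>R a) (0 + t *\<^sub>R b)) has_vector_derivative left_field gmult b (r *\<^sub>R a)) (at 0)"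
    unfolding left_field_def
    using smooth_line_derivative[OF smooth_gmult[OF smooth_const smooth_ident], where x = 0 and t = 0] by simp
  moreover have "((\<lambda>t. gmult (r *\<^sub>R a) (0 + t *\<^sub>R b)) has_vector_derivative (\<Sum>k\<in>{1..s}. \<Sum>ps\<in>dynkin_tuples s k.
     (dynkin_coeff k ps * (r ^ deg1 ps * (if deg2 ps = 1 then 1 else 0))) *\<^sub>R nested_bracket br (word a b ps))) (at 0)"
  proof -
    have d: "((\<lambda>t. (dynkin_coeff k ps * (r ^ deg1 ps * t ^ deg2 ps)) *\<^sub>R nested_bracket br (word a b ps)) has_vector_derivative
      (dynkin_coeff k ps * (r ^ deg1 ps * (if deg2 ps = 1 then 1 else 0))) *\<^sub>R nested_bracket br (word a b ps)) (at 0)" for k ps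
    proof -
      have "((\<lambda>t. dynkin_coeff k ps * (r ^ deg1 ps * t ^ deg2 ps)) has_real_derivative
          dynkin_coeff k ps * (r ^ deg1 ps * (if deg2 ps = 1 then 1 else 0))) (at 0)"
        by (auto intro!: derivative_eq_intros simp: power_0_left)
      from has_vector_derivative_scaleR[OF this has_vector_derivative_const] show ?thesis
        by (simp only: scaleR_zero_right add_0_left)
    qed
    show ?thesis unfolding add_0_left gmult_scaled
      by (intro has_vector_derivative_sum d)
  qed
  ultimately show ?thesis by (rule vector_derivative_unique_at)
qed

lemma left_field_linear: "linear (\<lambda>a. left_field gmult a x)"
  unfolding left_field_def
  using frechet_derivative_linear[OF smooth_gmult[OF smooth_const smooth_ident]] by simp

text \<open>A tuple has at most as many pairs as its total degree, so one entry of each kind forces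
  at most two pairs.\<close>

lemma dynkin_mixed:
  assumes "2 \<le> s"
  shows "{ps \<in> dynkin_tuples s 1. deg1 ps = 1 \<and> deg2 ps = 1} = {[(1, 1)]}"
    and "{ps \<in> dynkin_tuples s 2. deg1 ps = 1 \<and> deg2 ps = 1} = {[(1, 0), (0, 1)], [(0, 1), (1, 0)]}"
    and "3 \<le> k \<Longrightarrow> {ps \<in> dynkin_tuples s k. deg1 ps = 1 \<and> deg2 ps = 1} = {}"
proof -
  have len: "length ps \<le> deg1 ps + deg2 ps" if "\<forall>(p, q) \<in> set ps. p + q > 0" for ps
    using that by (induction ps) (auto simp: deg1_def deg2_def)
  have tot: "(\<Sum>(p, q) \<leftarrow> ps. p + q) = deg1 ps + deg2 ps" for ps
    by (induction ps) (auto simp: deg1_def deg2_def)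
  show "{ps \<in> dynkin_tuples s 1. deg1 ps = 1 \<and> deg2 ps = 1} = {[(1, 1)]}"
    using assms by (auto simp: dynkin_tuples_def deg1_def deg2_def length_Suc_conv)
  show "{ps \<in> dynkin_tuples s 2. deg1 ps = 1 \<and> deg2 ps = 1} = {[(1, 0), (0, 1)], [(0, 1), (1, 0)]}"
    using assms by (auto simp: dynkin_tuples_def deg1_def deg2_def length_Suc_conv numeral_2_eq_2 add_is_1)
  show "{ps \<in> dynkin_tuples s k. deg1 ps = 1 \<and> deg2 ps = 1} = {}" if "3 \<le> k"
    using len that by (fastforce simp: dynkin_tuples_def)
qed

text \<open>Only words with one \<open>a\<close> and one \<open>b\<close> survive. The tuple with
  one pair contributes half the bracket; the two tuples with two pairs contribute
  \<open>br a b\<close> and \<open>br b a\<close> with equal coefficient -1/4 and cancel. This is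
  how the Lie bracket is recovered from the group law.\<close>

lemma left_field_second_order:
  "((\<lambda>r. left_field gmult b (r *\<^sub>R a)) has_vector_derivative (1 / 2) *\<^sub>R br a b) (at 0)"
proof -
  let ?n = "\<lambda>ps. nested_bracket br (word a b ps)"
  let ?B = "\<lambda>k. {ps \<in> dynkin_tuples s k. deg1 ps = 1 \<and> deg2 ps = 1}"
  define m where "m = (\<Sum>k\<in>{1..s}. \<Sum>ps\<in>dynkin_tuples s k.
     (dynkin_coeff k ps * (if deg1 ps = 1 \<and> deg2 ps = 1 then 1 else 0)) *\<^sub>R ?n ps)"
  have d: "((\<lambda>r. (dynkin_coeff k ps * (r ^ deg1 ps * (if deg2 ps = 1 then 1 else 0))) *\<^sub>R ?n ps) has_vector_derivative
      (dynkin_coeff k ps * (if deg1 ps = 1 \<and> deg2 ps = 1 then 1 else 0)) *\<^sub>R ?n ps) (at 0)" for k ps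
  proof -
    have "((\<lambda>r. dynkin_coeff k ps * (r ^ deg1 ps * (if deg2 ps = 1 then 1 else 0))) has_real_derivative
        dynkin_coeff k ps * (if deg1 ps = 1 \<and> deg2 ps = 1 then 1 else 0)) (at 0)"
      by (auto intro!: derivative_eq_intros simp: power_0_left)
    from has_vector_derivative_scaleR[OF this has_vector_derivative_const] show ?thesis
      by (simp only: scaleR_zero_right add_0_left)
  qed
  have der: "((\<lambda>r. left_field gmult b (r *\<^sub>R a)) has_vector_derivative m) (at 0)"
    unfolding left_field_scaled m_def by (intro has_vector_derivative_sum d)
  have m: "m = (\<Sum>k\<in>{1..s}. \<Sum>ps\<in>?B k. dynkin_coeff k ps *\<^sub>R ?n ps)"
    unfolding m_def
  proof (rule sum.cong[OF refl])
    fix k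
    have "(\<Sum>ps\<in>dynkin_tuples s k. (dynkin_coeff k ps * (if deg1 ps = 1 \<and> deg2 ps = 1 then 1 else 0)) *\<^sub>R ?n ps) =
      (\<Sum>ps\<in>dynkin_tuples s k. if deg1 ps = 1 \<and> deg2 ps = 1 then dynkin_coeff k ps *\<^sub>R ?n ps else 0)"
      by (intro sum.cong) auto
    then show "(\<Sum>ps\<in>dynkin_tuples s k. (dynkin_coeff k ps * (if deg1 ps = 1 \<and> deg2 ps = 1 then 1 else 0)) *\<^sub>R ?n ps) =
      (\<Sum>ps\<in>?B k. dynkin_coeff k ps *\<^sub>R ?n ps)"
      by (simp add: sum.inter_filter[OF finite_dynkin_tuples])
  qed
  have "m = (1 / 2) *\<^sub>R br a b"
  proof (cases "2 \<le> s")
    case True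
    note mixed = dynkin_mixed[OF True]
    have "m = (\<Sum>k\<in>{1, 2}. \<Sum>ps\<in>?B k. dynkin_coeff k ps *\<^sub>R ?n ps)"
      unfolding m
    proof (intro sum.mono_neutral_right ballI)
      fix k assume "k \<in> {1..s} - {1, 2}"
      then have "3 \<le> k" by auto
      then show "(\<Sum>ps\<in>?B k. dynkin_coeff k ps *\<^sub>R ?n ps) = 0" using mixed(3)[of k] by (simp only: sum.empty)
    qed (use True in auto)
    also have "\<dots> = (1 / 2) *\<^sub>R br a b + ((- 1 / 4) *\<^sub>R br a b + (- 1 / 4) *\<^sub>R br b a)"
      by (simp add: mixed(1,2)[unfolded One_nat_def] dynkin_coeff_def word_def)
    also have "\<dots> = (1 / 2) *\<^sub>R br a b" using br_antisym[of b a] by simp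
    finally show ?thesis .
  next
    case False
    \<comment> \<open>In step one the truncation at degree 1 leaves no mixed word, and the bracket
      vanishes because \<open>V 1\<close> is the whole space.\<close>
    then have s: "s = 1" using step_pos by simp
    have "?B k = {}" for k
    proof -
      have "(\<Sum>(p, q) \<leftarrow> ps. p + q) = deg1 ps + deg2 ps" for ps
        by (induction ps) (auto simp: deg1_def deg2_def)
      then show ?thesis by (auto simp: dynkin_tuples_def s)
    qed
    then have "m = 0" unfolding m by (simp only: sum.empty sum.neutral_const)
    moreover have "x \<in> V 1" for x using part(2)[of x] part_layer[of 1 x] s by simp
    then have "br a b = 0" using bracket_last[of a b] s by simp
    ultimately show ?thesis by simp
  qed
  then show ?thesis using der by simp
qed

text \<open>\<open>LX\<close> moves the point by multiplication on the right, so it commutes with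
  left translations and can act on translated kernels. \<open>RX\<close> moves it on the left; it
  arises when the base point \<open>x\<close> of a kernel \<open>pk i (gmult (- x) \<xi>)\<close>
  varies.\<close>

definition LX :: "real ^ 'n \<Rightarrow> (real ^ 'n \<Rightarrow> real) \<Rightarrow> real ^ 'n \<Rightarrow> real" where
  "LX a \<phi> x = frechet_derivative (\<lambda>z. \<phi> (gmult x z)) (at 0) a"

definition RX :: "real ^ 'n \<Rightarrow> (real ^ 'n \<Rightarrow> real) \<Rightarrow> real ^ 'n \<Rightarrow> real" where
  "RX a \<phi> x = frechet_derivative (\<lambda>z. \<phi> (gmult z x)) (at 0) a"

lemma LX_eq: "smooth \<phi> \<Longrightarrow> LX a \<phi> x = frechet_derivative \<phi> (at x) (left_field gmult a x)"
  unfolding LX_def left_field_def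
  by (subst frechet_derivative_chain[OF _ smooth_gmult[OF smooth_const smooth_ident]]) auto

lemma RX_eq: "smooth \<phi> \<Longrightarrow> RX a \<phi> x = frechet_derivative \<phi> (at x) (frechet_derivative (\<lambda>z. gmult z x) (at 0) a)"
  unfolding RX_def
  by (subst frechet_derivative_chain[OF _ smooth_gmult[OF smooth_ident smooth_const]]) auto

lemma LX_linear: "smooth \<phi> \<Longrightarrow> linear (\<lambda>a. LX a \<phi> x)"
  unfolding LX_def
  by (rule frechet_derivative_linear[OF smooth_compose[OF _ smooth_gmult[OF smooth_const smooth_ident]]])

lemma RX_linear: "smooth \<phi> \<Longrightarrow> linear (\<lambda>a. RX a \<phi> x)"
  unfolding RX_def
  by (rule frechet_derivative_linear[OF smooth_compose[OF _ smooth_gmult[OF smooth_ident smooth_const]]])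

lemma smooth_partial_derivative:
  fixes c d :: "'d::euclidean_space \<Rightarrow> real ^ 'n" and H :: "(real ^ 'n) \<times> (real ^ 'n) \<Rightarrow> 'c::euclidean_space"
  assumes "smooth H" "smooth g" "smooth d" "smooth c"
  shows "smooth (\<lambda>x. frechet_derivative (\<lambda>z. H (g x, z)) (at (d x)) (c x))"
proof -
  have "frechet_derivative (\<lambda>z. H (x, z)) (at y) v = frechet_derivative H (at (x, y)) (0, v)" for x y v
  proof -
    have "((\<lambda>z. (x, z)) has_derivative (\<lambda>v. (0, v))) (at y)"
      by (auto intro!: derivative_eq_intros)
    then show ?thesis
      using frechet_derivative_chain[OF assms(1) smooth_Pair[OF smooth_const smooth_ident], of x y v]
        frechet_derivative_eqI by metis
  qed
  then show ?thesis
    using assms by (auto intro!: smooth_frechet_apply smooth_Pair)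
qed

lemma smooth_LX: "smooth \<phi> \<Longrightarrow> smooth (LX a \<phi>)"
  unfolding LX_def
  using smooth_partial_derivative[OF smooth_compose[OF _ smooth_gmult[OF smooth_fst smooth_snd]] smooth_ident smooth_const smooth_const, of \<phi> 0 a]
  by simp

lemma smooth_RX: "smooth \<phi> \<Longrightarrow> smooth (RX a \<phi>)"
  unfolding RX_def
  using smooth_partial_derivative[OF smooth_compose[OF _ smooth_gmult[OF smooth_snd smooth_fst]] smooth_ident smooth_const smooth_const, of \<phi> 0 a]
  by simp

lemma smooth_left_field: "smooth (left_field gmult a)"
  unfolding left_field_def
  using smooth_partial_derivative[OF smooth_gmult[OF smooth_fst smooth_snd] smooth_ident smooth_const smooth_const, of 0 a]
  by simp

lemma LX_translate: "LX a (\<lambda>v. \<phi> (gmult y v)) x = LX a \<phi> (gmult y x)"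
  by (simp add: LX_def assoc)

lemma LX_mult: "smooth \<phi> \<Longrightarrow> smooth \<psi> \<Longrightarrow> LX a (\<lambda>x. \<phi> x * \<psi> x) x = \<phi> x * LX a \<psi> x + LX a \<phi> x * \<psi> x"
  by (simp add: LX_eq smooth_mult frechet_derivative_eqI[OF has_derivative_mult[OF smooth_has_derivative smooth_has_derivative]])

text \<open>The curve is a translated one-parameter subgroup (\<open>gmult_parallel\<close>), so the
  derivative at time \<open>t\<close> is the derivative at time 0 from a shifted starting
  point.\<close>

lemma LX_curve:
  assumes "smooth \<phi>"
  shows "((\<lambda>t. \<phi> (gmult x (t *\<^sub>R a))) has_real_derivative LX a \<phi> (gmult x (t *\<^sub>R a))) (at t)"
proof -
  have "((\<lambda>h. \<phi> (gmult (gmult x (t *\<^sub>R a)) (0 + h *\<^sub>R a))) has_real_derivative LX a \<phi> (gmult x (t *\<^sub>R a))) (at 0)"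
    unfolding LX_def has_real_derivative_iff_has_vector_derivative
    using smooth_line_derivative[OF smooth_compose[OF assms smooth_gmult[OF smooth_const smooth_ident]], where t = 0 and x = 0]
    by simp
  moreover have "(\<lambda>h. \<phi> (gmult (gmult x (t *\<^sub>R a)) (0 + h *\<^sub>R a))) = (\<lambda>h. \<phi> (gmult x ((h + t) *\<^sub>R a)))"
    by (simp add: assoc gmult_parallel add.commute)
  ultimately have "((\<lambda>h. \<phi> (gmult x ((h + t) *\<^sub>R a))) has_real_derivative LX a \<phi> (gmult x (t *\<^sub>R a))) (at 0)" by simp
  then show ?thesis using DERIV_shift[of "\<lambda>h. \<phi> (gmult x (h *\<^sub>R a))" _ 0 t] by simp
qed

lemma RX_curve:
  assumes "smooth \<phi>"
  shows "((\<lambda>t. \<phi> (gmult (t *\<^sub>R a) x)) has_real_derivative RX a \<phi> (gmult (t *\<^sub>R a) x)) (at t)"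
proof -
  have "((\<lambda>h. \<phi> (gmult (0 + h *\<^sub>R a) (gmult (t *\<^sub>R a) x))) has_real_derivative RX a \<phi> (gmult (t *\<^sub>R a) x)) (at 0)"
    unfolding RX_def has_real_derivative_iff_has_vector_derivative
    using smooth_line_derivative[OF smooth_compose[OF assms smooth_gmult[OF smooth_ident smooth_const]], where t = 0 and x = 0]
    by simp
  moreover have "(\<lambda>h. \<phi> (gmult (0 + h *\<^sub>R a) (gmult (t *\<^sub>R a) x))) = (\<lambda>h. \<phi> (gmult ((h + t) *\<^sub>R a) x))"
    by (simp add: assoc[symmetric] gmult_parallel)
  ultimately have "((\<lambda>h. \<phi> (gmult ((h + t) *\<^sub>R a) x)) has_real_derivative RX a \<phi> (gmult (t *\<^sub>R a) x)) (at 0)" by simp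
  then show ?thesis using DERIV_shift[of "\<lambda>h. \<phi> (gmult (h *\<^sub>R a) x)" _ 0 t] by simp
qed

text \<open>In coordinates centred at \<open>x\<close>, applying \<open>LX b\<close> and then
  \<open>LX a\<close> gives a second derivative at 0 plus the first derivative along half the
  bracket. Antisymmetrising removes the symmetric second derivative and doubles the other
  term.\<close>

lemma LX_commutator:
  assumes "smooth \<phi>"
  shows "LX a (LX b \<phi>) x - LX b (LX a \<phi>) x = LX (br a b) \<phi> x"
proof -
  define f where "f = (\<lambda>z. \<phi> (gmult x z))"
  have f: "smooth f" unfolding f_def using assms by (intro smooth_compose[OF assms] smooth_gmult) auto
  have key: "LX a (LX b \<phi>) x = frechet_derivative f (at 0) ((1 / 2) *\<^sub>R br a b) +
      frechet_derivative (\<lambda>v. frechet_derivative f (at v) b) (at 0) a" for a b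
  proof -
    let ?D = "\<lambda>v i. frechet_derivative f (at v) i"
    have "((\<lambda>r. LX b \<phi> (gmult x (r *\<^sub>R a))) has_real_derivative LX a (LX b \<phi>) x) (at 0)"
      using LX_curve[OF smooth_LX[OF assms], where t = 0] by simp
    moreover have "LX b \<phi> (gmult x (r *\<^sub>R a)) = (\<Sum>i\<in>Basis. (left_field gmult b (r *\<^sub>R a) \<bullet> i) * ?D (r *\<^sub>R a) i)" for r
    proof -
      have "LX b \<phi> (gmult x (r *\<^sub>R a)) = LX b f (r *\<^sub>R a)"
        unfolding f_def LX_translate ..
      also have "\<dots> = ?D (r *\<^sub>R a) (left_field gmult b (r *\<^sub>R a))" by (rule LX_eq[OF f])
      finally show ?thesis
        using linear_euclidean_expansion[OF frechet_derivative_linear[OF f], of "r *\<^sub>R a" "left_field gmult b (r *\<^sub>R a)"]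
        by simp
    qed
    moreover have "((\<lambda>r. \<Sum>i\<in>Basis. (left_field gmult b (r *\<^sub>R a) \<bullet> i) * ?D (r *\<^sub>R a) i) has_real_derivative
        (\<Sum>i\<in>Basis. (left_field gmult b (0 *\<^sub>R a) \<bullet> i) * frechet_derivative (\<lambda>v. ?D v i) (at 0) a +
          (((1 / 2) *\<^sub>R br a b) \<bullet> i) * ?D (0 *\<^sub>R a) i)) (at 0)"
    proof (intro DERIV_sum)
      fix i :: "real ^ 'n"
      have "((\<lambda>r. left_field gmult b (r *\<^sub>R a) \<bullet> i) has_real_derivative ((1 / 2) *\<^sub>R br a b) \<bullet> i) (at 0)"
        unfolding has_real_derivative_iff_has_vector_derivative
        by (rule bounded_linear.has_vector_derivative[OF bounded_linear_inner_left left_field_second_order])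
      moreover have "((\<lambda>r. ?D (r *\<^sub>R a) i) has_real_derivative frechet_derivative (\<lambda>v. ?D v i) (at 0) a) (at 0)"
        unfolding has_real_derivative_iff_has_vector_derivative
        using smooth_line_derivative[OF smooth_deriv[OF f, of i], of 0 a 0] by simp
      ultimately show "((\<lambda>r. (left_field gmult b (r *\<^sub>R a) \<bullet> i) * ?D (r *\<^sub>R a) i) has_real_derivative
          (left_field gmult b (0 *\<^sub>R a) \<bullet> i) * frechet_derivative (\<lambda>v. ?D v i) (at 0) a +
          (((1 / 2) *\<^sub>R br a b) \<bullet> i) * ?D (0 *\<^sub>R a) i) (at 0)"
        by (rule DERIV_cong[OF DERIV_mult]) (simp add: algebra_simps)
    qed
    ultimately have "LX a (LX b \<phi>) x = (\<Sum>i\<in>Basis. (left_field gmult b (0 *\<^sub>R a) \<bullet> i) * frechet_derivative (\<lambda>v. ?D v i) (at 0) a +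
          (((1 / 2) *\<^sub>R br a b) \<bullet> i) * ?D (0 *\<^sub>R a) i)"
      using DERIV_unique by simp
    moreover have "left_field gmult b 0 = b"
    proof -
      have "gmult 0 = (\<lambda>z. z)" by auto
      then show ?thesis by (simp add: left_field_def)
    qed
    moreover have "(\<Sum>i\<in>Basis. (b \<bullet> i) * frechet_derivative (\<lambda>v. ?D v i) (at 0) a) = frechet_derivative (\<lambda>v. ?D v b) (at 0) a"
    proof -
      have "(\<lambda>v. ?D v b) = (\<lambda>v. \<Sum>i\<in>Basis. (b \<bullet> i) * ?D v i)"
        by (rule ext, subst linear_euclidean_expansion[OF frechet_derivative_linear[OF f], of _ b]) simp
      then have 1: "frechet_derivative (\<lambda>v. ?D v b) (at 0) a = frechet_derivative (\<lambda>v. \<Sum>i\<in>Basis. (b \<bullet> i) * ?D v i) (at 0) a"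
        by (rule arg_cong[where f = "\<lambda>F. frechet_derivative F (at 0) a"])
      have "((\<lambda>v. \<Sum>i\<in>Basis. (b \<bullet> i) * ?D v i) has_derivative
          (\<lambda>h. \<Sum>i\<in>Basis. (b \<bullet> i) * frechet_derivative (\<lambda>v. ?D v i) (at 0) h)) (at 0)"
        by (intro has_derivative_sum has_derivative_mult_right smooth_has_derivative smooth_deriv f)
      then show ?thesis unfolding 1 by (subst frechet_derivative_eqI) auto
    qed
    moreover have "(\<Sum>i\<in>Basis. (((1 / 2) *\<^sub>R br a b) \<bullet> i) * ?D 0 i) = ?D 0 ((1 / 2) *\<^sub>R br a b)"
      using linear_euclidean_expansion[OF frechet_derivative_linear[OF f], of 0 "(1 / 2) *\<^sub>R br a b"] by simp
    ultimately show ?thesis by (simp add: sum.distrib)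
  qed
  have "LX a (LX b \<phi>) x - LX b (LX a \<phi>) x =
      frechet_derivative f (at 0) ((1 / 2) *\<^sub>R br a b) - frechet_derivative f (at 0) ((1 / 2) *\<^sub>R br b a)"
    unfolding key using second_derivative_symmetric[OF f, of a 0 b] by simp
  also have "\<dots> = frechet_derivative f (at 0) (br a b)"
    using br_antisym[of b a] linear_scale[OF frechet_derivative_linear[OF f]] linear_neg[OF frechet_derivative_linear[OF f]]
    by simp
  finally show ?thesis by (simp add: LX_def f_def)
qed

end

subsection \<open>Linear and unimodular changes of variables\<close>

text \<open>
  The library's change of variables asks for a well-ordered index type; \<open>wo\<close> is a copy of a finite
  type that carries such an order.
\<close>

typedef 'n wo = "UNIV :: 'n set" by auto

instance wo :: (finite) finite
proof
  have "surj (Abs_wo :: 'a \<Rightarrow> 'a wo)" by (metis Rep_wo_inverse surjI)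
  then show "finite (UNIV :: 'a wo set)" using finite_imageI[of "UNIV :: 'a set" Abs_wo] by simp
qed

instantiation wo :: (finite) wellorder
begin

definition "x \<le> y \<longleftrightarrow> to_nat (Rep_wo x) \<le> to_nat (Rep_wo y)" for x y :: "'a wo"
definition "x < y \<longleftrightarrow> to_nat (Rep_wo x) < to_nat (Rep_wo y)" for x y :: "'a wo"

instance
proof
  fix x y z :: "'a wo"
  show "x < y \<longleftrightarrow> x \<le> y \<and> \<not> y \<le> x" "x \<le> x" "x \<le> y \<or> y \<le> x"
    by (auto simp: less_eq_wo_def less_wo_def)
  show "x \<le> y \<Longrightarrow> y \<le> z \<Longrightarrow> x \<le> z" by (auto simp: less_eq_wo_def)
  show "x \<le> y \<Longrightarrow> y \<le> x \<Longrightarrow> x = y" by (auto simp: less_eq_wo_def Rep_wo_inject)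
  fix P :: "'a wo \<Rightarrow> bool" and a assume P: "\<And>x. (\<And>y. y < x \<Longrightarrow> P y) \<Longrightarrow> P x"
  show "P a"
  proof (induction "to_nat (Rep_wo a)" arbitrary: a rule: less_induct)
    case less
    show ?case by (rule P, rule less) (simp add: less_wo_def)
  qed
qed

end

definition to_wo :: "real ^ 'n \<Rightarrow> real ^ ('n::finite) wo" where "to_wo x = (\<chi> i. x $ Rep_wo i)"
definition of_wo :: "real ^ ('n::finite) wo \<Rightarrow> real ^ 'n" where "of_wo x = (\<chi> i. x $ Abs_wo i)"

lemma to_of_wo [simp]: "to_wo (of_wo x) = x" "of_wo (to_wo y) = y"
  by (auto simp: to_wo_def of_wo_def vec_eq_iff Rep_wo_inverse Abs_wo_inverse)

lemma linear_to_wo: "linear to_wo" and linear_of_wo: "linear of_wo"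
  by (auto intro!: linearI simp: to_wo_def of_wo_def vec_eq_iff)

lemma bounded_linear_wo: "bounded_linear to_wo" "bounded_linear of_wo"
  by (simp_all add: linear_to_wo linear_of_wo linear_linear)

lemma borel_wo [measurable]: "to_wo \<in> borel \<rightarrow>\<^sub>M borel" "of_wo \<in> borel \<rightarrow>\<^sub>M borel"
  by (rule borel_measurable_continuous_onI, rule linear_continuous_on, rule bounded_linear_wo)+

lemma emeasure_lborel_box_cart:
  fixes l u :: "real ^ 'm"
  shows "emeasure lborel (box l u) = (if \<forall>i. l $ i \<le> u $ i then ennreal (\<Prod>i\<in>UNIV. u $ i - l $ i) else 0)"
proof -
  have "(\<Prod>b\<in>Basis. (u - l) \<bullet> b) = (\<Prod>i\<in>UNIV. u $ i - l $ i)"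
    unfolding Basis_vec_def
    by (subst prod.reindex_cong[where l = "\<lambda>i. axis i 1" and B = UNIV])
      (auto simp: inj_on_def axis_eq_axis inner_axis inner_diff_left)
  then show ?thesis
    by (auto simp: emeasure_lborel_box_eq Basis_vec_def inner_axis)
qed

lemma distr_lborel_of_wo: "distr lborel borel of_wo = (lborel :: (real ^ 'n) measure)"
proof (rule lborel_eqI[symmetric])
  fix l u :: "real ^ 'n" assume lu: "\<And>b. b \<in> Basis \<Longrightarrow> l \<bullet> b \<le> u \<bullet> b"
  have vim: "of_wo -` box l u = box (to_wo l) (to_wo u)"
    by (auto simp: box_def Basis_vec_def inner_axis of_wo_def to_wo_def)
      (metis Abs_wo_inverse UNIV_I Rep_wo_inverse)+
  have "bij_betw Rep_wo UNIV (UNIV :: 'n set)"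
    by (metis Abs_wo_inverse Rep_wo_inject UNIV_I bij_betw_def inj_onI surjI)
  then have "(\<Prod>i\<in>UNIV. to_wo u $ i - to_wo l $ i) = (\<Prod>i\<in>UNIV. u $ i - l $ i)"
    using prod.reindex_bij_betw[of Rep_wo UNIV UNIV "\<lambda>i. u $ i - l $ i"] by (simp add: to_wo_def)
  then have "emeasure lborel (box (to_wo l) (to_wo u)) = emeasure lborel (box l u)"
    by (auto simp: emeasure_lborel_box_cart to_wo_def) (metis Abs_wo_inverse UNIV_I)
  also have "\<dots> = (\<Prod>b\<in>Basis. (u - l) \<bullet> b)"
    using lu by simp
  finally show "emeasure (distr lborel borel of_wo) (box l u) = (\<Prod>b\<in>Basis. (u - l) \<bullet> b)"
    by (subst emeasure_distr) (simp_all add: vim)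
qed simp

lemma distr_lborel_to_wo: "distr lborel borel to_wo = (lborel :: (real ^ ('n::finite) wo) measure)"
proof -
  have "distr (distr lborel borel of_wo) borel to_wo = distr (lborel :: (real ^ ('n::finite) wo) measure) borel (\<lambda>x. x)"
    by (simp add: distr_distr comp_def)
  then show ?thesis by (simp add: distr_lborel_of_wo distr_id2)
qed

text \<open>Lebesgue measure is determined by its values on boxes. The preimage of a box under
  \<open>f\<close> is its image under \<open>g\<close>, whose volume is that of the box times the
  constant Jacobian.\<close>

lemma distr_lborel_diffeo_wo:
  fixes f g :: "real ^ 'm :: {finite, wellorder} \<Rightarrow> real ^ 'm :: {finite, wellorder}"
  assumes f: "f \<in> borel_measurable borel" and inv: "\<And>x. f (g x) = x" "\<And>x. g (f x) = x"
    and g: "\<And>x. (g has_derivative g' x) (at x)" and c: "\<And>x. \<bar>det (matrix (g' x))\<bar> = c" "c > 0"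
  shows "distr lborel borel f = density lborel (\<lambda>_. ennreal c)"
proof -
  define M where "M = density (distr lborel borel f) (\<lambda>_. ennreal (1 / c))"
  have "M = lborel"
  proof (rule lborel_eqI[symmetric])
    fix l u :: "real ^ 'm :: {finite, wellorder}" assume lu: "\<And>b. b \<in> Basis \<Longrightarrow> l \<bullet> b \<le> u \<bullet> b"
    have vim: "f -` box l u = g ` box l u"
      using inv by (auto simp: image_iff) metis
    have b: "f -` box l u \<in> sets borel"
      using measurable_sets[OF f, of "box l u"] by simp
    have int: "(\<lambda>x. \<bar>det (matrix (g' x))\<bar>) integrable_on box l u"
      unfolding c by (simp add: integrable_on_const)
    have gd: "(g has_derivative g' x) (at x within box l u)" for x
      using g has_derivative_at_withinI by blast
    have inj: "inj_on g (box l u)" by (metis inv(1) inj_onI)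
    have m: "g ` box l u \<in> lmeasurable"
      using measurable_differentiable_image_eq[OF _ gd inj] int by simp
    have "measure lebesgue (g ` box l u) = integral (box l u) (\<lambda>x. \<bar>det (matrix (g' x))\<bar>)"
      by (rule measure_differentiable_image_eq[OF _ gd inj int]) simp
    also have "\<dots> = c * measure lborel (box l u)"
      using lmeasure_integral[OF lmeasurable_box, of l u] integral_mult_right[of "box l u" c "\<lambda>_. 1"]
      by (simp add: c)
    finally have ms: "measure lebesgue (g ` box l u) = c * measure lborel (box l u)" .
    have "emeasure lborel (f -` box l u) = emeasure lebesgue (g ` box l u)"
      using b by (simp add: vim)
    also have "\<dots> = ennreal (c * measure lborel (box l u))"
      using m ms emeasure_eq_measure2 by (simp add: emeasure_eq_ennreal_measure fmeasurable_def less_top)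
    finally have e: "emeasure lborel (f -` box l u) = ennreal (c * measure lborel (box l u))" .
    have "emeasure M (box l u) = ennreal (1 / c) * emeasure lborel (f -` box l u)"
      unfolding M_def using f by (simp add: emeasure_density_const emeasure_distr)
    also have "\<dots> = ennreal (measure lborel (box l u))"
      unfolding e using c(2) by (simp add: ennreal_mult[symmetric])
    also have "\<dots> = (\<Prod>b\<in>Basis. (u - l) \<bullet> b)"
      using lu by simp
    finally show "emeasure M (box l u) = (\<Prod>b\<in>Basis. (u - l) \<bullet> b)" .
  qed (simp add: M_def)
  then have "density lborel (\<lambda>_. ennreal c) = density M (\<lambda>_. ennreal c)" by simp
  also have "\<dots> = density (distr lborel borel f) (\<lambda>_. ennreal (1 / c) * ennreal c)"
    unfolding M_def by (rule density_density_eq) auto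
  also have "\<dots> = distr lborel borel f"
    using c(2) by (simp add: ennreal_mult[symmetric] density_1 ennreal_1)
  finally show ?thesis by simp
qed

definition jac :: "(real ^ 'n \<Rightarrow> real ^ 'n) \<Rightarrow> real" where
  "jac L = \<bar>det (matrix (to_wo \<circ> L \<circ> of_wo))\<bar>"

lemma jac_compose:
  assumes "linear L" "linear M" shows "jac (L \<circ> M) = jac L * jac M"
proof -
  have "to_wo \<circ> (L \<circ> M) \<circ> of_wo = (to_wo \<circ> L \<circ> of_wo) \<circ> (to_wo \<circ> M \<circ> of_wo)" by auto
  moreover have "linear (to_wo \<circ> L \<circ> of_wo)" "linear (to_wo \<circ> M \<circ> of_wo)"
    using assms by (auto intro!: linear_compose linear_to_wo linear_of_wo)
  ultimately show ?thesis unfolding jac_def by (simp add: matrix_compose det_mul abs_mult)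
qed

lemma jac_id [simp]: "jac (\<lambda>x. x) = 1"
  using matrix_id_mat_1 by (simp add: jac_def comp_def id_def)

lemma distr_lborel_diffeo:
  fixes f g :: "real ^ 'n \<Rightarrow> real ^ 'n"
  assumes f: "f \<in> borel_measurable borel" and inv: "\<And>x. f (g x) = x" "\<And>x. g (f x) = x"
    and g: "\<And>x. (g has_derivative g' x) (at x)" and c: "\<And>x. jac (g' x) = c" "c > 0"
  shows "distr lborel borel f = density lborel (\<lambda>_. ennreal c)"
proof -
  let ?f = "to_wo \<circ> f \<circ> of_wo" and ?g = "to_wo \<circ> g \<circ> of_wo"
  have "distr lborel borel ?f = density lborel (\<lambda>_. ennreal c)"
  proof (rule distr_lborel_diffeo_wo)
    show "?f \<in> borel_measurable borel" using f by measurable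
    show "?f (?g x) = x" "?g (?f x) = x" for x by (simp_all add: inv)
    show "(?g has_derivative to_wo \<circ> g' (of_wo x) \<circ> of_wo) (at x)" for x
      unfolding comp_def
      by (intro bounded_linear.has_derivative[OF bounded_linear_wo(1)] has_derivative_compose[OF _ g]
         bounded_linear_imp_has_derivative bounded_linear_wo)
    show "\<bar>det (matrix (to_wo \<circ> g' (of_wo x) \<circ> of_wo))\<bar> = c" for x
      using c(1) by (simp add: jac_def)
  qed (rule c)
  moreover have "distr lborel borel f = distr (distr (distr lborel borel to_wo) borel ?f) borel of_wo"
    using f by (simp add: distr_distr comp_def)
  ultimately have "distr lborel borel f = distr (density lborel (\<lambda>_. ennreal c)) borel of_wo"
    by (simp add: distr_lborel_to_wo)
  also have "\<dots> = density (distr lborel borel of_wo) (\<lambda>_. ennreal c)"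
    by (rule density_distr[symmetric]) auto
  finally show ?thesis by (simp add: distr_lborel_of_wo)
qed

subsection \<open>Haar measure\<close>

context carnot
begin

text \<open>This is the power of \<open>\<bar>t\<bar>\<close> whose exponent is the homogeneous
  dimension of the group; multiplicativity and positivity carry all later rescalings.\<close>

definition J :: "real \<Rightarrow> real" where "J t = jac (dil t)"

lemma J_mult: "J (t * u) = J t * J u"
  using jac_compose[OF linear_dil linear_dil, of t u] by (simp add: J_def comp_def)

lemma J_1 [simp]: "J 1 = 1"
proof -
  have "dil 1 = (\<lambda>x. x)" by auto
  then show ?thesis by (simp add: J_def)
qed

lemma J_pos: "t \<noteq> 0 \<Longrightarrow> J t > 0"
proof -
  assume "t \<noteq> 0"
  then have "J t * J (1 / t) = 1" using J_mult[of t "1 / t"] by simp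
  then have "J t \<noteq> 0" by auto
  then show ?thesis by (simp add: J_def jac_def)
qed

lemma J_power: "J (t ^ n) = J t ^ n"
  by (induction n) (auto simp: J_mult)

lemma distr_dil: "t \<noteq> 0 \<Longrightarrow> distr lborel borel (dil (1 / t)) = density lborel (\<lambda>_. ennreal (J t))"
  by (rule distr_lborel_diffeo[where g = "dil t" and g' = "\<lambda>_. dil t"])
    (auto simp: J_def[symmetric] J_pos intro: bounded_linear_imp_has_derivative[OF bounded_linear_dil])

text \<open>Conjugating by a dilation moves both points towards 0 without changing the Jacobian. By
  continuity the Jacobian equals its value at the origin, where left translation is the
  identity.\<close>

lemma jac_left_translation: "jac (frechet_derivative (\<lambda>z. gmult x z) (at z)) = 1"
proof -
  define D where "D = (\<lambda>x z. frechet_derivative (\<lambda>z. gmult x z) (at z))"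
  have sm: "smooth (\<lambda>z. gmult x z)" for x by (intro smooth_gmult) auto
  have lin: "linear (D x z)" for x z unfolding D_def by (rule frechet_derivative_linear[OF sm])
  have scale: "jac (D (dil t x) (dil t z)) = jac (D x z)" if "t \<noteq> 0" for t x z
  proof -
    have smd: "smooth (dil t)" by (rule smooth_bounded_linear[OF bounded_linear_dil])
    have fd: "frechet_derivative (dil t) (at y) = dil t" for y
      by (rule frechet_derivative_eqI[OF bounded_linear_imp_has_derivative[OF bounded_linear_dil]])
    have "frechet_derivative (\<lambda>z. gmult (dil t x) (dil t z)) (at z) v = D (dil t x) (dil t z) (dil t v)" for v
      using frechet_derivative_chain[OF sm smd, of "dil t x" z v] fd by (simp add: D_def)
    moreover have "frechet_derivative (\<lambda>z. gmult (dil t x) (dil t z)) (at z) v = dil t (D x z v)" for v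
      unfolding gmult_dil using frechet_derivative_chain[OF smd sm, of x z v] fd by (simp add: D_def)
    ultimately have "D (dil t x) (dil t z) \<circ> dil t = dil t \<circ> D x z" by auto
    then have "jac (D (dil t x) (dil t z)) * J t = J t * jac (D x z)"
      using jac_compose[OF lin linear_dil] jac_compose[OF linear_dil lin] by (metis J_def)
    then show ?thesis using J_pos[OF that] by simp
  qed
  have "continuous_on UNIV (\<lambda>t. D (dil t x) (dil t z) v)" for v
  proof -
    have "smooth (\<lambda>p. frechet_derivative (\<lambda>z. gmult (fst p) z) (at (snd p)) v)"
      using smooth_partial_derivative[OF smooth_gmult[OF smooth_fst smooth_snd] smooth_fst smooth_snd smooth_const] by simp
    moreover have "continuous_on UNIV (\<lambda>t. (dil t x, dil t z))"
      by (intro continuous_on_Pair continuous_on_dil continuous_on_const continuous_on_id)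
    ultimately show ?thesis
      unfolding D_def
      using smooth_continuous_compose[of "\<lambda>p. frechet_derivative (\<lambda>z. gmult (fst p) z) (at (snd p)) v" UNIV "\<lambda>t. (dil t x, dil t z)"]
      by simp
  qed
  then have "continuous_on UNIV (\<lambda>t. jac (D (dil t x) (dil t z)))"
    unfolding jac_def det_def matrix_def
    by (auto intro!: continuous_intros bounded_linear.continuous_on[OF bounded_linear_wo(1)])
  then have "isCont (\<lambda>t. jac (D (dil t x) (dil t z))) 0"
    by (simp add: continuous_on_eq_continuous_at)
  then have "((\<lambda>t. jac (D (dil t x) (dil t z))) \<longlongrightarrow> jac (D 0 0)) (at_right 0)"
    by (auto simp: isCont_def intro: tendsto_within_subset)
  moreover have "eventually (\<lambda>t. jac (D (dil t x) (dil t z)) = jac (D x z)) (at_right 0)"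
    by (auto intro: eventually_mono[OF eventually_at_right_less] scale)
  ultimately have "((\<lambda>t. jac (D x z)) \<longlongrightarrow> jac (D 0 0)) (at_right (0::real))"
    by (rule Lim_transform_eventually)
  then have "jac (D x z) = jac (D 0 0)"
    using tendsto_unique[OF trivial_limit_at_right_real] tendsto_const by blast
  moreover have "gmult 0 = (\<lambda>z. z)" by auto
  ultimately show ?thesis by (simp add: D_def)
qed

lemma distr_left_translation: "distr lborel borel (gmult x) = lborel"
proof -
  have "distr lborel borel (gmult x) = density lborel (\<lambda>_. ennreal 1)"
  proof (rule distr_lborel_diffeo)
    show "(gmult (- x) has_derivative frechet_derivative (\<lambda>z. gmult (- x) z) (at z)) (at z)" for z
      by (rule smooth_has_derivative[OF smooth_gmult]) auto
    show "gmult x (gmult (- x) z) = z" "gmult (- x) (gmult x z) = z" for z by simp_all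
  qed (simp_all add: jac_left_translation)
  then show ?thesis by (simp add: density_1)
qed

lemma distr_neg: "distr lborel borel uminus = (lborel :: (real ^ 'n) measure)"
proof -
  have "distr lborel borel uminus = density (lborel :: (real ^ 'n) measure) (\<lambda>_. ennreal (jac (\<lambda>x :: real ^ 'n. - x)))"
  proof (rule distr_lborel_diffeo[where g = uminus and g' = "\<lambda>_ x. - x"])
    have "jac (\<lambda>x :: real ^ 'n. - x) * jac (\<lambda>x :: real ^ 'n. - x) = 1"
      using jac_compose[of "\<lambda>x :: real ^ 'n. - x" "\<lambda>x. - x"] linear_uminus by (simp add: comp_def)
    then have "jac (\<lambda>x :: real ^ 'n. - x) \<noteq> 0" by auto
    then show "0 < jac (\<lambda>x :: real ^ 'n. - x)" by (simp add: jac_def)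
  qed (auto intro!: derivative_eq_intros)
  moreover have "jac (\<lambda>x :: real ^ 'n. - x) = 1"
  proof -
    have "jac (\<lambda>x :: real ^ 'n. - x) * jac (\<lambda>x :: real ^ 'n. - x) = 1"
      using jac_compose[of "\<lambda>x :: real ^ 'n. - x" "\<lambda>x. - x"] linear_uminus by (simp add: comp_def)
    then have "jac (\<lambda>x :: real ^ 'n. - x) ^ 2 = 1" by (simp add: power2_eq_square)
    then show ?thesis by (auto simp: jac_def power2_eq_1_iff)
  qed
  ultimately show ?thesis by (simp add: density_1)
qed

text \<open>The group inverse \<open>uminus\<close> preserves Lebesgue measure and turns left
  translations into right ones, so invariance on one side gives it on the other.\<close>

lemma distr_right_translation: "distr lborel borel (\<lambda>z. gmult z x) = lborel"
proof -
  have "(\<lambda>z. gmult z x) = uminus \<circ> gmult (- x) \<circ> uminus" by (auto simp: neg_gmult)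
  then have "distr lborel borel (\<lambda>z. gmult z x) = distr (distr (distr lborel borel uminus) borel (gmult (- x))) borel uminus"
    by (simp add: distr_distr comp_assoc)
  then show ?thesis by (simp add: distr_neg distr_left_translation)
qed

end

subsection \<open>Horizontal divergences\<close>

lemma integrable_compact_support:
  fixes f :: "'a::euclidean_space \<Rightarrow> real"
  assumes "continuous_on UNIV f" "\<And>x. norm x > R \<Longrightarrow> f x = 0" shows "integrable lborel f"
proof -
  have "integrable lborel (\<lambda>x. indicator (cball 0 R) x *\<^sub>R f x)"
    using assms(1) by (intro borel_integrable_compact) (auto intro: continuous_on_subset)
  moreover have "(\<lambda>x. indicator (cball 0 R) x *\<^sub>R f x) = f"
    using assms(2) by (force simp: indicator_def not_le)
  ultimately show ?thesis by simp
qed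

lemma test_smooth: "f \<in> test_functions \<Longrightarrow> smooth f"
  by (simp add: test_functions_iff)

lemma test_integrable: "f \<in> test_functions \<Longrightarrow> integrable lborel f" for f :: "'a::euclidean_space \<Rightarrow> real"
  using integrable_compact_support[of f] smooth_continuous_on[of f UNIV] by (auto simp: test_functions_iff)

lemma test_bounded:
  fixes f :: "'a::euclidean_space \<Rightarrow> real"
  assumes "f \<in> test_functions" shows "\<exists>B. \<forall>x. \<bar>f x\<bar> \<le> B"
proof -
  obtain R where R: "smooth f" "\<And>x. norm x > R \<Longrightarrow> f x = 0"
    using assms by (auto simp: test_functions_iff)
  have "bounded (f ` cball 0 R)"
    by (intro compact_imp_bounded compact_continuous_image smooth_continuous_on R) simp
  then obtain B where B: "\<And>x. norm x \<le> R \<Longrightarrow> \<bar>f x\<bar> \<le> B"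
    unfolding bounded_iff by (auto simp: image_iff) (metis mem_cball_0)
  have "\<bar>f x\<bar> \<le> \<bar>B\<bar>" for x
    using B[of x] R(2)[of x] by (cases "norm x \<le> R") auto
  then show ?thesis by blast
qed

lemma test_mult: "smooth g \<Longrightarrow> f \<in> test_functions \<Longrightarrow> (\<lambda>x. g x * f x) \<in> test_functions"
  for f g :: "'a::euclidean_space \<Rightarrow> real"
  by (auto simp: test_functions_iff intro: smooth_mult)

lemma continuous_AE_zero:
  fixes f :: "'a::euclidean_space \<Rightarrow> real"
  assumes "continuous_on UNIV f" "AE x in lborel. f x = 0" shows "f x = 0"
proof (rule ccontr)
  assume x: "f x \<noteq> 0"
  have "open {x. f x \<noteq> 0}"
    using open_Collect_neq[OF assms(1) continuous_on_const] by simp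
  then obtain e where e: "e > 0" "ball x e \<subseteq> {x. f x \<noteq> 0}"
    using x open_contains_ball by blast
  have "AE y in lborel. y \<notin> ball x e"
    using assms(2) by (rule eventually_mono) (use e(2) in auto)
  then have "emeasure lborel (ball x e) = 0"
    by (subst (asm) AE_iff_measurable[where N = "ball x e"]) auto
  then show False using content_ball_pos[OF e(1), of x] by (simp add: measure_def)
qed

text \<open>A flow that preserves Lebesgue measure leaves the integral of \<open>\<phi>\<close>
  constant, so the time derivative has integral 0. Properness for times in \<open>{0..1}\<close>
  confines all difference quotients to one ball, as dominated convergence requires.\<close>

lemma integral_flow_derivative:
  fixes \<phi> D :: "'a::euclidean_space \<Rightarrow> real" and T :: "real \<Rightarrow> 'a \<Rightarrow> 'a"
  assumes \<phi>: "\<phi> \<in> test_functions" and D: "D \<in> test_functions"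
    and T: "\<And>t. T t \<in> borel_measurable borel" "\<And>t. distr lborel borel (T t) = lborel" "\<And>x. T 0 x = x"
    and proper: "\<And>R. \<exists>R'. \<forall>t\<in>{0..1}. \<forall>x. norm (T t x) \<le> R \<longrightarrow> norm x \<le> R'"
    and der: "\<And>x t. ((\<lambda>t. \<phi> (T t x)) has_real_derivative D (T t x)) (at t)"
  shows "(\<integral>x. D x \<partial>lborel) = 0"
proof -
  obtain R where R: "\<And>x. norm x > R \<Longrightarrow> D x = 0" using D by (auto simp: test_functions_iff)
  obtain B where B: "\<And>x. \<bar>D x\<bar> \<le> B" using test_bounded[OF D] by blast
  obtain R' where R': "\<And>t x. t \<in> {0..1} \<Longrightarrow> norm (T t x) \<le> R \<Longrightarrow> norm x \<le> R'" using proper by metis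
  have \<phi>b: "\<phi> \<in> borel_measurable borel" "D \<in> borel_measurable borel"
    using \<phi> D by (auto intro!: borel_measurable_continuous_onI smooth_continuous_on test_smooth)
  define q where "q = (\<lambda>n x. real (Suc n) * (\<phi> (T (1 / real (Suc n)) x) - \<phi> x))"
  have "(\<lambda>n. \<integral>x. q n x \<partial>lborel) \<longlonglongrightarrow> (\<integral>x. D x \<partial>lborel)"
  proof (rule integral_dominated_convergence[where w = "\<lambda>x. indicator (cball 0 R') x * B"])
    show "D \<in> borel_measurable lborel" "q n \<in> borel_measurable lborel" for n
      using \<phi>b T(1) unfolding q_def by (auto intro!: borel_measurable_times borel_measurable_diff measurable_compose[OF T(1)])
    show "integrable lborel (\<lambda>x. indicator (cball 0 R') x * B)"
      by (intro integrable_mult_left integrable_real_indicator) (auto intro: emeasure_bounded_finite[unfolded infinity_ennreal_def])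
    show "AE x in lborel. (\<lambda>n. q n x) \<longlonglongrightarrow> D x"
    proof (rule AE_I2)
      fix x
      have "((\<lambda>h. (\<phi> (T (0 + h) x) - \<phi> (T 0 x)) / h) \<longlongrightarrow> D (T 0 x)) (at 0)"
        using der[of x 0] by (simp add: DERIV_def)
      then have "(\<lambda>n. (\<phi> (T (0 + 1 / real (Suc n)) x) - \<phi> (T 0 x)) / (1 / real (Suc n))) \<longlonglongrightarrow> D (T 0 x)"
      proof (rule filterlim_compose)
        show "filterlim (\<lambda>n. 1 / real (Suc n)) (at 0) sequentially"
          unfolding filterlim_at using LIMSEQ_inverse_real_of_nat[unfolded inverse_eq_divide]
          by (simp del: of_nat_Suc)
      qed
      then show "(\<lambda>n. q n x) \<longlonglongrightarrow> D x"
        by (simp add: q_def T(3) mult.commute)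
    qed
    fix n
    show "AE x in lborel. norm (q n x) \<le> indicator (cball 0 R') x * B"
    proof (rule AE_I2)
      fix x
      define h where "h = 1 / real (Suc n)"
      have h: "0 < h" "h \<le> 1" by (auto simp: h_def)
      \<comment> \<open>By the mean value theorem the difference quotient is a value of
        \<open>D\<close> at an intermediate time, hence bounded by \<open>B\<close> and zero outside
        the common ball.\<close>
      obtain z where z: "0 < z" "z < h" "\<phi> (T h x) - \<phi> (T 0 x) = (h - 0) * D (T z x)"
        using MVT2[OF h(1) der[of x]] by blast
      have "q n x = D (T z x)"
        using z(3) h(1) by (simp add: q_def T(3) h_def[symmetric]) (simp add: h_def)
      moreover have "D (T z x) = 0" if "norm x > R'"
        using R[of "T z x"] R'[of z x] z h that by (meson atLeastAtMost_iff less_imp_le linorder_not_le order_trans)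
      ultimately show "norm (q n x) \<le> indicator (cball 0 R') x * B"
        using B[of "T z x"] by (cases "norm x \<le> R'") auto
    qed
  qed
  moreover have "(\<integral>x. q n x \<partial>lborel) = 0" for n
  proof -
    let ?t = "1 / real (Suc n)"
    have i: "integrable lborel \<phi>" by (rule test_integrable[OF \<phi>])
    have "integrable (distr lborel borel (T ?t)) \<phi>" using i T(2) by simp
    then have "integrable lborel (\<lambda>x. \<phi> (T ?t x))"
      by (rule integrable_distr[rotated]) (use T(1) in simp)
    moreover have "(\<integral>x. \<phi> (T ?t x) \<partial>lborel) = (\<integral>x. \<phi> x \<partial>lborel)"
      using integral_distr[of "T ?t" lborel borel \<phi>] T(1,2) \<phi>b by simp
    ultimately show ?thesis using i by (simp add: q_def)
  qed
  ultimately show ?thesis by (simp add: LIMSEQ_const_iff)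
qed

context carnot
begin

lemma gmult_bounded: "\<exists>R'. \<forall>x y. norm x \<le> R \<longrightarrow> norm y \<le> S \<longrightarrow> norm (gmult x y) \<le> R'"
proof -
  have "compact ((\<lambda>p. gmult (fst p) (snd p)) ` (cball 0 R \<times> cball 0 S))"
    by (intro compact_continuous_image continuous_on_gmult continuous_intros compact_Times) auto
  then have "bounded ((\<lambda>p. gmult (fst p) (snd p)) ` (cball 0 R \<times> cball 0 S))"
    by (rule compact_imp_bounded)
  then obtain R' where "\<And>p. p \<in> cball 0 R \<times> cball 0 S \<Longrightarrow> norm (gmult (fst p) (snd p)) \<le> R'"
    unfolding bounded_iff by blast
  then show ?thesis by force
qed

lemma test_LX: assumes "\<phi> \<in> test_functions" shows "LX a \<phi> \<in> test_functions"
proof -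
  obtain R where R: "smooth \<phi>" "\<And>x. norm x > R \<Longrightarrow> \<phi> x = 0"
    using assms by (auto simp: test_functions_iff)
  have "LX a \<phi> x = 0" if "norm x > R" for x
  proof -
    have "open {x. norm x > R}" by (simp add: open_Collect_less continuous_intros)
    then have "frechet_derivative \<phi> (at x) = frechet_derivative (\<lambda>_. 0) (at x)"
      using that R(2) by (intro frechet_derivative_transform_within_open[where X = "{x. norm x > R}"])
        (auto intro: smooth_differentiable[OF R(1)])
    then show ?thesis by (simp add: LX_eq[OF R(1)])
  qed
  then show ?thesis using smooth_LX[OF R(1)] by (auto simp: test_functions_iff)
qed

lemma test_RX: assumes "\<phi> \<in> test_functions" shows "RX a \<phi> \<in> test_functions"
proof -
  obtain R where R: "smooth \<phi>" "\<And>x. norm x > R \<Longrightarrow> \<phi> x = 0"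
    using assms by (auto simp: test_functions_iff)
  have "RX a \<phi> x = 0" if "norm x > R" for x
  proof -
    have "open {x. norm x > R}" by (simp add: open_Collect_less continuous_intros)
    then have "frechet_derivative \<phi> (at x) = frechet_derivative (\<lambda>_. 0) (at x)"
      using that R(2) by (intro frechet_derivative_transform_within_open[where X = "{x. norm x > R}"])
        (auto intro: smooth_differentiable[OF R(1)])
    then show ?thesis by (simp add: RX_eq[OF R(1)])
  qed
  then show ?thesis using smooth_RX[OF R(1)] by (auto simp: test_functions_iff)
qed

definition test_on :: "(real ^ 'n) set \<Rightarrow> (real ^ 'n \<Rightarrow> real) set" where
  "test_on K = {\<phi> \<in> test_functions. \<forall>x. x \<notin> K \<longrightarrow> \<phi> x = 0}"

lemma test_onD: "\<phi> \<in> test_on K \<Longrightarrow> \<phi> \<in> test_functions"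
  by (simp add: test_on_def)

lemma test_on_mult: "smooth g \<Longrightarrow> f \<in> test_on K \<Longrightarrow> (\<lambda>x. g x * f x) \<in> test_on K"
  by (simp add: test_on_def test_mult)

lemma test_on_LX: assumes "closed K" "\<phi> \<in> test_on K" shows "LX a \<phi> \<in> test_on K"
proof -
  have sm: "smooth \<phi>" using assms(2) by (simp add: test_on_def test_functions_iff)
  have "LX a \<phi> x = 0" if "x \<notin> K" for x
  proof -
    have "frechet_derivative \<phi> (at x) = frechet_derivative (\<lambda>_. 0) (at x)"
      using that assms by (intro frechet_derivative_transform_within_open[where X = "- K"])
        (auto simp: test_on_def intro: smooth_differentiable[OF sm])
    then show ?thesis by (simp add: LX_eq[OF sm])
  qed
  then show ?thesis using test_LX assms(2) by (simp add: test_on_def)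
qed

lemma test_left_translate:
  assumes "\<phi> \<in> test_functions" shows "(\<lambda>v. \<phi> (gmult y v)) \<in> test_functions"
proof -
  obtain R where R: "smooth \<phi>" "\<And>x. norm x > R \<Longrightarrow> \<phi> x = 0"
    using assms by (auto simp: test_functions_iff)
  obtain R' where R': "\<And>v z. norm v \<le> norm y \<Longrightarrow> norm z \<le> R \<Longrightarrow> norm (gmult v z) \<le> R'"
    using gmult_bounded by metis
  have "\<phi> (gmult y v) = 0" if "norm v > R'" for v
    using R'[of "- y" "gmult y v"] that R(2)[of "gmult y v"] by force
  then show ?thesis
    using smooth_compose[OF R(1) smooth_gmult[OF smooth_const smooth_ident]] by (auto simp: test_functions_iff)
qed

lemma norm_scaled_le: "t \<in> {0..1} \<Longrightarrow> norm (t *\<^sub>R a) \<le> norm a"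
  for a :: "'b::real_normed_vector" by (simp add: mult_left_le_one_le)

lemma integral_LX: assumes "\<phi> \<in> test_functions" shows "(\<integral>x. LX a \<phi> x \<partial>lborel) = 0"
proof (rule integral_flow_derivative[OF assms test_LX[OF assms], where T = "\<lambda>t x. gmult x (t *\<^sub>R a)"])
  fix R :: real
  obtain R' where R': "\<And>v z. norm v \<le> R \<Longrightarrow> norm z \<le> norm a \<Longrightarrow> norm (gmult v z) \<le> R'"
    using gmult_bounded by metis
  have "norm x \<le> R'" if "t \<in> {0..1}" "norm (gmult x (t *\<^sub>R a)) \<le> R" for t x
    using R'[OF that(2), of "- (t *\<^sub>R a)"] norm_scaled_le[OF that(1), of a] by simp
  then show "\<exists>R'. \<forall>t\<in>{0..1}. \<forall>x. norm (gmult x (t *\<^sub>R a)) \<le> R \<longrightarrow> norm x \<le> R'" by blast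
qed (use LX_curve[OF test_smooth[OF assms]] distr_right_translation in auto)

lemma integral_RX: assumes "\<phi> \<in> test_functions" shows "(\<integral>x. RX a \<phi> x \<partial>lborel) = 0"
proof (rule integral_flow_derivative[OF assms test_RX[OF assms], where T = "\<lambda>t x. gmult (t *\<^sub>R a) x"])
  fix R :: real
  obtain R' where R': "\<And>v z. norm v \<le> norm a \<Longrightarrow> norm z \<le> R \<Longrightarrow> norm (gmult v z) \<le> R'"
    using gmult_bounded by metis
  have "norm x \<le> R'" if "t \<in> {0..1}" "norm (gmult (t *\<^sub>R a) x) \<le> R" for t x
    using R'[OF _ that(2), of "- (t *\<^sub>R a)"] norm_scaled_le[OF that(1), of a] by simp
  then show "\<exists>R'. \<forall>t\<in>{0..1}. \<forall>x. norm (gmult (t *\<^sub>R a) x) \<le> R \<longrightarrow> norm x \<le> R'" by blast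
qed (use RX_curve[OF test_smooth[OF assms]] distr_left_translation in auto)

text \<open>Divergences of horizontal fields are the test functions on which the constraints give
  information. Fixing the support \<open>K\<close> keeps the later estimates local.\<close>

definition hdiv :: "(real ^ 'n) set \<Rightarrow> (real ^ 'n \<Rightarrow> real) \<Rightarrow> bool" where
  "hdiv K f \<longleftrightarrow> (\<exists>l. (\<forall>(a, \<theta>)\<in>set l. a \<in> V 1 \<and> \<theta> \<in> test_on K) \<and> f = (\<lambda>x. \<Sum>(a, \<theta>)\<leftarrow>l. LX a \<theta> x))"

lemma hdiv_add: "hdiv K f \<Longrightarrow> hdiv K g \<Longrightarrow> hdiv K (\<lambda>x. f x + g x)"
proof -
  assume "hdiv K f" "hdiv K g"
  then obtain l l' where "\<forall>(a, \<theta>)\<in>set l. a \<in> V 1 \<and> \<theta> \<in> test_on K" "f = (\<lambda>x. \<Sum>(a, \<theta>)\<leftarrow>l. LX a \<theta> x)"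
    "\<forall>(a, \<theta>)\<in>set l'. a \<in> V 1 \<and> \<theta> \<in> test_on K" "g = (\<lambda>x. \<Sum>(a, \<theta>)\<leftarrow>l'. LX a \<theta> x)"
    unfolding hdiv_def by blast
  then show ?thesis unfolding hdiv_def by (intro exI[of _ "l @ l'"]) auto
qed

lemma hdiv_zero: "hdiv K (\<lambda>x. 0)"
  unfolding hdiv_def by (intro exI[of _ "[]"]) auto

lemma hdiv_LX: "a \<in> V 1 \<Longrightarrow> \<theta> \<in> test_on K \<Longrightarrow> hdiv K (LX a \<theta>)"
  unfolding hdiv_def by (intro exI[of _ "[(a, \<theta>)]"]) auto

lemma hdiv_scale: assumes "hdiv K f" shows "hdiv K (\<lambda>x. c * f x)"
proof -
  obtain l where l: "\<forall>(a, \<theta>)\<in>set l. a \<in> V 1 \<and> \<theta> \<in> test_on K" "f = (\<lambda>x. \<Sum>(a, \<theta>)\<leftarrow>l. LX a \<theta> x)"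
    using assms unfolding hdiv_def by blast
  let ?l = "map (\<lambda>(a, \<theta>). (c *\<^sub>R a, \<theta>)) l"
  have "c * (\<Sum>(a, \<theta>)\<leftarrow>l. LX a \<theta> x) = (\<Sum>(a, \<theta>)\<leftarrow>?l. LX a \<theta> x)" for x
    using l(1) by (induction l) (auto simp: linear_scale[OF LX_linear] test_smooth[OF test_onD] algebra_simps)
  then have "(\<lambda>x. c * f x) = (\<lambda>x. \<Sum>(a, \<theta>)\<leftarrow>?l. LX a \<theta> x)" unfolding l(2) by (rule ext)
  moreover have "\<forall>(a, \<theta>)\<in>set ?l. a \<in> V 1 \<and> \<theta> \<in> test_on K"
    using l(1) step_pos by (auto intro!: subspace_scale subspace_layer)
  ultimately show ?thesis unfolding hdiv_def by blast
qed

lemma hdiv_sum: "(\<And>i. i \<in> I \<Longrightarrow> hdiv K (f i)) \<Longrightarrow> hdiv K (\<lambda>x. \<Sum>i\<in>I. f i x)"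
  by (induction I rule: infinite_finite_induct) (auto intro: hdiv_add hdiv_zero)

lemma hdiv_diff: "hdiv K f \<Longrightarrow> hdiv K g \<Longrightarrow> hdiv K (\<lambda>x. f x - g x)"
  using hdiv_add[OF _ hdiv_scale, of K f g "-1"] by simp

text \<open>Here the first layer generates the others: by the commutator formula the field of a
  bracket is \<open>LX a\<close> of one test function minus a field of the preceding layer applied
  to another, and the latter is covered by induction.\<close>

lemma hdiv_LX_layer:
  assumes K: "closed K" and "i \<in> {1..s}" "c \<in> V i" "\<phi> \<in> test_on K" shows "hdiv K (LX c \<phi>)"
proof -
  have "1 \<le> i \<Longrightarrow> i \<le> s \<Longrightarrow> c \<in> V i \<Longrightarrow> \<phi> \<in> test_on K \<Longrightarrow> hdiv K (LX c \<phi>)" for c \<phi>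
  proof (induction i arbitrary: c \<phi> rule: dec_induct)
    case base
    then show ?case by (simp add: hdiv_LX)
  next
    case (step i)
    let ?S = "{c. \<forall>\<phi>\<in>test_on K. hdiv K (LX c \<phi>)}"
    have "subspace ?S"
    proof (rule subspaceI)
      have "LX 0 \<phi> = (\<lambda>x. 0)" if "\<phi> \<in> test_on K" for \<phi>
        using linear_0[OF LX_linear[OF test_smooth[OF test_onD[OF that]]]] by auto
      then show "0 \<in> ?S" using hdiv_zero by auto
    next
      fix x y assume xy: "x \<in> ?S" "y \<in> ?S"
      have "LX (x + y) \<phi> = (\<lambda>z. LX x \<phi> z + LX y \<phi> z)" if "\<phi> \<in> test_on K" for \<phi>
        using linear_add[OF LX_linear[OF test_smooth[OF test_onD[OF that]]]] by auto
      then show "x + y \<in> ?S" using xy hdiv_add by auto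
    next
      fix x and k :: real assume x: "x \<in> ?S"
      have "LX (k *\<^sub>R x) \<phi> = (\<lambda>z. k * LX x \<phi> z)" if "\<phi> \<in> test_on K" for \<phi>
        using linear_scale[OF LX_linear[OF test_smooth[OF test_onD[OF that]]]] by auto
      then show "k *\<^sub>R x \<in> ?S" using x hdiv_scale by auto
    qed
    moreover have "{br a b | a b. a \<in> V 1 \<and> b \<in> V i} \<subseteq> ?S"
    proof clarify
      fix a b \<phi> assume ab: "a \<in> V 1" "b \<in> V i" and \<phi>: "\<phi> \<in> test_on K"
      have "LX (br a b) \<phi> = (\<lambda>x. LX a (LX b \<phi>) x - LX b (LX a \<phi>) x)"
        using LX_commutator[OF test_smooth[OF test_onD[OF \<phi>]]] by auto
      moreover have "hdiv K (LX a (LX b \<phi>))" using ab \<phi> by (intro hdiv_LX test_on_LX[OF K])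
      moreover have "hdiv K (LX b (LX a \<phi>))" using ab \<phi> step by (intro step.IH test_on_LX[OF K]) auto
      ultimately show "hdiv K (LX (br a b) \<phi>)" by (simp add: hdiv_diff)
    qed
    ultimately have "span {br a b | a b. a \<in> V 1 \<and> b \<in> V i} \<subseteq> ?S" by (intro span_minimal)
    then show ?case using bracket_layer[of i] step by auto
  qed
  then show ?thesis using assms by auto
qed

lemma hdiv_LX_any: assumes "closed K" "\<phi> \<in> test_on K" shows "hdiv K (LX c \<phi>)"
proof -
  have "LX c \<phi> = (\<lambda>x. LX (\<Sum>i\<in>{1..s}. part c i) \<phi> x)" using part(2)[of c] by simp
  also have "\<dots> = (\<lambda>x. \<Sum>i\<in>{1..s}. LX (part c i) \<phi> x)"
    using linear_sum[OF LX_linear[OF test_smooth[OF test_onD[OF assms(2)]]]] by auto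
  finally show ?thesis using hdiv_LX_layer[OF assms(1) _ part_layer assms(2)] hdiv_sum[of "{1..s}" K] by simp
qed

text \<open>
  A right-invariant field is a combination of left-invariant ones with smooth coefficients, and no
  zeroth-order term remains because both kinds of fields preserve Lebesgue measure.
\<close>

lemma hdiv_RX: assumes K: "closed K" and \<phi>: "\<phi> \<in> test_on K" shows "hdiv K (RX b \<phi>)"
proof -
  \<comment> \<open>Since \<open>gmult z v\<close> is \<open>v\<close> times the conjugate of
    \<open>z\<close> by \<open>- v\<close>, the right-invariant field with value \<open>b\<close> at
    0 coincides at \<open>v\<close> with the left-invariant field of \<open>c v\<close>.\<close>
  define c where "c = (\<lambda>v. frechet_derivative (\<lambda>z. gmult (gmult (- v) z) v) (at 0) b)"
  define ci where "ci = (\<lambda>i v. c v \<bullet> i)"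
  have sc: "smooth c"
    unfolding c_def
    using smooth_partial_derivative[OF smooth_gmult[OF smooth_gmult[OF smooth_uminus[OF smooth_fst] smooth_snd] smooth_fst]
        smooth_ident smooth_const smooth_const, of 0 b] by simp
  have sci: "smooth (ci i)" for i unfolding ci_def by (intro smooth_inner sc smooth_const)
  have RX: "RX b \<psi> v = (\<Sum>i\<in>Basis. ci i v * LX i \<psi> v)" if "\<psi> \<in> test_functions" for \<psi> v
  proof -
    have s1: "smooth (\<lambda>z. \<psi> (gmult v z))"
      by (intro smooth_compose[OF test_smooth[OF that]] smooth_gmult) auto
    have s2: "smooth (\<lambda>z. gmult (gmult (- v) z) v)"
      by (intro smooth_gmult) auto
    have "RX b \<psi> v = frechet_derivative (\<lambda>z. \<psi> (gmult v (gmult (gmult (- v) z) v))) (at 0) b"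
      by (simp add: RX_def assoc[symmetric])
    also have "\<dots> = frechet_derivative (\<lambda>z. \<psi> (gmult v z)) (at (gmult (gmult (- v) 0) v)) (c v)"
      unfolding c_def by (rule frechet_derivative_chain[OF s1 s2])
    also have "\<dots> = LX (c v) \<psi> v" by (simp add: LX_def)
    also have "\<dots> = (\<Sum>i\<in>Basis. ci i v * LX i \<psi> v)"
      using linear_euclidean_expansion[OF LX_linear[OF test_smooth[OF that]], of "c v" v] by (simp add: ci_def)
    finally show ?thesis .
  qed
  define \<kappa> where "\<kappa> = (\<lambda>v. \<Sum>i\<in>Basis. LX i (ci i) v)"
  have s\<kappa>: "smooth \<kappa>" unfolding \<kappa>_def by (intro smooth_sum smooth_LX sci)
  have RX2: "RX b \<psi> v = (\<Sum>i\<in>Basis. LX i (\<lambda>x. ci i x * \<psi> x) v) - \<kappa> v * \<psi> v" if "\<psi> \<in> test_functions" for \<psi> v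
    unfolding RX[OF that] \<kappa>_def
    by (simp add: LX_mult[OF sci test_smooth[OF that]] sum.distrib sum_distrib_right)
  have int0: "(\<integral>v. \<kappa> v * \<psi> v \<partial>lborel) = 0" if \<psi>: "\<psi> \<in> test_functions" for \<psi>
  proof -
    have i: "integrable lborel (LX i (\<lambda>x. ci i x * \<psi> x))" for i
      by (intro test_integrable test_LX test_mult sci \<psi>)
    have "\<kappa> v * \<psi> v = (\<Sum>i\<in>Basis. LX i (\<lambda>x. ci i x * \<psi> x) v) - RX b \<psi> v" for v
      using RX2[OF \<psi>, of v] by simp
    then have "(\<integral>v. \<kappa> v * \<psi> v \<partial>lborel) = (\<Sum>i\<in>Basis. \<integral>v. LX i (\<lambda>x. ci i x * \<psi> x) v \<partial>lborel) - (\<integral>v. RX b \<psi> v \<partial>lborel)"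
      using i test_integrable[OF test_RX[OF \<psi>, of b]] by simp
    then show ?thesis
      using integral_LX[OF test_mult[OF sci \<psi>]] integral_RX[OF \<psi>] by simp
  qed
  \<comment> \<open>The integral of \<open>\<kappa>\<close> against every test function is 0. Taking
    \<open>\<kappa>\<close> times a bump at \<open>x\<close> as the test function makes the
    integrand nonnegative and forces \<open>\<kappa> x = 0\<close>.\<close>
  have "\<kappa> x = 0" for x :: "real ^ 'n"
  proof -
    let ?b = "\<lambda>v :: real ^ 'n. bump (v - x)"
    have sb: "smooth ?b" by (intro smooth_compose[OF smooth_bump] smooth_diff) auto
    have tb: "?b \<in> test_functions"
    proof (rule test_functionsI[OF sb, of "norm x + 1"])
      fix v :: "real ^ 'n" assume "norm v > norm x + 1"
      then have "norm (v - x) \<ge> 1" using norm_triangle_sub[of v x] by simp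
      then show "bump (v - x) = 0" by (rule bump_eq_0)
    qed
    have t: "(\<lambda>v. \<kappa> v * ?b v) \<in> test_functions" by (rule test_mult[OF s\<kappa> tb])
    have t2: "(\<lambda>v. \<kappa> v * (\<kappa> v * ?b v)) \<in> test_functions" by (rule test_mult[OF s\<kappa> t])
    have "AE v in lborel. \<kappa> v * (\<kappa> v * ?b v) = 0"
    proof (subst integral_nonneg_eq_0_iff_AE[OF test_integrable[OF t2], symmetric])
      have "0 \<le> (\<kappa> v * \<kappa> v) * ?b v" for v
        by (intro mult_nonneg_nonneg zero_le_square bump_nonneg)
      then show "AE v in lborel. 0 \<le> \<kappa> v * (\<kappa> v * ?b v)" by (simp add: mult.assoc)
    qed (rule int0[OF t])
    then have "\<kappa> x * (\<kappa> x * ?b x) = 0"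
      by (rule continuous_AE_zero[rotated]) (use smooth_continuous_on[OF test_smooth[OF t2]] in simp)
    moreover have "?b x > 0" by (simp add: bump_pos_iff)
    ultimately show ?thesis by simp
  qed
  then have "RX b \<phi> = (\<lambda>v. \<Sum>i\<in>Basis. LX i (\<lambda>x. ci i x * \<phi> x) v)"
    using RX2[OF test_onD[OF \<phi>]] by auto
  then show ?thesis
    using hdiv_sum[of Basis K "\<lambda>i. LX i (\<lambda>x. ci i x * \<phi> x)"] hdiv_LX_any[OF K test_on_mult[OF sci \<phi>]] by simp
qed

end

subsection \<open>A self-similar random walk\<close>

lemma smooth_lipschitz_on_ball:
  fixes F :: "'a::euclidean_space \<Rightarrow> 'b::real_normed_vector"
  assumes "smooth F"
  shows "\<exists>L\<ge>0. \<forall>x\<in>cball 0 R. \<forall>y\<in>cball 0 R. norm (F x - F y) \<le> L * norm (x - y)"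
proof -
  have "\<exists>B. \<forall>x\<in>cball 0 R. norm (frechet_derivative F (at x) i) \<le> B" for i
  proof -
    have "bounded ((\<lambda>x. frechet_derivative F (at x) i) ` cball 0 R)"
      by (intro compact_imp_bounded compact_continuous_image smooth_continuous_on smooth_deriv assms) simp
    then show ?thesis unfolding bounded_iff by auto
  qed
  then obtain B where B: "\<And>i x. x \<in> cball 0 R \<Longrightarrow> norm (frechet_derivative F (at x) i) \<le> B i" by metis
  define L where "L = (\<Sum>i\<in>Basis. \<bar>B i\<bar>)"
  have on: "onorm (frechet_derivative F (at x)) \<le> L" if "x \<in> cball 0 R" for x
  proof -
    have "onorm (frechet_derivative F (at x)) \<le> (\<Sum>i\<in>Basis. norm (frechet_derivative F (at x) i))"
      by (rule onorm_componentwise) (rule has_derivative_bounded_linear[OF smooth_has_derivative[OF assms]])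
    also have "\<dots> \<le> L" unfolding L_def using B[OF that] by (intro sum_mono) (meson abs_ge_self order_trans)
    finally show ?thesis .
  qed
  have "norm (F x - F y) \<le> L * norm (x - y)" if "x \<in> cball 0 R" "y \<in> cball 0 R" for x y
    by (rule differentiable_bound[OF convex_cball _ on that])
      (use smooth_has_derivative[OF assms] has_derivative_at_withinI in blast)
  moreover have "L \<ge> 0" by (simp add: L_def sum_nonneg)
  ultimately show ?thesis by blast
qed

context carnot
begin

definition qq :: "real ^ 'n \<Rightarrow> real" where "qq x = bump x / (\<integral>y. bump y \<partial>(lborel :: (real ^ 'n) measure))"

lemma test_bump: "bump \<in> (test_functions :: (real ^ 'n \<Rightarrow> real) set)"
  by (rule test_functionsI[OF smooth_bump, of 1]) (simp add: bump_eq_0)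

lemma integral_bump_pos: "(\<integral>y. bump y \<partial>(lborel :: (real ^ 'n) measure)) > 0"
proof -
  have "(\<integral>y. bump y \<partial>(lborel :: (real ^ 'n) measure)) \<noteq> 0"
  proof
    assume "(\<integral>y. bump y \<partial>(lborel :: (real ^ 'n) measure)) = 0"
    then have "AE y in (lborel :: (real ^ 'n) measure). bump y = 0"
      using test_integrable[OF test_bump] bump_nonneg by (subst (asm) integral_nonneg_eq_0_iff_AE) auto
    then have "bump (0 :: real ^ 'n) = 0"
      by (rule continuous_AE_zero[rotated]) (rule smooth_continuous_on[OF smooth_bump])
    then show False using bump_pos_iff[of "0 :: real ^ 'n"] by simp
  qed
  moreover have "(\<integral>y. bump y \<partial>(lborel :: (real ^ 'n) measure)) \<ge> 0"
    by (intro integral_nonneg_AE AE_I2 bump_nonneg)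
  ultimately show ?thesis by simp
qed

lemma qq_nonneg: "qq x \<ge> 0"
  unfolding qq_def by (intro divide_nonneg_nonneg bump_nonneg less_imp_le[OF integral_bump_pos])

lemma smooth_qq: "smooth qq"
  using smooth_mult[OF smooth_const smooth_bump, of "1 / (\<integral>y. bump y \<partial>(lborel :: (real ^ 'n) measure))"] by (simp add: qq_def[abs_def])

lemma qq_zero: "norm x \<ge> 1 \<Longrightarrow> qq x = 0"
  by (simp add: qq_def bump_eq_0)

lemma test_qq: "qq \<in> test_functions"
  by (rule test_functionsI[OF smooth_qq, of 1]) (simp add: qq_zero)

lemma integral_qq: "(\<integral>x. qq x \<partial>lborel) = 1"
  using integral_bump_pos by (simp add: qq_def)

lemma qq_borel [measurable]: "qq \<in> borel_measurable borel"
  by (intro borel_measurable_continuous_onI smooth_continuous_on smooth_qq)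

lemma qq_lower: "\<exists>c>0. \<forall>x. norm x \<le> 1 / 2 \<longrightarrow> c \<le> qq x"
proof -
  obtain x0 :: "real ^ 'n" where x0: "x0 \<in> cball 0 (1 / 2)" "\<And>y. y \<in> cball 0 (1 / 2) \<Longrightarrow> qq x0 \<le> qq y"
    using continuous_attains_inf[of "cball (0 :: real ^ 'n) (1 / 2)" qq] smooth_continuous_on[OF smooth_qq] by auto
  have "norm x0 < 1" using x0(1) by simp
  then have "bump x0 > 0" by (simp only: bump_pos_iff)
  then have "qq x0 > 0" using integral_bump_pos by (simp add: qq_def)
  then show ?thesis using x0(2) by auto
qed

text \<open>The demands on the scaling ratio: the walk stays in the ball of radius 2; from a walk
  position every point of the dilated ball of radius 3 is reached by a step in the half ball, where
  the step density is bounded below; one step halves distances; supports of finer kernels remain in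
  that dilated ball.\<close>

definition ratio :: "real \<Rightarrow> bool" where
  "ratio t \<longleftrightarrow> 0 < t \<and> t \<le> 1 / 2 \<and>
    (\<forall>y v. norm y \<le> 1 \<longrightarrow> norm v \<le> 3 \<longrightarrow> norm (gmult y (dil t v)) \<le> 2) \<and>
    (\<forall>z Y. norm z \<le> 3 \<longrightarrow> norm Y \<le> 2 \<longrightarrow> norm (gmult (dil t z) (- dil t Y)) \<le> 1 / 2) \<and>
    (\<forall>y v v'. norm y \<le> 1 \<longrightarrow> norm v \<le> 2 \<longrightarrow> norm v' \<le> 2 \<longrightarrow>
      norm (gmult y (dil t v) - gmult y (dil t v')) \<le> norm (v - v') / 2) \<and>
    (\<forall>y z v r. norm y \<le> 1 \<longrightarrow> norm z \<le> 2 \<longrightarrow> norm v \<le> 1 \<longrightarrow> 0 \<le> r \<longrightarrow> r \<le> 1 \<longrightarrow>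
      norm (gmult y (dil t (gmult z (dil r v)))) \<le> 3)"

lemma ratio_exists: "\<exists>t. ratio t"
proof -
  obtain C where C: "C \<ge> 1" "\<And>t x. 0 \<le> t \<Longrightarrow> t \<le> 1 \<Longrightarrow> norm (dil t x) \<le> C * t * norm x"
    using norm_dil_le by blast
  obtain R1 where R1: "\<And>z v. norm z \<le> 2 \<Longrightarrow> norm v \<le> C \<Longrightarrow> norm (gmult z v) \<le> R1"
    using gmult_bounded by metis
  obtain R2 where R2: "\<And>z v. norm z \<le> 3 \<Longrightarrow> norm v \<le> 2 \<Longrightarrow> norm (gmult z v) \<le> R2"
    using gmult_bounded by metis
  define R where "R = max 3 R1"
  obtain L where L: "L \<ge> 0" "\<And>p p'. p \<in> cball 0 (1 + C * R) \<Longrightarrow> p' \<in> cball 0 (1 + C * R) \<Longrightarrow>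
      norm (gmult (fst p) (snd p) - gmult (fst p') (snd p')) \<le> L * norm (p - p')"
    using smooth_lipschitz_on_ball[OF smooth_gmult[OF smooth_fst smooth_snd], of "1 + C * R"] by blast
  \<comment> \<open>The entries ensure, in this order: \<open>t\<close> at most 1/2, contraction by
    1/2, displacement at most 1, quotients of norm at most 1/2. The added 1s keep the denominators
    positive.\<close>
  define t where "t = Min {1 / 2, 1 / (2 * (L * C + 1)), 1 / (L * C * R + 1), 1 / (2 * (C * \<bar>R2\<bar> + 1))}"
  have R: "R \<ge> 3" "R1 \<le> R" by (auto simp: R_def)
  have pos: "L * C \<ge> 0" "L * C * R \<ge> 0" "C * \<bar>R2\<bar> \<ge> 0" using L C R by auto
  have t0: "0 < t" using pos by (auto simp: t_def add_nonneg_pos)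
  have t1: "t \<le> 1 / 2" "t \<le> 1 / (2 * (L * C + 1))" "t \<le> 1 / (L * C * R + 1)" "t \<le> 1 / (2 * (C * \<bar>R2\<bar> + 1))"
    by (auto simp: t_def)
  have "t * (2 * (L * C + 1)) \<le> 1" "t * (L * C * R + 1) \<le> 1" "t * (2 * (C * \<bar>R2\<bar> + 1)) \<le> 1"
    using t1 pos by (auto simp: pos_le_divide_eq)
  then have t: "L * C * t \<le> 1 / 2" "L * C * t * R \<le> 1" "C * t * \<bar>R2\<bar> \<le> 1 / 2"
    using t0 by (auto simp: algebra_simps)
  have bd: "norm (dil t v) \<le> C * R" if "norm v \<le> R" for v
  proof -
    have "C * t * norm v \<le> C * 1 * R" using that C(1) t0 t1(1) R by (intro mult_mono) auto
    then show ?thesis using C(2)[of t v] t0 t1(1) by simp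
  qed
  have mem: "(y, v) \<in> cball 0 (1 + C * R)" if "norm y \<le> 1" "norm v \<le> C * R" for y v
    using norm_Pair_le[of y v] that by simp
  have lip: "norm (gmult y (dil t v) - gmult y (dil t v')) \<le> L * C * t * norm (v - v')"
    if "norm y \<le> 1" "norm v \<le> R" "norm v' \<le> R" for y v v'
  proof -
    have "norm (gmult y (dil t v) - gmult y (dil t v')) \<le> L * norm ((y, dil t v) - (y, dil t v'))"
      using L(2)[OF mem[OF that(1) bd[OF that(2)]] mem[OF that(1) bd[OF that(3)]]] by simp
    also have "\<dots> = L * norm (dil t (v - v'))"
      by (simp add: norm_Pair linear_diff[OF linear_dil])
    also have "\<dots> \<le> L * (C * t * norm (v - v'))"
      using C(2)[of t "v - v'"] t0 t1(1) L(1) by (intro mult_left_mono) auto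
    finally show ?thesis by simp
  qed
  have near: "norm (gmult y (dil t v)) \<le> 2" if "norm y \<le> 1" "norm v \<le> R" for y v
  proof -
    have "norm (gmult y (dil t v) - y) \<le> L * C * t * norm v"
      using lip[OF that, of 0] R by simp
    also have "\<dots> \<le> L * C * t * R" using that(2) pos t0 by (intro mult_left_mono) auto
    finally show ?thesis using t(2) that(1) norm_triangle_sub[of "gmult y (dil t v)" y] by simp
  qed
  have "ratio t"
    unfolding ratio_def
  proof (intro conjI allI impI)
    fix y v :: "real ^ 'n" assume "norm y \<le> 1" "norm v \<le> 3"
    then show "norm (gmult y (dil t v)) \<le> 2" using near R by simp
  next
    fix z Y :: "real ^ 'n" assume "norm z \<le> 3" "norm Y \<le> 2"
    then have "norm (gmult z (- Y)) \<le> \<bar>R2\<bar>" using R2[of z "- Y"] by simp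
    then have "C * t * norm (gmult z (- Y)) \<le> C * t * \<bar>R2\<bar>" using C(1) t0 by (intro mult_left_mono) auto
    moreover have "gmult (dil t z) (- dil t Y) = dil t (gmult z (- Y))"
      by (simp add: dil_neg[symmetric] gmult_dil)
    ultimately show "norm (gmult (dil t z) (- dil t Y)) \<le> 1 / 2"
      using C(2)[of t "gmult z (- Y)"] t0 t1(1) t(3) by simp
  next
    fix y v v' :: "real ^ 'n" assume "norm y \<le> 1" "norm v \<le> 2" "norm v' \<le> 2"
    then have "norm (gmult y (dil t v) - gmult y (dil t v')) \<le> L * C * t * norm (v - v')"
      using lip R by simp
    also have "\<dots> \<le> 1 / 2 * norm (v - v')" using t(1) by (intro mult_right_mono) auto
    finally show "norm (gmult y (dil t v) - gmult y (dil t v')) \<le> norm (v - v') / 2" by simp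
  next
    fix y z v :: "real ^ 'n" and r :: real assume *: "norm y \<le> 1" "norm z \<le> 2" "norm v \<le> 1" "0 \<le> r" "r \<le> 1"
    have "C * r * norm v \<le> C * 1 * 1" using * C(1) by (intro mult_mono) auto
    then have "norm (dil r v) \<le> C" using C(2)[of r v] * by simp
    then have "norm (gmult z (dil r v)) \<le> R" using R1[of z "dil r v"] R * by simp
    then show "norm (gmult y (dil t (gmult z (dil r v)))) \<le> 3" using near[OF *(1)] by fastforce
  qed (use t0 t1 in auto)
  then show ?thesis ..
qed

definition th :: real where "th = (SOME t. ratio t)"

lemma ratio_th: "ratio th"
  unfolding th_def by (rule someI_ex[OF ratio_exists])

lemma th_bounds: "0 < th" "th \<le> 1 / 2" "th < 1" "th \<noteq> 0"
  using ratio_th by (auto simp: ratio_def)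

lemma th_step: "norm y \<le> 1 \<Longrightarrow> norm v \<le> 3 \<Longrightarrow> norm (gmult y (dil th v)) \<le> 2"
  and th_quotient: "norm z \<le> 3 \<Longrightarrow> norm Y \<le> 2 \<Longrightarrow> norm (gmult (dil th z) (- dil th Y)) \<le> 1 / 2"
  and th_contraction: "norm y \<le> 1 \<Longrightarrow> norm v \<le> 2 \<Longrightarrow> norm v' \<le> 2 \<Longrightarrow>
      norm (gmult y (dil th v) - gmult y (dil th v')) \<le> norm (v - v') / 2"
  and th_local: "norm y \<le> 1 \<Longrightarrow> norm z \<le> 2 \<Longrightarrow> norm v \<le> 1 \<Longrightarrow> 0 \<le> r \<Longrightarrow> r \<le> 1 \<Longrightarrow>
      norm (gmult y (dil th (gmult z (dil r v)))) \<le> 3"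
  using ratio_th by (auto simp: ratio_def)

definition Qm :: "(real ^ 'n) measure" where "Qm = density lborel (\<lambda>x. ennreal (qq x))"

lemma sets_Qm [measurable_cong, simp]: "sets Qm = sets borel" and space_Qm [simp]: "space Qm = UNIV"
  by (simp_all add: Qm_def)

lemma prob_space_Qm: "prob_space Qm"
proof
  have "emeasure Qm (space Qm) = (\<integral>\<^sup>+x. ennreal (qq x) \<partial>lborel)"
    by (simp add: Qm_def emeasure_density)
  also have "\<dots> = ennreal (\<integral>x. qq x \<partial>lborel)"
    by (rule nn_integral_eq_integral) (auto simp: test_integrable[OF test_qq] qq_nonneg)
  finally show "emeasure Qm (space Qm) = 1" by (simp add: integral_qq)
qed

lemma Qm_support: "AE y in Qm. norm y \<le> 1"
  unfolding Qm_def by (subst AE_density) (auto intro!: AE_I2 simp: qq_zero not_le intro: ccontr)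

lemma integral_Qm: "f \<in> borel_measurable borel \<Longrightarrow> (\<integral>x. f x \<partial>Qm) = (\<integral>x. qq x *\<^sub>R f x \<partial>lborel)"
  for f :: "real ^ 'n \<Rightarrow> 'b::{banach, second_countable_topology}"
  unfolding Qm_def by (rule integral_density) (auto simp: qq_nonneg)

text \<open>In law this is a product of independent steps dilated by the successive powers of
  \<open>th\<close>. Lengthening the walk adds a factor at the smallest scale only, hence the
  convergence.\<close>

primrec Pn :: "nat \<Rightarrow> (real ^ 'n) measure" where
  "Pn 0 = return borel 0"
| "Pn (Suc n) = distr (Qm \<Otimes>\<^sub>M Pn n) borel (\<lambda>(y, Y). gmult y (dil th Y))"

lemma sets_Pn [measurable_cong, simp]: "sets (Pn n) = sets borel" and space_Pn [simp]: "space (Pn n) = UNIV"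
  by (cases n; simp)+

declare Pn.simps [simp del]

lemma prob_space_Pn: "prob_space (Pn n)"
proof (induction n)
  case 0
  then show ?case by (simp add: prob_space_return Pn.simps)
next
  case (Suc n)
  interpret Q: prob_space Qm by (rule prob_space_Qm)
  interpret P: prob_space "Pn n" by (rule Suc)
  interpret QP: pair_prob_space Qm "Pn n" ..
  show ?case by (simp add: QP.prob_space_distr Pn.simps)
qed

lemma Pn_support: "AE Y in Pn n. norm Y \<le> 2"
proof (induction n)
  case 0
  show ?case unfolding Pn.simps by (subst AE_return) auto
next
  case (Suc n)
  interpret Q: prob_space Qm by (rule prob_space_Qm)
  interpret P: prob_space "Pn n" by (rule prob_space_Pn)
  interpret QP: pair_prob_space Qm "Pn n" ..
  have "AE p in Qm \<Otimes>\<^sub>M Pn n. norm (fst p) \<le> 1 \<and> norm (snd p) \<le> 2"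
  proof (rule QP.AE_pair_measure)
    show "{p \<in> space (Qm \<Otimes>\<^sub>M Pn n). norm (fst p) \<le> 1 \<and> norm (snd p) \<le> 2} \<in> sets (Qm \<Otimes>\<^sub>M Pn n)"
      by measurable
    show "AE x in Qm. AE y in Pn n. norm (fst (x, y)) \<le> 1 \<and> norm (snd (x, y)) \<le> 2"
      using Qm_support Suc by auto
  qed
  then have "AE p in Qm \<Otimes>\<^sub>M Pn n. norm (case p of (y, Y) \<Rightarrow> gmult y (dil th Y)) \<le> 2"
    by (rule eventually_mono) (auto intro!: th_step)
  then show ?case unfolding Pn.simps by (subst AE_distr_iff) auto
qed

lemma integral_Pn_Suc:
  fixes f :: "real ^ 'n \<Rightarrow> 'b::{banach, second_countable_topology}"
  assumes f: "f \<in> borel_measurable borel" and B: "\<And>x. norm (f x) \<le> B"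
  shows "(\<integral>x. f x \<partial>Pn (Suc n)) = (\<integral>y. (\<integral>Y. f (gmult y (dil th Y)) \<partial>Pn n) \<partial>Qm)"
    and "(\<integral>x. f x \<partial>Pn (Suc n)) = (\<integral>Y. (\<integral>y. f (gmult y (dil th Y)) \<partial>Qm) \<partial>Pn n)"
proof -
  interpret Q: prob_space Qm by (rule prob_space_Qm)
  interpret P: prob_space "Pn n" by (rule prob_space_Pn)
  interpret QP: pair_prob_space Qm "Pn n" ..
  have m: "(\<lambda>(y, Y). f (gmult y (dil th Y))) \<in> borel_measurable (Qm \<Otimes>\<^sub>M Pn n)"
    using f by measurable
  have int: "integrable (Qm \<Otimes>\<^sub>M Pn n) (\<lambda>(y, Y). f (gmult y (dil th Y)))"
    using B m by (intro QP.integrable_const_bound[of _ B]) auto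
  have "(\<integral>x. f x \<partial>Pn (Suc n)) = (\<integral>p. (\<lambda>(y, Y). f (gmult y (dil th Y))) p \<partial>(Qm \<Otimes>\<^sub>M Pn n))"
    unfolding Pn.simps using f by (subst integral_distr) (auto simp: case_prod_unfold)
  then show "(\<integral>x. f x \<partial>Pn (Suc n)) = (\<integral>y. (\<integral>Y. f (gmult y (dil th Y)) \<partial>Pn n) \<partial>Qm)"
    and "(\<integral>x. f x \<partial>Pn (Suc n)) = (\<integral>Y. (\<integral>y. f (gmult y (dil th Y)) \<partial>Qm) \<partial>Pn n)"
    using QP.integral_fst'[OF int] QP.integral_snd[OF int] by auto
qed

section \<open>Changes of variables in Lebesgue integrals\<close>

lemma integral_right_shift:
  fixes f :: "real ^ 'n \<Rightarrow> 'b::{banach, second_countable_topology}"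
  assumes "f \<in> borel_measurable borel"
  shows "(\<integral>x. f (gmult x y) \<partial>lborel) = (\<integral>x. f x \<partial>lborel)"
proof -
  have "(\<integral>x. f x \<partial>lborel) = (\<integral>x. f x \<partial>(distr lborel borel (\<lambda>z. gmult z y)))"
    by (simp add: distr_right_translation)
  also have "\<dots> = (\<integral>x. f (gmult x y) \<partial>lborel)"
    using assms by (intro integral_distr) auto
  finally show ?thesis by simp
qed

lemma integral_left_shift:
  fixes f :: "real ^ 'n \<Rightarrow> 'b::{banach, second_countable_topology}"
  assumes "f \<in> borel_measurable borel"
  shows "(\<integral>x. f (gmult y x) \<partial>lborel) = (\<integral>x. f x \<partial>lborel)"
proof -
  have "(\<integral>x. f x \<partial>lborel) = (\<integral>x. f x \<partial>(distr lborel borel (gmult y)))"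
    by (simp add: distr_left_translation)
  also have "\<dots> = (\<integral>x. f (gmult y x) \<partial>lborel)"
    using assms by (intro integral_distr) auto
  finally show ?thesis by simp
qed

lemma integral_neg:
  fixes f :: "real ^ 'n \<Rightarrow> 'b::{banach, second_countable_topology}"
  assumes "f \<in> borel_measurable borel"
  shows "(\<integral>x. f (- x) \<partial>lborel) = (\<integral>x. f x \<partial>lborel)"
proof -
  have "(\<integral>x. f x \<partial>lborel) = (\<integral>x. f x \<partial>(distr lborel borel uminus))"
    by (simp add: distr_neg)
  also have "\<dots> = (\<integral>x. f (- x) \<partial>lborel)"
    using assms by (intro integral_distr) auto
  finally show ?thesis by simp
qed

lemma integral_dil:
  fixes f :: "real ^ 'n \<Rightarrow> 'b::{banach, second_countable_topology}"
  assumes "f \<in> borel_measurable borel" "t \<noteq> 0"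
  shows "(\<integral>x. f (dil t x) \<partial>lborel) = (1 / J t) *\<^sub>R (\<integral>x. f x \<partial>lborel)"
proof -
  have "distr lborel borel (dil t) = density lborel (\<lambda>_. ennreal (J (1 / t)))"
    using distr_dil[of "1 / t"] assms(2) by simp
  moreover have "J (1 / t) = 1 / J t"
  proof -
    have "J (1 / t) * J t = 1" using J_mult[of "1 / t" t] assms(2) by simp
    then show ?thesis using J_pos[OF assms(2)] by (simp add: field_simps)
  qed
  ultimately have d: "distr lborel borel (dil t) = density lborel (\<lambda>_. ennreal (1 / J t))" by simp
  have "(\<integral>x. f (dil t x) \<partial>lborel) = (\<integral>x. f x \<partial>(distr lborel borel (dil t)))"
    using assms by (intro integral_distr[symmetric]) auto
  also have "\<dots> = (\<integral>x. (1 / J t) *\<^sub>R f x \<partial>lborel)"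
    unfolding d using assms J_pos[OF assms(2)] by (intro integral_density) auto
  finally show ?thesis by simp
qed

text \<open>The law \<open>Pn n\<close> converges in the Wasserstein sense, by the contraction built into \<open>th\<close>.\<close>

lemma Pn_cauchy:
  assumes "f \<in> borel_measurable borel" "\<And>x. \<bar>f x\<bar> \<le> B" "0 \<le> L"
    and "\<And>x y. norm x \<le> 2 \<Longrightarrow> norm y \<le> 2 \<Longrightarrow> \<bar>f x - f y\<bar> \<le> L * norm (x - y)"
  shows "\<bar>(\<integral>x. f x \<partial>Pn (Suc n)) - (\<integral>x. f x \<partial>Pn n)\<bar> \<le> L * 2 * (1 / 2) ^ n"
  using assms
proof (induction n arbitrary: f L)
  case 0
  interpret P: prob_space "Pn (Suc 0)" by (rule prob_space_Pn)
  have i: "integrable (Pn (Suc 0)) f"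
    using 0 by (intro P.integrable_const_bound[of _ B]) auto
  have "(\<integral>x. f x \<partial>Pn (Suc 0)) - f 0 = (\<integral>x. f x - f 0 \<partial>Pn (Suc 0))"
    using Bochner_Integration.integral_diff[OF i P.integrable_const[of "f 0"]] P.prob_space
    by simp
  also have "\<bar>\<dots>\<bar> \<le> (\<integral>x. \<bar>f x - f 0\<bar> \<partial>Pn (Suc 0))"
    by (rule integral_abs_bound)
  also have "\<dots> \<le> (\<integral>x. L * 2 \<partial>Pn (Suc 0))"
  proof (rule integral_mono_AE)
    show "AE x in Pn (Suc 0). \<bar>f x - f 0\<bar> \<le> L * 2"
      using Pn_support[of "Suc 0"]
    proof (rule eventually_mono)
      fix x :: "real ^ 'n" assume "norm x \<le> 2"
      then show "\<bar>f x - f 0\<bar> \<le> L * 2"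
        using 0(4)[of x 0] mult_left_mono[of "norm x" 2 L] 0(3) by simp
    qed
  qed (use i in auto)
  finally have "\<bar>(\<integral>x. f x \<partial>Pn (Suc 0)) - f 0\<bar> \<le> L * 2" using P.prob_space by simp
  moreover have "(\<integral>x. f x \<partial>Pn 0) = f 0" using 0(1) by (simp add: integral_return Pn.simps)
  ultimately show ?case by simp
next
  case (Suc n)
  interpret Q: prob_space Qm by (rule prob_space_Qm)
  note fm [measurable] = Suc.prems(1)
  \<comment> \<open>Averaging over the outermost step turns the integral of \<open>f\<close> at
    level \<open>k + 1\<close> into that of \<open>g\<close> at level \<open>k\<close>, and the
    contraction halves the Lipschitz constant.\<close>
  define g where "g = (\<lambda>Y. \<integral>y. f (gmult y (dil th Y)) \<partial>Qm)"
  have int: "integrable Qm (\<lambda>y. f (gmult y (dil th Y)))" for Y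
    using Suc.prems(2) by (intro Q.integrable_const_bound[of _ B]) auto
  have g: "g \<in> borel_measurable borel"
    unfolding g_def by (rule Q.borel_measurable_lebesgue_integral) measurable
  have gB: "\<bar>g x\<bar> \<le> B" for x
  proof -
    have "\<bar>g x\<bar> \<le> (\<integral>y. \<bar>f (gmult y (dil th x))\<bar> \<partial>Qm)"
      unfolding g_def by (rule integral_abs_bound)
    also have "\<dots> \<le> (\<integral>y. B \<partial>Qm)"
      using int Suc.prems(2) by (intro integral_mono) auto
    finally show ?thesis using Q.prob_space by simp
  qed
  have gL: "\<bar>g x - g y\<bar> \<le> (L / 2) * norm (x - y)" if xy: "norm x \<le> 2" "norm y \<le> 2" for x y
  proof -
    have "\<bar>g x - g y\<bar> = \<bar>\<integral>z. f (gmult z (dil th x)) - f (gmult z (dil th y)) \<partial>Qm\<bar>"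
      using int by (simp add: g_def)
    also have "\<dots> \<le> (\<integral>z. \<bar>f (gmult z (dil th x)) - f (gmult z (dil th y))\<bar> \<partial>Qm)"
      by (rule integral_abs_bound)
    also have "\<dots> \<le> (\<integral>z. L * (norm (x - y) / 2) \<partial>Qm)"
    proof (rule integral_mono_AE)
      show "AE z in Qm. \<bar>f (gmult z (dil th x)) - f (gmult z (dil th y))\<bar> \<le> L * (norm (x - y) / 2)"
        using Qm_support
      proof (rule eventually_mono)
        fix z :: "real ^ 'n" assume z: "norm z \<le> 1"
        have "\<bar>f (gmult z (dil th x)) - f (gmult z (dil th y))\<bar> \<le> L * norm (gmult z (dil th x) - gmult z (dil th y))"
          using xy z by (intro Suc.prems(4) th_step) auto
        also have "\<dots> \<le> L * (norm (x - y) / 2)"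
          using th_contraction[OF z xy] Suc.prems(3) by (rule mult_left_mono)
        finally show "\<bar>f (gmult z (dil th x)) - f (gmult z (dil th y))\<bar> \<le> L * (norm (x - y) / 2)" .
      qed
    qed (use int in auto)
    finally show ?thesis using Q.prob_space by simp
  qed
  have "\<bar>(\<integral>x. g x \<partial>Pn (Suc n)) - (\<integral>x. g x \<partial>Pn n)\<bar> \<le> (L / 2) * 2 * (1 / 2) ^ n"
    using Suc.prems(3) by (intro Suc.IH g gB gL) auto
  moreover have "(\<integral>x. f x \<partial>Pn (Suc k)) = (\<integral>x. g x \<partial>Pn k)" for k
    unfolding g_def using integral_Pn_Suc(2)[OF fm, of B] Suc.prems(2) by simp
  ultimately show ?case by simp
qed

end

lemma geometric_limit:
  fixes a :: "nat \<Rightarrow> real"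
  assumes "\<And>n. \<bar>a (Suc n) - a n\<bar> \<le> C * (1 / 2) ^ n"
  shows "convergent a" "\<bar>lim a - a n\<bar> \<le> 2 * C * (1 / 2) ^ n"
proof -
  define d where "d = (\<lambda>n. a (Suc n) - a n)"
  have sC: "summable (\<lambda>n. C * (1 / 2) ^ n)" by (intro summable_mult summable_geometric) simp
  have sd: "summable d"
    by (rule summable_comparison_test'[OF sC, of 0]) (use assms in \<open>auto simp: d_def\<close>)
  have tel: "(\<Sum>k<n. d k) = a n - a 0" for n
    by (induction n) (auto simp: d_def)
  have "(\<lambda>n. a n - a 0) \<longlonglongrightarrow> suminf d"
    using summable_LIMSEQ[OF sd] by (simp add: tel)
  then have lim: "a \<longlonglongrightarrow> suminf d + a 0"
    using tendsto_add[OF _ tendsto_const[of "a 0"], of "\<lambda>n. a n - a 0"] by fastforce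
  then show "convergent a" by (auto simp: convergent_def)
  have "lim a - a n = (\<Sum>k. d (k + n))"
    using limI[OF lim] suminf_minus_initial_segment[OF sd, of n] tel[of n] by simp
  also have "\<bar>\<dots>\<bar> \<le> (\<Sum>k. C * (1 / 2) ^ (k + n))"
  proof -
    have sn: "summable (\<lambda>k. C * (1 / 2) ^ (k + n))" using sC by (rule summable_ignore_initial_segment)
    have "summable (\<lambda>k. \<bar>d (k + n)\<bar>)"
      by (rule summable_comparison_test'[OF sn, of 0]) (use assms in \<open>auto simp: d_def\<close>)
    then show ?thesis
      using assms by (intro order_trans[OF summable_rabs suminf_le] sn) (auto simp: d_def)
  qed
  also have "\<dots> = 2 * C * (1 / 2) ^ n"
  proof -
    have "(\<Sum>k. C * (1 / 2) ^ (k + n)) = (\<Sum>k. (C * (1 / 2) ^ n) * (1 / 2 :: real) ^ k)"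
      by (simp add: power_add mult_ac)
    also have "\<dots> = (C * (1 / 2) ^ n) * (\<Sum>k. (1 / 2 :: real) ^ k)"
      by (intro suminf_mult summable_geometric) simp
    finally show ?thesis using suminf_geometric[of "1 / 2 :: real"] by simp
  qed
  finally show "\<bar>lim a - a n\<bar> \<le> 2 * C * (1 / 2) ^ n" .
qed

section \<open>The smooth limit density and its refinement equation\<close>

context carnot
begin

text \<open>
  The limit density \<open>pp\<close> is used instead of an arbitrary bump because it satisfies the exact refinement
  equation \<open>pp_fixpoint\<close>: a single step of the walk turns the kernel at one scale into that at the previous one.
\<close>

definition pn :: "nat \<Rightarrow> real ^ 'n \<Rightarrow> real" where
  "pn n v = (\<integral>Y. qq (gmult v (- dil th Y)) \<partial>Pn n)"

definition pp :: "real ^ 'n \<Rightarrow> real" where "pp v = lim (\<lambda>n. pn n v)"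

lemma smooth_step_kernel: "smooth (\<lambda>p. qq (gmult (fst p) (- dil th (snd p))))"
  by (intro smooth_compose[OF smooth_qq] smooth_gmult smooth_uminus smooth_linear_compose[OF bounded_linear_dil]) auto

lemma qq_bounded: "\<exists>B. \<forall>x. \<bar>qq x\<bar> \<le> B"
  by (rule test_bounded[OF test_qq])

lemma step_kernel_zero: "norm v > 2 \<Longrightarrow> norm Y \<le> 3 \<Longrightarrow> qq (gmult v (- dil th Y)) = 0"
proof (rule ccontr)
  assume *: "norm v > 2" "norm Y \<le> 3" "qq (gmult v (- dil th Y)) \<noteq> 0"
  then have "norm (gmult v (- dil th Y)) < 1" using qq_zero not_le by blast
  then have "norm (gmult (gmult v (- dil th Y)) (dil th Y)) \<le> 2"
    using *(2) by (intro th_step) auto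
  then show False using *(1) by simp
qed

text \<open>\<open>Pn_cauchy\<close> is applied to the step kernel as a function of
  \<open>Y\<close>. For \<open>v\<close> outside the ball of radius 2 the kernel vanishes on the
  walk, so one Lipschitz constant serves all \<open>v\<close>.\<close>

lemma pn_cauchy: "\<exists>L\<ge>0. \<forall>n v. \<bar>pn (Suc n) v - pn n v\<bar> \<le> L * (1 / 2) ^ n"
proof -
  obtain L where L: "L \<ge> 0" "\<And>p p'. p \<in> cball 0 4 \<Longrightarrow> p' \<in> cball 0 4 \<Longrightarrow>
      norm (qq (gmult (fst p) (- dil th (snd p))) - qq (gmult (fst p') (- dil th (snd p')))) \<le> L * norm (p - p')"
    using smooth_lipschitz_on_ball[OF smooth_step_kernel, of 4] by blast
  obtain B where B: "\<And>x. \<bar>qq x\<bar> \<le> B" using qq_bounded by blast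
  have "\<bar>pn (Suc n) v - pn n v\<bar> \<le> L * 2 * (1 / 2) ^ n" for n v
    unfolding pn_def
  proof (rule Pn_cauchy[OF _ B L(1)])
    show "(\<lambda>Y. qq (gmult v (- dil th Y))) \<in> borel_measurable borel" by measurable
    fix x y :: "real ^ 'n" assume xy: "norm x \<le> 2" "norm y \<le> 2"
    show "\<bar>qq (gmult v (- dil th x)) - qq (gmult v (- dil th y))\<bar> \<le> L * norm (x - y)"
    proof (cases "norm v \<le> 2")
      case True
      have "(v, x) \<in> cball 0 4" "(v, y) \<in> cball 0 4"
        using norm_Pair_le[of v x] norm_Pair_le[of v y] True xy by auto
      then show ?thesis using L(2)[of "(v, x)" "(v, y)"] by (simp add: norm_Pair)
    next
      case False
      then show ?thesis using step_kernel_zero[of v] xy L(1) by simp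
    qed
  qed
  then show ?thesis using L(1) by (intro exI[of _ "L * 2"]) auto
qed

lemma pn_converges:
  obtains C where "\<And>v. (\<lambda>n. pn n v) \<longlonglongrightarrow> pp v" "\<And>n v. \<bar>pp v - pn n v\<bar> \<le> C * (1 / 2) ^ n" "C \<ge> 0"
proof -
  obtain L where L: "L \<ge> 0" "\<And>n v. \<bar>pn (Suc n) v - pn n v\<bar> \<le> L * (1 / 2) ^ n" using pn_cauchy by blast
  show ?thesis
  proof (rule that[of "2 * L"])
    show "(\<lambda>n. pn n v) \<longlonglongrightarrow> pp v" for v
      unfolding pp_def using geometric_limit(1)[of "\<lambda>n. pn n v", OF L(2)] by (simp add: convergent_LIMSEQ_iff)
    show "\<bar>pp v - pn n v\<bar> \<le> 2 * L * (1 / 2) ^ n" for n v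
      unfolding pp_def by (rule geometric_limit(2)[of "\<lambda>n. pn n v", OF L(2)])
  qed (use L in simp)
qed

lemma pn_borel [measurable]: "pn n \<in> borel_measurable borel"
proof -
  interpret P: prob_space "Pn n" by (rule prob_space_Pn)
  show ?thesis unfolding pn_def by (rule P.borel_measurable_lebesgue_integral) measurable
qed

lemma pn_nonneg: "pn n v \<ge> 0"
  unfolding pn_def by (intro integral_nonneg_AE AE_I2 qq_nonneg)

lemma pn_zero: "norm v > 2 \<Longrightarrow> pn n v = 0"
proof -
  assume "norm v > 2"
  then have "AE Y in Pn n. qq (gmult v (- dil th Y)) = 0"
    using Pn_support[of n] by (auto elim!: eventually_mono intro: step_kernel_zero)
  then show ?thesis unfolding pn_def by (simp add: integral_eq_zero_AE)
qed

lemma pp_nonneg: "pp v \<ge> 0"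
proof (rule pn_converges)
  fix C assume "\<And>v. (\<lambda>n. pn n v) \<longlonglongrightarrow> pp v"
  then show ?thesis by (rule LIMSEQ_le_const) (auto intro: pn_nonneg)
qed

lemma pp_zero: "norm v > 2 \<Longrightarrow> pp v = 0"
  by (simp add: pp_def pn_zero)

lemma pp_borel [measurable]: "pp \<in> borel_measurable borel"
proof (rule pn_converges)
  fix C assume "\<And>v. (\<lambda>n. pn n v) \<longlonglongrightarrow> pp v"
  then show ?thesis by (rule borel_measurable_LIMSEQ_metric[OF pn_borel])
qed

lemma pp_bounded: "\<exists>B. \<forall>v. \<bar>pp v\<bar> \<le> B"
proof (rule pn_converges)
  fix C assume C: "\<And>n v. \<bar>pp v - pn n v\<bar> \<le> C * (1 / 2) ^ n"
  obtain B where B: "\<And>x. \<bar>qq x\<bar> \<le> B" using qq_bounded by blast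
  have "\<bar>pp v\<bar> \<le> C + B" for v
  proof -
    have "pn 0 v = qq (gmult v (- dil th 0))"
      unfolding pn_def Pn.simps by (rule integral_return) auto
    then show ?thesis using C[of v 0] B[of "gmult v (- dil th 0)"] by simp
  qed
  then show ?thesis by blast
qed

lemma integral_density_step:
  fixes f :: "real ^ 'n \<Rightarrow> real"
  assumes f [measurable]: "f \<in> borel_measurable borel"
  shows "(\<integral>y. f (gmult y (dil th Y)) \<partial>Qm) = (\<integral>v. qq (gmult v (- dil th Y)) * f v \<partial>lborel)"
proof -
  have "(\<integral>y. f (gmult y (dil th Y)) \<partial>Qm) = (\<integral>y. qq y * f (gmult y (dil th Y)) \<partial>lborel)"
    by (subst integral_Qm) auto
  also have "\<dots> = (\<integral>y. (\<lambda>v. qq (gmult v (- dil th Y)) * f v) (gmult y (dil th Y)) \<partial>lborel)"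
    by simp
  also have "\<dots> = (\<integral>v. qq (gmult v (- dil th Y)) * f v \<partial>lborel)"
    by (rule integral_right_shift) measurable
  finally show ?thesis .
qed

text \<open>The index is off by one because \<open>Pn 0\<close> is a point mass: a density exists
  only after one step of density \<open>qq\<close>, and \<open>pn n\<close> is the density of
  \<open>Pn (Suc n)\<close>.\<close>

lemma integral_Pn_density:
  fixes f :: "real ^ 'n \<Rightarrow> real"
  assumes f [measurable]: "f \<in> borel_measurable borel" and B: "\<And>x. \<bar>f x\<bar> \<le> B"
  shows "(\<integral>x. f x \<partial>Pn (Suc n)) = (\<integral>v. f v * pn n v \<partial>lborel)"
proof -
  interpret P: prob_space "Pn n" by (rule prob_space_Pn)
  interpret LP: pair_sigma_finite lborel "Pn n" ..
  obtain Bq where Bq: "\<And>x. \<bar>qq x\<bar> \<le> Bq" using qq_bounded by blast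
  have m: "(\<lambda>(v, Y). qq (gmult v (- dil th Y)) * f v) \<in> borel_measurable (lborel \<Otimes>\<^sub>M Pn n)"
    by measurable
  have "integrable (lborel \<Otimes>\<^sub>M Pn n) (\<lambda>(v, Y). qq (gmult v (- dil th Y)) * f v)"
  proof (rule Bochner_Integration.integrable_bound[where f = "\<lambda>(v :: real ^ 'n, Y). indicat_real (cball 0 2) v * (Bq * B)"])
    have "integrable lborel (\<lambda>v :: real ^ 'n. indicat_real (cball 0 2) v * (Bq * B))"
      by (intro integrable_mult_left integrable_real_indicator)
        (auto intro: emeasure_bounded_finite[unfolded infinity_ennreal_def])
    then show "integrable (lborel \<Otimes>\<^sub>M Pn n) (\<lambda>(v :: real ^ 'n, Y). indicat_real (cball 0 2) v * (Bq * B))"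
    proof (intro LP.Fubini_integrable)
      show "(\<lambda>(v :: real ^ 'n, Y). indicat_real (cball 0 2) v * (Bq * B)) \<in> borel_measurable (lborel \<Otimes>\<^sub>M Pn n)"
        unfolding case_prod_beta
        by (intro borel_measurable_times borel_measurable_const measurable_compose[OF measurable_fst borel_measurable_indicator]) simp
    qed (simp_all add: P.prob_space[simplified] abs_mult)
    have "AE p in lborel \<Otimes>\<^sub>M Pn n. norm (snd p) \<le> 2"
    proof (rule LP.AE_pair_measure)
      show "{p \<in> space (lborel \<Otimes>\<^sub>M Pn n). norm (snd p) \<le> 2} \<in> sets (lborel \<Otimes>\<^sub>M Pn n)" by measurable
    qed (use Pn_support[of n] in auto)
    then show "AE p in lborel \<Otimes>\<^sub>M Pn n. norm (case p of (v, Y) \<Rightarrow> qq (gmult v (- dil th Y)) * f v)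
        \<le> norm (case p of (v, Y) \<Rightarrow> indicat_real (cball 0 2) v * (Bq * B))"
    proof (rule eventually_mono, clarify)
      fix v Y :: "real ^ 'n" assume Y: "norm (snd (v, Y)) \<le> 2"
      have "Bq \<ge> 0" "B \<ge> 0" using Bq[of 0] B[of 0] by auto
      then show "norm (qq (gmult v (- dil th Y)) * f v) \<le> norm (indicat_real (cball 0 2) v * (Bq * B))"
        using step_kernel_zero[of v Y] Y Bq[of "gmult v (- dil th Y)"] B[of v]
        by (cases "norm v \<le> 2") (auto simp: abs_mult intro!: mult_mono)
    qed
  qed (rule m)
  from LP.Fubini_integral[OF this]
  have "(\<integral>Y. (\<integral>v. qq (gmult v (- dil th Y)) * f v \<partial>lborel) \<partial>Pn n) = (\<integral>v. (\<integral>Y. qq (gmult v (- dil th Y)) * f v \<partial>Pn n) \<partial>lborel)" .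
  moreover have "(\<integral>x. f x \<partial>Pn (Suc n)) = (\<integral>Y. (\<integral>v. qq (gmult v (- dil th Y)) * f v \<partial>lborel) \<partial>Pn n)"
    using integral_Pn_Suc(2)[OF f, of B n] B integral_density_step[OF f] by simp
  moreover have "(\<integral>Y. qq (gmult v (- dil th Y)) * f v \<partial>Pn n) = f v * pn n v" for v
    unfolding pn_def by (simp add: mult.commute)
  ultimately show ?thesis by (simp only:)
qed

lemma integrable_cball: "integrable lborel (\<lambda>v :: real ^ 'n. indicator (cball 0 R) v * c :: real)"
  by (intro integrable_mult_left integrable_real_indicator)
    (auto intro: emeasure_bounded_finite[unfolded infinity_ennreal_def])

lemma pn_pp_limit:
  fixes f :: "real ^ 'n \<Rightarrow> real"
  assumes f [measurable]: "f \<in> borel_measurable borel" and B: "\<And>x. \<bar>f x\<bar> \<le> B"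
  shows "(\<lambda>n. \<integral>v. f v * pn n v \<partial>lborel) \<longlonglongrightarrow> (\<integral>v. f v * pp v \<partial>lborel)"
proof (rule pn_converges)
  fix C assume C: "\<And>v. (\<lambda>n. pn n v) \<longlonglongrightarrow> pp v" "\<And>n v. \<bar>pp v - pn n v\<bar> \<le> C * (1 / 2) ^ n" "C \<ge> 0"
  obtain Bp where Bp: "\<And>v. \<bar>pp v\<bar> \<le> Bp" using pp_bounded by blast
  show ?thesis
  proof (rule integral_dominated_convergence[where w = "\<lambda>v. indicator (cball 0 2) v * (B * (C + Bp))"])
    show "AE v in lborel. (\<lambda>n. f v * pn n v) \<longlonglongrightarrow> f v * pp v"
      by (intro AE_I2 tendsto_mult tendsto_const C)
    fix n
    show "AE v in lborel. norm (f v * pn n v) \<le> indicator (cball 0 2) v * (B * (C + Bp))"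
    proof (rule AE_I2)
      fix v :: "real ^ 'n"
      have "C * (1 / 2) ^ n \<le> C * 1" using C(3) by (intro mult_left_mono power_le_one) auto
      then have "\<bar>pn n v\<bar> \<le> C + Bp" using C(2)[of v n] Bp[of v] by simp
      moreover have "B \<ge> 0" using B[of 0] by simp
      ultimately show "norm (f v * pn n v) \<le> indicator (cball 0 2) v * (B * (C + Bp))"
        using B[of v] pn_zero[of v n] by (cases "norm v \<le> 2") (auto simp: abs_mult intro!: mult_mono)
    qed
    show "(\<lambda>v. f v * pn n v) \<in> borel_measurable lborel" by measurable
  qed (measurable, rule integrable_cball)
qed

lemma integral_pp: "(\<integral>v. pp v \<partial>lborel) = 1"
proof -
  have "(\<integral>v. 1 * pn n v \<partial>lborel) = 1" for n
  proof -
    interpret P: prob_space "Pn (Suc n)" by (rule prob_space_Pn)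
    show ?thesis using integral_Pn_density[of "\<lambda>_. 1" 1 n] P.prob_space by simp
  qed
  then show ?thesis using pn_pp_limit[of "\<lambda>_. 1" 1] by (simp add: LIMSEQ_const_iff)
qed

lemma pp_fixpoint: "pp v = (\<integral>Y. qq (gmult v (- dil th Y)) * pp Y \<partial>lborel)"
proof (rule pn_converges)
  fix C assume C: "\<And>v. (\<lambda>n. pn n v) \<longlonglongrightarrow> pp v"
  obtain B where B: "\<And>x. \<bar>qq x\<bar> \<le> B" using qq_bounded by blast
  have "pn (Suc n) v = (\<integral>Y. qq (gmult v (- dil th Y)) * pn n Y \<partial>lborel)" for n
    unfolding pn_def[of "Suc n"] by (rule integral_Pn_density[OF _ B]) measurable
  then have "(\<lambda>n. pn (Suc n) v) \<longlonglongrightarrow> (\<integral>Y. qq (gmult v (- dil th Y)) * pp Y \<partial>lborel)"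
    using pn_pp_limit[OF _ B, of "\<lambda>Y. gmult v (- dil th Y)"] by simp
  moreover have "(\<lambda>n. pn (Suc n) v) \<longlonglongrightarrow> pp v" using C[of v] by (rule LIMSEQ_Suc)
  ultimately show ?thesis using LIMSEQ_unique by blast
qed

lemma pp_integrable: "integrable lborel pp"
proof -
  obtain Bp where Bp: "\<And>v. \<bar>pp v\<bar> \<le> Bp" using pp_bounded by blast
  show ?thesis
  proof (rule Bochner_Integration.integrable_bound[OF integrable_cball[of 2 Bp]])
    show "AE v in lborel. norm (pp v) \<le> norm (indicator (cball 0 2) v * Bp :: real)"
    proof (rule AE_I2)
      fix v show "norm (pp v) \<le> norm (indicator (cball 0 2) v * Bp :: real)"
        using Bp[of v] pp_zero[of v] by (cases "norm v \<le> 2") auto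
    qed
  qed measurable
qed

text \<open>The refinement equation writes \<open>pp\<close> as an average of smooth step kernels
  over the compactly supported measure with density \<open>pp\<close>, so
  \<open>smooth_integral\<close> applies.\<close>

lemma smooth_pp: "smooth pp"
proof -
  define m where "m = density lborel (\<lambda>v. ennreal (pp v))"
  have "finite_measure m"
  proof
    have "emeasure m (space m) = (\<integral>\<^sup>+v. ennreal (pp v) \<partial>lborel)"
      by (simp add: m_def emeasure_density)
    also have "\<dots> = ennreal (\<integral>v. pp v \<partial>lborel)"
      by (rule nn_integral_eq_integral) (auto simp: pp_integrable pp_nonneg)
    finally show "emeasure m (space m) \<noteq> \<infinity>" by simp
  qed
  moreover have "AE v in m. v \<in> cball 0 2"
    unfolding m_def by (subst AE_density) (auto intro!: AE_I2 simp: pp_zero not_le intro: ccontr)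
  ultimately have "smooth (\<lambda>v. \<integral>Y. qq (gmult (fst (v, Y)) (- dil th (snd (v, Y)))) \<partial>m)"
    by (intro smooth_integral[OF smooth_step_kernel, of m "cball 0 2"]) (auto simp: m_def)
  moreover have "(\<integral>Y. qq (gmult v (- dil th Y)) \<partial>m) = pp v" for v
    unfolding m_def pp_fixpoint[of v]
    by (subst integral_density) (auto simp: pp_nonneg mult.commute)
  ultimately show ?thesis by simp
qed

section \<open>The kernels at all scales\<close>

definition pk :: "nat \<Rightarrow> real ^ 'n \<Rightarrow> real" where
  "pk i v = pp (dil (1 / th ^ i) v) / J th ^ i"

lemma th_pow: "th ^ i > 0" "th ^ i \<noteq> 0" "J th ^ i > 0" "J (th ^ i) = J th ^ i"
  using th_bounds J_pos[of th] by (auto simp: J_power)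

lemma pk_nonneg: "pk i v \<ge> 0"
  using pp_nonneg th_pow(3)[of i] by (simp add: pk_def)

lemma pk_borel [measurable]: "pk i \<in> borel_measurable borel"
  unfolding pk_def by measurable

lemma pk_bounded: "\<exists>B. \<forall>v. \<bar>pk i v\<bar> \<le> B"
proof -
  obtain Bp where Bp: "\<And>v. \<bar>pp v\<bar> \<le> Bp" using pp_bounded by blast
  have "\<bar>pk i v\<bar> \<le> Bp / J th ^ i" for v
    using Bp[of "dil (1 / th ^ i) v"] th_pow(3)[of i] by (simp add: pk_def divide_right_mono)
  then show ?thesis by blast
qed

lemma pk_dil: "pk i (dil (th ^ i) v) = pp v / J th ^ i"
  using th_bounds(4) by (simp add: pk_def)

lemma pk_Suc_dil: "pk (Suc i) (dil (th ^ i) v) = pk 1 v / J th ^ i"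
  using th_pow(2) th_bounds by (simp add: pk_def field_simps)

text \<open>This is \<open>pp_fixpoint\<close> with the step, rather than the rest of the walk, as
  the variable of integration; the kernel appears as an average of translates of the next finer
  one.\<close>

lemma pp_step: "pp v = (\<integral>y. qq y * pk 1 (gmult (- y) v) \<partial>lborel)"
proof -
  let ?f = "\<lambda>Z. qq (gmult v (- Z)) * pp (dil (1 / th) Z)"
  have "pp v = (\<integral>Y. ?f (dil th Y) \<partial>lborel)"
    using th_bounds by (subst pp_fixpoint) simp
  also have "\<dots> = (1 / J th) *\<^sub>R (\<integral>Z. ?f Z \<partial>lborel)"
    using th_bounds by (intro integral_dil) auto
  also have "(\<integral>Z. ?f Z \<partial>lborel) = (\<integral>Z. ?f (gmult Z v) \<partial>lborel)"
    by (rule integral_right_shift[symmetric]) measurable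
  also have "\<dots> = (\<integral>y. ?f (gmult (- y) v) \<partial>lborel)"
    by (rule integral_neg[symmetric]) measurable
  also have "\<dots> = (\<integral>y. qq y * pp (dil (1 / th) (gmult (- y) v)) \<partial>lborel)"
    by (simp add: neg_gmult)
  finally show ?thesis by (simp add: pk_def)
qed

lemma pk_step: "pk i v = (\<integral>y. qq y * pk (Suc i) (gmult (- dil (th ^ i) y) v) \<partial>lborel)"
proof -
  define v' where "v' = dil (1 / th ^ i) v"
  have v: "v = dil (th ^ i) v'" using th_bounds(4) by (simp add: v'_def)
  have "gmult (- dil (th ^ i) y) v = dil (th ^ i) (gmult (- y) v')" for y
    by (simp add: v dil_neg[symmetric] gmult_dil)
  then have "(\<integral>y. qq y * pk (Suc i) (gmult (- dil (th ^ i) y) v) \<partial>lborel) =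
      (\<integral>y. (qq y * pk 1 (gmult (- y) v')) / J th ^ i \<partial>lborel)"
    by (simp add: pk_Suc_dil)
  also have "\<dots> = pp v' / J th ^ i"
    unfolding pp_step[of v'] by simp
  finally show ?thesis by (simp add: v pk_dil)
qed

text \<open>On the dilated ball of radius 3 the density \<open>pn n\<close> is at least
  \<open>c\<close>, since the step needed to reach a point there from the rest of the walk lies in
  the half ball (\<open>th_quotient\<close>). As \<open>c\<close> is the same for all
  \<open>n\<close>, averages control Lebesgue integrals at all finer scales at once.\<close>

lemma Pn_lower:
  obtains c where "c > 0"
    "\<And>n B (f :: real ^ 'n \<Rightarrow> real). f \<in> borel_measurable borel \<Longrightarrow> (\<And>x. 0 \<le> f x) \<Longrightarrow> (\<And>x. f x \<le> B) \<Longrightarrow>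
      c * (\<integral>v. indicator (dil th ` cball 0 3) v * f v \<partial>lborel) \<le> (\<integral>x. f x \<partial>Pn (Suc n))"
proof -
  obtain c where c: "c > 0" "\<And>x. norm x \<le> 1 / 2 \<Longrightarrow> c \<le> qq x" using qq_lower by blast
  have low: "c \<le> pn n (dil th z)" if z: "norm z \<le> 3" for n z
  proof -
    interpret P: prob_space "Pn n" by (rule prob_space_Pn)
    obtain B where B: "\<And>x. \<bar>qq x\<bar> \<le> B" using qq_bounded by blast
    have "(\<integral>Y. c \<partial>Pn n) \<le> (\<integral>Y. qq (gmult (dil th z) (- dil th Y)) \<partial>Pn n)"
    proof (rule integral_mono_AE)
      show "integrable (Pn n) (\<lambda>Y. qq (gmult (dil th z) (- dil th Y)))"
        using B by (intro P.integrable_const_bound[of _ B]) auto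
      show "AE Y in Pn n. c \<le> qq (gmult (dil th z) (- dil th Y))"
        using Pn_support[of n] by (rule eventually_mono) (intro c th_quotient z)
    qed simp
    then show ?thesis using P.prob_space by (simp add: pn_def)
  qed
  have K: "compact (dil th ` cball 0 3)"
    by (intro compact_continuous_image linear_continuous_on bounded_linear_dil compact_cball)
  show ?thesis
  proof (rule that[OF c(1)])
    fix n B and f :: "real ^ 'n \<Rightarrow> real"
    assume f [measurable]: "f \<in> borel_measurable borel" and f0: "\<And>x. 0 \<le> f x" and B: "\<And>x. f x \<le> B"
    have Kb [measurable]: "dil th ` cball 0 3 \<in> sets borel" using K by (simp add: borel_compact)
    have iK: "integrable lborel (\<lambda>v :: real ^ 'n. indicator (dil th ` cball 0 3) v * B :: real)"
      by (intro integrable_mult_left integrable_real_indicator)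
        (use K Kb in \<open>auto intro: emeasure_bounded_finite[unfolded infinity_ennreal_def] compact_imp_bounded\<close>)
    have B0: "B \<ge> 0" using f0[of 0] B[of 0] by simp
    have i1: "integrable lborel (\<lambda>v. indicator (dil th ` cball 0 3) v * f v)"
      by (rule Bochner_Integration.integrable_bound[OF iK])
        (use f0 B B0 in \<open>auto simp: indicator_def\<close>)
    have i2: "integrable lborel (\<lambda>v. f v * pn n v)"
    proof (rule Bochner_Integration.integrable_bound[where f = "\<lambda>v. B * pn n v"])
      interpret P: prob_space "Pn (Suc n)" by (rule prob_space_Pn)
      have "(\<integral>v. 1 * pn n v \<partial>lborel) = 1"
        using integral_Pn_density[of "\<lambda>_. 1" 1 n] P.prob_space by simp
      then have "integrable lborel (pn n)" using not_integrable_integral_eq by fastforce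
      then show "integrable lborel (\<lambda>v. B * pn n v)" by simp
      show "AE v in lborel. norm (f v * pn n v) \<le> norm (B * pn n v)"
        using f0 B B0 pn_nonneg by (auto simp: abs_mult intro!: mult_right_mono)
    qed measurable
    have "c * (\<integral>v. indicator (dil th ` cball 0 3) v * f v \<partial>lborel) =
        (\<integral>v. c * (indicator (dil th ` cball 0 3) v * f v) \<partial>lborel)" by simp
    also have "\<dots> \<le> (\<integral>v. f v * pn n v \<partial>lborel)"
    proof (rule integral_mono)
      fix v show "c * (indicator (dil th ` cball 0 3) v * f v) \<le> f v * pn n v"
      proof (cases "v \<in> dil th ` cball 0 3")
        case True
        then have "c \<le> pn n v" using low by auto
        then show ?thesis using True mult_left_mono[OF _ f0[of v], of c "pn n v"] by (simp add: mult.commute)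
      qed (simp add: f0 pn_nonneg)
    qed (use i1 i2 in auto)
    also have "\<dots> = (\<integral>x. f x \<partial>Pn (Suc n))"
      by (rule integral_Pn_density[symmetric, of _ B]) (use f0 B in auto)
    finally show "c * (\<integral>v. indicator (dil th ` cball 0 3) v * f v \<partial>lborel) \<le> (\<integral>x. f x \<partial>Pn (Suc n))" .
  qed
qed

end

subsection \<open>Averages of a measure along the walk\<close>

context carnot
begin

text \<open>The expectation of \<open>F\<close> after \<open>n\<close> steps of the walk that starts
  at \<open>x\<close> with scale \<open>th ^ i\<close>.\<close>

definition av :: "nat \<Rightarrow> nat \<Rightarrow> (real ^ 'n \<Rightarrow> 'b::{banach, second_countable_topology}) \<Rightarrow> real ^ 'n \<Rightarrow> 'b" where
  "av i n F x = (\<integral>z. F (gmult x (dil (th ^ i) z)) \<partial>Pn n)"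

lemma av_integrable:
  fixes F :: "real ^ 'n \<Rightarrow> 'b::{banach, second_countable_topology}"
  assumes [measurable]: "F \<in> borel_measurable borel" and B: "\<And>x. norm (F x) \<le> B"
  shows "integrable (Pn n) (\<lambda>z. F (gmult x (dil t z)))"
proof -
  interpret P: prob_space "Pn n" by (rule prob_space_Pn)
  show ?thesis by (rule P.integrable_const_bound[of _ B]) (use B in auto)
qed

lemma av_borel [measurable]:
  fixes F :: "real ^ 'n \<Rightarrow> 'b::{banach, second_countable_topology}"
  assumes [measurable]: "F \<in> borel_measurable borel"
  shows "av i n F \<in> borel_measurable borel"
proof -
  interpret P: prob_space "Pn n" by (rule prob_space_Pn)
  show ?thesis unfolding av_def by (rule P.borel_measurable_lebesgue_integral) measurable
qed

lemma av_0: "F \<in> borel_measurable borel \<Longrightarrow> av i 0 F x = F x"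
  unfolding av_def Pn.simps by (subst integral_return) auto

lemma av_1:
  fixes G :: "real ^ 'n \<Rightarrow> 'b::{banach, second_countable_topology}"
  assumes [measurable]: "G \<in> borel_measurable borel" and C: "\<And>x. norm (G x) \<le> C"
  shows "av i 1 G x = (\<integral>y. G (gmult x (dil (th ^ i) y)) \<partial>Qm)"
proof -
  have "av i 1 G x = (\<integral>y. (\<integral>Y. G (gmult x (dil (th ^ i) (gmult y (dil th Y)))) \<partial>Pn 0) \<partial>Qm)"
    unfolding av_def One_nat_def by (rule integral_Pn_Suc(1)[OF _ C]) measurable
  moreover have "(\<integral>Y. G (gmult x (dil (th ^ i) (gmult y (dil th Y)))) \<partial>Pn 0) = G (gmult x (dil (th ^ i) y))" for y
    unfolding Pn.simps by (subst integral_return) auto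
  ultimately show ?thesis by (simp only:)
qed

text \<open>The tower property: the first of the \<open>n + 1\<close> steps has scale
  \<open>i\<close>, the others have finer scales.\<close>

lemma av_Suc:
  fixes F :: "real ^ 'n \<Rightarrow> 'b::{banach, second_countable_topology}"
  assumes [measurable]: "F \<in> borel_measurable borel" and B: "\<And>x. norm (F x) \<le> B"
  shows "av i (Suc n) F x = av i 1 (av (Suc i) n F) x"
proof -
  have avB: "norm (av (Suc i) n F x) \<le> B" for x
  proof -
    interpret P: prob_space "Pn n" by (rule prob_space_Pn)
    have "norm (av (Suc i) n F x) \<le> (\<integral>z. norm (F (gmult x (dil (th ^ Suc i) z))) \<partial>Pn n)"
      unfolding av_def by (rule integral_norm_bound)
    also have "\<dots> \<le> (\<integral>z. B \<partial>Pn n)"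
      by (intro integral_mono integrable_norm av_integrable[OF _ B]) (auto simp: B)
    finally show ?thesis using P.prob_space by simp
  qed
  have "av i (Suc n) F x = (\<integral>y. (\<integral>Y. F (gmult x (dil (th ^ i) (gmult y (dil th Y)))) \<partial>Pn n) \<partial>Qm)"
    unfolding av_def by (rule integral_Pn_Suc(1)[OF _ B]) measurable
  also have "\<dots> = (\<integral>y. av (Suc i) n F (gmult x (dil (th ^ i) y)) \<partial>Qm)"
    unfolding av_def by (simp add: gmult_dil[symmetric] assoc mult.commute)
  also have "\<dots> = av i 1 (av (Suc i) n F) x"
    by (rule av_1[symmetric, OF _ avB]) measurable
  finally show ?thesis .
qed

lemma av_mono:
  fixes F G :: "real ^ 'n \<Rightarrow> real"
  assumes [measurable]: "F \<in> borel_measurable borel" "G \<in> borel_measurable borel"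
    and "\<And>x. \<bar>F x\<bar> \<le> B" "\<And>x. \<bar>G x\<bar> \<le> C"
    and "\<And>z. norm z \<le> 2 \<Longrightarrow> F (gmult x (dil (th ^ i) z)) \<le> G (gmult x (dil (th ^ i) z))"
  shows "av i n F x \<le> av i n G x"
  unfolding av_def
proof (rule integral_mono_AE)
  show "AE z in Pn n. F (gmult x (dil (th ^ i) z)) \<le> G (gmult x (dil (th ^ i) z))"
    using Pn_support[of n] by (rule eventually_mono) (rule assms)
qed (use assms av_integrable[of F B] av_integrable[of G C] in auto)

lemma av_nonneg: "(\<And>x. 0 \<le> F x) \<Longrightarrow> 0 \<le> av i n F x" for F :: "real ^ 'n \<Rightarrow> real"
  unfolding av_def by (rule integral_nonneg_AE) simp

text \<open>Averages are taken over right translates, which preserve Lebesgue measure. Pointwise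
  inequalities between averages therefore integrate to inequalities between total integrals.\<close>

lemma integral_av:
  fixes F :: "real ^ 'n \<Rightarrow> real"
  assumes F: "integrable lborel F"
  shows "integrable lborel (av i n F)" "(\<integral>x. av i n F x \<partial>lborel) = (\<integral>x. F x \<partial>lborel)"
proof -
  interpret P: prob_space "Pn n" by (rule prob_space_Pn)
  interpret PL: pair_sigma_finite "Pn n" "lborel :: (real ^ 'n) measure" ..
  have Fm [measurable]: "F \<in> borel_measurable borel" using F by auto
  have sh: "integrable lborel (\<lambda>x. G (gmult x y))" if "integrable lborel G" for G :: "real ^ 'n \<Rightarrow> real" and y
  proof -
    have "integrable (distr lborel borel (\<lambda>z. gmult z y)) G" using that by (simp add: distr_right_translation)
    then show ?thesis by (rule integrable_distr[rotated]) measurable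
  qed
  have "integrable (Pn n \<Otimes>\<^sub>M lborel) (\<lambda>(z, x). F (gmult x (dil (th ^ i) z)))"
  proof (rule PL.Fubini_integrable)
    show "(\<lambda>(z, x). F (gmult x (dil (th ^ i) z))) \<in> borel_measurable (Pn n \<Otimes>\<^sub>M lborel)" by measurable
    have "(\<integral>x. norm (F (gmult x (dil (th ^ i) z))) \<partial>lborel) = (\<integral>x. norm (F x) \<partial>lborel)" for z
      using integral_right_shift[of "\<lambda>x. norm (F x)"] by simp
    then show "integrable (Pn n) (\<lambda>z. \<integral>x. norm (case (z, x) of (z, x) \<Rightarrow> F (gmult x (dil (th ^ i) z))) \<partial>lborel)"
      by simp
    show "AE z in Pn n. integrable lborel (\<lambda>x. case (z, x) of (z, x) \<Rightarrow> F (gmult x (dil (th ^ i) z)))"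
      using sh[OF F] by simp
  qed
  note * = PL.integrable_snd[OF this] PL.Fubini_integral[OF this]
  show "integrable lborel (av i n F)" using *(1) by (simp add: av_def[abs_def])
  have "(\<integral>x. av i n F x \<partial>lborel) = (\<integral>z. (\<integral>x. F (gmult x (dil (th ^ i) z)) \<partial>lborel) \<partial>Pn n)"
    using *(2) by (simp add: av_def)
  also have "\<dots> = (\<integral>z. (\<integral>x. F x \<partial>lborel) \<partial>Pn n)"
    by (simp add: integral_right_shift)
  finally show "(\<integral>x. av i n F x \<partial>lborel) = (\<integral>x. F x \<partial>lborel)" using P.prob_space by simp
qed

text \<open>
  The densities at scale \<open>th ^ i\<close> of the measure \<open>w\<close> and of the vector measure \<open>f w\<close>, and their quotient,
  which is \<open>0\<close> where the density of \<open>w\<close> vanishes.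
\<close>

definition dens :: "(real ^ 'n) measure \<Rightarrow> nat \<Rightarrow> real ^ 'n \<Rightarrow> real" where
  "dens w i x = (\<integral>\<xi>. pk i (gmult (- x) \<xi>) \<partial>w)"

definition flux :: "(real ^ 'n) measure \<Rightarrow> (real ^ 'n \<Rightarrow> real ^ 'n) \<Rightarrow> nat \<Rightarrow> real ^ 'n \<Rightarrow> real ^ 'n" where
  "flux w f i x = (\<integral>\<xi>. pk i (gmult (- x) \<xi>) *\<^sub>R f \<xi> \<partial>w)"

definition mdir :: "(real ^ 'n) measure \<Rightarrow> (real ^ 'n \<Rightarrow> real ^ 'n) \<Rightarrow> nat \<Rightarrow> real ^ 'n \<Rightarrow> real ^ 'n" where
  "mdir w f i x = flux w f i x /\<^sub>R dens w i x"

definition fin_borel :: "(real ^ 'n) measure \<Rightarrow> bool" where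
  "fin_borel w \<longleftrightarrow> finite_measure w \<and> sets w = sets borel"

definition density1 :: "(real ^ 'n \<Rightarrow> real ^ 'n) \<Rightarrow> bool" where
  "density1 f \<longleftrightarrow> f \<in> borel_measurable borel \<and> (\<forall>x. norm (f x) \<le> 1)"

lemma fin_borel_integrable:
  fixes g :: "real ^ 'n \<Rightarrow> 'b::{banach, second_countable_topology}"
  assumes "fin_borel w" "g \<in> borel_measurable borel" "\<And>x. norm (g x) \<le> B"
  shows "integrable w g"
proof -
  interpret finite_measure w using assms(1) by (simp add: fin_borel_def)
  have "g \<in> borel_measurable w"
    using assms(1,2) by (simp add: fin_borel_def cong: measurable_cong_sets)
  then show ?thesis using assms(3) by (intro integrable_const_bound[of _ B]) auto
qed

lemma pk_integrable:
  assumes "fin_borel w" "density1 f"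
  shows "integrable w (\<lambda>\<xi>. pk i (gmult (- x) \<xi>))" "integrable w (\<lambda>\<xi>. pk i (gmult (- x) \<xi>) *\<^sub>R f \<xi>)"
proof -
  obtain B where B: "\<And>v. \<bar>pk i v\<bar> \<le> B" using pk_bounded by blast
  have [measurable]: "f \<in> borel_measurable borel" using assms(2) by (simp add: density1_def)
  show "integrable w (\<lambda>\<xi>. pk i (gmult (- x) \<xi>))"
    by (rule fin_borel_integrable[OF assms(1), of _ B]) (use B in auto)
  show "integrable w (\<lambda>\<xi>. pk i (gmult (- x) \<xi>) *\<^sub>R f \<xi>)"
  proof (rule fin_borel_integrable[OF assms(1), of _ B])
    fix \<xi> show "norm (pk i (gmult (- x) \<xi>) *\<^sub>R f \<xi>) \<le> B"
      using B[of "gmult (- x) \<xi>"] assms(2) mult_mono[of "\<bar>pk i (gmult (- x) \<xi>)\<bar>" B "norm (f \<xi>)" 1]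
      by (simp add: density1_def)
  qed measurable
qed

lemma density1_zero: "density1 (\<lambda>_. 0)"
  by (simp add: density1_def)

lemma dens_nonneg: "dens w i x \<ge> 0"
  unfolding dens_def by (intro integral_nonneg_AE AE_I2 pk_nonneg)

lemma dens_borel: assumes "fin_borel w" shows "dens w i \<in> borel_measurable borel"
proof -
  interpret finite_measure w using assms by (simp add: fin_borel_def)
  have [measurable_cong]: "sets w = sets borel" using assms by (simp add: fin_borel_def)
  show ?thesis unfolding dens_def by (rule borel_measurable_lebesgue_integral) measurable
qed

lemma flux_borel: assumes "fin_borel w" "density1 f" shows "flux w f i \<in> borel_measurable borel"
proof -
  interpret finite_measure w using assms by (simp add: fin_borel_def)
  have [measurable_cong]: "sets w = sets borel" using assms by (simp add: fin_borel_def)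
  have [measurable]: "f \<in> borel_measurable borel" using assms(2) by (simp add: density1_def)
  show ?thesis unfolding flux_def by (rule borel_measurable_lebesgue_integral) measurable
qed

lemma mdir_borel: assumes "fin_borel w" "density1 f" shows "mdir w f i \<in> borel_measurable borel"
  using flux_borel[OF assms, of i] dens_borel[OF assms(1), of i] unfolding mdir_def by measurable

lemma flux_le: assumes "fin_borel w" "density1 f" shows "norm (flux w f i x) \<le> dens w i x"
proof -
  have "norm (flux w f i x) \<le> (\<integral>\<xi>. norm (pk i (gmult (- x) \<xi>) *\<^sub>R f \<xi>) \<partial>w)"
    unfolding flux_def by (rule integral_norm_bound)
  also have "\<dots> \<le> dens w i x"
    unfolding dens_def
  proof (rule integral_mono)
    fix \<xi> show "norm (pk i (gmult (- x) \<xi>) *\<^sub>R f \<xi>) \<le> pk i (gmult (- x) \<xi>)"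
      using assms(2) pk_nonneg[of i] by (simp add: density1_def mult_left_le)
  qed (use pk_integrable[OF assms] in \<open>auto intro: integrable_norm simp del: norm_scaleR\<close>)
  finally show ?thesis .
qed

lemma mdir_le: assumes "fin_borel w" "density1 f" shows "norm (mdir w f i x) \<le> 1"
  using flux_le[OF assms, of i x] dens_nonneg[of w i x] unfolding mdir_def
  by (cases "dens w i x = 0") (auto simp: divide_le_eq_1 field_simps)

lemma flux_eq: assumes "fin_borel w" "density1 f" shows "flux w f i x = dens w i x *\<^sub>R mdir w f i x"
  using flux_le[OF assms, of i x] unfolding mdir_def by (cases "dens w i x = 0") auto

lemma dens_bounded: assumes "fin_borel w" shows "\<exists>B. \<forall>x. \<bar>dens w i x\<bar> \<le> B"
proof -
  interpret finite_measure w using assms by (simp add: fin_borel_def)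
  obtain B where B: "\<And>v. \<bar>pk i v\<bar> \<le> B" using pk_bounded by blast
  have "\<bar>dens w i x\<bar> \<le> measure w (space w) * B" for x
  proof -
    have "dens w i x \<le> (\<integral>\<xi>. B \<partial>w)"
      unfolding dens_def using B pk_integrable(1)[OF assms density1_zero]
      by (intro integral_mono) (auto simp: abs_le_iff)
    then show ?thesis using dens_nonneg[of w i x] by simp
  qed
  then show ?thesis by blast
qed

text \<open>The martingale property over one step: \<open>pk_step\<close> under the integral over
  \<open>w\<close>, with the order of integration exchanged.\<close>

lemma level_step:
  fixes f :: "real ^ 'n \<Rightarrow> 'b::{banach, second_countable_topology}"
  assumes w: "fin_borel w" and f: "f \<in> borel_measurable borel" "\<And>x. norm (f x) \<le> 1"
  shows "(\<integral>\<xi>. pk i (gmult (- x) \<xi>) *\<^sub>R f \<xi> \<partial>w) =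
    (\<integral>y. (\<integral>\<xi>. pk (Suc i) (gmult (- gmult x (dil (th ^ i) y)) \<xi>) *\<^sub>R f \<xi> \<partial>w) \<partial>Qm)"
proof -
  note f(1) [measurable]
  interpret w: finite_measure w using w by (simp add: fin_borel_def)
  have [measurable_cong]: "sets w = sets borel" using w by (simp add: fin_borel_def)
  interpret Q: prob_space Qm by (rule prob_space_Qm)
  interpret Qw: pair_sigma_finite Qm w ..
  obtain B where B: "\<And>v. \<bar>pk (Suc i) v\<bar> \<le> B" using pk_bounded by blast
  have B0: "B \<ge> 0" using B[of 0] by simp
  let ?G = "\<lambda>(y, \<xi>). pk (Suc i) (gmult (- gmult x (dil (th ^ i) y)) \<xi>) *\<^sub>R f \<xi>"
  have bd: "norm (?G p) \<le> B" for p
    using B[of "gmult (- gmult x (dil (th ^ i) (fst p))) (snd p)"] f(2)[of "snd p"] B0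
      mult_mono[of "\<bar>pk (Suc i) (gmult (- gmult x (dil (th ^ i) (fst p))) (snd p))\<bar>" B "norm (f (snd p))" 1]
    by (simp add: case_prod_beta)
  have G: "?G \<in> borel_measurable (Qm \<Otimes>\<^sub>M w)" by measurable
  have fin: "finite_measure (Qm \<Otimes>\<^sub>M w)"
    by (rule finite_measure_pair_measure) unfold_locales
  have "integrable (Qm \<Otimes>\<^sub>M w) ?G"
    by (rule finite_measure.integrable_const_bound[OF fin, of _ B]) (use bd G in auto)
  from Qw.Fubini_integral[OF this]
  have "(\<integral>y. (\<integral>\<xi>. pk (Suc i) (gmult (- gmult x (dil (th ^ i) y)) \<xi>) *\<^sub>R f \<xi> \<partial>w) \<partial>Qm) =
      (\<integral>\<xi>. (\<integral>y. pk (Suc i) (gmult (- gmult x (dil (th ^ i) y)) \<xi>) *\<^sub>R f \<xi> \<partial>Qm) \<partial>w)" by simp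
  moreover have "(\<integral>y. pk (Suc i) (gmult (- gmult x (dil (th ^ i) y)) \<xi>) *\<^sub>R f \<xi> \<partial>Qm) = pk i (gmult (- x) \<xi>) *\<^sub>R f \<xi>" for \<xi>
  proof -
    have "(\<integral>y. pk (Suc i) (gmult (- gmult x (dil (th ^ i) y)) \<xi>) *\<^sub>R f \<xi> \<partial>Qm) =
        (\<integral>y. pk (Suc i) (gmult (- gmult x (dil (th ^ i) y)) \<xi>) \<partial>Qm) *\<^sub>R f \<xi>"
    proof (rule integral_scaleR_left)
      show "integrable Qm (\<lambda>y. pk (Suc i) (gmult (- gmult x (dil (th ^ i) y)) \<xi>))"
        by (rule Q.integrable_const_bound[of _ B]) (use B in auto)
    qed
    also have "(\<integral>y. pk (Suc i) (gmult (- gmult x (dil (th ^ i) y)) \<xi>) \<partial>Qm) = pk i (gmult (- x) \<xi>)"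
      by (subst integral_Qm) (simp_all add: neg_gmult assoc pk_step[of i "gmult (- x) \<xi>"])
    finally show ?thesis .
  qed
  ultimately show ?thesis by (simp only:)
qed

lemma dens_av: assumes w: "fin_borel w" shows "dens w i x = av i n (dens w (i + n)) x"
proof (induction n arbitrary: i x)
  case 0
  then show ?case by (simp add: av_0 dens_borel[OF w])
next
  case (Suc n)
  obtain B where B: "\<And>x. \<bar>dens w (Suc i) x\<bar> \<le> B" using dens_bounded[OF w] by blast
  obtain B' where B': "\<And>x. \<bar>dens w (i + Suc n) x\<bar> \<le> B'" using dens_bounded[OF w] by blast
  have "dens w i x = (\<integral>y. dens w (Suc i) (gmult x (dil (th ^ i) y)) \<partial>Qm)"
    unfolding dens_def using level_step[OF w, of "\<lambda>_. 1 :: real" i x] by simp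
  also have "\<dots> = av i 1 (dens w (Suc i)) x"
    by (rule av_1[symmetric, OF dens_borel[OF w], of _ B]) (use B in simp)
  also have "dens w (Suc i) = av (Suc i) n (dens w (i + Suc n))"
    by (rule ext) (use Suc[of "Suc i"] in \<open>simp only: add_Suc_right add_Suc\<close>)
  also have "av i 1 (av (Suc i) n (dens w (i + Suc n))) x = av i (Suc n) (dens w (i + Suc n)) x"
    by (rule av_Suc[symmetric, OF dens_borel[OF w], of _ B']) (use B' in simp)
  finally show ?case .
qed

lemma flux_av: assumes w: "fin_borel w" and f: "density1 f" shows "flux w f i x = av i n (flux w f (i + n)) x"
proof (induction n arbitrary: i x)
  case 0
  then show ?case by (simp add: av_0 flux_borel[OF w f])
next
  case (Suc n)
  obtain B where B: "\<And>x. \<bar>dens w (Suc i) x\<bar> \<le> B" using dens_bounded[OF w] by blast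
  obtain B' where B': "\<And>x. \<bar>dens w (i + Suc n) x\<bar> \<le> B'" using dens_bounded[OF w] by blast
  have NB: "norm (flux w f (Suc i) x) \<le> B" "norm (flux w f (i + Suc n) x) \<le> B'" for x
    using flux_le[OF w f, of "Suc i" x] flux_le[OF w f, of "i + Suc n" x] B[of x] B'[of x] by linarith+
  have "flux w f i x = (\<integral>y. flux w f (Suc i) (gmult x (dil (th ^ i) y)) \<partial>Qm)"
    unfolding flux_def using level_step[OF w, of f i x] f by (simp add: density1_def)
  also have "\<dots> = av i 1 (flux w f (Suc i)) x"
    by (rule av_1[symmetric, OF flux_borel[OF w f] NB(1)])
  also have "flux w f (Suc i) = av (Suc i) n (flux w f (i + Suc n))"
    by (rule ext) (use Suc[of "Suc i"] in \<open>simp only: add_Suc_right add_Suc\<close>)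
  also have "av i 1 (av (Suc i) n (flux w f (i + Suc n))) x = av i (Suc n) (flux w f (i + Suc n)) x"
    by (rule av_Suc[symmetric, OF flux_borel[OF w f] NB(2)])
  finally show ?case .
qed

lemma pk_integral: "integrable lborel (pk i)" "(\<integral>v. pk i v \<partial>lborel) = 1"
proof -
  have "distr lborel borel (dil (1 / th ^ i)) = density lborel (\<lambda>_. ennreal (J th ^ i))"
    using distr_dil[of "th ^ i"] th_pow by (simp add: power_one_over)
  moreover have "integrable (density lborel (\<lambda>_. ennreal (J th ^ i))) pp"
    using th_pow(3)[of i] pp_integrable by (subst integrable_density) auto
  ultimately have "integrable (distr lborel borel (dil (1 / th ^ i))) pp" by simp
  then have "integrable lborel (\<lambda>v. pp (dil (1 / th ^ i) v))"
    by (rule integrable_distr[rotated]) measurable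
  then show "integrable lborel (pk i)" unfolding pk_def by simp
  have Ji: "J (1 / th ^ i) = 1 / J th ^ i"
  proof -
    have "J (1 / th ^ i) * J (th ^ i) = 1" using J_mult[of "1 / th ^ i" "th ^ i"] th_bounds(4) by simp
    then show ?thesis using less_imp_neq[OF th_pow(3)[of i]] by (metis J_power eq_divide_imp)
  qed
  show "(\<integral>v. pk i v \<partial>lborel) = 1"
    unfolding pk_def using integral_dil[of pp "1 / th ^ i"] th_bounds(4) J_pos[OF th_bounds(4)] by (simp add: Ji integral_pp)
qed

lemma dens_integral: assumes w: "fin_borel w"
  shows "integrable lborel (dens w i)" "(\<integral>x. dens w i x \<partial>lborel) = measure w UNIV"
proof -
  interpret w: finite_measure w using w by (simp add: fin_borel_def)
  have [measurable_cong]: "sets w = sets borel" using w by (simp add: fin_borel_def)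
  have sp: "space w = UNIV" using w sets_eq_imp_space_eq[of w borel] by (simp add: fin_borel_def)
  interpret wL: pair_sigma_finite w "lborel :: (real ^ 'n) measure" ..
  have fib: "(\<integral>x. pk i (gmult (- x) \<xi>) \<partial>lborel) = 1" for \<xi>
  proof -
    have "(\<integral>x. pk i (gmult (- x) \<xi>) \<partial>lborel) = (\<integral>x. pk i (gmult x \<xi>) \<partial>lborel)"
      by (rule integral_neg) measurable
    also have "\<dots> = (\<integral>x. pk i x \<partial>lborel)" by (rule integral_right_shift) measurable
    finally show ?thesis by (simp add: pk_integral)
  qed
  have "integrable (w \<Otimes>\<^sub>M lborel) (\<lambda>(\<xi>, x). pk i (gmult (- x) \<xi>))"
  proof (rule wL.Fubini_integrable)
    show "(\<lambda>(\<xi>, x). pk i (gmult (- x) \<xi>)) \<in> borel_measurable (w \<Otimes>\<^sub>M lborel)" by measurable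
    show "integrable w (\<lambda>\<xi>. \<integral>x. norm (case (\<xi>, x) of (\<xi>, x) \<Rightarrow> pk i (gmult (- x) \<xi>)) \<partial>lborel)"
      by (simp add: pk_nonneg fib)
    show "AE \<xi> in w. integrable lborel (\<lambda>x. case (\<xi>, x) of (\<xi>, x) \<Rightarrow> pk i (gmult (- x) \<xi>))"
      using fib not_integrable_integral_eq by (auto intro!: AE_I2) fastforce
  qed
  note * = wL.integrable_snd[OF this] wL.Fubini_integral[OF this]
  show "integrable lborel (dens w i)" using *(1) by (simp add: dens_def[abs_def])
  show "(\<integral>x. dens w i x \<partial>lborel) = measure w UNIV"
    using *(2) by (simp add: dens_def fib sp)
qed

text \<open>The growth of \<open>energy_dens\<close> from one level to a finer one is the conditional variance \<open>gap\<close>.\<close>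

definition energy_dens :: "(real ^ 'n) measure \<Rightarrow> (real ^ 'n \<Rightarrow> real ^ 'n) \<Rightarrow> nat \<Rightarrow> real ^ 'n \<Rightarrow> real" where
  "energy_dens w f i x = dens w i x * (norm (mdir w f i x))\<^sup>2"

definition gap :: "(real ^ 'n) measure \<Rightarrow> (real ^ 'n \<Rightarrow> real ^ 'n) \<Rightarrow> nat \<Rightarrow> nat \<Rightarrow> real ^ 'n \<Rightarrow> real" where
  "gap w f i n x = av i n (\<lambda>y. dens w (i + n) y * (norm (mdir w f (i + n) y - mdir w f i x))\<^sup>2) x"

lemma energy_dens_bounds: assumes "fin_borel w" "density1 f" shows "0 \<le> energy_dens w f i x" "energy_dens w f i x \<le> dens w i x"
proof -
  have "(norm (mdir w f i x))\<^sup>2 \<le> 1\<^sup>2" by (intro power_mono mdir_le assms) simp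
  then show "0 \<le> energy_dens w f i x" "energy_dens w f i x \<le> dens w i x"
    using dens_nonneg[of w i x] by (auto simp: energy_dens_def mult_left_le)
qed

lemma energy_dens_borel: assumes "fin_borel w" "density1 f" shows "energy_dens w f i \<in> borel_measurable borel"
  using mdir_borel[OF assms, of i] dens_borel[OF assms(1), of i] unfolding energy_dens_def by measurable

lemma energy_dens_integrable: assumes "fin_borel w" "density1 f" shows "integrable lborel (energy_dens w f i)"
  by (rule Bochner_Integration.integrable_bound[OF dens_integral(1)[OF assms(1), of i]])
    (use energy_dens_borel[OF assms] energy_dens_bounds[OF assms] in \<open>auto intro!: AE_I2 order_trans[OF energy_dens_bounds(2)[OF assms]]\<close>)

lemma gap_integrand:
  assumes w: "fin_borel w" and f: "density1 f" and c: "norm c \<le> 1"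
  shows "(\<lambda>y. dens w i y * (norm (mdir w f i y - c))\<^sup>2) \<in> borel_measurable borel"
    and "\<exists>B. \<forall>y. \<bar>dens w i y * (norm (mdir w f i y - c))\<^sup>2\<bar> \<le> B"
proof -
  show "(\<lambda>y. dens w i y * (norm (mdir w f i y - c))\<^sup>2) \<in> borel_measurable borel"
    using mdir_borel[OF w f, of i] dens_borel[OF w, of i] by measurable
  obtain B where B: "\<And>x. \<bar>dens w i x\<bar> \<le> B" using dens_bounded[OF w] by blast
  have "\<bar>dens w i y * (norm (mdir w f i y - c))\<^sup>2\<bar> \<le> B * 2\<^sup>2" for y
  proof -
    have "norm (mdir w f i y - c) \<le> 2" using norm_triangle_ineq4[of "mdir w f i y" c] mdir_le[OF w f, of i y] c by simp
    then have "(norm (mdir w f i y - c))\<^sup>2 \<le> 2\<^sup>2" by (intro power_mono) auto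
    then show ?thesis using B[of y] by (simp add: abs_mult mult_mono)
  qed
  then show "\<exists>B. \<forall>y. \<bar>dens w i y * (norm (mdir w f i y - c))\<^sup>2\<bar> \<le> B" by blast
qed

text \<open>A variance is the mean of the square minus the square of the mean: by
  \<open>dens_av\<close> and \<open>flux_av\<close>, \<open>mdir w f i x\<close> is the mean of the
  finer directions weighted with their densities.\<close>

lemma gap_eq: assumes w: "fin_borel w" and f: "density1 f"
  shows "gap w f i n x = av i n (energy_dens w f (i + n)) x - energy_dens w f i x"
proof -
  let ?c = "mdir w f i x" and ?g = "\<lambda>z. gmult x (dil (th ^ i) z)"
  obtain B where B: "\<And>x. \<bar>dens w (i + n) x\<bar> \<le> B" using dens_bounded[OF w] by blast
  have NB: "norm (flux w f (i + n) x) \<le> B" for x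
    using flux_le[OF w f, of "i + n" x] B[of x] by linarith
  have SB: "norm (energy_dens w f (i + n) x) \<le> B" for x
    using energy_dens_bounds[OF w f, of "i + n" x] B[of x] by simp
  have iu: "integrable (Pn n) (\<lambda>z. dens w (i + n) (?g z))"
    by (rule av_integrable[OF dens_borel[OF w], of _ B]) (use B in simp)
  have iN: "integrable (Pn n) (\<lambda>z. flux w f (i + n) (?g z))"
    by (rule av_integrable[OF flux_borel[OF w f] NB])
  have iS: "integrable (Pn n) (\<lambda>z. energy_dens w f (i + n) (?g z))"
    by (rule av_integrable[OF energy_dens_borel[OF w f] SB])
  have pt: "dens w (i + n) y * (norm (mdir w f (i + n) y - ?c))\<^sup>2 =
      energy_dens w f (i + n) y - 2 * (flux w f (i + n) y \<bullet> ?c) + dens w (i + n) y * (norm ?c)\<^sup>2" for y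
    by (simp add: energy_dens_def flux_eq[OF w f, of "i + n" y] power2_norm_eq_inner inner_diff_left inner_diff_right
      inner_commute algebra_simps)
  have "gap w f i n x = (\<integral>z. energy_dens w f (i + n) (?g z) - 2 * (flux w f (i + n) (?g z) \<bullet> ?c) + dens w (i + n) (?g z) * (norm ?c)\<^sup>2 \<partial>Pn n)"
    unfolding gap_def av_def pt ..
  also have "\<dots> = (\<integral>z. energy_dens w f (i + n) (?g z) \<partial>Pn n) - 2 * ((\<integral>z. flux w f (i + n) (?g z) \<partial>Pn n) \<bullet> ?c)
      + (\<integral>z. dens w (i + n) (?g z) \<partial>Pn n) * (norm ?c)\<^sup>2"
    using iu iN iS by simp
  also have "\<dots> = av i n (energy_dens w f (i + n)) x - 2 * (flux w f i x \<bullet> ?c) + dens w i x * (norm ?c)\<^sup>2"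
    using dens_av[OF w, of i x n] flux_av[OF w f, of i x n] by (simp add: av_def)
  also have "\<dots> = av i n (energy_dens w f (i + n)) x - energy_dens w f i x"
    by (simp add: flux_eq[OF w f, of i x] energy_dens_def power2_norm_eq_inner)
  finally show ?thesis .
qed

lemma gap_nonneg: "gap w f i n x \<ge> 0"
  unfolding gap_def by (intro av_nonneg mult_nonneg_nonneg dens_nonneg) simp

lemma gap_le: assumes w: "fin_borel w" and f: "density1 f" shows "gap w f i n x \<le> dens w i x"
proof -
  obtain B where B: "\<And>x. \<bar>dens w (i + n) x\<bar> \<le> B" using dens_bounded[OF w] by blast
  have SB: "\<bar>energy_dens w f (i + n) x\<bar> \<le> B" for x
    using energy_dens_bounds[OF w f, of "i + n" x] B[of x] by simp
  have "av i n (energy_dens w f (i + n)) x \<le> av i n (dens w (i + n)) x"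
    by (rule av_mono[OF energy_dens_borel[OF w f] dens_borel[OF w] SB B energy_dens_bounds(2)[OF w f]])
  then show ?thesis
    using gap_eq[OF w f, of i n x] dens_av[OF w, of i x n] energy_dens_bounds(1)[OF w f, of i x] by simp
qed

definition energy :: "(real ^ 'n) measure \<Rightarrow> (real ^ 'n \<Rightarrow> real ^ 'n) \<Rightarrow> nat \<Rightarrow> real" where
  "energy w f i = (\<integral>x. energy_dens w f i x \<partial>lborel)"

lemma gap_integral: assumes w: "fin_borel w" and f: "density1 f"
  shows "integrable lborel (gap w f i n)" "(\<integral>x. gap w f i n x \<partial>lborel) = energy w f (i + n) - energy w f i"
proof -
  have e: "gap w f i n = (\<lambda>x. av i n (energy_dens w f (i + n)) x - energy_dens w f i x)" using gap_eq[OF w f] by auto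
  note a = integral_av[OF energy_dens_integrable[OF w f, of "i + n"], of i n]
  show "integrable lborel (gap w f i n)" unfolding e using a(1) energy_dens_integrable[OF w f] by simp
  show "(\<integral>x. gap w f i n x \<partial>lborel) = energy w f (i + n) - energy w f i"
    unfolding e energy_def using a energy_dens_integrable[OF w f, of i] by simp
qed

lemma energy_mono: assumes "fin_borel w" "density1 f" shows "energy w f i \<le> energy w f (i + n)"
proof -
  have "0 \<le> (\<integral>x. gap w f i n x \<partial>lborel)" by (intro integral_nonneg_AE AE_I2 gap_nonneg)
  then show ?thesis using gap_integral(2)[OF assms, of i n] by simp
qed

lemma energy_bounds: assumes "fin_borel w" "density1 f" shows "0 \<le> energy w f i" "energy w f i \<le> measure w UNIV"
proof -
  show "0 \<le> energy w f i" unfolding energy_def by (intro integral_nonneg_AE AE_I2 energy_dens_bounds assms)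
  have "energy w f i \<le> (\<integral>x. dens w i x \<partial>lborel)"
    unfolding energy_def by (intro integral_mono energy_dens_integrable dens_integral energy_dens_bounds assms)
  then show "energy w f i \<le> measure w UNIV" using dens_integral(2)[OF assms(1)] by simp
qed

end

subsection \<open>Multiscale expansion of a test function\<close>

lemma LIMSEQ_I_bound:
  fixes a :: "nat \<Rightarrow> real"
  assumes "(\<lambda>n. b n) \<longlonglongrightarrow> 0" "\<And>n. \<bar>a n - c\<bar> \<le> b n" shows "a \<longlonglongrightarrow> c"
proof -
  have "(\<lambda>n. a n - c) \<longlonglongrightarrow> 0"
    by (rule Lim_null_comparison[OF _ assms(1)]) (simp add: assms(2))
  then show ?thesis by (simp add: LIM_zero_iff)
qed

context carnot
begin

text \<open>A Lipschitz bound for \<open>g\<close> composed with the product is available on bounded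
  sets only, but for \<open>\<zeta>\<close> far out both values of \<open>g\<close> vanish, so the
  constant is uniform in \<open>\<zeta>\<close>.\<close>

lemma test_lipschitz_dil:
  assumes g: "g \<in> test_functions"
  shows "\<exists>C\<ge>0. \<forall>\<zeta> v t. norm v \<le> 2 \<longrightarrow> 0 \<le> t \<longrightarrow> t \<le> 1 \<longrightarrow> \<bar>g (gmult \<zeta> (- dil t v)) - g \<zeta>\<bar> \<le> C * t"
proof -
  obtain C where C: "C \<ge> 1" "\<And>t x. 0 \<le> t \<Longrightarrow> t \<le> 1 \<Longrightarrow> norm (dil t x) \<le> C * t * norm x"
    using norm_dil_le by blast
  obtain R where R: "smooth g" "\<And>x. norm x > R \<Longrightarrow> g x = 0" using g by (auto simp: test_functions_iff)
  obtain R0 where R0: "\<And>v z. norm v \<le> R \<Longrightarrow> norm z \<le> 2 * C \<Longrightarrow> norm (gmult v z) \<le> R0"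
    using gmult_bounded by metis
  define S where "S = \<bar>R\<bar> + \<bar>R0\<bar> + 2 * C"
  obtain L where L: "L \<ge> 0" "\<And>p p'. p \<in> cball 0 S \<Longrightarrow> p' \<in> cball 0 S \<Longrightarrow>
      norm (g (gmult (fst p) (snd p)) - g (gmult (fst p') (snd p'))) \<le> L * norm (p - p')"
    using smooth_lipschitz_on_ball[OF smooth_compose[OF R(1) smooth_gmult[OF smooth_fst smooth_snd]], of S] by blast
  have "\<bar>g (gmult \<zeta> (- dil t v)) - g \<zeta>\<bar> \<le> (L * (2 * C)) * t"
    if v: "norm v \<le> 2" and t: "0 \<le> t" "t \<le> 1" for \<zeta> v t
  proof -
    have "C * t * norm v \<le> C * t * 2" using v t C(1) by (intro mult_left_mono) auto
    then have d: "norm (dil t v) \<le> 2 * C * t" using C(2)[OF t, of v] by simp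
    also have "2 * C * t \<le> 2 * C * 1" using t C(1) by (intro mult_left_mono) auto
    finally have d2: "norm (dil t v) \<le> 2 * C" by simp
    show ?thesis
    proof (cases "norm \<zeta> \<le> \<bar>R\<bar> + \<bar>R0\<bar>")
      case True
      have "(\<zeta>, - dil t v) \<in> cball 0 S" "(\<zeta>, 0 :: real ^ 'n) \<in> cball 0 S"
        using norm_Pair_le[of \<zeta> "- dil t v"] norm_Pair_le[of \<zeta> "0 :: real ^ 'n"] True d2 C(1)
        unfolding mem_cball_0 by (simp_all add: S_def)
      then have "\<bar>g (gmult \<zeta> (- dil t v)) - g \<zeta>\<bar> \<le> L * norm (dil t v)"
        using L(2)[of "(\<zeta>, - dil t v)" "(\<zeta>, 0)"] by (simp add: norm_Pair)
      also have "\<dots> \<le> L * (2 * C * t)" using d L(1) by (rule mult_left_mono)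
      finally show ?thesis by simp
    next
      case False
      then have z: "g \<zeta> = 0" using R(2)[of \<zeta>] by simp
      have "g (gmult \<zeta> (- dil t v)) = 0"
      proof (rule ccontr)
        assume "g (gmult \<zeta> (- dil t v)) \<noteq> 0"
        then have "norm (gmult \<zeta> (- dil t v)) \<le> R" using R(2) not_le by blast
        then have "norm (gmult (gmult \<zeta> (- dil t v)) (dil t v)) \<le> R0" using R0 d2 by blast
        then show False using False by simp
      qed
      then show ?thesis using z L(1) C(1) t by simp
    qed
  qed
  then show ?thesis using L(1) C(1) by (intro exI[of _ "L * (2 * C)"]) auto
qed

text \<open>The density at scale \<open>l\<close> of the vector measure \<open>(f - e) w\<close>, by
  \<open>offset_eq\<close>; hence it inherits the averaging property from scale to scale.\<close>

definition offset :: "(real ^ 'n) measure \<Rightarrow> (real ^ 'n \<Rightarrow> real ^ 'n) \<Rightarrow> real ^ 'n \<Rightarrow> nat \<Rightarrow> real ^ 'n \<Rightarrow> real ^ 'n" where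
  "offset w f e l v = dens w l v *\<^sub>R (mdir w f l v - e)"

lemma offset_eq: assumes "fin_borel w" "density1 f" shows "offset w f e l v = (\<integral>\<xi>. pk l (gmult (- v) \<xi>) *\<^sub>R (f \<xi> - e) \<partial>w)"
proof -
  have "(\<integral>\<xi>. pk l (gmult (- v) \<xi>) *\<^sub>R (f \<xi> - e) \<partial>w) = flux w f l v - dens w l v *\<^sub>R e"
    unfolding flux_def dens_def using pk_integrable[OF assms] by (simp add: scaleR_diff_right)
  then show ?thesis by (simp add: offset_def flux_eq[OF assms] scaleR_diff_right)
qed

lemma offset_borel: assumes "fin_borel w" "density1 f" shows "offset w f e l \<in> borel_measurable borel"
  using mdir_borel[OF assms, of l] dens_borel[OF assms(1), of l] unfolding offset_def by measurable

lemma offset_le: assumes "fin_borel w" "density1 f" "norm e \<le> 1" shows "norm (offset w f e l v) \<le> 2 * dens w l v"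
proof -
  have "norm (mdir w f l v - e) \<le> 2"
    using norm_triangle_ineq4[of "mdir w f l v" e] mdir_le[OF assms(1,2), of l v] assms(3) by simp
  then have "dens w l v * norm (mdir w f l v - e) \<le> dens w l v * 2" by (intro mult_left_mono dens_nonneg)
  then show ?thesis using dens_nonneg[of w l v] by (simp add: offset_def)
qed

lemma offset_bounded: assumes "fin_borel w" "density1 f" "norm e \<le> 1" shows "\<exists>B. \<forall>v. norm (offset w f e l v) \<le> B"
proof -
  obtain B where B: "\<And>x. \<bar>dens w l x\<bar> \<le> B" using dens_bounded[OF assms(1)] by blast
  have "norm (offset w f e l v) \<le> 2 * B" for v using offset_le[OF assms, of l v] B[of v] by linarith
  then show ?thesis by blast
qed

lemma offset_av: assumes w: "fin_borel w" and f: "density1 f" and e: "norm e \<le> 1"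
  shows "offset w f e l v = (\<integral>y. offset w f e (Suc l) (gmult v (dil (th ^ l) y)) \<partial>Qm)"
proof -
  obtain B where B: "\<And>x. \<bar>dens w (Suc l) x\<bar> \<le> B" using dens_bounded[OF w] by blast
  have NB: "norm (flux w f (Suc l) x) \<le> B" for x
    using flux_le[OF w f, of "Suc l" x] B[of x] by linarith
  have eq: "offset w f e k v = flux w f k v - dens w k v *\<^sub>R e" for k v
    by (simp add: offset_def flux_eq[OF w f] scaleR_diff_right)
  interpret Q: prob_space Qm by (rule prob_space_Qm)
  note [measurable] = dens_borel[OF w] flux_borel[OF w f]
  have "integrable Qm (\<lambda>y. dens w (Suc l) (gmult v (dil (th ^ l) y)))"
    by (rule Q.integrable_const_bound[of _ B]) (use B in auto)
  moreover have "integrable Qm (\<lambda>y. flux w f (Suc l) (gmult v (dil (th ^ l) y)))"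
    by (rule Q.integrable_const_bound[of _ B]) (use NB in auto)
  ultimately show ?thesis
    unfolding eq
    using dens_av[OF w, of l v 1] flux_av[OF w f, of l v 1]
      av_1[OF dens_borel[OF w] B[folded real_norm_def], of l v] av_1[OF flux_borel[OF w f] NB, of l v] by simp
qed

lemma fubini_test:
  fixes F :: "'c::euclidean_space \<Rightarrow> real ^ 'n \<Rightarrow> 'b::{banach, second_countable_topology}"
  assumes P: "finite_measure P" "sets P = sets borel"
    and g [measurable]: "g \<in> borel_measurable borel" and K: "\<And>z. norm z > R \<Longrightarrow> g z = 0"
    and F [measurable]: "(\<lambda>(z, Y). F z Y) \<in> borel_measurable (borel \<Otimes>\<^sub>M borel)"
    and B: "\<And>z Y. norm (g z *\<^sub>R F z Y) \<le> B"
  shows "(\<integral>z. (\<integral>Y. g z *\<^sub>R F z Y \<partial>P) \<partial>lborel) = (\<integral>Y. (\<integral>z. g z *\<^sub>R F z Y \<partial>lborel) \<partial>P)"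
proof -
  interpret P: finite_measure P by (rule P(1))
  note P(2) [measurable_cong]
  interpret LP: pair_sigma_finite "lborel :: 'c measure" P ..
  have ic: "integrable lborel (\<lambda>v :: 'c. indicator (cball 0 R) v * c :: real)" for c
    by (intro integrable_mult_left integrable_real_indicator)
      (auto intro: emeasure_bounded_finite[unfolded infinity_ennreal_def])
  have G: "(\<lambda>(z, Y). g z *\<^sub>R F z Y) \<in> borel_measurable (lborel \<Otimes>\<^sub>M P)" by measurable
  have bd: "norm (g z *\<^sub>R F z Y) \<le> indicator (cball 0 R) z * B" for z Y
    using B[of z Y] K[of z] by (cases "norm z \<le> R") auto
  have intP: "integrable P (\<lambda>Y. g z *\<^sub>R F z Y)" for z
    by (rule P.integrable_const_bound[of _ B]) (use B in auto)
  have "integrable (lborel \<Otimes>\<^sub>M P) (\<lambda>(z, Y). g z *\<^sub>R F z Y)"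
  proof (rule LP.Fubini_integrable[OF G])
    show "AE z in lborel. integrable P (\<lambda>Y. case (z, Y) of (z, Y) \<Rightarrow> g z *\<^sub>R F z Y)"
      using intP by simp
    show "integrable lborel (\<lambda>z. \<integral>Y. norm (case (z, Y) of (z, Y) \<Rightarrow> g z *\<^sub>R F z Y) \<partial>P)"
    proof (rule Bochner_Integration.integrable_bound[OF ic[of "B * measure P (space P)"]])
      have "(\<lambda>(z, Y). norm (g z *\<^sub>R F z Y)) \<in> borel_measurable (lborel \<Otimes>\<^sub>M P)" by measurable
      then show "(\<lambda>z. \<integral>Y. norm (case (z, Y) of (z, Y) \<Rightarrow> g z *\<^sub>R F z Y) \<partial>P) \<in> borel_measurable lborel"
        using P.borel_measurable_lebesgue_integral[of "\<lambda>z Y. norm (g z *\<^sub>R F z Y)" lborel] by simp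
      show "AE z in lborel. norm (\<integral>Y. norm (case (z, Y) of (z, Y) \<Rightarrow> g z *\<^sub>R F z Y) \<partial>P)
          \<le> norm (indicator (cball 0 R) z * (B * measure P (space P)) :: real)"
      proof (rule AE_I2)
        fix z :: 'c
        have "(\<integral>Y. norm (g z *\<^sub>R F z Y) \<partial>P) \<le> (\<integral>Y. indicator (cball 0 R) z * B \<partial>P)"
          using intP[of z] bd by (intro integral_mono integrable_norm) auto
        moreover have "0 \<le> (\<integral>Y. norm (g z *\<^sub>R F z Y) \<partial>P)" by (intro integral_nonneg_AE) simp
        ultimately show "norm (\<integral>Y. norm (case (z, Y) of (z, Y) \<Rightarrow> g z *\<^sub>R F z Y) \<partial>P)
          \<le> norm (indicator (cball 0 R) z * (B * measure P (space P)) :: real)"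
          by (simp add: mult_ac)
      qed
    qed
  qed
  from LP.Fubini_integral[OF this] show ?thesis by simp
qed

text \<open>The integral of \<open>g\<close> against \<open>(f - e) w\<close> is the limit of its
  integrals against the densities \<open>offset\<close>. By \<open>offset_av\<close>, passing from
  scale \<open>l\<close> to \<open>l + 1\<close> moves the argument of \<open>g\<close> by a
  distance of order \<open>th ^ l\<close>, so the Lipschitz bound turns each increment into a
  geometrically weighted term of the sum.\<close>

lemma multiscale:
  assumes g: "g \<in> test_on (dil (th ^ 2) ` cball 0 2)"
  shows "\<exists>C\<ge>0. \<forall>w f e x s. fin_borel w \<longrightarrow> density1 f \<longrightarrow> norm e \<le> 1 \<longrightarrow> norm s \<le> 1 \<longrightarrow>
    summable (\<lambda>n. th ^ n * (\<integral>z. indicator (dil th ` cball 0 3) z * norm (offset w f e (n + 2) (gmult x z)) \<partial>lborel)) \<longrightarrow>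
    norm (\<integral>\<xi>. g (gmult (- gmult x (dil th s)) \<xi>) *\<^sub>R (f \<xi> - e) \<partial>w) \<le>
      C * (\<Sum>n. th ^ n * (\<integral>z. indicator (dil th ` cball 0 3) z * norm (offset w f e (n + 2) (gmult x z)) \<partial>lborel))"
proof -
  have gt: "g \<in> test_functions" by (rule test_onD[OF g])
  obtain C0 where C0: "C0 \<ge> 0" "\<And>\<zeta> v t. norm v \<le> 2 \<Longrightarrow> 0 \<le> t \<Longrightarrow> t \<le> 1 \<Longrightarrow> \<bar>g (gmult \<zeta> (- dil t v)) - g \<zeta>\<bar> \<le> C0 * t"
    using test_lipschitz_dil[OF gt] by blast
  obtain Bg where Bg: "\<And>x. \<bar>g x\<bar> \<le> Bg" using test_bounded[OF gt] by blast
  obtain R where R: "\<And>x. norm x > R \<Longrightarrow> g x = 0" using gt by (auto simp: test_functions_iff)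
  have Bg0: "Bg \<ge> 0" using Bg[of 0] by simp
  have gm [measurable]: "g \<in> borel_measurable borel"
    by (intro borel_measurable_continuous_onI smooth_continuous_on test_smooth[OF gt])
  let ?B = "dil th ` cball 0 3"
  have Bc: "compact ?B"
    by (intro compact_continuous_image linear_continuous_on bounded_linear_dil compact_cball)
  have Bm [measurable]: "?B \<in> sets borel" using Bc by (simp add: borel_compact)
  have iB: "integrable lborel (\<lambda>z. indicator ?B z * c)" for c :: real
    by (intro integrable_mult_left integrable_real_indicator)
      (use Bc Bm in \<open>auto intro: emeasure_bounded_finite[unfolded infinity_ennreal_def] compact_imp_bounded\<close>)
  define C where "C = Bg + C0"
  show ?thesis
  proof (intro exI[of _ C] conjI allI impI)
    fix w f and e x s :: "real ^ 'n"
    assume w: "fin_borel w" and f: "density1 f" and e: "norm e \<le> 1" and s: "norm s \<le> 1"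
    let ?I = "\<lambda>n. \<integral>z. indicator ?B z * norm (offset w f e (n + 2) (gmult x z)) \<partial>lborel"
    assume sum: "summable (\<lambda>n. th ^ n * ?I n)"
    define y where "y = gmult x (dil th s)"
    interpret w: finite_measure w using w by (simp add: fin_borel_def)
    have sw [measurable_cong]: "sets w = sets borel" using w by (simp add: fin_borel_def)
    interpret Q: prob_space Qm by (rule prob_space_Qm)
    note AAm [measurable] = offset_borel[OF w f]
    have fm [measurable]: "f \<in> borel_measurable borel" using f by (simp add: density1_def)
    have fe: "norm (f \<xi> - e) \<le> 2" for \<xi>
    proof -
      have "norm (f \<xi>) \<le> 1" using f by (simp add: density1_def)
      then show ?thesis using norm_triangle_ineq4[of "f \<xi>" e] e by simp
    qed
    define G where "G = (\<lambda>l. \<integral>z. g z *\<^sub>R offset w f e l (gmult y z) \<partial>lborel)"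
    \<comment> \<open>Even after a shift at scale \<open>k + 2\<close> the support of
      \<open>g\<close> remains in one fixed ball around \<open>x\<close>. This is where the support
      condition on \<open>g\<close> and \<open>th_local\<close> enter.\<close>
    have loc: "gmult (dil th s) z \<in> ?B"
      if "g (gmult z (- dil (th ^ Suc (Suc k)) v)) \<noteq> 0" "norm v \<le> 1" for z v k
    proof -
      have "gmult z (- dil (th ^ Suc (Suc k)) v) \<in> dil (th ^ 2) ` cball 0 2"
        using g that(1) unfolding test_on_def by blast
      then obtain z' where z': "norm z' \<le> 2" "gmult z (- dil (th ^ Suc (Suc k)) v) = dil (th ^ 2) z'"
        by auto
      have "z = gmult (dil (th ^ 2) z') (dil (th ^ Suc (Suc k)) v)" using z'(2)[symmetric] by simp
      also have "\<dots> = dil th (dil th (gmult z' (dil (th ^ k) v)))"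
        by (simp add: gmult_dil[symmetric] power2_eq_square mult_ac)
      finally have "gmult (dil th s) z = dil th (gmult s (dil th (gmult z' (dil (th ^ k) v))))"
        by (simp add: gmult_dil[symmetric])
      moreover have "norm (gmult s (dil th (gmult z' (dil (th ^ k) v)))) \<le> 3"
        using s z'(1) that(2) th_bounds by (intro th_local) (auto simp: power_le_one)
      ultimately show ?thesis by auto
    qed
    have loc0: "gmult (dil th s) z \<in> ?B" if "g z \<noteq> 0" for z
      using loc[of z 0 0] that by simp
    have shift: "(\<integral>z. indicator ?B (gmult (dil th s) z) * norm (offset w f e l (gmult y z)) \<partial>lborel) =
        (\<integral>z. indicator ?B z * norm (offset w f e l (gmult x z)) \<partial>lborel)" for l
      using integral_left_shift[of "\<lambda>z. indicator ?B z * norm (offset w f e l (gmult x z))" "dil th s"]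
      by (simp add: y_def assoc)
    have ishift: "integrable lborel (\<lambda>z. indicator ?B (gmult (dil th s) z) * norm (offset w f e l (gmult y z)))" for l
    proof -
      obtain B where B: "\<And>v. norm (offset w f e l v) \<le> B" using offset_bounded[OF w f e] by blast
      have "integrable lborel (\<lambda>z. indicator ?B z * norm (offset w f e l (gmult x z)))"
        by (rule Bochner_Integration.integrable_bound[OF iB[of B]])
          (use B in \<open>auto intro!: AE_I2 simp: indicator_def intro: order_trans[OF _ abs_ge_self]\<close>)
      then have "integrable (distr lborel borel (gmult (dil th s))) (\<lambda>z. indicator ?B z * norm (offset w f e l (gmult x z)))"
        by (simp add: distr_left_translation)
      then have "integrable lborel (\<lambda>z. indicator ?B (gmult (dil th s) z) * norm (offset w f e l (gmult x (gmult (dil th s) z))))"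
        by (rule integrable_distr[rotated]) measurable
      then show ?thesis by (simp add: y_def assoc)
    qed
    have start: "norm (G 2) \<le> Bg * ?I 0"
    proof -
      have "norm (G 2) \<le> (\<integral>z. norm (g z *\<^sub>R offset w f e 2 (gmult y z)) \<partial>lborel)"
        unfolding G_def by (rule integral_norm_bound)
      also have "\<dots> \<le> (\<integral>z. Bg * (indicator ?B (gmult (dil th s) z) * norm (offset w f e 2 (gmult y z))) \<partial>lborel)"
      proof (rule Bochner_Integration.integral_mono')
        fix z show "norm (g z *\<^sub>R offset w f e 2 (gmult y z)) \<le> Bg * (indicator ?B (gmult (dil th s) z) * norm (offset w f e 2 (gmult y z)))"
          using loc0[of z] Bg[of z] Bg0 by (cases "g z = 0") (auto intro!: mult_right_mono)
      qed (use ishift Bg0 in \<open>auto intro!: mult_nonneg_nonneg\<close>)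
      finally show ?thesis by (simp add: shift numeral_2_eq_2)
    qed
    have step: "norm (G (Suc (Suc (Suc k))) - G (Suc (Suc k))) \<le> C0 * (th ^ Suc k * ?I (Suc k))" for k
    proof -
      let ?l = "Suc (Suc k)"
      obtain B where B: "\<And>v. norm (offset w f e (Suc ?l) v) \<le> B" using offset_bounded[OF w f e] by blast
      have B0: "B \<ge> 0" using B[of 0] norm_ge_zero order_trans by blast
      let ?A = "offset w f e (Suc ?l)"
      have t: "0 \<le> th ^ ?l" "th ^ ?l \<le> 1" using th_bounds by (simp, intro power_le_one) auto
      have ig: "integrable lborel (\<lambda>z. g (gmult z (- dil (th ^ ?l) v)) *\<^sub>R ?A (gmult y z))" for v
      proof -
        have "integrable lborel (\<lambda>z. g z *\<^sub>R ?A (gmult y (gmult z (dil (th ^ ?l) v))))"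
        proof (rule Bochner_Integration.integrable_bound[OF integrable_cball[of R "Bg * B"]])
          show "AE z in lborel. norm (g z *\<^sub>R ?A (gmult y (gmult z (dil (th ^ ?l) v)))) \<le> norm (indicator (cball 0 R) z * (Bg * B) :: real)"
          proof (rule AE_I2)
            fix z show "norm (g z *\<^sub>R ?A (gmult y (gmult z (dil (th ^ ?l) v)))) \<le> norm (indicator (cball 0 R) z * (Bg * B) :: real)"
              using R[of z] Bg[of z] B Bg0 B0 by (cases "norm z \<le> R") (auto intro!: mult_mono)
          qed
        qed measurable
        then have "integrable (distr lborel borel (\<lambda>z. gmult z (- dil (th ^ ?l) v))) (\<lambda>z. g z *\<^sub>R ?A (gmult y (gmult z (dil (th ^ ?l) v))))"
          by (simp add: distr_right_translation)
        then have "integrable lborel (\<lambda>z. g (gmult z (- dil (th ^ ?l) v)) *\<^sub>R ?A (gmult y (gmult (gmult z (- dil (th ^ ?l) v)) (dil (th ^ ?l) v))))"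
          by (rule integrable_distr[rotated]) measurable
        then show ?thesis by simp
      qed
      have "G ?l = (\<integral>z. (\<integral>v. g z *\<^sub>R ?A (gmult y (gmult z (dil (th ^ ?l) v))) \<partial>Qm) \<partial>lborel)"
        unfolding G_def using offset_av[OF w f e, of ?l] by (simp add: assoc)
      also have "\<dots> = (\<integral>v. (\<integral>z. g z *\<^sub>R ?A (gmult y (gmult z (dil (th ^ ?l) v))) \<partial>lborel) \<partial>Qm)"
      proof (rule fubini_test[OF _ _ gm R, where B = "Bg * B"])
        show "finite_measure Qm" by unfold_locales
        show "norm (g z *\<^sub>R ?A (gmult y (gmult z (dil (th ^ ?l) v)))) \<le> Bg * B" for z v
          using Bg[of z] B Bg0 by (auto intro!: mult_mono)
      qed (simp, assumption, measurable)
      also have "\<dots> = (\<integral>v. (\<integral>z. g (gmult z (- dil (th ^ ?l) v)) *\<^sub>R ?A (gmult y z) \<partial>lborel) \<partial>Qm)"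
      proof (rule Bochner_Integration.integral_cong[OF refl])
        fix v
        show "(\<integral>z. g z *\<^sub>R ?A (gmult y (gmult z (dil (th ^ ?l) v))) \<partial>lborel) =
            (\<integral>z. g (gmult z (- dil (th ^ ?l) v)) *\<^sub>R ?A (gmult y z) \<partial>lborel)"
          using integral_right_shift[of "\<lambda>z. g (gmult z (- dil (th ^ ?l) v)) *\<^sub>R ?A (gmult y z)" "dil (th ^ ?l) v"] by simp
      qed
      finally have Gl: "G ?l = (\<integral>v. (\<integral>z. g (gmult z (- dil (th ^ ?l) v)) *\<^sub>R ?A (gmult y z) \<partial>lborel) \<partial>Qm)" .
      define H where "H = (\<lambda>v. \<integral>z. g (gmult z (- dil (th ^ ?l) v)) *\<^sub>R ?A (gmult y z) \<partial>lborel)"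
      have GlH: "G ?l = (\<integral>v. H v \<partial>Qm)" unfolding Gl H_def ..
      have H0: "H 0 = G (Suc ?l)" by (simp add: H_def G_def)
      have Hm [measurable]: "H \<in> borel_measurable borel"
        unfolding H_def by (rule lborel.borel_measurable_lebesgue_integral) measurable
      have diff: "norm (H v - H 0) \<le> C0 * (th ^ Suc k * ?I (Suc k))" if v: "norm v \<le> 1" for v
      proof -
        have e1: "H v - H 0 = (\<integral>z. (g (gmult z (- dil (th ^ ?l) v)) - g z) *\<^sub>R ?A (gmult y z) \<partial>lborel)"
          unfolding H_def using ig[of v] ig[of 0] by (simp add: scaleR_diff_left)
        have "norm (H v - H 0) \<le> (\<integral>z. norm ((g (gmult z (- dil (th ^ ?l) v)) - g z) *\<^sub>R ?A (gmult y z)) \<partial>lborel)"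
          unfolding e1 by (rule integral_norm_bound)
        also have "\<dots> \<le> (\<integral>z. (C0 * th ^ ?l) * (indicator ?B (gmult (dil th s) z) * norm (?A (gmult y z))) \<partial>lborel)"
        proof (rule Bochner_Integration.integral_mono')
          fix z
          have "\<bar>g (gmult z (- dil (th ^ ?l) v)) - g z\<bar> \<le> C0 * th ^ ?l" using v t by (intro C0) auto
          moreover have "gmult (dil th s) z \<in> ?B" if "g (gmult z (- dil (th ^ ?l) v)) - g z \<noteq> 0"
            using loc[of z k v] loc0[of z] that v by fastforce
          ultimately show "norm ((g (gmult z (- dil (th ^ ?l) v)) - g z) *\<^sub>R ?A (gmult y z)) \<le>
              (C0 * th ^ ?l) * (indicator ?B (gmult (dil th s) z) * norm (?A (gmult y z)))"
            using C0(1) t(1)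
            by (cases "g (gmult z (- dil (th ^ ?l) v)) - g z = 0") (auto intro!: mult_right_mono)
        qed (use ishift C0(1) t(1) in \<open>auto intro!: mult_nonneg_nonneg\<close>)
        also have "\<dots> = C0 * (th ^ ?l * ?I (Suc k))" by (simp add: shift numeral_2_eq_2)
        \<comment> \<open>One power of \<open>th\<close> is given up so that weight and scale index
          match the sum in the statement.\<close>
        also have "\<dots> \<le> C0 * (th ^ Suc k * ?I (Suc k))"
          using C0(1) th_bounds by (intro mult_left_mono mult_right_mono power_decreasing integral_nonneg_AE AE_I2) auto
        finally show ?thesis .
      qed
      have Hi: "integrable Qm H"
      proof (rule Q.integrable_const_bound[of _ "norm (H 0) + C0 * (th ^ Suc k * ?I (Suc k))"])
        show "AE v in Qm. norm (H v) \<le> norm (H 0) + C0 * (th ^ Suc k * ?I (Suc k))"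
          using Qm_support
        proof (rule eventually_mono)
          fix v :: "real ^ 'n" assume "norm v \<le> 1"
          then show "norm (H v) \<le> norm (H 0) + C0 * (th ^ Suc k * ?I (Suc k))"
            using diff[of v] norm_triangle_sub[of "H v" "H 0"] by simp
        qed
      qed measurable
      have e2: "G (Suc ?l) - G ?l = - (\<integral>v. H v - H 0 \<partial>Qm)"
        using Bochner_Integration.integral_diff[OF Hi Q.integrable_const[of "H 0"]] Q.prob_space
        unfolding GlH H0[symmetric] by simp
      have "norm (G (Suc ?l) - G ?l) \<le> (\<integral>v. norm (H v - H 0) \<partial>Qm)"
        unfolding e2 norm_minus_cancel by (rule integral_norm_bound)
      also have "\<dots> \<le> (\<integral>v. C0 * (th ^ Suc k * ?I (Suc k)) \<partial>Qm)"
      proof (rule integral_mono_AE)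
        show "AE v in Qm. norm (H v - H 0) \<le> C0 * (th ^ Suc k * ?I (Suc k))"
          using Qm_support by (rule eventually_mono) (rule diff)
      qed (use Hi in auto)
      finally show ?thesis using Q.prob_space by simp
    qed
    have bound: "norm (G (Suc (Suc k))) \<le> C * (\<Sum>n. th ^ n * ?I n)" for k
    proof -
      have In: "0 \<le> ?I n" for n by (intro integral_nonneg_AE AE_I2) auto
      have "norm (G (Suc (Suc k))) \<le> C * (\<Sum>n<Suc k. th ^ n * ?I n)"
      proof (induction k)
        case 0
        have "Bg * ?I 0 \<le> C * ?I 0" using C0(1) In[of 0] by (intro mult_right_mono) (auto simp: C_def)
        then show ?case using start by (simp add: numeral_2_eq_2)
      next
        case (Suc k)
        have "norm (G (Suc (Suc (Suc k)))) \<le> norm (G (Suc (Suc k))) + norm (G (Suc (Suc (Suc k))) - G (Suc (Suc k)))"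
          by (metis add_diff_cancel_left' diff_add_cancel norm_triangle_sub)
        also have "\<dots> \<le> C * (\<Sum>n<Suc k. th ^ n * ?I n) + C * (th ^ Suc k * ?I (Suc k))"
        proof (rule add_mono[OF Suc])
          have "0 \<le> th ^ Suc k * ?I (Suc k)" using th_bounds In by (intro mult_nonneg_nonneg) auto
          then show "norm (G (Suc (Suc (Suc k))) - G (Suc (Suc k))) \<le> C * (th ^ Suc k * ?I (Suc k))"
            using step[of k] Bg0 mult_right_mono[of C0 C "th ^ Suc k * ?I (Suc k)"] by (simp add: C_def)
        qed
        finally show ?case by (simp add: algebra_simps)
      qed
      also have "\<dots> \<le> C * (\<Sum>n. th ^ n * ?I n)"
        using In th_bounds Bg0 C0(1) by (intro mult_left_mono sum_le_suminf sum) (auto simp: C_def)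
      finally show ?thesis .
    qed
    have lim: "(\<lambda>l. G l) \<longlonglongrightarrow> (\<integral>\<xi>. g (gmult (- y) \<xi>) *\<^sub>R (f \<xi> - e) \<partial>w)"
    proof -
      \<comment> \<open>Fubini moves the kernel from the measure onto the test function:
        \<open>g'\<close> is a mollification of \<open>g\<close>, and it converges
        uniformly.\<close>
      define g' where "g' = (\<lambda>l \<zeta>. \<integral>z. g z * pk l (gmult (- z) \<zeta>) \<partial>lborel)"
      have G': "G l = (\<integral>\<xi>. g' l (gmult (- y) \<xi>) *\<^sub>R (f \<xi> - e) \<partial>w)" for l
      proof -
        obtain Bp where Bp: "\<And>v. \<bar>pk l v\<bar> \<le> Bp" using pk_bounded by blast
        have Bp0: "Bp \<ge> 0" using Bp[of 0] by simp
        have "G l = (\<integral>z. (\<integral>\<xi>. g z *\<^sub>R (pk l (gmult (- gmult y z) \<xi>) *\<^sub>R (f \<xi> - e)) \<partial>w) \<partial>lborel)"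
          unfolding G_def offset_eq[OF w f] by (simp only: integral_scaleR_right)
        also have "\<dots> = (\<integral>\<xi>. (\<integral>z. g z *\<^sub>R (pk l (gmult (- gmult y z) \<xi>) *\<^sub>R (f \<xi> - e)) \<partial>lborel) \<partial>w)"
        proof (rule fubini_test[OF _ sw gm R, where B = "Bg * (Bp * 2)"])
          show "norm (g z *\<^sub>R (pk l (gmult (- gmult y z) \<xi>) *\<^sub>R (f \<xi> - e))) \<le> Bg * (Bp * 2)" for z \<xi>
            using Bg[of z] Bp[of "gmult (- gmult y z) \<xi>"] fe[of \<xi>] Bg0 Bp0
            unfolding norm_scaleR by (intro mult_mono mult_nonneg_nonneg) simp_all
          show "finite_measure w" by unfold_locales
        qed (assumption, measurable)
        also have "\<dots> = (\<integral>\<xi>. g' l (gmult (- y) \<xi>) *\<^sub>R (f \<xi> - e) \<partial>w)"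
        proof (rule Bochner_Integration.integral_cong[OF refl])
          fix \<xi>
          have "integrable lborel (\<lambda>z. g z * pk l (gmult (- z) (gmult (- y) \<xi>)))"
          proof (rule Bochner_Integration.integrable_bound[OF integrable_cball[of R "Bg * Bp"]])
            show "AE z in lborel. norm (g z * pk l (gmult (- z) (gmult (- y) \<xi>))) \<le> norm (indicator (cball 0 R) z * (Bg * Bp) :: real)"
            proof (rule AE_I2)
              fix z show "norm (g z * pk l (gmult (- z) (gmult (- y) \<xi>))) \<le> norm (indicator (cball 0 R) z * (Bg * Bp) :: real)"
                using R[of z] Bg[of z] Bp Bg0 Bp0 by (cases "norm z \<le> R") (auto simp: abs_mult intro!: mult_mono)
            qed
          qed measurable
          then show "(\<integral>z. g z *\<^sub>R (pk l (gmult (- gmult y z) \<xi>) *\<^sub>R (f \<xi> - e)) \<partial>lborel) = g' l (gmult (- y) \<xi>) *\<^sub>R (f \<xi> - e)"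
            by (simp add: g'_def neg_gmult assoc)
        qed
        finally show ?thesis .
      qed
      have g'm [measurable]: "g' l \<in> borel_measurable borel" for l
        unfolding g'_def by (rule lborel.borel_measurable_lebesgue_integral) measurable
      have close: "\<bar>g' l \<zeta> - g \<zeta>\<bar> \<le> C0 * th ^ l" for l \<zeta>
      proof -
        have t: "0 \<le> th ^ l" "th ^ l \<le> 1" using th_bounds by (simp, intro power_le_one) auto
        have "g' l \<zeta> = (\<integral>z. (\<lambda>v. g (gmult \<zeta> (- v)) * pk l v) (gmult (- z) \<zeta>) \<partial>lborel)"
          by (simp add: g'_def neg_gmult)
        also have "\<dots> = (\<integral>z. (\<lambda>v. g (gmult \<zeta> (- v)) * pk l v) (gmult z \<zeta>) \<partial>lborel)"
          by (rule integral_neg[of "\<lambda>z. (\<lambda>v. g (gmult \<zeta> (- v)) * pk l v) (gmult z \<zeta>)"]) measurable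
        also have "\<dots> = (\<integral>v. g (gmult \<zeta> (- v)) * pk l v \<partial>lborel)"
          by (rule integral_right_shift) measurable
        finally have 1: "g' l \<zeta> = (\<integral>v. g (gmult \<zeta> (- v)) * pk l v \<partial>lborel)" .
        have i1: "integrable lborel (\<lambda>v. g (gmult \<zeta> (- v)) * pk l v)"
          by (rule Bochner_Integration.integrable_bound[where f = "\<lambda>v. Bg * pk l v"])
            (use Bg pk_nonneg[of l] Bg0 pk_integral(1) in \<open>auto simp: abs_mult intro!: AE_I2 mult_right_mono\<close>)
        have e3: "g' l \<zeta> - g \<zeta> = (\<integral>v. (g (gmult \<zeta> (- v)) - g \<zeta>) * pk l v \<partial>lborel)"
          unfolding 1 using i1 pk_integral[of l] by (simp add: left_diff_distrib)
        have "\<bar>g' l \<zeta> - g \<zeta>\<bar> \<le> (\<integral>v. \<bar>(g (gmult \<zeta> (- v)) - g \<zeta>) * pk l v\<bar> \<partial>lborel)"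
          unfolding e3 by (rule integral_abs_bound)
        also have "\<dots> \<le> (\<integral>v. (C0 * th ^ l) * pk l v \<partial>lborel)"
        proof (rule Bochner_Integration.integral_mono')
          fix v
          show "\<bar>(g (gmult \<zeta> (- v)) - g \<zeta>) * pk l v\<bar> \<le> (C0 * th ^ l) * pk l v"
          proof (cases "pk l v = 0")
            case False
            then have n: "norm (dil (1 / th ^ l) v) \<le> 2" using pp_zero by (force simp: pk_def)
            have "\<bar>g (gmult \<zeta> (- dil (th ^ l) (dil (1 / th ^ l) v))) - g \<zeta>\<bar> \<le> C0 * th ^ l"
              by (rule C0(2)[OF n t])
            then show ?thesis using th_bounds(4) pk_nonneg[of l v] by (simp add: abs_mult mult_right_mono)
          qed simp
        qed (use pk_integral(1) pk_nonneg C0(1) t(1) in \<open>auto intro!: mult_nonneg_nonneg\<close>)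
        finally show ?thesis using pk_integral(2)[of l] by simp
      qed
      have "(\<lambda>l. \<integral>\<xi>. g' l (gmult (- y) \<xi>) *\<^sub>R (f \<xi> - e) \<partial>w) \<longlonglongrightarrow> (\<integral>\<xi>. g (gmult (- y) \<xi>) *\<^sub>R (f \<xi> - e) \<partial>w)"
      proof (rule integral_dominated_convergence[where w = "\<lambda>_. (Bg + C0) * 2"])
        show "AE \<xi> in w. (\<lambda>l. g' l (gmult (- y) \<xi>) *\<^sub>R (f \<xi> - e)) \<longlonglongrightarrow> g (gmult (- y) \<xi>) *\<^sub>R (f \<xi> - e)"
        proof (intro AE_I2 tendsto_scaleR tendsto_const)
          fix \<xi>
          have "(\<lambda>l. C0 * th ^ l) \<longlonglongrightarrow> C0 * 0"
            by (intro tendsto_mult tendsto_const LIMSEQ_power_zero) (use th_bounds in simp)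
          then have "(\<lambda>l. C0 * th ^ l) \<longlonglongrightarrow> 0" by simp
          then show "(\<lambda>l. g' l (gmult (- y) \<xi>)) \<longlonglongrightarrow> g (gmult (- y) \<xi>)"
            by (rule LIMSEQ_I_bound) (rule close)
        qed
        show "AE \<xi> in w. norm (g' l (gmult (- y) \<xi>) *\<^sub>R (f \<xi> - e)) \<le> (Bg + C0) * 2" for l
        proof (rule AE_I2)
          fix \<xi>
          have "C0 * th ^ l \<le> C0 * 1" using C0(1) th_bounds by (intro mult_left_mono power_le_one) auto
          then have "\<bar>g' l (gmult (- y) \<xi>)\<bar> \<le> Bg + C0"
            using close[of l "gmult (- y) \<xi>"] Bg[of "gmult (- y) \<xi>"] by linarith
          then show "norm (g' l (gmult (- y) \<xi>) *\<^sub>R (f \<xi> - e)) \<le> (Bg + C0) * 2"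
            using fe[of \<xi>] Bg0 C0(1) unfolding norm_scaleR by (intro mult_mono) simp_all
        qed
      qed measurable
      then show ?thesis by (simp add: G')
    qed
    have "(\<lambda>k. norm (G (Suc (Suc k)))) \<longlonglongrightarrow> norm (\<integral>\<xi>. g (gmult (- y) \<xi>) *\<^sub>R (f \<xi> - e) \<partial>w)"
      by (intro tendsto_norm LIMSEQ_Suc lim)
    then show "norm (\<integral>\<xi>. g (gmult (- gmult x (dil th s)) \<xi>) *\<^sub>R (f \<xi> - e) \<partial>w) \<le> C * (\<Sum>n. th ^ n * ?I n)"
      unfolding y_def by (rule LIMSEQ_le_const2) (use bound in auto)
  qed (use Bg0 C0(1) in \<open>simp add: C_def\<close>)
qed

end

subsection \<open>The oscillation estimate\<close>

text \<open>For positive \<open>X\<close> and \<open>Z\<close> the right side is smallest at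
  \<open>l = sqrt (Z / X)\<close>. In the degenerate cases a suitable \<open>l\<close> gives
  \<open>S \<le> S / 2\<close>, which contradicts that \<open>S\<close> is positive.\<close>

lemma le_sqrt_mult_of_weighted:
  fixes S X Z :: real
  assumes "\<And>l. l > 0 \<Longrightarrow> S \<le> l * X / 2 + Z / (2 * l)" "X \<ge> 0" "Z \<ge> 0"
  shows "S \<le> sqrt (X * Z)"
proof (cases "S \<le> 0")
  case True
  then show ?thesis using assms by (simp add: order_trans[OF True])
next
  case False
  consider "X = 0" | "Z = 0" "X > 0" | "X > 0" "Z > 0" using assms by linarith
  then show ?thesis
  proof cases
    case 1
    have "S \<le> S / 2"
      using assms(1)[of "(Z + 1) / S"] False assms(3) 1
      by (auto simp: field_simps intro: order_trans[OF _ divide_right_mono] add_pos_nonneg)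
        (smt (verit) mult_nonneg_nonneg mult_pos_pos divide_le_eq)
    then show ?thesis using False by simp
  next
    case 2
    have "S \<le> S / 2"
      using assms(1)[of "S / X"] False 2 by (auto simp: field_simps)
    then show ?thesis using False by simp
  next
    case 3
    define a b where "a = sqrt X" and "b = sqrt Z"
    have ab: "a > 0" "b > 0" "X = a * a" "Z = b * b" using 3 by (auto simp: a_def b_def)
    have "S \<le> (b / a) * (a * a) / 2 + (b * b) / (2 * (b / a))"
      using assms(1)[of "b / a"] ab by simp
    also have "\<dots> = a * b" using ab(1,2) by (simp add: field_simps)
    finally show ?thesis by (simp add: real_sqrt_mult a_def b_def)
  qed
qed

context carnot
begin

text \<open>For finite \<open>I\<close> this is the smallest eigenvalue on \<open>V 1\<close> of the
  quadratic form given by the \<open>h j\<close>. It is positive exactly when their projections to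
  \<open>V 1\<close> span \<open>V 1\<close>.\<close>

definition psi :: "nat set \<Rightarrow> (nat \<Rightarrow> real ^ 'n) \<Rightarrow> real" where
  "psi I h = (INF v\<in>{v \<in> V 1. norm v = 1}. \<Sum>j\<in>I. (h j \<bullet> v)\<^sup>2)"

lemma subspace_V1: "subspace (V 1)"
  using subspace_layer[of 1] step_pos by simp

text \<open>If the first layer were zero, so would be all layers and the whole space. Hence the
  infimum in \<open>psi\<close> ranges over a nonempty set.\<close>

lemma V1_unit_exists: "{v \<in> V 1. norm v = 1} \<noteq> {}"
proof -
  have "\<exists>v\<in>V 1. v \<noteq> 0"
  proof (rule ccontr)
    assume "\<not> (\<exists>v\<in>V 1. v \<noteq> 0)"
    then have V1: "V 1 = {0}" using subspace_0[OF subspace_V1] by auto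
    have "1 \<le> i \<Longrightarrow> i \<le> s \<Longrightarrow> V i = {0}" for i
    proof (induction i rule: dec_induct)
      case (step i)
      then have "V (Suc i) = span {br a b | a b. a \<in> V 1 \<and> b \<in> V i}" using bracket_layer[of i] by auto
      also have "{br a b | a b. a \<in> V 1 \<and> b \<in> V i} = {0}" using step V1 by (auto simp: br_simps)
      finally show ?case by simp
    qed (use V1 in simp)
    then have "part x i = 0" if "i \<in> {1..s}" for x i using part_layer[OF that, of x] that by auto
    then have "x = 0" for x :: "real ^ 'n" using part(2)[of x] by simp
    then have "(axis undefined 1 :: real ^ 'n) = 0" by blast
    then show False by (simp add: axis_eq_0_iff)
  qed
  then obtain v where v: "v \<in> V 1" "v \<noteq> 0" by blast
  then have "v /\<^sub>R norm v \<in> {v \<in> V 1. norm v = 1}" using subspace_scale[OF subspace_V1] by simp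
  then show ?thesis by blast
qed

lemma psi_nonneg: "psi I h \<ge> 0"
  unfolding psi_def using V1_unit_exists by (intro cINF_greatest sum_nonneg) auto

lemma psi_lower: "v \<in> V 1 \<Longrightarrow> psi I h * (norm v)\<^sup>2 \<le> (\<Sum>j\<in>I. (h j \<bullet> v)\<^sup>2)"
proof (cases "v = 0")
  case False
  assume v: "v \<in> V 1"
  have "psi I h \<le> (\<Sum>j\<in>I. (h j \<bullet> (v /\<^sub>R norm v))\<^sup>2)"
    unfolding psi_def
    by (rule cINF_lower) (use v False subspace_scale[OF subspace_V1] in \<open>auto intro!: bdd_belowI[of _ 0] sum_nonneg\<close>)
  also have "\<dots> = (\<Sum>j\<in>I. (h j \<bullet> v)\<^sup>2) / (norm v)\<^sup>2"
    by (simp add: power_mult_distrib power_inverse sum_distrib_left[symmetric] divide_inverse mult.commute)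
  finally show ?thesis using False by (simp add: pos_le_divide_eq)
qed simp

lemma psi_approx: assumes "e > 0"
  shows "\<exists>v\<in>V 1. norm v = 1 \<and> (\<Sum>j\<in>I. (h j \<bullet> v)\<^sup>2) < psi I h + e"
proof -
  have "bdd_below ((\<lambda>v. \<Sum>j\<in>I. (h j \<bullet> v)\<^sup>2) ` {v \<in> V 1. norm v = 1})"
    by (auto intro!: bdd_belowI[of _ 0] sum_nonneg)
  then show ?thesis
    using cINF_less_iff[OF V1_unit_exists, of "\<lambda>v. \<Sum>j\<in>I. (h j \<bullet> v)\<^sup>2" "psi I h + e"] assms
    by (auto simp: psi_def)
qed

text \<open>The square of a sum is at most twice the sum of the squares, applied at a near-minimiser
  for \<open>h'\<close>. The factor 2 before \<open>psi I h'\<close> has to be beaten by the decay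
  of the densities when this is iterated over scales.\<close>

lemma psi_perturb: "psi I h \<le> 2 * psi I h' + 2 * (\<Sum>j\<in>I. (norm (h j - h' j))\<^sup>2)"
proof (rule field_le_epsilon)
  fix e :: real assume "e > 0"
  then obtain v where v: "v \<in> V 1" "norm v = 1" "(\<Sum>j\<in>I. (h' j \<bullet> v)\<^sup>2) < psi I h' + e / 2"
    using psi_approx[where e = "e / 2" and h = h' and I = I] by auto
  have "psi I h \<le> (\<Sum>j\<in>I. (h j \<bullet> v)\<^sup>2)" using psi_lower[OF v(1), of I h] v(2) by simp
  also have "\<dots> \<le> (\<Sum>j\<in>I. 2 * (h' j \<bullet> v)\<^sup>2 + 2 * (norm (h j - h' j))\<^sup>2)"
  proof (rule sum_mono)
    fix j
    have "((h j - h' j) \<bullet> v)\<^sup>2 \<le> (norm (h j - h' j))\<^sup>2"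
      using Cauchy_Schwarz_ineq2[of "h j - h' j" v] v(2) by (metis abs_norm_cancel abs_le_square_iff mult.right_neutral)
    moreover have "(h j \<bullet> v)\<^sup>2 \<le> 2 * (h' j \<bullet> v)\<^sup>2 + 2 * ((h j - h' j) \<bullet> v)\<^sup>2"
      using sum_squares_bound[of "h' j \<bullet> v" "(h j - h' j) \<bullet> v"]
      by (simp add: inner_diff_left power2_eq_square algebra_simps)
    ultimately show "(h j \<bullet> v)\<^sup>2 \<le> 2 * (h' j \<bullet> v)\<^sup>2 + 2 * (norm (h j - h' j))\<^sup>2" by simp
  qed
  also have "\<dots> = 2 * (\<Sum>j\<in>I. (h' j \<bullet> v)\<^sup>2) + 2 * (\<Sum>j\<in>I. (norm (h j - h' j))\<^sup>2)"
    by (simp add: sum.distrib sum_distrib_left)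
  finally show "psi I h \<le> 2 * psi I h' + 2 * (\<Sum>j\<in>I. (norm (h j - h' j))\<^sup>2) + e" using v(3) by simp
qed

text \<open>In the left-invariant frame the vector measures \<open>r j w\<close> are horizontal and
  have distributional divergence zero.\<close>

definition admissible :: "(real ^ 'n) measure \<Rightarrow> nat set \<Rightarrow> (nat \<Rightarrow> real ^ 'n \<Rightarrow> real ^ 'n) \<Rightarrow> bool" where
  "admissible w I r \<longleftrightarrow> fin_borel w \<and> finite I \<and> (\<forall>j\<in>I. density1 (r j) \<and> (\<forall>x. r j x \<in> V 1) \<and>
     (\<forall>\<theta>\<in>test_functions. (\<integral>\<xi>. LX (r j \<xi>) \<theta> \<xi> \<partial>w) = 0))"

text \<open>
  All finer scales \<open>i + n + 2\<close> enter the estimate at scale \<open>i\<close>; the weight \<open>th ^ n\<close> is the Lipschitz gain in \<open>multiscale\<close>.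
\<close>

definition rough :: "(real ^ 'n) measure \<Rightarrow> nat set \<Rightarrow> (nat \<Rightarrow> real ^ 'n \<Rightarrow> real ^ 'n) \<Rightarrow> nat \<Rightarrow> real ^ 'n \<Rightarrow> real" where
  "rough w I r i x = (\<Sum>n. th ^ n * (\<Sum>j\<in>I. gap w (r j) i (n + 2) x))"

lemma summable_th: "summable (\<lambda>n. th ^ n)"
  using th_bounds by (intro summable_geometric) simp

lemma summable_gap: assumes "fin_borel w" "density1 f" shows "summable (\<lambda>n. th ^ n * gap w f i (n + 2) x)"
proof (rule summable_comparison_test'[of "\<lambda>n. th ^ n * dens w i x" 0])
  show "summable (\<lambda>n. th ^ n * dens w i x)" by (intro summable_mult2 summable_th)
  show "norm (th ^ n * gap w f i (n + 2) x) \<le> th ^ n * dens w i x" for n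
    using gap_nonneg[of w f i "n + 2" x] gap_le[OF assms, of i "n + 2" x] th_bounds by (simp add: abs_mult)
qed

lemma rough_eq: assumes "admissible w I r" shows "rough w I r i x = (\<Sum>j\<in>I. \<Sum>n. th ^ n * gap w (r j) i (n + 2) x)"
  unfolding rough_def sum_distrib_left
proof (rule suminf_sum)
  fix j assume "j \<in> I"
  then show "summable (\<lambda>n. th ^ n * gap w (r j) i (n + 2) x)"
    using assms by (intro summable_gap) (auto simp: admissible_def)
qed

lemma rough_nonneg: assumes "admissible w I r" shows "rough w I r i x \<ge> 0"
  unfolding rough_eq[OF assms]
proof (intro sum_nonneg suminf_nonneg mult_nonneg_nonneg gap_nonneg)
  fix j assume "j \<in> I"
  then show "summable (\<lambda>n. th ^ n * gap w (r j) i (n + 2) x)"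
    using assms by (intro summable_gap) (auto simp: admissible_def)
qed (use th_bounds in simp)

text \<open>A subspace is closed under averages; membership is tested against the orthogonal
  complement.\<close>

lemma hh_V1: assumes w: "fin_borel w" and f: "density1 f" "\<And>\<xi>. f \<xi> \<in> V 1" shows "mdir w f i x \<in> V 1"
proof -
  have "flux w f i x \<in> (V 1)\<^sup>\<bottom>\<^sup>\<bottom>"
    unfolding orthogonal_comp_def orthogonal_def
  proof clarify
    fix y assume y: "\<forall>v\<in>V 1. v \<bullet> y = 0"
    have "y \<bullet> flux w f i x = (\<integral>\<xi>. y \<bullet> (pk i (gmult (- x) \<xi>) *\<^sub>R f \<xi>) \<partial>w)"
      unfolding flux_def using pk_integrable(2)[OF w f(1)] by (rule integral_inner_right[symmetric])
    also have "\<dots> = (\<integral>\<xi>. 0 \<partial>w)"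
    proof (rule Bochner_Integration.integral_cong[OF refl])
      fix \<xi> show "y \<bullet> (pk i (gmult (- x) \<xi>) *\<^sub>R f \<xi>) = 0"
        using bspec[OF y f(2)[of \<xi>]] by (simp add: inner_commute)
    qed
    also have "\<dots> = 0" by simp
    finally show "y \<bullet> flux w f i x = 0" .
  qed
  then have "flux w f i x \<in> V 1" using orthogonal_comp_self[OF subspace_V1] by simp
  then show ?thesis unfolding mdir_def by (rule subspace_scale[OF subspace_V1])
qed

lemma ball_mass:
  obtains c where "c > 0"
    "\<And>n B x (F :: real ^ 'n \<Rightarrow> real). F \<in> borel_measurable borel \<Longrightarrow> (\<And>v. 0 \<le> F v) \<Longrightarrow> (\<And>v. F v \<le> B) \<Longrightarrow>
      c * (\<integral>z. indicator (dil th ` cball 0 3) z * F (gmult x z) \<partial>lborel) \<le> av 0 (Suc n) F x"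
proof (rule Pn_lower)
  fix c
  assume c: "c > 0" and lo: "\<And>n B (f :: real ^ 'n \<Rightarrow> real). f \<in> borel_measurable borel \<Longrightarrow> (\<And>x. 0 \<le> f x) \<Longrightarrow> (\<And>x. f x \<le> B) \<Longrightarrow>
      c * (\<integral>v. indicator (dil th ` cball 0 3) v * f v \<partial>lborel) \<le> (\<integral>x. f x \<partial>Pn (Suc n))"
  show ?thesis
  proof (rule that[OF c])
    fix n B x and F :: "real ^ 'n \<Rightarrow> real"
    assume [measurable]: "F \<in> borel_measurable borel" and F: "\<And>v. 0 \<le> F v" "\<And>v. F v \<le> B"
    show "c * (\<integral>z. indicator (dil th ` cball 0 3) z * F (gmult x z) \<partial>lborel) \<le> av 0 (Suc n) F x"
      using lo[of "\<lambda>z. F (gmult x z)" B n] F by (simp add: av_def)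
  qed
qed

lemma ball_integrable:
  fixes F :: "real ^ 'n \<Rightarrow> real"
  assumes [measurable]: "F \<in> borel_measurable borel" and B: "\<And>v. \<bar>F v\<bar> \<le> B"
  shows "integrable lborel (\<lambda>z. indicator (dil th ` cball 0 3) z * F (gmult x z))"
proof -
  have Bc: "compact (dil th ` cball 0 3)"
    by (intro compact_continuous_image linear_continuous_on bounded_linear_dil compact_cball)
  have Bm [measurable]: "dil th ` cball 0 3 \<in> sets borel" using Bc by (simp add: borel_compact)
  have iB: "integrable lborel (\<lambda>z. indicator (dil th ` cball 0 3) z * c)" for c :: real
    by (intro integrable_mult_left integrable_real_indicator)
      (use Bc Bm in \<open>auto intro: emeasure_bounded_finite[unfolded infinity_ennreal_def] compact_imp_bounded\<close>)
  show ?thesis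
    by (rule Bochner_Integration.integrable_bound[OF iB[of B]])
      (use B in \<open>auto intro!: AE_I2 simp: indicator_def intro: order_trans[OF _ abs_ge_self]\<close>)
qed

text \<open>The norm of \<open>offset\<close> is a density times a deviation, which Young's
  inequality splits into a variance term and a density term. As \<open>e\<close> is the mean
  direction at \<open>x\<close>, the lower bound for the walk controls them by \<open>gap\<close>
  and \<open>dens w 0 x\<close>. The parameter is optimised only after summing over the
  scales.\<close>

lemma freeze_estimate:
  obtains c where "c > 0"
    "\<And>w f x e. fin_borel w \<Longrightarrow> density1 f \<Longrightarrow> e = mdir w f 0 x \<Longrightarrow>
      summable (\<lambda>n. th ^ n * (\<integral>z. indicator (dil th ` cball 0 3) z * norm (offset w f e (n + 2) (gmult x z)) \<partial>lborel)) \<and>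
      (\<Sum>n. th ^ n * (\<integral>z. indicator (dil th ` cball 0 3) z * norm (offset w f e (n + 2) (gmult x z)) \<partial>lborel)) \<le>
        c * sqrt (dens w 0 x * (\<Sum>n. th ^ n * gap w f 0 (n + 2) x))"
proof (rule ball_mass)
  fix c
  assume c: "c > 0" and lo: "\<And>n B x (F :: real ^ 'n \<Rightarrow> real). F \<in> borel_measurable borel \<Longrightarrow> (\<And>v. 0 \<le> F v) \<Longrightarrow> (\<And>v. F v \<le> B) \<Longrightarrow>
      c * (\<integral>z. indicator (dil th ` cball 0 3) z * F (gmult x z) \<partial>lborel) \<le> av 0 (Suc n) F x"
  show ?thesis
  proof (rule that[of "2 / c"])
    fix w f and x e :: "real ^ 'n"
    assume w: "fin_borel w" and f: "density1 f" and e: "e = mdir w f 0 x"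
    have e1: "norm e \<le> 1" unfolding e by (rule mdir_le[OF w f])
    let ?B = "dil th ` cball 0 3"
    let ?I = "\<lambda>n. \<integral>z. indicator ?B z * norm (offset w f e (n + 2) (gmult x z)) \<partial>lborel"
    let ?X = "\<lambda>n. gap w f 0 (n + 2) x"
    let ?u = "dens w 0 x"
    have u0: "?u \<ge> 0" by (rule dens_nonneg)
    have key: "?I n \<le> l * (?X n / c) / 2 + (?u / c) / (2 * l)" if l: "l > 0" for l n
    proof -
      let ?V = "\<lambda>v. dens w (n + 2) v * (norm (mdir w f (n + 2) v - e))\<^sup>2"
      obtain B1 where B1: "\<And>v. \<bar>dens w (n + 2) v\<bar> \<le> B1" using dens_bounded[OF w] by blast
      obtain B2 where B2: "\<And>v. \<bar>?V v\<bar> \<le> B2" using gap_integrand(2)[OF w f e1] by blast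
      obtain B3 where B3: "\<And>v. norm (offset w f e (n + 2) v) \<le> B3" using offset_bounded[OF w f e1] by blast
      have V0: "0 \<le> ?V v" for v using dens_nonneg by simp
      have B1': "dens w (n + 2) v \<le> B1" and B2': "?V v \<le> B2" for v using B1[of v] B2[of v] by linarith+
      note mV = gap_integrand(1)[OF w f e1, of "n + 2"]
      have 1: "c * (\<integral>z. indicator ?B z * dens w (n + 2) (gmult x z) \<partial>lborel) \<le> ?u"
        using lo[OF dens_borel[OF w, of "n + 2"] dens_nonneg B1', of x "Suc n"] dens_av[OF w, of 0 x "n + 2"] by simp
      have 2: "c * (\<integral>z. indicator ?B z * ?V (gmult x z) \<partial>lborel) \<le> ?X n"
        using lo[OF mV V0 B2', of x "Suc n"] by (simp add: gap_def e)
      have i1: "integrable lborel (\<lambda>z. indicator ?B z * dens w (n + 2) (gmult x z))"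
        by (rule ball_integrable[OF dens_borel[OF w] B1])
      have i2: "integrable lborel (\<lambda>z. indicator ?B z * ?V (gmult x z))"
        by (rule ball_integrable[OF mV B2])
      have "?I n \<le> (\<integral>z. (l / 2) * (indicator ?B z * ?V (gmult x z)) + (1 / (2 * l)) * (indicator ?B z * dens w (n + 2) (gmult x z)) \<partial>lborel)"
      proof (rule integral_mono)
        show "integrable lborel (\<lambda>z. indicator ?B z * norm (offset w f e (n + 2) (gmult x z)))"
          using offset_borel[OF w f, of e "n + 2"] B3 by (intro ball_integrable[of "\<lambda>v. norm (offset w f e (n + 2) v)" B3]) auto
        show "integrable lborel (\<lambda>z. (l / 2) * (indicator ?B z * ?V (gmult x z)) + (1 / (2 * l)) * (indicator ?B z * dens w (n + 2) (gmult x z)))"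
          by (intro Bochner_Integration.integrable_add integrable_mult_right i1 i2)
        fix z
        define a where "a = norm (mdir w f (n + 2) (gmult x z) - e)"
        define u where "u = dens w (n + 2) (gmult x z)"
        have u: "u \<ge> 0" by (simp add: u_def dens_nonneg)
        have "0 \<le> (l * a - 1)\<^sup>2 / (2 * l)" using l by simp
        also have "(l * a - 1)\<^sup>2 / (2 * l) = (l / 2) * a\<^sup>2 + 1 / (2 * l) - a"
          using l by (simp add: power2_eq_square field_simps)
        finally have "a \<le> (l / 2) * a\<^sup>2 + 1 / (2 * l)" by simp
        then have "u * a \<le> u * ((l / 2) * a\<^sup>2 + 1 / (2 * l))" using u by (rule mult_left_mono)
        then have "u * a \<le> (l / 2) * (u * a\<^sup>2) + (1 / (2 * l)) * u" by (simp add: algebra_simps)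
        moreover have "norm (offset w f e (n + 2) (gmult x z)) = u * a" using u by (simp add: offset_def a_def u_def)
        ultimately show "indicator ?B z * norm (offset w f e (n + 2) (gmult x z)) \<le>
            (l / 2) * (indicator ?B z * ?V (gmult x z)) + (1 / (2 * l)) * (indicator ?B z * dens w (n + 2) (gmult x z))"
          by (cases "z \<in> ?B") (auto simp: a_def u_def)
      qed
      also have "\<dots> = (l / 2) * (\<integral>z. indicator ?B z * ?V (gmult x z) \<partial>lborel) + (1 / (2 * l)) * (\<integral>z. indicator ?B z * dens w (n + 2) (gmult x z) \<partial>lborel)"
        using i1 i2 by simp
      also have "\<dots> \<le> (l / 2) * (?X n / c) + (1 / (2 * l)) * (?u / c)"
        using 1 2 c l by (intro add_mono mult_left_mono) (auto simp: pos_le_divide_eq mult.commute)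
      finally show ?thesis by (simp add: mult.commute mult.left_commute)
    qed
    have I0: "0 \<le> ?I n" for n by (intro integral_nonneg_AE AE_I2) auto
    have sX: "summable (\<lambda>n. th ^ n * ?X n)" by (rule summable_gap[OF w f])
    have X0: "0 \<le> (\<Sum>n. th ^ n * ?X n)"
      using th_bounds gap_nonneg by (intro suminf_nonneg sX) auto
    have su: "summable (\<lambda>n. th ^ n * (l * (?X n / c) / 2 + (?u / c) / (2 * l)))" for l
    proof -
      have "summable (\<lambda>n. (l / (2 * c)) * (th ^ n * ?X n) + ((?u / c) / (2 * l)) * th ^ n)"
        by (intro summable_add summable_mult sX summable_th)
      then show ?thesis by (simp add: algebra_simps)
    qed
    have sI: "summable (\<lambda>n. th ^ n * ?I n)"
      by (rule summable_comparison_test'[OF su[of 1], of 0]) (use key[of 1] I0 th_bounds in \<open>auto simp: abs_mult intro!: mult_left_mono\<close>)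
    have "(\<Sum>n. th ^ n * ?I n) \<le> l * ((\<Sum>n. th ^ n * ?X n) / c) / 2 + (2 * ?u / c) / (2 * l)" if l: "l > 0" for l
    proof -
      have "(\<Sum>n. th ^ n * ?I n) \<le> (\<Sum>n. th ^ n * (l * (?X n / c) / 2 + (?u / c) / (2 * l)))"
        using key[OF l] th_bounds by (intro suminf_le sI su mult_left_mono) auto
      also have "\<dots> = (\<Sum>n. (l / (2 * c)) * (th ^ n * ?X n) + ((?u / c) / (2 * l)) * th ^ n)"
        by (simp add: algebra_simps)
      also have "\<dots> = (l / (2 * c)) * (\<Sum>n. th ^ n * ?X n) + ((?u / c) / (2 * l)) * (\<Sum>n. th ^ n)"
        unfolding suminf_add[OF summable_mult[OF sX] summable_mult[OF summable_th], symmetric]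
          suminf_mult[OF sX] suminf_mult[OF summable_th] ..
      also have "\<dots> \<le> (l / (2 * c)) * (\<Sum>n. th ^ n * ?X n) + ((?u / c) / (2 * l)) * 2"
      proof -
        have "(\<Sum>n. th ^ n) = 1 / (1 - th)" using suminf_geometric[of th] th_bounds by simp
        also have "\<dots> \<le> 2" using th_bounds by (simp add: pos_divide_le_eq)
        finally have "(\<Sum>n. th ^ n) \<le> 2" .
        then show ?thesis using u0 c l by (intro add_left_mono mult_left_mono) auto
      qed
      finally show ?thesis using l c by (simp add: field_simps)
    qed
    then have "(\<Sum>n. th ^ n * ?I n) \<le> sqrt (((\<Sum>n. th ^ n * ?X n) / c) * (2 * ?u / c))"
      by (rule le_sqrt_mult_of_weighted) (use X0 u0 c in auto)
    also have "\<dots> \<le> sqrt ((2 / c)\<^sup>2 * (?u * (\<Sum>n. th ^ n * ?X n)))"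
    proof (rule real_sqrt_le_mono)
      have "((\<Sum>n. th ^ n * ?X n) / c) * (2 * ?u / c) = (2 / c\<^sup>2) * (?u * (\<Sum>n. th ^ n * ?X n))"
        by (simp add: power2_eq_square)
      also have "\<dots> \<le> (4 / c\<^sup>2) * (?u * (\<Sum>n. th ^ n * ?X n))"
        using c u0 X0 by (intro mult_right_mono divide_right_mono) auto
      finally show "((\<Sum>n. th ^ n * ?X n) / c) * (2 * ?u / c) \<le> (2 / c)\<^sup>2 * (?u * (\<Sum>n. th ^ n * ?X n))"
        by (simp add: power_divide)
    qed
    also have "\<dots> = (2 / c) * sqrt (?u * (\<Sum>n. th ^ n * ?X n))"
      using c by (simp add: real_sqrt_mult)
    finally show "summable (\<lambda>n. th ^ n * ?I n) \<and> (\<Sum>n. th ^ n * ?I n) \<le> (2 / c) * sqrt (?u * (\<Sum>n. th ^ n * ?X n))"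
      using sI by blast
  qed (use c in simp)
qed

text \<open>The constraint makes the integral of \<open>LX (r j \<xi>) \<theta>\<close> vanish;
  replacing \<open>r j \<xi>\<close> by the mean direction costs what \<open>multiscale\<close> and
  \<open>freeze_estimate\<close> bound. Thus a linear functional is small at every mean direction,
  and \<open>psi\<close> converts this into smallness on all of \<open>V 1\<close>.\<close>

lemma oscillation_single:
  assumes a: "a \<in> V 1" and th: "\<theta> \<in> test_on (dil (th ^ 2) ` cball 0 2)"
  shows "\<exists>C\<ge>0. \<forall>w I r x s. admissible w I r \<longrightarrow> norm s \<le> 1 \<longrightarrow>
    sqrt (psi I (\<lambda>j. mdir w (r j) 0 x)) * \<bar>\<integral>\<xi>. LX a \<theta> (gmult (- gmult x (dil th s)) \<xi>) \<partial>w\<bar> \<le>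
      C * sqrt (dens w 0 x * rough w I r 0 x)"
proof -
  have clK: "closed (dil (th ^ 2) ` cball 0 2)"
    by (intro compact_imp_closed compact_continuous_image linear_continuous_on bounded_linear_dil compact_cball)
  have "\<exists>C. \<forall>i. 0 \<le> C i \<and> (\<forall>w f e x s. fin_borel w \<longrightarrow> density1 f \<longrightarrow> norm e \<le> 1 \<longrightarrow> norm s \<le> 1 \<longrightarrow>
    summable (\<lambda>n. th ^ n * (\<integral>z. indicator (dil th ` cball 0 3) z * norm (offset w f e (n + 2) (gmult x z)) \<partial>lborel)) \<longrightarrow>
    norm (\<integral>\<xi>. LX i \<theta> (gmult (- gmult x (dil th s)) \<xi>) *\<^sub>R (f \<xi> - e) \<partial>w) \<le>
      C i * (\<Sum>n. th ^ n * (\<integral>z. indicator (dil th ` cball 0 3) z * norm (offset w f e (n + 2) (gmult x z)) \<partial>lborel)))"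
    by (rule choice) (rule allI, rule multiscale[OF test_on_LX[OF clK th]])
  then obtain C where C: "\<And>i. 0 \<le> C i" "\<And>i w f e x s. fin_borel w \<Longrightarrow> density1 f \<Longrightarrow> norm e \<le> 1 \<Longrightarrow> norm s \<le> 1 \<Longrightarrow>
    summable (\<lambda>n. th ^ n * (\<integral>z. indicator (dil th ` cball 0 3) z * norm (offset w f e (n + 2) (gmult x z)) \<partial>lborel)) \<Longrightarrow>
    norm (\<integral>\<xi>. LX i \<theta> (gmult (- gmult x (dil th s)) \<xi>) *\<^sub>R (f \<xi> - e) \<partial>w) \<le>
      C i * (\<Sum>n. th ^ n * (\<integral>z. indicator (dil th ` cball 0 3) z * norm (offset w f e (n + 2) (gmult x z)) \<partial>lborel))"
    by blast
  obtain c where c: "c > 0" "\<And>w f x e. fin_borel w \<Longrightarrow> density1 f \<Longrightarrow> e = mdir w f 0 x \<Longrightarrow>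
      summable (\<lambda>n. th ^ n * (\<integral>z. indicator (dil th ` cball 0 3) z * norm (offset w f e (n + 2) (gmult x z)) \<partial>lborel)) \<and>
      (\<Sum>n. th ^ n * (\<integral>z. indicator (dil th ` cball 0 3) z * norm (offset w f e (n + 2) (gmult x z)) \<partial>lborel)) \<le>
        c * sqrt (dens w 0 x * (\<Sum>n. th ^ n * gap w f 0 (n + 2) x))"
    by (rule freeze_estimate) (rule that)
  define D where "D = (\<Sum>i\<in>(Basis :: (real ^ 'n) set). C i) * c"
  have D0: "D \<ge> 0" using C(1) c(1) by (simp add: D_def sum_nonneg)
  have tt: "\<theta> \<in> test_functions" by (rule test_onD[OF th])
  have st: "smooth \<theta>" by (rule test_smooth[OF tt])
  show ?thesis
  proof (intro exI[of _ "D * norm a"] conjI allI impI)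
    fix w I r and x s :: "real ^ 'n"
    assume adm: "admissible w I r" and s: "norm s \<le> 1"
    have w: "fin_borel w" and fI: "finite I" and r: "\<And>j. j \<in> I \<Longrightarrow> density1 (r j)" "\<And>j \<xi>. j \<in> I \<Longrightarrow> r j \<xi> \<in> V 1"
      and con: "\<And>j \<phi>. j \<in> I \<Longrightarrow> \<phi> \<in> test_functions \<Longrightarrow> (\<integral>\<xi>. LX (r j \<xi>) \<phi> \<xi> \<partial>w) = 0"
      using adm by (auto simp: admissible_def)
    define y where "y = gmult x (dil th s)"
    define h where "h = (\<lambda>j. mdir w (r j) 0 x)"
    define X where "X = (\<lambda>j. \<Sum>n. th ^ n * gap w (r j) 0 (n + 2) x)"
    have LXb: "\<exists>B. \<forall>\<xi>. \<bar>LX b \<theta> (gmult (- y) \<xi>)\<bar> \<le> B" for b using test_bounded[OF test_LX[OF tt]] by blast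
    have LXm [measurable]: "LX b \<theta> \<in> borel_measurable borel" for b
      by (intro borel_measurable_continuous_onI smooth_continuous_on smooth_LX st)
    have iLX: "integrable w (\<lambda>\<xi>. LX b \<theta> (gmult (- y) \<xi>))" for b
    proof -
      obtain B where "\<And>\<xi>. \<bar>LX b \<theta> (gmult (- y) \<xi>)\<bar> \<le> B" using LXb by blast
      then show ?thesis by (intro fin_borel_integrable[OF w, of _ B]) auto
    qed
    define L where "L = (\<lambda>b. \<integral>\<xi>. LX b \<theta> (gmult (- y) \<xi>) \<partial>w)"
    have linL: "linear L"
    proof (rule linearI)
      fix b b' and k :: real
      show "L (b + b') = L b + L b'"
        unfolding L_def using iLX by (simp add: linear_add[OF LX_linear[OF st]])
      show "L (k *\<^sub>R b) = k *\<^sub>R L b"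
        unfolding L_def by (simp add: linear_scale[OF LX_linear[OF st]])
    qed
    \<comment> \<open>The representing vector of \<open>L\<close> is projected to
      \<open>V 1\<close>, because \<open>psi_lower\<close> speaks only about vectors of that
      layer.\<close>
    obtain W where W: "W \<in> V 1" "\<And>b. b \<in> V 1 \<Longrightarrow> L b = b \<bullet> W"
    proof -
      define W0 where "W0 = (\<Sum>i\<in>Basis. L i *\<^sub>R i)"
      have W0: "L b = b \<bullet> W0" for b
        using linear_euclidean_expansion[OF linL, of b] by (simp add: W0_def inner_sum_right mult.commute)
      obtain W z where Wz: "W \<in> span (V 1)" "\<And>v. v \<in> span (V 1) \<Longrightarrow> orthogonal z v" "W0 = W + z"
        using orthogonal_subspace_decomp_exists[of "V 1" W0] by blast
      have sp: "span (V 1) = V 1" using subspace_V1 by (simp add: span_eq_iff)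
      show ?thesis
      proof (rule that[of W])
        show "W \<in> V 1" using Wz(1) unfolding sp .
        fix b assume "b \<in> V 1"
        then have "b \<in> span (V 1)" unfolding sp .
        from Wz(2)[OF this] have "b \<bullet> z = 0" by (simp only: orthogonal_def inner_commute)
        then show "L b = b \<bullet> W" by (simp add: W0 Wz(3) inner_add_right)
      qed
    qed
    have hV: "h j \<in> V 1" if "j \<in> I" for j unfolding h_def by (rule hh_V1[OF w r(1)[OF that] r(2)[OF that]])
    have Lh: "\<bar>L (h j)\<bar> \<le> D * sqrt (dens w 0 x * X j)" if j: "j \<in> I" for j
    proof -
      have rm [measurable]: "r j \<in> borel_measurable borel" using r(1)[OF j] by (simp add: density1_def)
      have hj1: "norm (h j) \<le> 1" unfolding h_def by (rule mdir_le[OF w r(1)[OF j]])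
      note cc = c(2)[OF w r(1)[OF j] h_def[THEN fun_cong, of j]]
      have ri: "integrable w (\<lambda>\<xi>. LX i \<theta> (gmult (- y) \<xi>) *\<^sub>R (r j \<xi> - h j))" for i
      proof -
        obtain B where B: "\<And>\<xi>. \<bar>LX i \<theta> (gmult (- y) \<xi>)\<bar> \<le> B" using LXb by blast
        have "norm (r j \<xi> - h j) \<le> 2" for \<xi>
        proof -
          have "norm (r j \<xi>) \<le> 1" using r(1)[OF j] by (simp add: density1_def)
          then show ?thesis using norm_triangle_ineq4[of "r j \<xi>" "h j"] hj1 by simp
        qed
        then show ?thesis
          using B[of 0] by (intro fin_borel_integrable[OF w, of _ "B * 2"]) (auto intro!: mult_mono B)
      qed
      \<comment> \<open>Left-invariant derivatives commute with left translations, so the translated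
        \<open>\<theta>\<close> may be inserted into the constraint.\<close>
      have con0: "(\<integral>\<xi>. LX (r j \<xi>) \<theta> (gmult (- y) \<xi>) \<partial>w) = 0"
        using con[OF j test_left_translate[OF tt, of "- y"]] by (simp add: LX_translate)
      have "LX (r j \<xi>) \<theta> (gmult (- y) \<xi>) - LX (h j) \<theta> (gmult (- y) \<xi>) =
          (\<Sum>i\<in>Basis. (LX i \<theta> (gmult (- y) \<xi>) *\<^sub>R (r j \<xi> - h j)) \<bullet> i)" for \<xi>
        using linear_diff[OF LX_linear[OF st], of "r j \<xi>" "h j" "gmult (- y) \<xi>"]
          linear_euclidean_expansion[OF LX_linear[OF st], of "r j \<xi> - h j" "gmult (- y) \<xi>"]
        by (simp add: mult.commute)
      moreover have "integrable w (\<lambda>\<xi>. LX (r j \<xi>) \<theta> (gmult (- y) \<xi>))"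
      proof -
        have "LX (r j \<xi>) \<theta> (gmult (- y) \<xi>) = LX (h j) \<theta> (gmult (- y) \<xi>) +
          (\<Sum>i\<in>Basis. (LX i \<theta> (gmult (- y) \<xi>) *\<^sub>R (r j \<xi> - h j)) \<bullet> i)" for \<xi>
          using linear_diff[OF LX_linear[OF st], of "r j \<xi>" "h j" "gmult (- y) \<xi>"]
            linear_euclidean_expansion[OF LX_linear[OF st], of "r j \<xi> - h j" "gmult (- y) \<xi>"]
          by (simp add: mult.commute)
        then show ?thesis
          using iLX ri by (simp only:) (intro Bochner_Integration.integrable_add Bochner_Integration.integrable_sum integrable_inner_left)
      qed
      ultimately have "(\<integral>\<xi>. LX (r j \<xi>) \<theta> (gmult (- y) \<xi>) \<partial>w) - L (h j) =
          (\<integral>\<xi>. (\<Sum>i\<in>Basis. (LX i \<theta> (gmult (- y) \<xi>) *\<^sub>R (r j \<xi> - h j)) \<bullet> i) \<partial>w)"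
        using iLX[of "h j"] unfolding L_def by (subst Bochner_Integration.integral_diff[symmetric]) auto
      then have "- L (h j) = (\<integral>\<xi>. (\<Sum>i\<in>Basis. (LX i \<theta> (gmult (- y) \<xi>) *\<^sub>R (r j \<xi> - h j)) \<bullet> i) \<partial>w)"
        unfolding con0 by simp
      also have "\<dots> = (\<Sum>i\<in>Basis. (\<integral>\<xi>. LX i \<theta> (gmult (- y) \<xi>) *\<^sub>R (r j \<xi> - h j) \<partial>w) \<bullet> i)"
        by (subst Bochner_Integration.integral_sum)
          (rule integrable_inner_left[OF ri], intro sum.cong refl integral_inner_left ri)
      finally have eq: "- L (h j) = (\<Sum>i\<in>Basis. (\<integral>\<xi>. LX i \<theta> (gmult (- y) \<xi>) *\<^sub>R (r j \<xi> - h j) \<partial>w) \<bullet> i)" .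
      have "\<bar>L (h j)\<bar> = \<bar>- L (h j)\<bar>" by simp
      also have "\<dots> \<le> (\<Sum>i\<in>Basis. \<bar>(\<integral>\<xi>. LX i \<theta> (gmult (- y) \<xi>) *\<^sub>R (r j \<xi> - h j) \<partial>w) \<bullet> i\<bar>)"
        unfolding eq by (rule sum_abs)
      also have "\<dots> \<le> (\<Sum>i\<in>(Basis :: (real ^ 'n) set). C i * (c * sqrt (dens w 0 x * X j)))"
      proof (rule sum_mono)
        fix i :: "real ^ 'n" assume i: "i \<in> Basis"
        have "\<bar>(\<integral>\<xi>. LX i \<theta> (gmult (- y) \<xi>) *\<^sub>R (r j \<xi> - h j) \<partial>w) \<bullet> i\<bar> \<le> norm (\<integral>\<xi>. LX i \<theta> (gmult (- y) \<xi>) *\<^sub>R (r j \<xi> - h j) \<partial>w)"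
          using i by (rule Basis_le_norm)
        also have "\<dots> \<le> C i * (\<Sum>n. th ^ n * (\<integral>z. indicator (dil th ` cball 0 3) z * norm (offset w (r j) (h j) (n + 2) (gmult x z)) \<partial>lborel))"
          unfolding y_def by (rule C(2)[OF w r(1)[OF j] hj1 s conjunct1[OF cc]])
        also have "\<dots> \<le> C i * (c * sqrt (dens w 0 x * X j))"
          using conjunct2[OF cc] C(1) unfolding X_def by (rule mult_left_mono)
        finally show "\<bar>(\<integral>\<xi>. LX i \<theta> (gmult (- y) \<xi>) *\<^sub>R (r j \<xi> - h j) \<partial>w) \<bullet> i\<bar> \<le> C i * (c * sqrt (dens w 0 x * X j))" .
      qed
      also have "\<dots> = D * sqrt (dens w 0 x * X j)" by (simp add: D_def sum_distrib_right mult.assoc)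
      finally show ?thesis .
    qed
    have X0: "X j \<ge> 0" if "j \<in> I" for j
      unfolding X_def using th_bounds gap_nonneg by (intro suminf_nonneg summable_gap[OF w r(1)[OF that]]) auto
    have "psi I h * (norm W)\<^sup>2 \<le> (\<Sum>j\<in>I. (h j \<bullet> W)\<^sup>2)" by (rule psi_lower[OF W(1)])
    also have "\<dots> = (\<Sum>j\<in>I. (L (h j))\<^sup>2)" using W(2) hV by simp
    also have "\<dots> \<le> (\<Sum>j\<in>I. D\<^sup>2 * (dens w 0 x * X j))"
    proof (rule sum_mono)
      fix j assume j: "j \<in> I"
      have "(L (h j))\<^sup>2 \<le> (D * sqrt (dens w 0 x * X j))\<^sup>2"
        using Lh[OF j] by (intro abs_le_square_iff[THEN iffD1]) (auto intro: order_trans[OF _ abs_ge_self])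
      then show "(L (h j))\<^sup>2 \<le> D\<^sup>2 * (dens w 0 x * X j)"
        using X0[OF j] dens_nonneg[of w 0 x] by (simp add: power_mult_distrib)
    qed
    also have "\<dots> = D\<^sup>2 * (dens w 0 x * rough w I r 0 x)"
      by (simp add: rough_eq[OF adm] X_def sum_distrib_left)
    finally have "sqrt (psi I h * (norm W)\<^sup>2) \<le> sqrt (D\<^sup>2 * (dens w 0 x * rough w I r 0 x))" by (rule real_sqrt_le_mono)
    then have "sqrt (psi I h) * norm W \<le> D * sqrt (dens w 0 x * rough w I r 0 x)"
      using D0 by (simp add: real_sqrt_mult)
    moreover have "\<bar>L a\<bar> \<le> norm a * norm W" using W(2)[OF a] Cauchy_Schwarz_ineq2[of a W] by simp
    ultimately have "sqrt (psi I h) * \<bar>L a\<bar> \<le> (D * norm a) * sqrt (dens w 0 x * rough w I r 0 x)"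
      using mult_left_mono[of "\<bar>L a\<bar>" "norm a * norm W" "sqrt (psi I h)"]
        mult_left_mono[of "sqrt (psi I h) * norm W" "D * sqrt (dens w 0 x * rough w I r 0 x)" "norm a"] psi_nonneg[of I h]
      by (simp add: mult_ac)
    then show "sqrt (psi I (\<lambda>j. mdir w (r j) 0 x)) * \<bar>\<integral>\<xi>. LX a \<theta> (gmult (- gmult x (dil th s)) \<xi>) \<partial>w\<bar> \<le>
        (D * norm a) * sqrt (dens w 0 x * rough w I r 0 x)"
      by (simp add: h_def L_def y_def)
  qed (use D0 in simp)
qed

end

section \<open>Oscillation of the density seen from the coarsest scale\<close>

context carnot
begin

lemma oscillation_hdiv:
  assumes "hdiv (dil (th ^ 2) ` cball 0 2) f"
  shows "\<exists>C\<ge>0. \<forall>w I r x s. admissible w I r \<longrightarrow> norm s \<le> 1 \<longrightarrow>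
    sqrt (psi I (\<lambda>j. mdir w (r j) 0 x)) * \<bar>\<integral>\<xi>. f (gmult (- gmult x (dil th s)) \<xi>) \<partial>w\<bar> \<le>
      C * sqrt (dens w 0 x * rough w I r 0 x)"
proof -
  let ?K = "dil (th ^ 2) ` cball 0 2"
  obtain l where l: "\<forall>(a, \<theta>)\<in>set l. a \<in> V 1 \<and> \<theta> \<in> test_on ?K" and f: "f = (\<lambda>x. \<Sum>(a, \<theta>)\<leftarrow>l. LX a \<theta> x)"
    using assms unfolding hdiv_def by blast
  show ?thesis
    using l unfolding f
  proof (induction l)
    case Nil
    then show ?case by (intro exI[of _ 0]) simp
  next
    case (Cons p l)
    obtain a \<theta> where p: "p = (a, \<theta>)" by (cases p)
    then have a: "a \<in> V 1" "\<theta> \<in> test_on ?K" using Cons.prems by auto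
    have l': "\<forall>(a, \<theta>)\<in>set l. a \<in> V 1 \<and> \<theta> \<in> test_on ?K" using Cons.prems by auto
    obtain C where C: "C \<ge> 0" "\<And>w I r x s. admissible w I r \<Longrightarrow> norm s \<le> 1 \<Longrightarrow>
        sqrt (psi I (\<lambda>j. mdir w (r j) 0 x)) * \<bar>\<integral>\<xi>. (\<Sum>(a, \<theta>)\<leftarrow>l. LX a \<theta> (gmult (- gmult x (dil th s)) \<xi>)) \<partial>w\<bar> \<le>
          C * sqrt (dens w 0 x * rough w I r 0 x)"
      using Cons.IH[OF l'] by meson
    obtain D where D: "D \<ge> 0" "\<And>w I r x s. admissible w I r \<Longrightarrow> norm s \<le> 1 \<Longrightarrow>
        sqrt (psi I (\<lambda>j. mdir w (r j) 0 x)) * \<bar>\<integral>\<xi>. LX a \<theta> (gmult (- gmult x (dil th s)) \<xi>) \<partial>w\<bar> \<le>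
          D * sqrt (dens w 0 x * rough w I r 0 x)"
      using oscillation_single[OF a] by meson
    show ?case
    proof (intro exI[of _ "D + C"] conjI allI impI)
      fix w I r and x s :: "real ^ 'n"
      assume adm: "admissible w I r" and s: "norm s \<le> 1"
      have w: "fin_borel w" using adm by (simp add: admissible_def)
      let ?y = "\<lambda>\<xi>. gmult (- gmult x (dil th s)) \<xi>"
      have i: "integrable w (\<lambda>\<xi>. LX b \<phi> (?y \<xi>))" if "\<phi> \<in> test_on ?K" for b \<phi>
      proof -
        have t: "\<phi> \<in> test_functions" by (rule test_onD[OF that])
        have [measurable]: "LX b \<phi> \<in> borel_measurable borel"
          by (intro borel_measurable_continuous_onI smooth_continuous_on smooth_LX test_smooth t)
        obtain B where "\<And>\<xi>. \<bar>LX b \<phi> \<xi>\<bar> \<le> B" using test_bounded[OF test_LX[OF t]] by blast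
        then show ?thesis by (intro fin_borel_integrable[OF w, of _ B]) auto
      qed
      have i2: "integrable w (\<lambda>\<xi>. (\<Sum>(a, \<theta>)\<leftarrow>l. LX a \<theta> (?y \<xi>)))"
        using l' by (induction l) (auto intro!: i)
      have "(\<integral>\<xi>. (\<Sum>(a, \<theta>)\<leftarrow>p # l. LX a \<theta> (?y \<xi>)) \<partial>w) =
          (\<integral>\<xi>. LX a \<theta> (?y \<xi>) \<partial>w) + (\<integral>\<xi>. (\<Sum>(a, \<theta>)\<leftarrow>l. LX a \<theta> (?y \<xi>)) \<partial>w)"
        unfolding p using i[OF a(2), of a] i2 by simp
      then have "sqrt (psi I (\<lambda>j. mdir w (r j) 0 x)) * \<bar>\<integral>\<xi>. (\<Sum>(a, \<theta>)\<leftarrow>p # l. LX a \<theta> (?y \<xi>)) \<partial>w\<bar> \<le>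
          sqrt (psi I (\<lambda>j. mdir w (r j) 0 x)) * (\<bar>\<integral>\<xi>. LX a \<theta> (?y \<xi>) \<partial>w\<bar> + \<bar>\<integral>\<xi>. (\<Sum>(a, \<theta>)\<leftarrow>l. LX a \<theta> (?y \<xi>)) \<partial>w\<bar>)"
        using psi_nonneg by (intro mult_left_mono) auto
      also have "\<dots> \<le> (D + C) * sqrt (dens w 0 x * rough w I r 0 x)"
        using C(2)[OF adm s, of x] D(2)[OF adm s, of x] unfolding distrib_left distrib_right by (rule add_mono[rotated])
      finally show "sqrt (psi I (\<lambda>j. mdir w (r j) 0 x)) * \<bar>\<integral>\<xi>. (\<Sum>(a, \<theta>)\<leftarrow>p # l. LX a \<theta> (?y \<xi>)) \<partial>w\<bar> \<le>
          (D + C) * sqrt (dens w 0 x * rough w I r 0 x)" .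
    qed (use C D in simp)
  qed
qed

lemma smooth_pk: "smooth (pk i)"
proof -
  have "smooth (\<lambda>v. pp (dil (1 / th ^ i) v) * (1 / J th ^ i))"
    by (intro smooth_mult smooth_const smooth_compose[OF smooth_pp] smooth_bounded_linear bounded_linear_dil)
  then show ?thesis by (simp add: pk_def[abs_def])
qed

lemma pk_test_on: "pk i \<in> test_on (dil (th ^ i) ` cball 0 2)"
proof -
  let ?K = "dil (th ^ i) ` cball 0 2"
  have z: "pk i v = 0" if "v \<notin> ?K" for v
  proof -
    have "dil (1 / th ^ i) v \<notin> cball 0 2"
    proof
      assume "dil (1 / th ^ i) v \<in> cball 0 2"
      then have "dil (th ^ i) (dil (1 / th ^ i) v) \<in> ?K" by (rule imageI)
      then show False using that unfolding dil_inverse(2)[OF th_pow(2)] by simp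
    qed
    then show ?thesis by (simp add: pk_def pp_zero)
  qed
  have "compact ?K"
    by (intro compact_continuous_image linear_continuous_on bounded_linear_dil compact_cball)
  then obtain R where R: "\<And>x. x \<in> ?K \<Longrightarrow> norm x \<le> R" using compact_imp_bounded bounded_iff by metis
  have "pk i \<in> test_functions"
  proof (rule test_functionsI[OF smooth_pk, where R = R])
    fix x :: "real ^ 'n" assume "norm x > R"
    then have "x \<notin> ?K" using R[of x] by linarith
    then show "pk i x = 0" by (rule z)
  qed
  then show ?thesis using z by (simp add: test_on_def)
qed

text \<open>Moving the base point from \<open>x\<close> to \<open>gmult x (dil th s)\<close>
  multiplies the argument of the kernel on the left, so the change of density is an integral of
  right-invariant derivatives of \<open>pk 2\<close>. These are horizontal divergences by
  \<open>hdiv_RX\<close>. The kernel of scale 2 is taken because its support fits the set that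
  \<open>multiscale\<close> prescribes.\<close>

lemma oscillation:
  "\<exists>C\<ge>0. \<forall>w I r x s. admissible w I r \<longrightarrow> norm s \<le> 1 \<longrightarrow>
    sqrt (psi I (\<lambda>j. mdir w (r j) 0 x)) * \<bar>dens w 2 (gmult x (dil th s)) - dens w 2 x\<bar> \<le>
      C * sqrt (dens w 0 x * rough w I r 0 x)"
proof -
  let ?K = "dil (th ^ 2) ` cball 0 2"
  have clK: "closed ?K"
    by (intro compact_imp_closed compact_continuous_image linear_continuous_on bounded_linear_dil compact_cball)
  have "\<exists>C. \<forall>b. 0 \<le> C b \<and> (\<forall>w I r x s. admissible w I r \<longrightarrow> norm s \<le> 1 \<longrightarrow>
    sqrt (psi I (\<lambda>j. mdir w (r j) 0 x)) * \<bar>\<integral>\<xi>. RX b (pk 2) (gmult (- gmult x (dil th s)) \<xi>) \<partial>w\<bar> \<le>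
      C b * sqrt (dens w 0 x * rough w I r 0 x))"
    by (rule choice) (rule allI, rule oscillation_hdiv[OF hdiv_RX[OF clK pk_test_on]])
  then obtain C where C: "\<And>b. 0 \<le> C b" "\<And>b w I r x s. admissible w I r \<Longrightarrow> norm s \<le> 1 \<Longrightarrow>
    sqrt (psi I (\<lambda>j. mdir w (r j) 0 x)) * \<bar>\<integral>\<xi>. RX b (pk 2) (gmult (- gmult x (dil th s)) \<xi>) \<partial>w\<bar> \<le>
      C b * sqrt (dens w 0 x * rough w I r 0 x)"
    by meson
  obtain S where S: "S \<ge> 0" "\<And>s. norm s \<le> 1 \<Longrightarrow> norm (dil th s) \<le> S"
  proof -
    have "bounded (dil th ` cball 0 1)"
      by (intro compact_imp_bounded compact_continuous_image linear_continuous_on bounded_linear_dil compact_cball)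
    then obtain S where S: "\<forall>x\<in>cball 0 1. norm (dil th x) \<le> S" unfolding bounded_iff by auto
    show ?thesis
    proof (rule that[of S])
      show "S \<ge> 0" using S[rule_format, of 0] by simp
    qed (use S in simp)
  qed
  define D where "D = S * (\<Sum>b\<in>(Basis :: (real ^ 'n) set). C b)"
  have D0: "D \<ge> 0" using C(1) S(1) by (simp add: D_def sum_nonneg)
  have sm: "smooth (pk 2)" by (rule smooth_pk)
  have tpk: "pk 2 \<in> test_functions" by (rule test_onD[OF pk_test_on])
  show ?thesis
  proof (intro exI[of _ D] conjI allI impI D0)
    fix w I r and x s :: "real ^ 'n"
    assume adm: "admissible w I r" and s: "norm s \<le> 1"
    have w: "fin_borel w" using adm by (simp add: admissible_def)
    have fw: "finite_measure w" and sw: "sets w = sets borel" using w by (auto simp: fin_borel_def)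
    define \<sigma> where "\<sigma> = dil th s"
    define F where "F = (\<lambda>t \<xi>. RX (- \<sigma>) (pk 2) (gmult (t *\<^sub>R (- \<sigma>)) (gmult (- x) \<xi>)))"
    \<comment> \<open>Inversion reverses the order of a product; this is why the displacement
      appears on the left and with a minus sign.\<close>
    have pt: "gmult (- gmult x (dil th (t *\<^sub>R s))) \<xi> = gmult (t *\<^sub>R (- \<sigma>)) (gmult (- x) \<xi>)" for t \<xi>
      by (simp add: neg_gmult \<sigma>_def dil_scaleR assoc)
    have cRX: "continuous_on UNIV (RX b (pk 2))" for b by (intro smooth_continuous_on smooth_RX sm)
    have RXm [measurable]: "RX b (pk 2) \<in> borel_measurable borel" for b
      by (rule borel_measurable_continuous_onI[OF cRX])
    have RXB: "\<exists>B. \<forall>y. \<bar>RX b (pk 2) y\<bar> \<le> B" for b by (rule test_bounded[OF test_RX[OF tpk]])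
    have FTC: "(\<integral>t. indicator {0..1} t *\<^sub>R F t \<xi> \<partial>lborel) =
        pk 2 (gmult (- gmult x \<sigma>) \<xi>) - pk 2 (gmult (- x) \<xi>)" for \<xi>
    proof -
      have "(\<integral>t. F t \<xi> * indicator {0..1} t \<partial>lborel) =
          pk 2 (gmult (1 *\<^sub>R (- \<sigma>)) (gmult (- x) \<xi>)) - pk 2 (gmult (0 *\<^sub>R (- \<sigma>)) (gmult (- x) \<xi>))"
      proof (rule integral_FTC_Icc_real)
        fix t :: real
        show "((\<lambda>t. pk 2 (gmult (t *\<^sub>R (- \<sigma>)) (gmult (- x) \<xi>))) has_real_derivative F t \<xi>) (at t)"
          unfolding F_def by (rule RX_curve[OF sm])
        have "continuous_on UNIV (\<lambda>t. F t \<xi>)"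
          unfolding F_def
          by (intro continuous_on_compose2[OF cRX] continuous_on_gmult continuous_intros) auto
        then show "isCont (\<lambda>t. F t \<xi>) t" by (simp add: continuous_on_eq_continuous_at)
      qed simp
      also have "\<dots> = pk 2 (gmult (- gmult x \<sigma>) \<xi>) - pk 2 (gmult (- x) \<xi>)"
        using pt[of 1 \<xi>] by (simp add: \<sigma>_def)
      finally show ?thesis by (simp add: mult.commute)
    qed
    obtain B where B: "\<And>y. \<bar>RX (- \<sigma>) (pk 2) y\<bar> \<le> B" using RXB by blast
    have d0: "density1 (\<lambda>_. 0)" by (rule density1_zero)
    have "dens w 2 (gmult x \<sigma>) - dens w 2 x = (\<integral>\<xi>. (\<integral>t. indicator {0..1} t *\<^sub>R F t \<xi> \<partial>lborel) \<partial>w)"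
      unfolding FTC dens_def using pk_integrable(1)[OF w d0]
      by (simp add: Bochner_Integration.integral_diff)
    also have "\<dots> = (\<integral>t. (\<integral>\<xi>. indicator {0..1} t *\<^sub>R F t \<xi> \<partial>w) \<partial>lborel)"
    proof (rule fubini_test[symmetric, OF fw sw, where R = 1 and B = B])
      show "(\<lambda>(t, \<xi>). F t \<xi>) \<in> borel_measurable (borel \<Otimes>\<^sub>M borel)" unfolding F_def by measurable
      show "norm (indicator {0..1} t *\<^sub>R F t \<xi>) \<le> B" for t :: real and \<xi>
        using B[of "gmult (t *\<^sub>R (- \<sigma>)) (gmult (- x) \<xi>)"]
        by (auto simp: F_def indicator_def intro: order_trans[OF abs_ge_zero])
      show "indicator {0..1} t = (0 :: real)" if "1 < norm t" for t :: real using that by (auto simp: indicator_def)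
    qed auto
    also have "\<dots> = (\<integral>t. indicator {0..1} t * (\<integral>\<xi>. F t \<xi> \<partial>w) \<partial>lborel)" by simp
    finally have eq: "dens w 2 (gmult x \<sigma>) - dens w 2 x = (\<integral>t. indicator {0..1} t * (\<integral>\<xi>. F t \<xi> \<partial>w) \<partial>lborel)" .
    let ?p = "sqrt (psi I (\<lambda>j. mdir w (r j) 0 x))" and ?q = "sqrt (dens w 0 x * rough w I r 0 x)"
    have q0: "?q \<ge> 0" by (simp add: dens_nonneg rough_nonneg[OF adm])
    have p0: "?p \<ge> 0" by (simp add: psi_nonneg)
    have key: "?p * \<bar>\<integral>\<xi>. F t \<xi> \<partial>w\<bar> \<le> D * ?q" if t: "t \<in> {0..1}" for t
    proof -
      have ts: "norm (t *\<^sub>R s) \<le> 1" using norm_scaled_le[OF t, of s] s by linarith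
      let ?G = "\<lambda>b. \<integral>\<xi>. RX b (pk 2) (gmult (- gmult x (dil th (t *\<^sub>R s))) \<xi>) \<partial>w"
      have iG: "integrable w (\<lambda>\<xi>. RX b (pk 2) (gmult (- gmult x (dil th (t *\<^sub>R s))) \<xi>))" for b
      proof -
        obtain B where "\<And>y. \<bar>RX b (pk 2) y\<bar> \<le> B" using RXB by blast
        then show ?thesis by (intro fin_borel_integrable[OF w, of _ B]) auto
      qed
      have "(\<integral>\<xi>. F t \<xi> \<partial>w) = (\<integral>\<xi>. (\<Sum>b\<in>Basis. ((- \<sigma>) \<bullet> b) * RX b (pk 2) (gmult (- gmult x (dil th (t *\<^sub>R s))) \<xi>)) \<partial>w)"
        unfolding F_def pt by (subst linear_euclidean_expansion[OF RX_linear[OF sm], of "- \<sigma>"]) simp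
      also have "\<dots> = (\<Sum>b\<in>Basis. ((- \<sigma>) \<bullet> b) * ?G b)"
        using iG by (subst Bochner_Integration.integral_sum) auto
      finally have "?p * \<bar>\<integral>\<xi>. F t \<xi> \<partial>w\<bar> = ?p * \<bar>\<Sum>b\<in>Basis. ((- \<sigma>) \<bullet> b) * ?G b\<bar>" by simp
      also have "\<dots> \<le> ?p * (\<Sum>b\<in>Basis. \<bar>((- \<sigma>) \<bullet> b) * ?G b\<bar>)"
        using p0 by (intro mult_left_mono sum_abs)
      also have "\<dots> = (\<Sum>b\<in>Basis. \<bar>(- \<sigma>) \<bullet> b\<bar> * (?p * \<bar>?G b\<bar>))"
        by (simp only: sum_distrib_left abs_mult mult.left_commute)
      also have "\<dots> \<le> (\<Sum>b\<in>(Basis :: (real ^ 'n) set). S * (C b * ?q))"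
      proof (rule sum_mono)
        fix b :: "real ^ 'n" assume b: "b \<in> Basis"
        have "\<bar>(- \<sigma>) \<bullet> b\<bar> \<le> S" using Basis_le_norm[OF b, of "- \<sigma>"] S(2)[OF s] by (simp add: \<sigma>_def)
        then show "\<bar>(- \<sigma>) \<bullet> b\<bar> * (?p * \<bar>?G b\<bar>) \<le> S * (C b * ?q)"
          using C(2)[OF adm ts, of x b] S(1) mult_nonneg_nonneg[OF p0 abs_ge_zero] by (rule mult_mono)
      qed
      also have "\<dots> = D * ?q" by (simp add: D_def sum_distrib_left sum_distrib_right mult.assoc)
      finally show ?thesis .
    qed
    have "?p * \<bar>dens w 2 (gmult x \<sigma>) - dens w 2 x\<bar> = \<bar>\<integral>t. ?p * (indicator {0..1} t * (\<integral>\<xi>. F t \<xi> \<partial>w)) \<partial>lborel\<bar>"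
      unfolding eq using p0 by (simp add: abs_mult)
    also have "\<dots> \<le> (\<integral>t. \<bar>?p * (indicator {0..1} t * (\<integral>\<xi>. F t \<xi> \<partial>w))\<bar> \<partial>lborel)"
      by (rule integral_abs_bound)
    also have "\<dots> \<le> (\<integral>t. indicator {0..1 :: real} t * (D * ?q) \<partial>lborel)"
    proof (rule Bochner_Integration.integral_mono')
      show "integrable lborel (\<lambda>t. indicator {0..1 :: real} t * (D * ?q))"
        by (intro integrable_mult_left integrable_real_indicator) auto
      show "\<bar>?p * (indicator {0..1} t * (\<integral>\<xi>. F t \<xi> \<partial>w))\<bar> \<le> indicator {0..1} t * (D * ?q)" for t :: real
        using key[of t] p0 by (auto simp: indicator_def abs_mult)
      show "0 \<le> indicator {0..1} t * (D * ?q)" for t :: real using D0 q0 by (auto simp: indicator_def)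
    qed
    also have "\<dots> = D * ?q" by simp
    finally show "?p * \<bar>dens w 2 (gmult x (dil th s)) - dens w 2 x\<bar> \<le> D * ?q" by (simp add: \<sigma>_def)
  qed
qed

section \<open>Transport of the oscillation estimate to every scale\<close>

lemma LX_dil:
  assumes \<theta>: "smooth \<theta>" and a: "a \<in> V 1"
  shows "LX a (\<lambda>v. \<theta> (dil u v)) x = u * LX a \<theta> (dil u x)"
proof -
  have sg: "smooth (\<lambda>z. \<theta> (gmult (dil u x) z))"
    by (intro smooth_compose[OF \<theta>] smooth_gmult smooth_const smooth_ident)
  have fd: "frechet_derivative (dil u) (at 0) a = dil u a"
    using frechet_derivative_at[OF bounded_linear_imp_has_derivative[OF bounded_linear_dil, of u "at 0"]] by metis
  have au: "dil u a = u *\<^sub>R a" using dil_layer[of a 1 u] a step_pos by (simp add: layer_def)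
  have "LX a (\<lambda>v. \<theta> (dil u v)) x = frechet_derivative (\<lambda>z. \<theta> (gmult (dil u x) (dil u z))) (at 0) a"
    by (simp add: LX_def gmult_dil)
  also have "\<dots> = frechet_derivative (\<lambda>z. \<theta> (gmult (dil u x) z)) (at (dil u 0)) (frechet_derivative (dil u) (at 0) a)"
    by (rule frechet_derivative_chain[OF sg smooth_bounded_linear[OF bounded_linear_dil]])
  also have "\<dots> = LX (u *\<^sub>R a) \<theta> (dil u x)" by (simp add: fd au LX_def)
  also have "\<dots> = u * LX a \<theta> (dil u x)" by (simp add: linear_scale[OF LX_linear[OF \<theta>]])
  finally show ?thesis .
qed

lemma test_dil: assumes \<theta>: "\<theta> \<in> test_functions" and u: "u \<noteq> 0" shows "(\<lambda>v. \<theta> (dil u v) :: real) \<in> test_functions"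
proof -
  obtain R where R: "\<And>x. norm x > R \<Longrightarrow> \<theta> x = 0" and sm: "smooth \<theta>" using \<theta> by (auto simp: test_functions_iff)
  have "bounded (dil (1 / u) ` cball 0 R)"
    by (intro compact_imp_bounded compact_continuous_image linear_continuous_on bounded_linear_dil compact_cball)
  then obtain S where S: "\<forall>x\<in>cball 0 R. norm (dil (1 / u) x) \<le> S" unfolding bounded_iff by auto
  show ?thesis
  proof (rule test_functionsI[of _ S])
    show "smooth (\<lambda>v. \<theta> (dil u v))" by (rule smooth_compose[OF sm smooth_bounded_linear[OF bounded_linear_dil]])
    fix x :: "real ^ 'n" assume x: "norm x > S"
    have "norm (dil u x) > R"
    proof (rule ccontr)
      assume "\<not> norm (dil u x) > R"
      then have "norm (dil (1 / u) (dil u x)) \<le> S" using S by (simp del: dil_dil dil_inverse)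
      then show False using x unfolding dil_inverse(1)[OF u] by simp
    qed
    then show "\<theta> (dil u x) = 0" by (rule R)
  qed
qed

text \<open>Dilating by \<open>1 / th ^ i\<close> turns scale \<open>i\<close> into scale 0, so that
  an estimate at scale 0 holds at every scale with the same constant.\<close>

definition zoom :: "nat \<Rightarrow> (real ^ 'n) measure \<Rightarrow> (real ^ 'n) measure" where
  "zoom i w = distr w borel (dil (1 / th ^ i))"

definition zoomf :: "nat \<Rightarrow> (real ^ 'n \<Rightarrow> real ^ 'n) \<Rightarrow> real ^ 'n \<Rightarrow> real ^ 'n" where
  "zoomf i f x = f (dil (th ^ i) x)"

lemma zoom_dil: "dil (1 / th ^ i) (dil (th ^ i) x) = x" "dil (th ^ i) (dil (1 / th ^ i) x) = x"
  "zoomf i f (dil (1 / th ^ i) x) = f x"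
  unfolding zoomf_def dil_inverse[OF th_pow(2)] by (rule refl)+

lemma integral_zoom:
  fixes g :: "real ^ 'n \<Rightarrow> 'b::{banach, second_countable_topology}"
  assumes w: "fin_borel w" and g: "g \<in> borel_measurable borel"
  shows "(\<integral>\<xi>. g \<xi> \<partial>zoom i w) = (\<integral>\<xi>. g (dil (1 / th ^ i) \<xi>) \<partial>w)"
proof -
  have [measurable_cong]: "sets w = sets borel" using w by (simp add: fin_borel_def)
  show ?thesis unfolding zoom_def using g by (intro integral_distr) measurable
qed

lemma pk_zoom: "pk l (gmult (- x) (dil (1 / th ^ i) \<xi>)) = J th ^ i * pk (l + i) (gmult (- dil (th ^ i) x) \<xi>)"
proof -
  have "gmult (- x) (dil (1 / th ^ i) \<xi>) = dil (1 / th ^ i) (gmult (- dil (th ^ i) x) \<xi>)"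
    by (simp add: gmult_dil[symmetric] dil_neg zoom_dil del: dil_dil)
  then show ?thesis using J_pos[OF th_bounds(4)] th_bounds(4)
    by (simp add: pk_def power_add field_simps)
qed

lemma dens_zoom: assumes w: "fin_borel w" shows "dens (zoom i w) l x = J th ^ i * dens w (l + i) (dil (th ^ i) x)"
proof -
  have "dens (zoom i w) l x = (\<integral>\<xi>. pk l (gmult (- x) (dil (1 / th ^ i) \<xi>)) \<partial>w)"
    unfolding dens_def by (intro integral_zoom[OF w]) measurable
  then show ?thesis unfolding pk_zoom dens_def by simp
qed

lemma density1_zoom: "density1 f \<Longrightarrow> density1 (zoomf i f)"
proof -
  assume f: "density1 f"
  then have [measurable]: "f \<in> borel_measurable borel" by (simp add: density1_def)
  have "(\<lambda>x. f (dil (th ^ i) x)) \<in> borel_measurable borel" by measurable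
  then show ?thesis using f by (simp add: density1_def zoomf_def[abs_def])
qed

lemma mdir_zoom: assumes w: "fin_borel w" and f: "density1 f"
  shows "mdir (zoom i w) (zoomf i f) l x = mdir w f (l + i) (dil (th ^ i) x)"
proof -
  have [measurable]: "zoomf i f \<in> borel_measurable borel" using density1_zoom[OF f] by (simp add: density1_def)
  have "flux (zoom i w) (zoomf i f) l x = (\<integral>\<xi>. pk l (gmult (- x) (dil (1 / th ^ i) \<xi>)) *\<^sub>R zoomf i f (dil (1 / th ^ i) \<xi>) \<partial>w)"
    unfolding flux_def by (intro integral_zoom[OF w]) measurable
  then have "flux (zoom i w) (zoomf i f) l x = J th ^ i *\<^sub>R flux w f (l + i) (dil (th ^ i) x)"
    unfolding pk_zoom flux_def zoom_dil by (simp flip: scaleR_scaleR)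
  then have "mdir (zoom i w) (zoomf i f) l x = (inverse (J th ^ i) * J th ^ i) *\<^sub>R mdir w f (l + i) (dil (th ^ i) x)"
    unfolding mdir_def dens_zoom[OF w] by (simp add: mult_ac)
  also have "inverse (J th ^ i) * J th ^ i = 1" using J_pos[OF th_bounds(4)] by simp
  finally show ?thesis by simp
qed

lemma gap_zoom: assumes w: "fin_borel w" and f: "density1 f"
  shows "gap (zoom i w) (zoomf i f) l n x = J th ^ i * gap w f (l + i) n (dil (th ^ i) x)"
proof -
  have "dil (th ^ i) (gmult x (dil (th ^ l) z)) = gmult (dil (th ^ i) x) (dil (th ^ (l + i)) z)" for z
    by (simp add: gmult_dil[symmetric] power_add mult.commute)
  then show ?thesis
    unfolding gap_def av_def dens_zoom[OF w] mdir_zoom[OF w f] by (simp add: mult.assoc add_ac)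
qed

lemma fin_borel_zoom: assumes w: "fin_borel w" shows "fin_borel (zoom i w)"
proof -
  have [measurable_cong]: "sets w = sets borel" and f: "finite_measure w" using w by (auto simp: fin_borel_def)
  show ?thesis unfolding fin_borel_def zoom_def
    by (intro conjI finite_measure.finite_measure_distr[OF f]) auto
qed

text \<open>Dilations multiply all first-layer fields by one common factor (\<open>LX_dil\<close>),
  so the vanishing of the divergences survives.\<close>

lemma admissible_zoom: assumes "admissible w I r" shows "admissible (zoom i w) I (\<lambda>j. zoomf i (r j))"
proof -
  have w: "fin_borel w" and fI: "finite I" and r: "\<And>j. j \<in> I \<Longrightarrow> density1 (r j)" "\<And>j \<xi>. j \<in> I \<Longrightarrow> r j \<xi> \<in> V 1"
    and con: "\<And>j \<phi>. j \<in> I \<Longrightarrow> \<phi> \<in> test_functions \<Longrightarrow> (\<integral>\<xi>. LX (r j \<xi>) \<phi> \<xi> \<partial>w) = 0"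
    using assms by (auto simp: admissible_def)
  have "(\<integral>\<xi>. LX (zoomf i (r j) \<xi>) \<theta> \<xi> \<partial>zoom i w) = 0" if j: "j \<in> I" and \<theta>: "\<theta> \<in> test_functions" for j \<theta>
  proof -
    have sm: "smooth \<theta>" by (rule test_smooth[OF \<theta>])
    have [measurable]: "zoomf i (r j) \<in> borel_measurable borel"
      using density1_zoom[OF r(1)[OF j]] by (simp add: density1_def)
    have [measurable]: "LX b \<theta> \<in> borel_measurable borel" for b
      by (intro borel_measurable_continuous_onI smooth_continuous_on smooth_LX sm)
    have "(\<lambda>\<xi>. LX (zoomf i (r j) \<xi>) \<theta> \<xi>) = (\<lambda>\<xi>. \<Sum>b\<in>Basis. (zoomf i (r j) \<xi> \<bullet> b) * LX b \<theta> \<xi>)"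
      by (intro ext, subst linear_euclidean_expansion[OF LX_linear[OF sm]]) simp
    then have m: "(\<lambda>\<xi>. LX (zoomf i (r j) \<xi>) \<theta> \<xi>) \<in> borel_measurable borel" by simp
    have "(\<integral>\<xi>. LX (zoomf i (r j) \<xi>) \<theta> \<xi> \<partial>zoom i w) = (\<integral>\<xi>. LX (r j \<xi>) \<theta> (dil (1 / th ^ i) \<xi>) \<partial>w)"
      unfolding integral_zoom[OF w m] zoom_dil ..
    also have "\<dots> = th ^ i * (\<integral>\<xi>. (1 / th ^ i) * LX (r j \<xi>) \<theta> (dil (1 / th ^ i) \<xi>) \<partial>w)"
      using th_pow(2)[of i] by simp
    also have "\<dots> = th ^ i * (\<integral>\<xi>. LX (r j \<xi>) (\<lambda>v. \<theta> (dil (1 / th ^ i) v)) \<xi> \<partial>w)"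
      using LX_dil[OF sm r(2)[OF j]] by simp
    also have "\<dots> = 0"
      using con[OF j test_dil[OF \<theta>, of "1 / th ^ i"]] th_pow(2)[of i] by simp
    finally show ?thesis .
  qed
  then show ?thesis
    using w fI r unfolding admissible_def by (simp add: fin_borel_zoom density1_zoom) (simp add: zoomf_def)
qed

lemma rough_zoom: assumes adm: "admissible w I r"
  shows "rough (zoom i w) I (\<lambda>j. zoomf i (r j)) l x = J th ^ i * rough w I r (l + i) (dil (th ^ i) x)"
proof -
  have w: "fin_borel w" and r: "\<And>j. j \<in> I \<Longrightarrow> density1 (r j)" using adm by (auto simp: admissible_def)
  have "(\<Sum>n. th ^ n * gap (zoom i w) (zoomf i (r j)) l (n + 2) x) =
      J th ^ i * (\<Sum>n. th ^ n * gap w (r j) (l + i) (n + 2) (dil (th ^ i) x))" if "j \<in> I" for j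
    unfolding gap_zoom[OF w r[OF that]] mult.left_commute[of _ "J th ^ i"]
    by (rule suminf_mult[OF summable_gap[OF w r[OF that]]])
  then show ?thesis
    unfolding rough_eq[OF adm] rough_eq[OF admissible_zoom[OF adm]] sum_distrib_left by (intro sum.cong refl)
qed

text \<open>Under \<open>zoom\<close> both sides of the estimate at scale 0 acquire the factor
  \<open>J th ^ i\<close>, which cancels.\<close>

lemma oscillation_level:
  obtains C where "C \<ge> 0" "\<And>w I r i x s. admissible w I r \<Longrightarrow> norm s \<le> 1 \<Longrightarrow>
    sqrt (psi I (\<lambda>j. mdir w (r j) i x)) * \<bar>dens w (i + 2) (gmult x (dil (th ^ (i + 1)) s)) - dens w (i + 2) x\<bar> \<le>
      C * sqrt (dens w i x * rough w I r i x)"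
proof -
  obtain C where C: "C \<ge> 0" "\<And>w I r x s. admissible w I r \<Longrightarrow> norm s \<le> 1 \<Longrightarrow>
    sqrt (psi I (\<lambda>j. mdir w (r j) 0 x)) * \<bar>dens w 2 (gmult x (dil th s)) - dens w 2 x\<bar> \<le>
      C * sqrt (dens w 0 x * rough w I r 0 x)"
    using oscillation by meson
  show ?thesis
  proof (rule that[OF C(1)])
    fix w I r i and x s :: "real ^ 'n"
    assume adm: "admissible w I r" and s: "norm s \<le> 1"
    have w: "fin_borel w" and r: "\<And>j. j \<in> I \<Longrightarrow> density1 (r j)" using adm by (auto simp: admissible_def)
    let ?j = "J th ^ i" and ?y = "dil (1 / th ^ i) x"
    have j0: "?j > 0" by (rule th_pow)
    have dd: "dil (th ^ i) (gmult ?y (dil th s)) = gmult x (dil (th ^ (i + 1)) s)"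
      unfolding gmult_dil[symmetric] zoom_dil by (simp add: mult.commute)
    have psi: "psi I (\<lambda>j. mdir (zoom i w) (zoomf i (r j)) 0 ?y) = psi I (\<lambda>j. mdir w (r j) i x)"
      unfolding psi_def using mdir_zoom[OF w r, of _ i 0 ?y] by (simp add: zoom_dil cong: sum.cong del: dil_dil)
    have "sqrt (psi I (\<lambda>j. mdir w (r j) i x)) * \<bar>?j * dens w (i + 2) (gmult x (dil (th ^ (i + 1)) s)) - ?j * dens w (i + 2) x\<bar> \<le>
        C * sqrt ((?j * dens w i x) * (?j * rough w I r i x))"
      using C(2)[OF admissible_zoom[OF adm, of i] s, of ?y]
      unfolding psi dens_zoom[OF w] rough_zoom[OF adm] dd zoom_dil by (simp add: add.commute)
    also have "(?j * dens w i x) * (?j * rough w I r i x) = ?j\<^sup>2 * (dens w i x * rough w I r i x)"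
      by (simp add: power2_eq_square)
    also have "C * sqrt \<dots> = ?j * (C * sqrt (dens w i x * rough w I r i x))"
      using j0 by (simp add: real_sqrt_mult)
    also have "sqrt (psi I (\<lambda>j. mdir w (r j) i x)) * \<bar>?j * dens w (i + 2) (gmult x (dil (th ^ (i + 1)) s)) - ?j * dens w (i + 2) x\<bar> =
        ?j * (sqrt (psi I (\<lambda>j. mdir w (r j) i x)) * \<bar>dens w (i + 2) (gmult x (dil (th ^ (i + 1)) s)) - dens w (i + 2) x\<bar>)"
      using j0 by (simp flip: right_diff_distrib add: abs_mult)
    finally show "sqrt (psi I (\<lambda>j. mdir w (r j) i x)) * \<bar>dens w (i + 2) (gmult x (dil (th ^ (i + 1)) s)) - dens w (i + 2) x\<bar> \<le>
        C * sqrt (dens w i x * rough w I r i x)"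
      using j0 by simp
  qed
qed

end

subsection \<open>An almost decreasing functional\<close>

text \<open>
  \<open>damp c\<close> is convex, lies below \<open>u\<^sup>2 / c\<close> and differs from \<open>u\<close> by at most \<open>c\<close>; \<open>damp_gap c U M\<close> is its
  remainder of first order at \<open>M\<close>.
\<close>

definition damp :: "real \<Rightarrow> real \<Rightarrow> real" where "damp c u = u\<^sup>2 / (u + c)"

definition damp_slope :: "real \<Rightarrow> real \<Rightarrow> real" where "damp_slope c M = (M\<^sup>2 + 2 * M * c) / (M + c)\<^sup>2"

definition damp_gap :: "real \<Rightarrow> real \<Rightarrow> real \<Rightarrow> real" where "damp_gap c U M = c\<^sup>2 * (U - M)\<^sup>2 / ((U + c) * (M + c)\<^sup>2)"

lemma
  fixes c U :: real
  assumes c: "c > 0" and U: "U \<ge> 0"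
  shows damp_nonneg: "0 \<le> damp c U" and damp_le: "damp c U \<le> U" and damp_le_square: "damp c U \<le> U\<^sup>2 / c"
  and damp_ge: "damp c U \<ge> U - c"
proof -
  have p: "U + c > 0" using c U by simp
  show "0 \<le> damp c U" using c U by (simp add: damp_def)
  show "damp c U \<le> U" using c U p by (simp add: damp_def pos_divide_le_eq power2_eq_square algebra_simps)
  show "damp c U \<le> U\<^sup>2 / c" using c U p unfolding damp_def by (intro divide_left_mono) auto
  show "damp c U \<ge> U - c" unfolding damp_def pos_le_divide_eq[OF p] by (simp add: power2_eq_square algebra_simps)
qed

context
  fixes c U M :: real
  assumes c: "c > 0" and U: "U \<ge> 0" and M: "M \<ge> 0"
begin

lemma damp_gap_nonneg: "0 \<le> damp_gap c U M"
  using c U M by (simp add: damp_gap_def)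

lemma damp_expand: "damp c U = damp c M + damp_slope c M * (U - M) + damp_gap c U M"
proof -
  have p: "U + c \<noteq> 0" "M + c \<noteq> 0" using c U M by auto
  then show ?thesis unfolding damp_def damp_slope_def damp_gap_def
    by (simp add: divide_simps) algebra
qed

text \<open>The weight \<open>U / (U + c)\<close> of the density in \<open>damp c U\<close> varies
  from scale to scale; this bounds the cost of freezing it at \<open>M / (M + c)\<close>.\<close>

lemma damp_gap_weight: "U * (U / (U + c) - M / (M + c))\<^sup>2 \<le> damp_gap c U M"
proof -
  have p: "U + c > 0" "M + c > 0" using c U M by auto
  have "U / (U + c) - M / (M + c) = c * (U - M) / ((U + c) * (M + c))"
    using p by (simp add: field_simps)
  then have "U * (U / (U + c) - M / (M + c))\<^sup>2 = (U / (U + c)) * damp_gap c U M"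
    using p by (simp add: damp_gap_def power_divide power_mult_distrib) (simp add: power2_eq_square)
  also have "\<dots> \<le> 1 * damp_gap c U M" using p c U damp_gap_nonneg by (intro mult_right_mono) auto
  finally show ?thesis by simp
qed

text \<open>A bound free of \<open>c\<close> for the case in which the density has dropped and no
  oscillation estimate with comparable densities is available.\<close>

lemma damp_gap_le_add: "damp_gap c U M \<le> U + M"
proof -
  have p: "(U + c) * (M + c)\<^sup>2 > 0" using c U M by (intro mult_pos_pos zero_less_power) auto
  have "(U + c) * (M + c)\<^sup>2 - c\<^sup>2 * (U + M) = U * M\<^sup>2 + 2 * U * M * c + c * M\<^sup>2 + M * c\<^sup>2 + c ^ 3"
    by (simp add: power2_eq_square power3_eq_cube algebra_simps)
  moreover have "\<dots> \<ge> 0" using c U M by simp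
  ultimately have 1: "c\<^sup>2 * (U + M) \<le> (U + c) * (M + c)\<^sup>2" by linarith
  have "c\<^sup>2 * (U - M)\<^sup>2 \<le> c\<^sup>2 * (U + M)\<^sup>2"
    using U M by (intro mult_left_mono) (auto simp: power2_eq_square algebra_simps)
  also have "\<dots> = (U + M) * (c\<^sup>2 * (U + M))" by (simp add: power2_eq_square)
  also have "\<dots> \<le> (U + M) * ((U + c) * (M + c)\<^sup>2)" using 1 U M by (intro mult_left_mono) auto
  finally show ?thesis using p by (simp add: damp_gap_def pos_divide_le_eq)
qed

text \<open>Since \<open>c\<close> is absent on the right, the squared oscillation of the density
  controls the remainder uniformly in \<open>c\<close>.\<close>

lemma damp_gap_le_square: "M * damp_gap c U M \<le> (U - M)\<^sup>2"
proof -
  have p: "(U + c) * (M + c)\<^sup>2 > 0" using c U M by (intro mult_pos_pos zero_less_power) auto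
  have "(U + c) * (M + c)\<^sup>2 - M * c\<^sup>2 = U * (M + c)\<^sup>2 + c * M\<^sup>2 + M * c\<^sup>2 + c ^ 3"
    by (simp add: power2_eq_square power3_eq_cube algebra_simps)
  moreover have "\<dots> \<ge> 0" using c U M by simp
  ultimately have "M * c\<^sup>2 \<le> (U + c) * (M + c)\<^sup>2" by linarith
  then have "(M * c\<^sup>2) * (U - M)\<^sup>2 \<le> ((U + c) * (M + c)\<^sup>2) * (U - M)\<^sup>2" by (intro mult_right_mono) auto
  then show ?thesis using p by (simp add: damp_gap_def pos_divide_le_eq mult_ac)
qed

text \<open>A joint expansion of the density \<open>U\<close> about \<open>M\<close> and of a
  direction component \<open>a + d\<close> about \<open>a\<close>. Along the walk the terms linear
  in \<open>U - M\<close> and in \<open>U * d\<close> average to zero. Young's inequality absorbs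
  the mixed term, which doubles both remainders.\<close>

lemma damp_square_expand:
  "damp c U * (a + d)\<^sup>2 \<le> a\<^sup>2 * (damp c M + damp_slope c M * (U - M) + 2 * damp_gap c U M) + 2 * a * (M / (M + c)) * (U * d) + 2 * (U * d\<^sup>2)"
proof -
  define g where "g = U / (U + c)"
  define g' where "g' = M / (M + c)"
  have g: "g \<le> 1" and B: "damp c U = U * g" using c U by (auto simp: g_def damp_def power2_eq_square)
  have 1: "a\<^sup>2 * (U * (g - g')\<^sup>2) \<le> a\<^sup>2 * damp_gap c U M"
    using damp_gap_weight by (intro mult_left_mono) (auto simp: g_def g'_def)
  have 2: "U * g * d\<^sup>2 \<le> U * d\<^sup>2" using mult_right_mono[OF mult_left_mono[OF g U], of "d\<^sup>2"] by simp
  have 3: "2 * a * U * (g - g') * d \<le> a\<^sup>2 * (U * (g - g')\<^sup>2) + U * d\<^sup>2"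
  proof -
    have "0 \<le> U * (a * (g - g') - d)\<^sup>2" using U by simp
    then show ?thesis by (simp add: power2_eq_square algebra_simps)
  qed
  have "damp c U * (a + d)\<^sup>2 = a\<^sup>2 * damp c U + 2 * a * g' * (U * d) + 2 * a * U * (g - g') * d + U * g * d\<^sup>2"
    unfolding B by (simp add: power2_eq_square algebra_simps)
  also have "\<dots> \<le> a\<^sup>2 * damp c U + 2 * a * g' * (U * d) + (a\<^sup>2 * damp_gap c U M + U * d\<^sup>2) + U * d\<^sup>2"
    using 1 2 3 by linarith
  also have "a\<^sup>2 * damp c U = a\<^sup>2 * (damp c M + damp_slope c M * (U - M) + damp_gap c U M)" by (subst damp_expand) simp
  finally show ?thesis by (simp add: g'_def algebra_simps)
qed

end

context carnot
begin

text \<open>The sums are continuous in \<open>v\<close>, so a countable dense set of unit vectors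
  suffices; this makes \<open>psi\<close> measurable along measurable fields.\<close>

lemma psi_countable:
  obtains T where "countable T" "T \<noteq> {}" "\<And>I h. psi I h = (INF v\<in>T. \<Sum>j\<in>I. (h j \<bullet> v)\<^sup>2)"
proof -
  let ?S = "{v \<in> V 1. norm v = 1}"
  obtain T where T: "countable T" "T \<subseteq> ?S" "?S \<subseteq> closure T" by (rule separable)
  have ne: "T \<noteq> {}" using T(3) V1_unit_exists by auto
  show ?thesis
  proof (rule that[OF T(1) ne])
    fix I :: "nat set" and h :: "nat \<Rightarrow> real ^ 'n"
    let ?f = "\<lambda>v. \<Sum>j\<in>I. (h j \<bullet> v)\<^sup>2"
    have bdd: "bdd_below (?f ` X)" for X by (auto intro!: bdd_belowI[of _ 0] sum_nonneg)
    show "psi I h = (INF v\<in>T. ?f v)"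
    proof (rule antisym)
      show "psi I h \<le> (INF v\<in>T. ?f v)" unfolding psi_def by (intro cINF_superset_mono ne bdd T) auto
      have "closed {v. (INF v\<in>T. ?f v) \<le> ?f v}" by (intro closed_Collect_le continuous_intros)
      moreover have "T \<subseteq> {v. (INF v\<in>T. ?f v) \<le> ?f v}" using bdd by (auto intro: cINF_lower)
      ultimately have "closure T \<subseteq> {v. (INF v\<in>T. ?f v) \<le> ?f v}" by (rule closure_minimal[rotated])
      then show "(INF v\<in>T. ?f v) \<le> psi I h"
        unfolding psi_def using V1_unit_exists T(3) by (intro cINF_greatest) auto
    qed
  qed
qed

lemma psi_borel: assumes "\<And>j. j \<in> I \<Longrightarrow> f j \<in> borel_measurable M"
  shows "(\<lambda>x. psi I (\<lambda>j. f j x)) \<in> borel_measurable M"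
proof (rule psi_countable)
  fix T assume T: "countable T" "T \<noteq> {}" "\<And>I h. psi I h = (INF v\<in>T. \<Sum>j\<in>I. (h j \<bullet> v)\<^sup>2)"
  show ?thesis unfolding T(3)
    using assms by (intro borel_measurable_cINF T(1) borel_measurable_sum) (auto intro!: bdd_belowI[of _ 0] sum_nonneg)
qed

lemma psi_le: assumes "\<And>j. j \<in> I \<Longrightarrow> norm (h j) \<le> 1" shows "psi I h \<le> card I"
proof -
  obtain v where v: "v \<in> V 1" "norm v = 1" using V1_unit_exists by auto
  have "psi I h \<le> (\<Sum>j\<in>I. (h j \<bullet> v)\<^sup>2)" using psi_lower[OF v(1), of I h] v(2) by simp
  also have "\<dots> \<le> (\<Sum>j\<in>I. 1)"
  proof (rule sum_mono)
    fix j assume "j \<in> I"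
    then have "\<bar>h j \<bullet> v\<bar> \<le> 1" using Cauchy_Schwarz_ineq2[of "h j" v] assms[of j] v(2) by simp
    then show "(h j \<bullet> v)\<^sup>2 \<le> 1" by (simp add: abs_square_le_1)
  qed
  finally show ?thesis by simp
qed

text \<open>For a fixed unit \<open>v\<close> in \<open>V 1\<close> the expansion
  \<open>damp_square_expand\<close> is averaged over one step: the linear terms vanish by
  \<open>dens_av\<close> and \<open>flux_av\<close>, leaving the convexity remainder and the
  conditional variance \<open>gap\<close>. Only afterwards is \<open>v\<close> chosen as a
  near-minimiser for the mean directions at \<open>x\<close>.\<close>

lemma functional_step_pointwise:
  assumes adm: "admissible w I r" and c: "c > 0"
  shows "av k 1 (\<lambda>y. damp c (dens w (k + 1) y) * psi I (\<lambda>j. mdir w (r j) (k + 1) y)) x \<le>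
    (damp c (dens w k x) + 2 * av k 1 (\<lambda>y. damp_gap c (dens w (k + 1) y) (dens w k x)) x) * psi I (\<lambda>j. mdir w (r j) k x) +
    2 * (\<Sum>j\<in>I. gap w (r j) k 1 x)"
proof -
  have w: "fin_borel w" and fI: "finite I" and r: "\<And>j. j \<in> I \<Longrightarrow> density1 (r j)"
    using adm by (auto simp: admissible_def)
  define P where "P = Pn 1"
  interpret P: prob_space P unfolding P_def by (rule prob_space_Pn)
  have [measurable_cong]: "sets P = sets borel" by (simp add: P_def)
  define y where "y = (\<lambda>z. gmult x (dil (th ^ k) z))"
  have [measurable]: "y \<in> borel_measurable P" unfolding y_def by measurable
  note [measurable] = dens_borel[OF w]
  define U where "U = (\<lambda>z. dens w (k + 1) (y z))"
  define H where "H = (\<lambda>j z. mdir w (r j) (k + 1) (y z))"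
  define M where "M = dens w k x"
  define h where "h = (\<lambda>j. mdir w (r j) k x)"
  have U0: "U z \<ge> 0" and M0: "M \<ge> 0" for z by (simp_all add: U_def M_def dens_nonneg)
  have mU [measurable]: "U \<in> borel_measurable P" unfolding U_def by measurable
  have mH: "H j \<in> borel_measurable P" if "j \<in> I" for j
    unfolding H_def using measurable_compose[OF _ mdir_borel[OF w r[OF that]]] by measurable
  obtain B where B: "\<And>z. U z \<le> B" using dens_bounded[OF w, of "k + 1"] by (auto simp: U_def abs_le_iff)
  have H1: "norm (H j z) \<le> 1" and h1: "norm (h j) \<le> 1" if "j \<in> I" for j z
    using mdir_le[OF w r[OF that]] by (auto simp: H_def h_def)
  have iU: "integrable P U"
    using B U0 by (intro P.integrable_const_bound[of _ B]) auto
  have EU: "(\<integral>z. U z \<partial>P) = M"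
    using dens_av[OF w, of k x 1] by (simp add: M_def U_def av_def P_def y_def)
  have iH: "integrable P (\<lambda>z. U z *\<^sub>R H j z)" if j: "j \<in> I" for j
    using B U0 H1[OF j] mH[OF j] by (intro Bochner_Integration.integrable_bound[OF iU]) (auto intro!: AE_I2 mult_left_le)
  have EH: "(\<integral>z. U z *\<^sub>R H j z \<partial>P) = M *\<^sub>R h j" if j: "j \<in> I" for j
    using flux_av[OF w r[OF j], of k x 1] flux_eq[OF w r[OF j]]
    by (simp add: M_def U_def H_def h_def av_def P_def y_def)
  have iD: "integrable P (\<lambda>z. U z * (norm (H j z - h j))\<^sup>2)" if j: "j \<in> I" for j
  proof (rule Bochner_Integration.integrable_bound[OF integrable_mult_left[OF iU, of 4]])
    show "(\<lambda>z. U z * (norm (H j z - h j))\<^sup>2) \<in> borel_measurable P" using mH[OF j] by measurable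
    have "(norm (H j z - h j))\<^sup>2 \<le> 2\<^sup>2" for z
      using norm_triangle_ineq4[of "H j z" "h j"] H1[OF j, of z] h1[OF j] by (intro power_mono) auto
    then show "AE z in P. norm (U z * (norm (H j z - h j))\<^sup>2) \<le> norm (U z * 4)"
      using U0 by (auto intro!: AE_I2 mult_left_mono)
  qed
  have ED: "(\<integral>z. U z * (norm (H j z - h j))\<^sup>2 \<partial>P) = gap w (r j) k 1 x" for j
    by (simp add: gap_def av_def P_def U_def H_def h_def y_def)
  have ib: "integrable P (\<lambda>z. damp_gap c (U z) M)"
  proof (rule Bochner_Integration.integrable_bound[OF Bochner_Integration.integrable_add[OF iU P.integrable_const[of M]]])
    show "(\<lambda>z. damp_gap c (U z) M) \<in> borel_measurable P" unfolding damp_gap_def by measurable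
    show "AE z in P. norm (damp_gap c (U z) M) \<le> norm (U z + M)"
      using damp_gap_nonneg[OF c U0 M0] damp_gap_le_add[OF c U0 M0] U0 M0 by (intro AE_I2) auto
  qed
  define Q where "Q = (\<integral>z. damp_gap c (U z) M \<partial>P)"
  have Q0: "Q \<ge> 0" unfolding Q_def by (intro integral_nonneg_AE AE_I2 damp_gap_nonneg c U0 M0)
  have ipsi: "integrable P (\<lambda>z. damp c (U z) * psi I (\<lambda>j. H j z))"
  proof (rule Bochner_Integration.integrable_bound[OF integrable_mult_left[OF iU, of "card I"]])
    have [measurable]: "(\<lambda>z. psi I (\<lambda>j. H j z)) \<in> borel_measurable P" by (rule psi_borel[OF mH])
    show "(\<lambda>z. damp c (U z) * psi I (\<lambda>j. H j z)) \<in> borel_measurable P" unfolding damp_def by measurable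
    have "damp c (U z) * psi I (\<lambda>j. H j z) \<le> U z * real (card I)" for z
      using damp_le[OF c U0] psi_le[of I "\<lambda>j. H j z"] H1 U0 psi_nonneg by (intro mult_mono) auto
    then show "AE z in P. norm (damp c (U z) * psi I (\<lambda>j. H j z)) \<le> norm (U z * real (card I))"
      using damp_nonneg[OF c U0] psi_nonneg[where I = I] U0 by (intro AE_I2) (simp add: abs_mult)
  qed
  have key: "(\<integral>z. damp c (U z) * psi I (\<lambda>j. H j z) \<partial>P) \<le>
      (damp c M + 2 * Q) * (\<Sum>j\<in>I. (h j \<bullet> v)\<^sup>2) + 2 * (\<Sum>j\<in>I. gap w (r j) k 1 x)"
    if v: "v \<in> V 1" "norm v = 1" for v
  proof -
    define a where "a = (\<lambda>j. h j \<bullet> v)"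
    \<comment> \<open>The linear term is written through \<open>U z *\<^sub>R H j z\<close> and
      \<open>U z\<close>, whose means are known from \<open>EH\<close> and \<open>EU\<close>, so
      that it visibly integrates to zero.\<close>
    define G where "G = (\<lambda>j z. (a j)\<^sup>2 * (damp c M + damp_slope c M * (U z - M) + 2 * damp_gap c (U z) M) +
      2 * a j * (M / (M + c)) * ((U z *\<^sub>R H j z) \<bullet> v - a j * U z) + 2 * (U z * (norm (H j z - h j))\<^sup>2))"
    have iG: "integrable P (G j)" if "j \<in> I" for j
      unfolding G_def using that iU iH iD ib
      by (intro Bochner_Integration.integrable_add Bochner_Integration.integrable_diff integrable_mult_right P.integrable_const integrable_inner_left)
    have EG: "(\<integral>z. G j z \<partial>P) = (a j)\<^sup>2 * (damp c M + 2 * Q) + 2 * gap w (r j) k 1 x" if j: "j \<in> I" for j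
    proof -
      have "(\<integral>z. (U z *\<^sub>R H j z) \<bullet> v \<partial>P) = a j * M"
        using integral_inner_left[OF iH[OF j], of v] EH[OF j] by (simp add: a_def)
      moreover have "integrable P (\<lambda>z. (U z *\<^sub>R H j z) \<bullet> v)" by (rule integrable_inner_left[OF iH[OF j]])
      ultimately show ?thesis
        unfolding G_def using iU ib iD[OF j]
        by (simp add: EU ED Q_def[symmetric] P.prob_space del: inner_scaleR_left)
    qed
    have "damp c (U z) * psi I (\<lambda>j. H j z) \<le> (\<Sum>j\<in>I. G j z)" for z
    proof -
      have "damp c (U z) * psi I (\<lambda>j. H j z) \<le> damp c (U z) * (\<Sum>j\<in>I. (H j z \<bullet> v)\<^sup>2)"
        using psi_lower[OF v(1), of I "\<lambda>j. H j z"] v(2) damp_nonneg[OF c U0] by (intro mult_left_mono) auto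
      also have "\<dots> = (\<Sum>j\<in>I. damp c (U z) * (a j + (H j z - h j) \<bullet> v)\<^sup>2)"
        by (simp add: sum_distrib_left a_def inner_diff_left)
      also have "\<dots> \<le> (\<Sum>j\<in>I. G j z)"
      proof (rule sum_mono)
        fix j
        let ?d = "(H j z - h j) \<bullet> v"
        have "damp c (U z) * (a j + ?d)\<^sup>2 \<le> (a j)\<^sup>2 * (damp c M + damp_slope c M * (U z - M) + 2 * damp_gap c (U z) M) +
            2 * a j * (M / (M + c)) * (U z * ?d) + 2 * (U z * ?d\<^sup>2)"
          by (rule damp_square_expand[OF c U0 M0])
        also have "?d\<^sup>2 \<le> (norm (H j z - h j))\<^sup>2"
          using Cauchy_Schwarz_ineq2[of "H j z - h j" v] v(2) by (metis abs_norm_cancel abs_le_square_iff mult.right_neutral)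
        then have "(a j)\<^sup>2 * (damp c M + damp_slope c M * (U z - M) + 2 * damp_gap c (U z) M) +
            2 * a j * (M / (M + c)) * (U z * ?d) + 2 * (U z * ?d\<^sup>2) \<le> (a j)\<^sup>2 * (damp c M + damp_slope c M * (U z - M) + 2 * damp_gap c (U z) M) +
            2 * a j * (M / (M + c)) * (U z * ?d) + 2 * (U z * (norm (H j z - h j))\<^sup>2)"
          using U0 by (intro add_left_mono mult_left_mono) auto
        also have "U z * ?d = (U z *\<^sub>R H j z) \<bullet> v - a j * U z" by (simp add: a_def inner_diff_left algebra_simps)
        finally show "damp c (U z) * (a j + ?d)\<^sup>2 \<le> G j z" by (simp add: G_def)
      qed
      finally show ?thesis .
    qed
    then have "(\<integral>z. damp c (U z) * psi I (\<lambda>j. H j z) \<partial>P) \<le> (\<integral>z. (\<Sum>j\<in>I. G j z) \<partial>P)"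
      using iG by (intro integral_mono ipsi Bochner_Integration.integrable_sum)
    also have "\<dots> = (\<Sum>j\<in>I. (a j)\<^sup>2 * (damp c M + 2 * Q) + 2 * gap w (r j) k 1 x)"
      using iG EG by (subst Bochner_Integration.integral_sum) auto
    finally show ?thesis by (simp add: sum.distrib sum_distrib_left sum_distrib_right a_def mult.commute)
  qed
  have "(\<integral>z. damp c (U z) * psi I (\<lambda>j. H j z) \<partial>P) \<le> (damp c M + 2 * Q) * psi I h + 2 * (\<Sum>j\<in>I. gap w (r j) k 1 x)"
  proof (rule field_le_epsilon)
    fix e :: real assume e: "e > 0"
    define q where "q = damp c M + 2 * Q"
    have q: "q \<ge> 0" using damp_nonneg[OF c M0] Q0 by (simp add: q_def)
    obtain v where v: "v \<in> V 1" "norm v = 1" "(\<Sum>j\<in>I. (h j \<bullet> v)\<^sup>2) < psi I h + e / (q + 1)"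
      using psi_approx[where e = "e / (q + 1)" and I = I and h = h] e q by auto
    have "q * (\<Sum>j\<in>I. (h j \<bullet> v)\<^sup>2) \<le> q * (psi I h + e / (q + 1))" using v(3) q by (intro mult_left_mono) auto
    also have "\<dots> \<le> q * psi I h + e" using q e by (simp add: distrib_left pos_divide_le_eq)
    finally show "(\<integral>z. damp c (U z) * psi I (\<lambda>j. H j z) \<partial>P) \<le> (damp c M + 2 * Q) * psi I h + 2 * (\<Sum>j\<in>I. gap w (r j) k 1 x) + e"
      using key[OF v(1,2)] by (simp add: q_def)
  qed
  then show ?thesis by (simp add: av_def P_def U_def H_def h_def M_def Q_def y_def)
qed

text \<open>Compares the mean directions of two scales at the same point. By convexity the left side
  is at most a one-step average at scale \<open>i + 1\<close>. The density of that step is bounded,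
  and \<open>Pn_lower\<close> bounds the resulting Lebesgue integral by the two-step average from
  scale \<open>i\<close> that defines \<open>gap\<close>.\<close>

lemma freeze_gap:
  obtains C where "C \<ge> 0" "\<And>w f i x. fin_borel w \<Longrightarrow> density1 f \<Longrightarrow>
    dens w (i + 1) x * (norm (mdir w f (i + 1) x - mdir w f i x))\<^sup>2 \<le> C * gap w f i 2 x"
proof (rule Pn_lower)
  fix c
  assume c: "c > 0" and lo: "\<And>n B (f :: real ^ 'n \<Rightarrow> real). f \<in> borel_measurable borel \<Longrightarrow> (\<And>x. 0 \<le> f x) \<Longrightarrow> (\<And>x. f x \<le> B) \<Longrightarrow>
      c * (\<integral>v. indicator (dil th ` cball 0 3) v * f v \<partial>lborel) \<le> (\<integral>x. f x \<partial>Pn (Suc n))"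
  obtain b where b: "\<And>x. \<bar>qq x\<bar> \<le> b" using qq_bounded by blast
  have b0: "b \<ge> 0" using b[of 0] by linarith
  have j0: "J th > 0" using J_pos[OF th_bounds(4)] .
  show ?thesis
  \<comment> \<open>Here \<open>b\<close> bounds the step density, \<open>J th\<close> is the
    Jacobian between the two scales, and \<open>c\<close> comes from
    \<open>Pn_lower\<close>.\<close>
  proof (rule that[of "b / J th / c"])
    show "b / J th / c \<ge> 0" using c b0 j0 by simp
    fix w f i and x :: "real ^ 'n"
    assume w: "fin_borel w" and f: "density1 f"
    define e where "e = mdir w f i x"
    have e: "norm e \<le> 1" unfolding e_def by (rule mdir_le[OF w f])
    define F where "F = (\<lambda>y. dens w (i + 2) y * (norm (mdir w f (i + 2) y - e))\<^sup>2)"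
    have Fm [measurable]: "F \<in> borel_measurable borel" unfolding F_def by (rule gap_integrand(1)[OF w f e])
    obtain B where B: "\<And>y. \<bar>F y\<bar> \<le> B" using gap_integrand(2)[OF w f e] unfolding F_def by blast
    have F0: "F y \<ge> 0" for y by (simp add: F_def dens_nonneg)
    define h where "h = mdir w f (i + 1) x"
    note [measurable] = dens_borel[OF w] mdir_borel[OF w f]
    interpret Q: prob_space Qm by (rule prob_space_Qm)
    define y where "y = (\<lambda>z. gmult x (dil (th ^ (i + 1)) z))"
    have [measurable]: "y \<in> borel_measurable borel" unfolding y_def by measurable
    have avQ: "av (i + 1) 1 G x = (\<integral>z. G (y z) \<partial>Qm)" if "G \<in> borel_measurable borel" "\<And>x. norm (G x) \<le> C"
      for C and G :: "real ^ 'n \<Rightarrow> 'b::{banach, second_countable_topology}"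
      unfolding y_def by (rule av_1[OF that])
    obtain D where D: "\<And>y. \<bar>dens w (i + 2) y\<bar> \<le> D" using dens_bounded[OF w] by blast
    have iU: "integrable Qm (\<lambda>z. dens w (i + 2) (y z))"
      using D by (intro Q.integrable_const_bound[of _ D]) auto
    have NB: "norm (flux w f (i + 2) y) \<le> D" for y using flux_le[OF w f, of "i + 2" y] D[of y] by linarith
    note [measurable] = flux_borel[OF w f]
    have iN: "integrable Qm (\<lambda>z. flux w f (i + 2) (y z))"
      using NB by (intro Q.integrable_const_bound[of _ D]) auto
    have iF: "integrable Qm (\<lambda>z. F (y z))"
      using B by (intro Q.integrable_const_bound[of _ B]) auto
    have EU: "(\<integral>z. dens w (i + 2) (y z) \<partial>Qm) = dens w (i + 1) x"
      using dens_av[OF w, of "i + 1" x 1] avQ[OF dens_borel[OF w, of "i + 2"], of D] D by simp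
    have EN: "(\<integral>z. flux w f (i + 2) (y z) \<partial>Qm) = dens w (i + 1) x *\<^sub>R h"
      using flux_av[OF w f, of "i + 1" x 1] avQ[OF flux_borel[OF w f, of "i + 2"], of D] NB flux_eq[OF w f, of "i + 1" x]
      by (simp add: h_def)
    \<comment> \<open>The added inner product has mean zero because \<open>h\<close> is the mean
      direction; with it the integrand becomes the tangent minorant of \<open>F\<close>.\<close>
    have "dens w (i + 1) x * (norm (h - e))\<^sup>2 = (\<integral>z. dens w (i + 2) (y z) * (norm (h - e))\<^sup>2 +
        2 * ((flux w f (i + 2) (y z) - dens w (i + 2) (y z) *\<^sub>R h) \<bullet> (h - e)) \<partial>Qm)"
      using iU iN EU EN by (simp add: inner_diff_left)
    also have "\<dots> \<le> (\<integral>z. F (y z) \<partial>Qm)"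
    proof (rule integral_mono)
      show "integrable Qm (\<lambda>z. dens w (i + 2) (y z) * (norm (h - e))\<^sup>2 + 2 * ((flux w f (i + 2) (y z) - dens w (i + 2) (y z) *\<^sub>R h) \<bullet> (h - e)))"
        using iU iN by (intro Bochner_Integration.integrable_add integrable_mult_right integrable_mult_left integrable_inner_left Bochner_Integration.integrable_diff integrable_scaleR_left)
      fix z
      let ?U = "dens w (i + 2) (y z)" and ?H = "mdir w f (i + 2) (y z)"
      have "(norm (?H - e))\<^sup>2 = (norm (h - e))\<^sup>2 + 2 * ((?H - h) \<bullet> (h - e)) + (norm (?H - h))\<^sup>2"
        by (simp add: power2_norm_eq_inner inner_diff_left inner_diff_right inner_commute)
      then have "?U * ((norm (h - e))\<^sup>2 + 2 * ((?H - h) \<bullet> (h - e))) \<le> ?U * (norm (?H - e))\<^sup>2"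
        using dens_nonneg by (intro mult_left_mono) auto
      then show "?U * (norm (h - e))\<^sup>2 + 2 * ((flux w f (i + 2) (y z) - ?U *\<^sub>R h) \<bullet> (h - e)) \<le> F (y z)"
        unfolding flux_eq[OF w f] F_def by (simp add: algebra_simps inner_diff_left)
    qed (rule iF)
    also have "\<dots> = (\<integral>z. qq z * F (y z) \<partial>lborel)" by (subst integral_Qm) simp_all
    also have "\<dots> = (\<integral>z. qq (dil (1 / th) (dil th z)) * F (gmult x (dil (th ^ i) (dil th z))) \<partial>lborel)"
      by (simp add: y_def th_bounds mult.commute)
    also have "\<dots> = (1 / J th) * (\<integral>v. qq (dil (1 / th) v) * F (gmult x (dil (th ^ i) v)) \<partial>lborel)"
      using integral_dil[of "\<lambda>v. qq (dil (1 / th) v) * F (gmult x (dil (th ^ i) v))" th] th_bounds by simp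
    \<comment> \<open>The rescaled step density vanishes outside the dilated unit ball, which lies
      in the set on which \<open>Pn_lower\<close> gives control.\<close>
    also have "\<dots> \<le> (1 / J th) * (\<integral>v. b * (indicator (dil th ` cball 0 3) v * F (gmult x (dil (th ^ i) v))) \<partial>lborel)"
    proof (intro mult_left_mono Bochner_Integration.integral_mono')
      have "integrable lborel (\<lambda>z. indicator (dil th ` cball 0 3) z * F (gmult x (dil (th ^ i) (gmult 0 z))))"
        using B by (intro ball_integrable[where x = 0]) auto
      then show "integrable lborel (\<lambda>v. b * (indicator (dil th ` cball 0 3) v * F (gmult x (dil (th ^ i) v))))" by simp
      fix v
      show "0 \<le> b * (indicator (dil th ` cball 0 3) v * F (gmult x (dil (th ^ i) v)))" using b0 F0 by simp
      show "qq (dil (1 / th) v) * F (gmult x (dil (th ^ i) v)) \<le> b * (indicator (dil th ` cball 0 3) v * F (gmult x (dil (th ^ i) v)))"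
      proof (cases "v \<in> dil th ` cball 0 3")
        case True
        then show ?thesis using b[of "dil (1 / th) v"] F0 by (auto intro!: mult_right_mono)
      next
        case False
        have "norm (dil (1 / th) v) > 3"
        proof (rule ccontr)
          assume "\<not> norm (dil (1 / th) v) > 3"
          then have "dil th (dil (1 / th) v) \<in> dil th ` cball 0 3" by (intro imageI) simp
          then show False using False unfolding dil_inverse(2)[OF th_bounds(4)] by simp
        qed
        then show ?thesis using False by (simp add: qq_zero)
      qed
    qed (use j0 in simp)
    also have "\<dots> = b / J th / c * (c * (\<integral>v. indicator (dil th ` cball 0 3) v * F (gmult x (dil (th ^ i) v)) \<partial>lborel))"
      using c by simp
    also have "\<dots> \<le> b / J th / c * (\<integral>v. F (gmult x (dil (th ^ i) v)) \<partial>Pn (Suc 1))"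
    proof (rule mult_left_mono[OF lo])
      show "F (gmult x (dil (th ^ i) v)) \<le> B" for v using B[of "gmult x (dil (th ^ i) v)"] by linarith
    qed (use c b0 j0 F0 in auto)
    also have "(\<integral>v. F (gmult x (dil (th ^ i) v)) \<partial>Pn (Suc 1)) = gap w f i 2 x"
      by (simp add: gap_def av_def F_def e_def numeral_2_eq_2)
    finally show "dens w (i + 1) x * (norm (mdir w f (i + 1) x - mdir w f i x))\<^sup>2 \<le> b / J th / c * gap w f i 2 x"
      by (simp add: h_def e_def)
  qed
qed

end

text \<open>A shift by \<open>p\<close> consists of \<open>p\<close> unit shifts, each of which
  telescopes to at most \<open>m\<close>.\<close>

lemma sum_shift_difference_le:
  fixes g :: "nat \<Rightarrow> real"
  assumes "\<And>i. 0 \<le> g i" "\<And>i. g i \<le> m"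
  shows "(\<Sum>i<N. g (i + p) - g i) \<le> p * m"
proof (induction p)
  case (Suc p)
  have "(\<Sum>i<N. g (i + Suc p) - g i) = (\<Sum>i<N. g (i + p) - g i) + (\<Sum>i<N. g (Suc i + p) - g (i + p))"
    by (simp add: sum_subtractf)
  also have "(\<Sum>i<N. g (Suc i + p) - g (i + p)) = g (N + p) - g p"
    using sum_lessThan_telescope[of "\<lambda>i. g (i + p)" N] by simp
  also have "\<dots> \<le> m" using assms(1)[of p] assms(2)[of "N + p"] by linarith
  finally show ?case using Suc by (simp add: algebra_simps)
qed simp

text \<open>Summing the recursion bounds the partial sums of \<open>f\<close> by half of themselves
  plus a constant.\<close>

lemma summable_halving:
  fixes f a :: "nat \<Rightarrow> real"
  assumes f: "\<And>i. f (Suc i) = f i / 2 + a i" and "\<And>i. 0 \<le> f i" and a: "summable a" "\<And>i. 0 \<le> a i"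
  shows "summable f"
proof (rule summableI_nonneg_bounded)
  fix N
  have "(\<Sum>i<N. f i) = 2 * f 0 + 2 * (\<Sum>i<N. a i) - 2 * f N"
    by (induction N) (auto simp: f)
  also have "(\<Sum>i<N. a i) \<le> (\<Sum>i. a i)" using a by (intro sum_le_suminf) auto
  finally show "(\<Sum>i<N. f i) \<le> 2 * f 0 + 2 * (\<Sum>i. a i)" using assms(2)[of N] by linarith
qed (rule assms(2))

section \<open>The convexity remainder, scale by scale\<close>

context carnot
begin

text \<open>The oscillation constant is squared and moved under the root so that a single
  \<open>K\<close> covers both estimates.\<close>

lemma level_facts:
  obtains K where "K \<ge> 0"
    "\<And>w I r i x. admissible w I r \<Longrightarrow>
      dens w (i + 1) x * (\<Sum>j\<in>I. (norm (mdir w (r j) (i + 1) x - mdir w (r j) i x))\<^sup>2) \<le> K * rough w I r i x"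
    "\<And>w I r i x s. admissible w I r \<Longrightarrow> norm s \<le> 1 \<Longrightarrow>
      sqrt (psi I (\<lambda>j. mdir w (r j) i x)) * \<bar>dens w (i + 2) (gmult x (dil (th ^ (i + 1)) s)) - dens w (i + 2) x\<bar> \<le>
        sqrt (K * (dens w i x * rough w I r i x))"
proof (rule freeze_gap, rule oscillation_level)
  fix C D :: real
  assume C: "C \<ge> 0" and fg: "\<And>w f i x. fin_borel w \<Longrightarrow> density1 f \<Longrightarrow>
    dens w (i + 1) x * (norm (mdir w f (i + 1) x - mdir w f i x))\<^sup>2 \<le> C * gap w f i 2 x"
    and D: "D \<ge> 0" and osc: "\<And>w I r i x s. admissible w I r \<Longrightarrow> norm s \<le> 1 \<Longrightarrow>
    sqrt (psi I (\<lambda>j. mdir w (r j) i x)) * \<bar>dens w (i + 2) (gmult x (dil (th ^ (i + 1)) s)) - dens w (i + 2) x\<bar> \<le>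
      D * sqrt (dens w i x * rough w I r i x)"
  show ?thesis
  proof (rule that[of "C + D\<^sup>2"])
    fix w I r i and x :: "real ^ 'n"
    assume adm: "admissible w I r"
    have w: "fin_borel w" and r: "\<And>j. j \<in> I \<Longrightarrow> density1 (r j)" using adm by (auto simp: admissible_def)
    have R0: "rough w I r i x \<ge> 0" by (rule rough_nonneg[OF adm])
    have "dens w (i + 1) x * (\<Sum>j\<in>I. (norm (mdir w (r j) (i + 1) x - mdir w (r j) i x))\<^sup>2) \<le> (\<Sum>j\<in>I. C * gap w (r j) i 2 x)"
      unfolding sum_distrib_left using fg[OF w r] by (intro sum_mono)
    also have "\<dots> \<le> C * rough w I r i x"
      unfolding rough_eq[OF adm] sum_distrib_left
    proof (intro sum_mono mult_left_mono C)
      fix j assume j: "j \<in> I"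
      have "(\<Sum>n\<in>{0}. th ^ n * gap w (r j) i (n + 2) x) \<le> (\<Sum>n. th ^ n * gap w (r j) i (n + 2) x)"
        using th_bounds gap_nonneg by (intro sum_le_suminf summable_gap[OF w r[OF j]]) auto
      then show "gap w (r j) i 2 x \<le> (\<Sum>n. th ^ n * gap w (r j) i (n + 2) x)" by (simp add: numeral_2_eq_2)
    qed
    also have "\<dots> \<le> (C + D\<^sup>2) * rough w I r i x" using R0 by (intro mult_right_mono) auto
    finally show "dens w (i + 1) x * (\<Sum>j\<in>I. (norm (mdir w (r j) (i + 1) x - mdir w (r j) i x))\<^sup>2) \<le> (C + D\<^sup>2) * rough w I r i x" .
    fix s :: "real ^ 'n" assume s: "norm s \<le> 1"
    note osc[OF adm s, of i x]
    also have "D * sqrt (dens w i x * rough w I r i x) = sqrt (D\<^sup>2 * (dens w i x * rough w I r i x))"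
      using D by (simp add: real_sqrt_mult)
    also have "\<dots> \<le> sqrt ((C + D\<^sup>2) * (dens w i x * rough w I r i x))"
      using C R0 dens_nonneg by (intro real_sqrt_le_mono mult_right_mono) auto
    finally show "sqrt (psi I (\<lambda>j. mdir w (r j) i x)) * \<bar>dens w (i + 2) (gmult x (dil (th ^ (i + 1)) s)) - dens w (i + 2) x\<bar> \<le>
        sqrt ((C + D\<^sup>2) * (dens w i x * rough w I r i x))" .
  qed (use C in simp)
qed

text \<open>
  The oscillation estimate at scale \<open>i\<close> is stated with \<open>dens w i\<close> and helps only while the next density is not
  much smaller. Consecutive large drops are controlled by this recursion instead: each of them halves
  \<open>psi * dens\<close> up to an increment of energy.
\<close>

primrec drop_bound :: "real \<Rightarrow> (real ^ 'n) measure \<Rightarrow> nat set \<Rightarrow> (nat \<Rightarrow> real ^ 'n \<Rightarrow> real ^ 'n) \<Rightarrow> nat \<Rightarrow> real ^ 'n \<Rightarrow> real" where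
  "drop_bound K w I r 0 x = card I * dens w 1 x"
| "drop_bound K w I r (Suc i) x = drop_bound K w I r i x / 2 + K * rough w I r i x"

lemma drop_bound_nonneg: "admissible w I r \<Longrightarrow> K \<ge> 0 \<Longrightarrow> drop_bound K w I r i x \<ge> 0"
  by (induction i) (auto simp: dens_nonneg rough_nonneg)

text \<open>If \<open>dens w i x\<close> is at most four times \<open>dens w (i + 1) x\<close>, the
  oscillation estimate divided by the density bounds the remainder by \<open>rough\<close>.
  Otherwise the remainder is at most twice the density (\<open>damp_gap_le_add\<close>), and
  \<open>drop_bound\<close> bounds \<open>psi\<close> times the density. Both cases use
  \<open>psi\<close> at scale \<open>i\<close>; \<open>psi_perturb\<close> passes to scale
  \<open>i + 1\<close>.\<close>

lemma gap_bound:
  obtains K where "K \<ge> 0" "\<And>w I r i x c. admissible w I r \<Longrightarrow> c > 0 \<Longrightarrow>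
    psi I (\<lambda>j. mdir w (r j) (i + 1) x) * av (i + 1) 1 (\<lambda>y. damp_gap c (dens w (i + 2) y) (dens w (i + 1) x)) x \<le>
      4 * drop_bound K w I r i x + 3 * K * rough w I r i x"
proof (rule level_facts)
  fix K
  assume K: "K \<ge> 0" and L1: "\<And>w I r i x. admissible w I r \<Longrightarrow>
      dens w (i + 1) x * (\<Sum>j\<in>I. (norm (mdir w (r j) (i + 1) x - mdir w (r j) i x))\<^sup>2) \<le> K * rough w I r i x"
    and L2: "\<And>w I r i x s. admissible w I r \<Longrightarrow> norm s \<le> 1 \<Longrightarrow>
      sqrt (psi I (\<lambda>j. mdir w (r j) i x)) * \<bar>dens w (i + 2) (gmult x (dil (th ^ (i + 1)) s)) - dens w (i + 2) x\<bar> \<le>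
        sqrt (K * (dens w i x * rough w I r i x))"
  show ?thesis
  \<comment> \<open>The 16 is a 4 from squaring a drop by one half, times a 4 from the comparison
    \<open>u i \<le> 4 * u (i + 1)\<close>.\<close>
  proof (rule that[of "16 * K"])
    fix w I r i c and x :: "real ^ 'n"
    assume adm: "admissible w I r" and c: "c > (0 :: real)"
    have w: "fin_borel w" and r: "\<And>j. j \<in> I \<Longrightarrow> density1 (r j)" using adm by (auto simp: admissible_def)
    define R where "R = (\<lambda>i. rough w I r i x)"
    define u where "u = (\<lambda>i. dens w i x)"
    define p where "p = (\<lambda>i. psi I (\<lambda>j. mdir w (r j) i x))"
    define D where "D = (\<lambda>i. \<Sum>j\<in>I. (norm (mdir w (r j) (i + 1) x - mdir w (r j) i x))\<^sup>2)"
    define F where "F = (\<lambda>i. drop_bound (16 * K) w I r i x)"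
    have R0: "R i \<ge> 0" and u0: "u i \<ge> 0" and p0: "p i \<ge> 0" and D0: "D i \<ge> 0" and F0: "F i \<ge> 0" for i
      using K by (auto simp: R_def u_def p_def D_def F_def rough_nonneg[OF adm] dens_nonneg psi_nonneg drop_bound_nonneg[OF adm] intro!: sum_nonneg)
    have psi_step: "p (i + 1) \<le> 2 * p i + 2 * D i" for i unfolding p_def D_def by (rule psi_perturb)
    have uD: "u (i + 1) * D i \<le> K * R i" for i unfolding u_def D_def R_def by (rule L1[OF adm])
    interpret Q: prob_space Qm by (rule prob_space_Qm)
    note [measurable] = dens_borel[OF w]
    define U where "U = (\<lambda>i z. dens w (i + 2) (gmult x (dil (th ^ (i + 1)) z)))"
    have Um [measurable]: "U i \<in> borel_measurable borel" for i unfolding U_def by measurable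
    have U0: "U i z \<ge> 0" for i z by (simp add: U_def dens_nonneg)
    have UB: "\<exists>B. \<forall>z. \<bar>U i z\<bar> \<le> B" for i using dens_bounded[OF w, of "i + 2"] by (auto simp: U_def)
    have iU: "integrable Qm (U i)" for i
    proof -
      obtain B where "\<And>z. \<bar>U i z\<bar> \<le> B" using UB by blast
      then show ?thesis by (intro Q.integrable_const_bound[of _ B]) auto
    qed
    have EU: "(\<integral>z. U i z \<partial>Qm) = u (i + 1)" for i
    proof -
      obtain B where "\<And>z. \<bar>dens w (i + 2) z\<bar> \<le> B" using dens_bounded[OF w] by blast
      then show ?thesis
        using dens_av[OF w, of "i + 1" x 1] av_1[OF dens_borel[OF w, of "i + 2"], of B "i + 1" x] by (simp add: u_def U_def)
    qed
    have osc: "AE z in Qm. sqrt (p i) * \<bar>U i z - u (i + 2)\<bar> \<le> sqrt (K * (u i * R i))" for i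
      using Qm_support
    proof eventually_elim
      case (elim z)
      show ?case using L2[OF adm elim, of i x] by (simp add: p_def U_def u_def R_def)
    qed
    have mean: "sqrt (p i) * \<bar>u (i + 1) - u (i + 2)\<bar> \<le> sqrt (K * (u i * R i))" for i
    proof -
      have "sqrt (p i) * \<bar>u (i + 1) - u (i + 2)\<bar> = \<bar>\<integral>z. sqrt (p i) * (U i z - u (i + 2)) \<partial>Qm\<bar>"
        using iU p0[of i] Q.prob_space by (simp add: EU abs_mult)
      also have "\<dots> \<le> (\<integral>z. \<bar>sqrt (p i) * (U i z - u (i + 2))\<bar> \<partial>Qm)" by (rule integral_abs_bound)
      also have "\<dots> \<le> sqrt (K * (u i * R i))"
      proof (rule Q.integral_le_const)
        show "integrable Qm (\<lambda>z. \<bar>sqrt (p i) * (U i z - u (i + 2))\<bar>)"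
          by (intro integrable_abs integrable_mult_right Bochner_Integration.integrable_diff iU Q.integrable_const)
        show "AE z in Qm. \<bar>sqrt (p i) * (U i z - u (i + 2))\<bar> \<le> sqrt (K * (u i * R i))"
          using osc[of i] p0[of i] by (simp add: abs_mult)
      qed
      finally show ?thesis .
    qed
    have square: "p i * d\<^sup>2 \<le> t\<^sup>2 * (K * (u i * R i))" if "sqrt (p i) * \<bar>d\<bar> \<le> t * sqrt (K * (u i * R i))" for i t d
    proof -
      have "(sqrt (p i) * \<bar>d\<bar>)\<^sup>2 \<le> (t * sqrt (K * (u i * R i)))\<^sup>2"
        using that p0 by (intro power_mono) auto
      then show ?thesis using p0 K u0 R0 by (simp add: power_mult_distrib)
    qed
    \<comment> \<open>A drop by more than the factor 4 beats the factor 2 of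
      \<open>psi_perturb\<close> and leaves the factor 1/2 of the recursion.\<close>
    have drop_or: "p (i + 1) * u (i + 2) \<le> p i * u (i + 1) / 2 + K * R i / 2" if "u (i + 1) > 4 * u (i + 2)" for i
    proof -
      have "p (i + 1) * u (i + 2) \<le> (2 * p i + 2 * D i) * (u (i + 1) / 4)"
        using that u0 p0 D0 by (intro mult_mono psi_step) auto
      then show ?thesis using uD[of i] by (simp add: algebra_simps)
    qed
    \<comment> \<open>If the density is comparable with that of the preceding scale, the oscillation
      estimate applies directly. If not, the preceding scale satisfies the hypothesis too, and
      \<open>drop_or\<close> advances the recursion. At scale 0 the bound of \<open>psi\<close> by
      the number of directions suffices.\<close>
    have drop: "p i * u (i + 1) \<le> F i + 16 * K * R i" if "u (i + 2) \<le> u (i + 1) / 2" for i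
      using that
    proof (induction i)
      have caseA: "p i * u (i + 1) \<le> 16 * K * R i" if d: "u (i + 2) \<le> u (i + 1) / 2" and A: "u i \<le> 4 * u (i + 1)" for i
      proof (cases "u (i + 1) = 0")
        case True
        then show ?thesis using K R0 by simp
      next
        case False
        then have pos: "u (i + 1) > 0" using u0[of "i + 1"] by simp
        have "p i * (u (i + 1) / 2)\<^sup>2 \<le> p i * (u (i + 1) - u (i + 2))\<^sup>2"
          using d u0 p0 by (intro mult_left_mono power_mono) (auto simp: field_simps)
        also have "\<dots> \<le> K * (u i * R i)" using square[of i "u (i + 1) - u (i + 2)" 1] mean[of i] by simp
        also have "\<dots> \<le> K * (4 * u (i + 1) * R i)" using A K R0 by (intro mult_left_mono mult_right_mono) auto
        finally have "(p i * u (i + 1)) * u (i + 1) \<le> (16 * K * R i) * u (i + 1)"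
          by (simp add: power2_eq_square algebra_simps)
        then show ?thesis using pos by simp
      qed
      {
        case 0
        have "p 0 \<le> card I" unfolding p_def using mdir_le[OF w r] by (intro psi_le)
        then have "p 0 * u 1 \<le> F 0" unfolding F_def u_def by (simp add: mult_right_mono dens_nonneg)
        then show ?case using K R0[of 0] by (simp add: add_increasing2)
      next
        case (Suc i)
        show ?case
        proof (cases "u (Suc i) \<le> 4 * u (Suc i + 1)")
          case True
          then show ?thesis using caseA[OF Suc.prems] F0[of "Suc i"] by linarith
        next
          case False
          then have b: "u (i + 1) > 4 * u (i + 2)" by simp
          then have "p i * u (i + 1) \<le> F i + 16 * K * R i" using u0[of "i + 2"] by (intro Suc.IH) linarith
          moreover have "p (i + 1) * u (i + 2) \<le> p i * u (i + 1) / 2 + K * R i / 2" by (rule drop_or[OF b])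
          moreover have "F (Suc i) = F i / 2 + 16 * K * R i" by (simp add: F_def R_def)
          moreover have "K * R i \<ge> 0" "K * R (Suc i) \<ge> 0" using K R0 by simp_all
          ultimately show ?thesis by simp
        qed
      }
    qed
    have large: "p i * u (i + 1) \<le> F i" if "u i > 4 * u (i + 1)" for i
    proof (cases i)
      case 0
      have "p 0 \<le> card I" unfolding p_def using mdir_le[OF w r] by (intro psi_le)
      then show ?thesis unfolding F_def u_def 0 by (simp add: mult_right_mono dens_nonneg)
    next
      case (Suc k)
      have b: "u (k + 1) > 4 * u (k + 2)" using that Suc by simp
      then have "p k * u (k + 1) \<le> F k + 16 * K * R k" using u0[of "k + 2"] by (intro drop) linarith
      moreover have "p (k + 1) * u (k + 2) \<le> p k * u (k + 1) / 2 + K * R k / 2" by (rule drop_or[OF b])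
      moreover have "F (Suc k) = F k / 2 + 16 * K * R k" by (simp add: F_def R_def)
      moreover have "K * R k \<ge> 0" using K R0 by simp
      ultimately show ?thesis using Suc by simp
    qed
    define M where "M = u (i + 1)"
    have M0: "M \<ge> 0" using u0 by (simp add: M_def)
    have ib: "integrable Qm (\<lambda>z. damp_gap c (U i z) M)"
    proof (rule Bochner_Integration.integrable_bound[OF Bochner_Integration.integrable_add[OF iU Q.integrable_const[of M]]])
      show "(\<lambda>z. damp_gap c (U i z) M) \<in> borel_measurable Qm" unfolding damp_gap_def by measurable
      show "AE z in Qm. norm (damp_gap c (U i z) M) \<le> norm (U i z + M)"
        using damp_gap_nonneg[OF c U0 M0] damp_gap_le_add[OF c U0 M0] U0 M0 by (intro AE_I2) auto
    qed
    define G where "G = (\<integral>z. damp_gap c (U i z) M \<partial>Qm)"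
    have G0: "G \<ge> 0" unfolding G_def by (intro integral_nonneg_AE AE_I2 damp_gap_nonneg c U0 M0)
    have G2: "G \<le> 2 * M"
    proof -
      have "G \<le> (\<integral>z. U i z + M \<partial>Qm)"
        unfolding G_def by (intro integral_mono ib Bochner_Integration.integrable_add iU Q.integrable_const damp_gap_le_add c U0 M0)
      then show ?thesis using iU Q.prob_space by (simp add: EU M_def)
    qed
    have pG: "p i * G \<le> 16 * K * R i + 2 * F i"
    proof (cases "u i \<le> 4 * M")
      case True
      show ?thesis
      proof (cases "M = 0")
        case True
        then have "G = 0" using G0 G2 by simp
        then show ?thesis using K R0[of i] F0[of i] by simp
      next
        case False
        then have pos: "M > 0" using M0 by simp
        have "M * (p i * G) = (\<integral>z. M * p i * damp_gap c (U i z) M \<partial>Qm)" using ib by (simp add: G_def)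
        also have "\<dots> \<le> 4 * (K * (u i * R i))"
        proof (rule Q.integral_le_const)
          show "integrable Qm (\<lambda>z. M * p i * damp_gap c (U i z) M)" by (intro integrable_mult_right ib)
          show "AE z in Qm. M * p i * damp_gap c (U i z) M \<le> 4 * (K * (u i * R i))"
            using osc[of i]
          proof eventually_elim
            case (elim z)
            have "sqrt (p i) * \<bar>U i z - M\<bar> \<le> sqrt (p i) * (\<bar>U i z - u (i + 2)\<bar> + \<bar>u (i + 1) - u (i + 2)\<bar>)"
              using p0 by (intro mult_left_mono) (auto simp: M_def)
            also have "\<dots> \<le> 2 * sqrt (K * (u i * R i))" using elim mean[of i] by (simp add: distrib_left)
            finally have "p i * (U i z - M)\<^sup>2 \<le> 4 * (K * (u i * R i))" using square[of i "U i z - M" 2] by simp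
            moreover have "M * damp_gap c (U i z) M \<le> (U i z - M)\<^sup>2" by (rule damp_gap_le_square[OF c U0 M0])
            then have "p i * (M * damp_gap c (U i z) M) \<le> p i * (U i z - M)\<^sup>2" using p0 by (intro mult_left_mono)
            ultimately show ?case by (simp add: mult_ac)
          qed
        qed
        also have "\<dots> \<le> 4 * (K * (4 * M * R i))" using True K R0 by (intro mult_left_mono mult_right_mono) auto
        finally have "M * (p i * G) \<le> M * (16 * K * R i)" by (simp add: mult_ac)
        then have "p i * G \<le> 16 * K * R i" using pos by simp
        then show ?thesis using F0[of i] by linarith
      qed
    next
      case False
      then have "p i * M \<le> F i" using large[of i] by (simp add: M_def)
      moreover have "p i * G \<le> p i * (2 * M)" using G2 p0 by (rule mult_left_mono)
      moreover have "K * R i \<ge> 0" using K R0 by simp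
      ultimately show ?thesis by simp
    qed
    \<comment> \<open>The change of directions \<open>D i\<close> is under control only when
      weighted with the density \<open>M\<close> (\<open>uD\<close>); the bound \<open>G2\<close>
      supplies that weight.\<close>
    have "p (i + 1) * G \<le> (2 * p i + 2 * D i) * G" using psi_step G0 by (rule mult_right_mono)
    moreover have "D i * G \<le> D i * (2 * M)" using G2 D0 by (rule mult_left_mono)
    moreover have "D i * M \<le> K * R i" using uD[of i] by (simp add: M_def mult.commute)
    moreover have "K * R i \<ge> 0" using K R0 by simp
    ultimately have "p (i + 1) * G \<le> 4 * F i + 3 * (16 * K) * R i"
      using pG by (simp add: algebra_simps)
    moreover have "av (i + 1) 1 (\<lambda>y. damp_gap c (dens w (i + 2) y) (dens w (i + 1) x)) x = G"
    proof -
      obtain B where B: "\<And>z. \<bar>dens w (i + 2) z\<bar> \<le> B" using dens_bounded[OF w] by blast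
      have "norm (damp_gap c (dens w (i + 2) y) (dens w (i + 1) x)) \<le> B + M" for y
        using damp_gap_nonneg[OF c dens_nonneg[of w "i + 2" y] M0] damp_gap_le_add[OF c dens_nonneg[of w "i + 2" y] M0] B[of y]
        by (auto simp: M_def u_def)
      moreover have "(\<lambda>y. damp_gap c (dens w (i + 2) y) (dens w (i + 1) x)) \<in> borel_measurable borel"
        unfolding damp_gap_def by measurable
      ultimately show ?thesis by (subst av_1[where C = "B + M"]) (auto simp: G_def U_def M_def u_def)
    qed
    ultimately show "psi I (\<lambda>j. mdir w (r j) (i + 1) x) * av (i + 1) 1 (\<lambda>y. damp_gap c (dens w (i + 2) y) (dens w (i + 1) x)) x \<le>
      4 * drop_bound (16 * K) w I r i x + 3 * (16 * K) * rough w I r i x"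
      by (simp add: p_def F_def R_def)
  qed (use K in simp)
qed

section \<open>Summability over the scales\<close>

lemma rough_integral:
  assumes adm: "admissible w I r"
  shows "integrable lborel (rough w I r i)"
    and "(\<integral>x. rough w I r i x \<partial>lborel) = (\<Sum>n. th ^ n * (\<Sum>j\<in>I. energy w (r j) (i + (n + 2)) - energy w (r j) i))"
proof -
  have w: "fin_borel w" and r: "\<And>j. j \<in> I \<Longrightarrow> density1 (r j)" using adm by (auto simp: admissible_def)
  define f where "f = (\<lambda>n x. th ^ n * (\<Sum>j\<in>I. gap w (r j) i (n + 2) x))"
  have if': "integrable lborel (f n)" for n
    unfolding f_def by (intro integrable_mult_right Bochner_Integration.integrable_sum gap_integral(1) w r)
  have f0: "f n x \<ge> 0" for n x using th_bounds by (auto simp: f_def intro!: mult_nonneg_nonneg sum_nonneg gap_nonneg)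
  have Ef: "(\<integral>x. f n x \<partial>lborel) = th ^ n * (\<Sum>j\<in>I. energy w (r j) (i + (n + 2)) - energy w (r j) i)" for n
    unfolding f_def using gap_integral[OF w r] by (simp add: Bochner_Integration.integral_sum)
  have s1: "summable (\<lambda>n. f n x)" for x
    unfolding f_def sum_distrib_left by (intro summable_sum summable_gap w r)
  have s2: "summable (\<lambda>n. \<integral>x. f n x \<partial>lborel)"
  proof (rule summable_comparison_test'[of "\<lambda>n. th ^ n * (card I * measure w UNIV)" 0])
    show "summable (\<lambda>n. th ^ n * (card I * measure w UNIV))" by (intro summable_mult2 summable_th)
    fix n
    have "(\<Sum>j\<in>I. energy w (r j) (i + (n + 2)) - energy w (r j) i) \<le> (\<Sum>j\<in>I. measure w UNIV)"
    proof (rule sum_mono)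
      fix j assume j: "j \<in> I"
      show "energy w (r j) (i + (n + 2)) - energy w (r j) i \<le> measure w UNIV"
        using energy_bounds[OF w r[OF j], of "i + (n + 2)"] energy_bounds(1)[OF w r[OF j], of i] by linarith
    qed
    then have "(\<integral>x. f n x \<partial>lborel) \<le> th ^ n * (card I * measure w UNIV)"
      unfolding Ef using th_bounds by (intro mult_left_mono) auto
    moreover have "(\<integral>x. f n x \<partial>lborel) \<ge> 0" using f0 by simp
    ultimately show "norm (\<integral>x. f n x \<partial>lborel) \<le> th ^ n * (card I * measure w UNIV)" by simp
  qed
  have R: "rough w I r i = (\<lambda>x. \<Sum>n. f n x)" unfolding rough_def f_def ..
  have n: "\<bar>f n x\<bar> = f n x" for n x using f0 by simp
  show "integrable lborel (rough w I r i)"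
    unfolding R by (rule integrable_suminf) (simp_all add: n if' s1 s2)
  have "(\<integral>x. (\<Sum>n. f n x) \<partial>lborel) = (\<Sum>n. \<integral>x. f n x \<partial>lborel)"
    by (rule integral_suminf) (simp_all add: n if' s1 s2)
  then show "(\<integral>x. rough w I r i x \<partial>lborel) = (\<Sum>n. th ^ n * (\<Sum>j\<in>I. energy w (r j) (i + (n + 2)) - energy w (r j) i))"
    unfolding R Ef .
qed

text \<open>For fixed \<open>n\<close> and each direction, the energy increments over
  \<open>n + 2\<close> scales sum to at most \<open>n + 2\<close> times the mass. The weights
  \<open>th ^ n\<close> make this summable in \<open>n\<close>, and the two sums are
  exchanged.\<close>

lemma summable_rough:
  assumes adm: "admissible w I r"
  shows "summable (\<lambda>i. \<integral>x. rough w I r i x \<partial>lborel)"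
proof -
  have w: "fin_borel w" and r: "\<And>j. j \<in> I \<Longrightarrow> density1 (r j)" using adm by (auto simp: admissible_def)
  define m where "m = measure w UNIV"
  define a where "a = (\<lambda>i n. \<Sum>j\<in>I. energy w (r j) (i + (n + 2)) - energy w (r j) i)"
  have G0: "0 \<le> energy w (r j) i" and Gm: "energy w (r j) i \<le> m" if "j \<in> I" for j i
    using energy_bounds[OF w r[OF that]] by (auto simp: m_def)
  have a0: "a i n \<ge> 0" for i n
    unfolding a_def using energy_mono[OF w r, of _ i "n + 2"] by (intro sum_nonneg) simp
  have aN: "(\<Sum>i<N. a i n) \<le> card I * (real (n + 2) * m)" for n N
  proof -
    have "(\<Sum>i<N. a i n) = (\<Sum>j\<in>I. \<Sum>i<N. energy w (r j) (i + (n + 2)) - energy w (r j) i)"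
      unfolding a_def by (rule sum.swap)
    also have "\<dots> \<le> (\<Sum>j\<in>I. real (n + 2) * m)"
      by (intro sum_mono sum_shift_difference_le G0 Gm)
    finally show ?thesis by simp
  qed
  have sm: "summable (\<lambda>n. th ^ n * (card I * (real (n + 2) * m)))"
  proof (rule summable_comparison_test'[of "\<lambda>n. (2 * card I * m) * (of_nat (Suc n) * th ^ n)" 0])
    show "summable (\<lambda>n. (2 * card I * m) * (of_nat (Suc n) * th ^ n))"
      using geometric_deriv_sums[of th] th_bounds by (intro summable_mult) (auto simp: sums_iff)
    have m0: "m \<ge> 0" by (simp add: m_def)
    fix n
    have "norm (th ^ n * (card I * (real (n + 2) * m))) = (card I * m) * (real (n + 2) * th ^ n)"
      using th_bounds m0 by (simp add: abs_mult mult_ac)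
    also have "\<dots> \<le> (card I * m) * (real (2 * Suc n) * th ^ n)"
      using th_bounds m0 by (intro mult_left_mono mult_right_mono) auto
    finally show "norm (th ^ n * (card I * (real (n + 2) * m))) \<le> (2 * card I * m) * (of_nat (Suc n) * th ^ n)"
      by (simp add: algebra_simps)
  qed
  have sa: "summable (\<lambda>n. th ^ n * a i n)" for i
  proof (rule summable_comparison_test'[OF sm, of 0])
    fix n
    have "a i n \<le> (\<Sum>k<Suc i. a k n)" using a0 by (simp add: sum_nonneg)
    then show "norm (th ^ n * a i n) \<le> th ^ n * (card I * (real (n + 2) * m))"
      using th_bounds a0[of i n] aN[of n "Suc i"] by (simp add: abs_mult)
  qed
  show ?thesis
  proof (rule summableI_nonneg_bounded)
    show "0 \<le> (\<integral>x. rough w I r i x \<partial>lborel)" for i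
      by (intro integral_nonneg_AE AE_I2 rough_nonneg adm)
    fix N
    have "(\<Sum>i<N. \<integral>x. rough w I r i x \<partial>lborel) = (\<Sum>i<N. \<Sum>n. th ^ n * a i n)"
      unfolding rough_integral(2)[OF adm] a_def ..
    also have "\<dots> = (\<Sum>n. \<Sum>i<N. th ^ n * a i n)" by (rule suminf_sum[symmetric]) (rule sa)
    also have "\<dots> \<le> (\<Sum>n. th ^ n * (card I * (real (n + 2) * m)))"
      using th_bounds aN by (intro suminf_le summable_sum sa sm) (auto simp flip: sum_distrib_left intro!: mult_left_mono)
    finally show "(\<Sum>i<N. \<integral>x. rough w I r i x \<partial>lborel) \<le> (\<Sum>n. th ^ n * (card I * (real (n + 2) * m)))" .
  qed
qed

section \<open>The functional and its growth from scale to scale\<close>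

definition Phi :: "(real ^ 'n) measure \<Rightarrow> nat set \<Rightarrow> (nat \<Rightarrow> real ^ 'n \<Rightarrow> real ^ 'n) \<Rightarrow> real \<Rightarrow> nat \<Rightarrow> real" where
  "Phi w I r c i = (\<integral>x. damp c (dens w i x) * psi I (\<lambda>j. mdir w (r j) i x) \<partial>lborel)"

lemma hpsi_borel: assumes adm: "admissible w I r"
  shows "(\<lambda>x. psi I (\<lambda>j. mdir w (r j) i x)) \<in> borel_measurable borel"
  using adm by (intro psi_borel mdir_borel) (auto simp: admissible_def)

lemma hpsi_le: assumes adm: "admissible w I r" shows "psi I (\<lambda>j. mdir w (r j) i x) \<le> card I"
  using adm mdir_le by (intro psi_le) (auto simp: admissible_def)

lemma Phi_integrable: assumes adm: "admissible w I r" and c: "c > 0"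
  shows "integrable lborel (\<lambda>x. damp c (dens w i x) * psi I (\<lambda>j. mdir w (r j) i x))"
proof -
  have w: "fin_borel w" using adm by (auto simp: admissible_def)
  note [measurable] = hpsi_borel[OF adm] dens_borel[OF w]
  show ?thesis
  proof (rule Bochner_Integration.integrable_bound[OF integrable_mult_left[where c = "real (card I)", OF dens_integral(1)[OF w, of i]]])
    show "(\<lambda>x. damp c (dens w i x) * psi I (\<lambda>j. mdir w (r j) i x)) \<in> borel_measurable lborel"
      unfolding damp_def by measurable
    have "damp c (dens w i x) * psi I (\<lambda>j. mdir w (r j) i x) \<le> dens w i x * card I" for x
      by (intro mult_mono damp_le c dens_nonneg hpsi_le adm psi_nonneg)
    then show "AE x in lborel. norm (damp c (dens w i x) * psi I (\<lambda>j. mdir w (r j) i x)) \<le> norm (dens w i x * real (card I))"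
      using damp_nonneg[OF c dens_nonneg] psi_nonneg dens_nonneg by (intro AE_I2) (simp add: abs_mult)
  qed
qed

text \<open>At a fixed scale the density is bounded, and \<open>damp_le_square\<close> gains the
  factor \<open>1 / c\<close>.\<close>

lemma Phi_le: assumes adm: "admissible w I r"
  shows "\<exists>B. \<forall>c>0. Phi w I r c i \<le> B / c"
proof -
  have w: "fin_borel w" using adm by (auto simp: admissible_def)
  obtain B where B: "\<And>x. \<bar>dens w i x\<bar> \<le> B" using dens_bounded[OF w] by blast
  have "Phi w I r c i \<le> (B * card I * measure w UNIV) / c" if c: "c > 0" for c
  proof -
    have "Phi w I r c i \<le> (\<integral>x. (B / c * card I) * dens w i x \<partial>lborel)"
      unfolding Phi_def
    proof (rule integral_mono[OF Phi_integrable[OF adm c] integrable_mult_right[OF dens_integral(1)[OF w]]])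
      fix x
      have "damp c (dens w i x) \<le> dens w i x * dens w i x / c"
        using damp_le_square[OF c dens_nonneg] by (simp add: power2_eq_square)
      also have "\<dots> \<le> B * dens w i x / c"
        using B[of x] c dens_nonneg[of w i x] by (intro divide_right_mono mult_right_mono) auto
      finally have "damp c (dens w i x) \<le> B * dens w i x / c" .
      moreover have "B \<ge> 0" using B[of x] by linarith
      ultimately have "damp c (dens w i x) * psi I (\<lambda>j. mdir w (r j) i x) \<le> (B * dens w i x / c) * card I"
        using c dens_nonneg by (intro mult_mono hpsi_le adm psi_nonneg) auto
      then show "damp c (dens w i x) * psi I (\<lambda>j. mdir w (r j) i x) \<le> (B / c * card I) * dens w i x"
        by (simp add: mult_ac)
    qed
    also have "\<dots> = (B * card I * measure w UNIV) / c" using dens_integral[OF w] by simp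
    finally show ?thesis .
  qed
  then show ?thesis by blast
qed

text \<open>The pointwise step is integrated over \<open>x\<close>: \<open>integral_av\<close>
  removes the average on the left, and the errors on the right come from \<open>rough\<close>,
  \<open>drop_bound\<close> and energy increments, none of which depends on \<open>c\<close>. The
  index starts at 1 because \<open>gap_bound\<close> looks one scale back.\<close>

lemma functional_decay:
  assumes adm: "admissible w I r"
  obtains e where "\<And>i. 0 \<le> e i" "summable e" "\<And>c i. c > 0 \<Longrightarrow> Phi w I r c (Suc (Suc i)) \<le> Phi w I r c (Suc i) + e i"
proof (rule gap_bound)
  have w: "fin_borel w" and r: "\<And>j. j \<in> I \<Longrightarrow> density1 (r j)" using adm by (auto simp: admissible_def)
  fix K
  assume K: "K \<ge> 0" and gb: "\<And>w I r i x c. admissible w I r \<Longrightarrow> c > 0 \<Longrightarrow>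
    psi I (\<lambda>j. mdir w (r j) (i + 1) x) * av (i + 1) 1 (\<lambda>y. damp_gap c (dens w (i + 2) y) (dens w (i + 1) x)) x \<le>
      4 * drop_bound K w I r i x + 3 * K * rough w I r i x"
  define rho where "rho = (\<lambda>i. \<integral>x. rough w I r i x \<partial>lborel)"
  define f where "f = (\<lambda>i. \<integral>x. drop_bound K w I r i x \<partial>lborel)"
  define g where "g = (\<lambda>i. \<Sum>j\<in>I. energy w (r j) (Suc i + 1) - energy w (r j) (Suc i))"
  have iF: "integrable lborel (drop_bound K w I r i)" for i
    by (induction i) (auto intro!: dens_integral(1) w rough_integral(1) adm)
  have fS: "f (Suc i) = f i / 2 + K * rho i" for i
  proof -
    have "drop_bound K w I r (Suc i) = (\<lambda>x. drop_bound K w I r i x / 2 + K * rough w I r i x)" by auto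
    then show ?thesis unfolding f_def rho_def using iF rough_integral(1)[OF adm] by simp
  qed
  have f0: "f i \<ge> 0" for i unfolding f_def by (intro integral_nonneg_AE AE_I2 drop_bound_nonneg adm K)
  have rho0: "rho i \<ge> 0" for i unfolding rho_def by (intro integral_nonneg_AE AE_I2 rough_nonneg adm)
  have sr: "summable rho" unfolding rho_def by (rule summable_rough[OF adm])
  have sf: "summable f"
    by (rule summable_halving[of f "\<lambda>i. K * rho i"]) (use fS f0 K rho0 sr in \<open>auto intro: summable_mult\<close>)
  have g0: "g i \<ge> 0" for i unfolding g_def using energy_mono[OF w r, of _ "Suc i" 1] by (intro sum_nonneg) simp
  have sg: "summable g"
  proof (rule summableI_nonneg_bounded[OF g0])
    fix N
    have "(\<Sum>i<N. g i) = (\<Sum>j\<in>I. \<Sum>i<N. energy w (r j) (Suc (i + 1)) - energy w (r j) (Suc i))"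
      unfolding g_def by (subst sum.swap) simp
    also have "\<dots> \<le> (\<Sum>j\<in>I. real 1 * measure w UNIV)"
      by (intro sum_mono sum_shift_difference_le[where g = "\<lambda>i. energy w (r _) (Suc i)"] energy_bounds w r)
    finally show "(\<Sum>i<N. g i) \<le> (\<Sum>j\<in>I. real 1 * measure w UNIV)" .
  qed
  define e where "e = (\<lambda>i. 8 * f i + 6 * K * rho i + 2 * g i)"
  show ?thesis
  proof (rule that[of e])
    show "0 \<le> e i" for i using f0 rho0 g0 K by (simp add: e_def)
    show "summable e" unfolding e_def by (intro summable_add summable_mult sf sr sg)
    fix c :: real and i :: nat assume c: "c > 0"
    define k where "k = i + 1"
    let ?G = "\<lambda>k x. damp c (dens w k x) * psi I (\<lambda>j. mdir w (r j) k x)"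
    have iG: "integrable lborel (?G k)" for k by (rule Phi_integrable[OF adm c])
    have igap: "integrable lborel (\<lambda>x. \<Sum>j\<in>I. gap w (r j) k 1 x)"
      by (intro Bochner_Integration.integrable_sum gap_integral(1) w r)
    have "Phi w I r c (k + 1) = (\<integral>x. av k 1 (?G (k + 1)) x \<partial>lborel)"
      unfolding Phi_def by (rule integral_av(2)[OF iG, symmetric])
    also have "\<dots> \<le> (\<integral>x. ?G k x + (2 * (4 * drop_bound K w I r i x + 3 * K * rough w I r i x) + 2 * (\<Sum>j\<in>I. gap w (r j) k 1 x)) \<partial>lborel)"
    proof (rule integral_mono)
      show "integrable lborel (av k 1 (?G (k + 1)))" by (rule integral_av(1)[OF iG])
      show "integrable lborel (\<lambda>x. ?G k x + (2 * (4 * drop_bound K w I r i x + 3 * K * rough w I r i x) + 2 * (\<Sum>j\<in>I. gap w (r j) k 1 x)))"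
        using iG iF igap rough_integral(1)[OF adm]
        by (intro Bochner_Integration.integrable_add integrable_mult_right)
      fix x
      have "psi I (\<lambda>j. mdir w (r j) k x) * av k 1 (\<lambda>y. damp_gap c (dens w (k + 1) y) (dens w k x)) x \<le>
          4 * drop_bound K w I r i x + 3 * K * rough w I r i x"
        using gb[OF adm c, of i x] by (simp add: k_def)
      then show "av k 1 (?G (k + 1)) x \<le> ?G k x + (2 * (4 * drop_bound K w I r i x + 3 * K * rough w I r i x) + 2 * (\<Sum>j\<in>I. gap w (r j) k 1 x))"
        using functional_step_pointwise[OF adm c, of k x] by (simp add: algebra_simps)
    qed
    also have "\<dots> = Phi w I r c k + (2 * (4 * f i + 3 * K * rho i) + 2 * (\<Sum>j\<in>I. energy w (r j) (k + 1) - energy w (r j) k))"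
      using iG iF igap rough_integral(1)[OF adm] gap_integral[OF w r]
      by (simp add: Phi_def f_def rho_def Bochner_Integration.integral_sum)
    finally show "Phi w I r c (Suc (Suc i)) \<le> Phi w I r c (Suc i) + e i"
      by (simp add: k_def e_def g_def)
  qed
qed

end

subsection \<open>Null sets\<close>

context carnot
begin

definition smear :: "(real ^ 'n) measure \<Rightarrow> (real ^ 'n \<Rightarrow> real) \<Rightarrow> nat \<Rightarrow> real ^ 'n \<Rightarrow> real" where
  "smear w g l x = (\<integral>\<xi>. pk l (gmult (- x) \<xi>) * g \<xi> \<partial>w)"

lemma smear_integrand:
  assumes w: "fin_borel w" and [measurable]: "g \<in> borel_measurable borel" and G: "\<And>\<xi>. \<bar>g \<xi>\<bar> \<le> G"
  shows "integrable w (\<lambda>\<xi>. pk l (gmult (- x) \<xi>) * g \<xi>)"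
proof -
  obtain B where B: "\<And>v. \<bar>pk l v\<bar> \<le> B" using pk_bounded by blast
  have "B \<ge> 0" using B[of 0] by linarith
  then show ?thesis
    using B G by (intro fin_borel_integrable[OF w, of _ "B * G"]) (auto simp: abs_mult intro!: mult_mono)
qed

lemma smear_borel: assumes w: "fin_borel w" and [measurable]: "g \<in> borel_measurable borel"
  shows "smear w g l \<in> borel_measurable borel"
proof -
  have [measurable_cong]: "sets w = sets borel" and "finite_measure w" using w by (auto simp: fin_borel_def)
  then interpret finite_measure w by simp
  show ?thesis unfolding smear_def[abs_def] by measurable
qed

lemma smear_integrable:
  assumes w: "fin_borel w" and g: "g \<in> borel_measurable borel" "\<And>\<xi>. \<bar>g \<xi>\<bar> \<le> G"
    and ch: "continuous_on UNIV ch" "\<And>x. norm x > R \<Longrightarrow> ch x = 0" "\<And>x. 0 \<le> ch x" "\<And>x. ch x \<le> (1 :: real)"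
  shows "integrable lborel (\<lambda>x. ch x * smear w g l x)"
proof -
  have fw: "finite_measure w" using w by (auto simp: fin_borel_def)
  note [measurable] = smear_borel[OF w g(1)] borel_measurable_continuous_onI[OF ch(1)]
  obtain B where B: "\<And>v. \<bar>pk l v\<bar> \<le> B" using pk_bounded by blast
  have B0: "B \<ge> 0" using B[of 0] by linarith
  have T: "\<bar>smear w g l x\<bar> \<le> B * G * measure w UNIV" for x
  proof -
    have "\<bar>smear w g l x\<bar> \<le> (\<integral>\<xi>. \<bar>pk l (gmult (- x) \<xi>) * g \<xi>\<bar> \<partial>w)" unfolding smear_def by (rule integral_abs_bound)
    also have "\<dots> \<le> (\<integral>\<xi>. B * G \<partial>w)"
    proof (rule integral_mono[OF integrable_abs[OF smear_integrand[OF w g]] finite_measure.integrable_const[OF fw]])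
      show "\<bar>pk l (gmult (- x) \<xi>) * g \<xi>\<bar> \<le> B * G" for \<xi>
        unfolding abs_mult using B g(2) B0 by (intro mult_mono) auto
    qed
    also have "\<dots> = B * G * measure w UNIV"
      using w sets_eq_imp_space_eq[of w borel] by (simp add: fin_borel_def mult.commute)
    finally show ?thesis .
  qed
  show ?thesis
  proof (rule Bochner_Integration.integrable_bound[OF integrable_cball[of R "B * G * measure w UNIV"]])
    have "\<bar>ch x * smear w g l x\<bar> \<le> \<bar>indicator (cball 0 R) x * (B * G * measure w UNIV)\<bar>" for x
    proof (cases "norm x \<le> R")
      case True
      have "\<bar>ch x\<bar> * \<bar>smear w g l x\<bar> \<le> 1 * \<bar>B * G * measure w UNIV\<bar>"
        using ch(3,4) T[of x] by (intro mult_mono) auto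
      then show ?thesis using True by (simp add: abs_mult)
    qed (use ch(2)[of x] in simp)
    then show "AE x in lborel. norm (ch x * smear w g l x) \<le> norm (indicator (cball 0 R) x * (B * G * measure w UNIV))"
      by simp
  qed measurable
qed

text \<open>Invariance of Lebesgue measure lets the kernel act on the test function instead of the
  measure, where it becomes an average of \<open>ch\<close> over right translates.\<close>

lemma kernel_transpose:
  assumes [measurable]: "ch \<in> borel_measurable borel"
  shows "(\<integral>z. ch z * pk l (gmult (- z) Y) \<partial>lborel) = (\<integral>v. ch (gmult Y (- dil (th ^ l) v)) * pp v \<partial>lborel)"
proof -
  define h where "h = (\<lambda>x. ch (gmult Y (- x)) * pk l x)"
  have [measurable]: "h \<in> borel_measurable borel" unfolding h_def by measurable
  have "(\<integral>z. ch z * pk l (gmult (- z) Y) \<partial>lborel) = (\<integral>z. ch (- z) * pk l (gmult z Y) \<partial>lborel)"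
    using integral_neg[of "\<lambda>z. ch z * pk l (gmult (- z) Y)"] by simp
  also have "\<dots> = (\<integral>z. h (gmult z Y) \<partial>lborel)"
    by (simp add: h_def neg_gmult)
  also have "\<dots> = (\<integral>z. h z \<partial>lborel)" by (rule integral_right_shift) simp
  also have "\<dots> = J th ^ l * (\<integral>v. h (dil (th ^ l) v) \<partial>lborel)"
    using integral_dil[of h "th ^ l"] th_pow[of l] J_pos[OF th_bounds(4)] by simp
  also have "\<dots> = (\<integral>v. J th ^ l * h (dil (th ^ l) v) \<partial>lborel)" by simp
  also have "\<dots> = (\<integral>v. ch (gmult Y (- dil (th ^ l) v)) * pp v \<partial>lborel)"
    using th_pow(3)[of l] J_pos[OF th_bounds(4)] by (simp add: h_def pk_dil)
  finally show ?thesis .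
qed

text \<open>After transposing the kernels, weak convergence of the mollified measures to
  \<open>g w\<close> reduces to pointwise convergence of bounded averages of
  \<open>ch\<close>.\<close>

lemma smear_limit:
  assumes w: "fin_borel w" and g: "g \<in> borel_measurable borel" "\<And>\<xi>. \<bar>g \<xi>\<bar> \<le> G"
    and ch: "continuous_on UNIV ch" "\<And>x. norm x > R \<Longrightarrow> ch x = 0" "\<And>x. 0 \<le> ch x" "\<And>x. ch x \<le> (1 :: real)"
  shows "(\<lambda>l. \<integral>x. ch x * smear w g l x \<partial>lborel) \<longlonglongrightarrow> (\<integral>\<xi>. ch \<xi> * g \<xi> \<partial>w)"
proof -
  have sw [measurable_cong]: "sets w = sets borel" and fw: "finite_measure w" using w by (auto simp: fin_borel_def)
  note [measurable] = borel_measurable_continuous_onI[OF ch(1)] g(1)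
  define c where "c = (\<lambda>l Y. \<integral>v. ch (gmult Y (- dil (th ^ l) v)) * pp v \<partial>lborel)"
  have [measurable]: "c l \<in> borel_measurable borel" for l unfolding c_def by measurable
  have eq: "(\<integral>x. ch x * smear w g l x \<partial>lborel) = (\<integral>Y. c l Y * g Y \<partial>w)" for l
  proof -
    obtain B where B: "\<And>v. \<bar>pk l v\<bar> \<le> B" using pk_bounded by blast
    have B0: "B \<ge> 0" using B[of 0] by linarith
    have "(\<integral>x. ch x * smear w g l x \<partial>lborel) = (\<integral>x. (\<integral>Y. ch x *\<^sub>R (pk l (gmult (- x) Y) * g Y) \<partial>w) \<partial>lborel)"
      unfolding smear_def using smear_integrand[OF w g] by simp
    also have "\<dots> = (\<integral>Y. (\<integral>x. ch x *\<^sub>R (pk l (gmult (- x) Y) * g Y) \<partial>lborel) \<partial>w)"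
    proof (rule fubini_test[OF fw sw, where R = R and B = "1 * (B * G)"])
      show "norm z > R \<Longrightarrow> ch z = 0" for z by (rule ch(2))
      show "norm (ch z *\<^sub>R (pk l (gmult (- z) Y) * g Y)) \<le> 1 * (B * G)" for z Y
        using ch(3,4)[of z] B[of "gmult (- z) Y"] g(2)[of Y] B0
        unfolding real_scaleR_def real_norm_def abs_mult by (intro mult_mono) auto
    qed measurable
    also have "\<dots> = (\<integral>Y. (\<integral>x. (ch x * pk l (gmult (- x) Y)) * g Y \<partial>lborel) \<partial>w)" by (simp add: mult.assoc)
    also have "\<dots> = (\<integral>Y. c l Y * g Y \<partial>w)"
      unfolding c_def using kernel_transpose[of ch l] by simp
    finally show ?thesis .
  qed
  have lim: "(\<lambda>l. c l Y) \<longlonglongrightarrow> ch Y" for Y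
  proof -
    have "(\<lambda>l. c l Y) \<longlonglongrightarrow> (\<integral>v. ch Y * pp v \<partial>lborel)"
      unfolding c_def
    proof (rule integral_dominated_convergence[where w = pp])
      show "AE v in lborel. (\<lambda>l. ch (gmult Y (- dil (th ^ l) v)) * pp v) \<longlonglongrightarrow> ch Y * pp v"
      proof (rule AE_I2)
        fix v
        have "(\<lambda>l. th ^ l) \<longlonglongrightarrow> 0" using th_bounds by (intro LIMSEQ_power_zero) simp
        moreover have "continuous_on UNIV (\<lambda>t. ch (gmult Y (- dil t v)))"
          by (intro continuous_on_compose2[OF ch(1)] continuous_on_gmult continuous_on_dil continuous_intros) auto
        then have "isCont (\<lambda>t. ch (gmult Y (- dil t v))) 0" by (simp add: continuous_on_eq_continuous_at)
        ultimately have "(\<lambda>l. ch (gmult Y (- dil (th ^ l) v))) \<longlonglongrightarrow> ch (gmult Y (- dil 0 v))"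
          by (rule isCont_tendsto_compose[rotated])
        moreover have "dil 0 v = 0" by (auto simp: dil_def intro!: sum.neutral)
        ultimately show "(\<lambda>l. ch (gmult Y (- dil (th ^ l) v)) * pp v) \<longlonglongrightarrow> ch Y * pp v"
          by (intro tendsto_mult_right) simp
      qed
      show "AE v in lborel. norm (ch (gmult Y (- dil (th ^ l) v)) * pp v) \<le> pp v" for l
        using ch(3,4) pp_nonneg by (intro AE_I2) (auto simp: abs_mult intro!: mult_left_le_one_le)
    qed (simp_all add: pp_integrable)
    then show ?thesis by (simp add: integral_pp)
  qed
  have c1: "\<bar>c l Y\<bar> \<le> 1" for l Y
  proof -
    have "\<bar>c l Y\<bar> \<le> (\<integral>v. \<bar>ch (gmult Y (- dil (th ^ l) v)) * pp v\<bar> \<partial>lborel)" unfolding c_def by (rule integral_abs_bound)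
    also have "\<dots> \<le> (\<integral>v. pp v \<partial>lborel)"
      using ch(3,4) pp_nonneg by (intro Bochner_Integration.integral_mono' pp_integrable) (auto simp: abs_mult intro!: mult_left_le_one_le)
    finally show ?thesis by (simp add: integral_pp)
  qed
  show ?thesis unfolding eq
  proof (rule integral_dominated_convergence[where w = "\<lambda>_. G"])
    show "integrable w (\<lambda>_. G)" by (rule finite_measure.integrable_const[OF fw])
    show "AE Y in w. (\<lambda>l. c l Y * g Y) \<longlonglongrightarrow> ch Y * g Y"
      by (intro AE_I2 tendsto_mult_right lim)
    show "AE Y in w. norm (c l Y * g Y) \<le> G" for l
    proof (rule AE_I2)
      fix Y show "norm (c l Y * g Y) \<le> G"
        using mult_mono[OF c1[of l Y] g(2)[of Y]] by (simp add: abs_mult)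
    qed
  qed measurable
qed

text \<open>Jensen's inequality for the squared distance to \<open>e\<close>, obtained from its
  tangent at the mean direction, whose linear part integrates to zero.\<close>

lemma freeze_average:
  assumes w: "fin_borel w" and f: "density1 f"
  shows "dens w l x * (norm (mdir w f l x - e))\<^sup>2 \<le> smear w (\<lambda>\<xi>. (norm (f \<xi> - e))\<^sup>2) l x"
proof -
  define h where "h = mdir w f l x"
  have fm [measurable]: "f \<in> borel_measurable borel" and f1: "\<And>\<xi>. norm (f \<xi>) \<le> 1" using f by (auto simp: density1_def)
  note i = pk_integrable[OF w f, of l x]
  have b: "\<bar>(norm (f \<xi> - e))\<^sup>2\<bar> \<le> (1 + norm e)\<^sup>2" for \<xi>
    using norm_triangle_ineq4[of "f \<xi>" e] f1[of \<xi>] by (simp add: power_mono)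
  have "dens w l x * (norm (h - e))\<^sup>2 =
      (\<integral>\<xi>. pk l (gmult (- x) \<xi>) * (norm (h - e))\<^sup>2 + 2 * ((pk l (gmult (- x) \<xi>) *\<^sub>R f \<xi> - pk l (gmult (- x) \<xi>) *\<^sub>R h) \<bullet> (h - e)) \<partial>w)"
  proof -
    have "(\<integral>\<xi>. (pk l (gmult (- x) \<xi>) *\<^sub>R f \<xi> - pk l (gmult (- x) \<xi>) *\<^sub>R h) \<bullet> (h - e) \<partial>w) =
        (flux w f l x - dens w l x *\<^sub>R h) \<bullet> (h - e)"
      using i by (subst integral_inner_left) (simp_all add: dens_def flux_def)
    also have "\<dots> = 0" using flux_eq[OF w f, of l x] by (simp add: h_def)
    finally have z: "(\<integral>\<xi>. (pk l (gmult (- x) \<xi>) *\<^sub>R f \<xi> - pk l (gmult (- x) \<xi>) *\<^sub>R h) \<bullet> (h - e) \<partial>w) = 0" .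
    have "integrable w (\<lambda>\<xi>. (pk l (gmult (- x) \<xi>) *\<^sub>R f \<xi> - pk l (gmult (- x) \<xi>) *\<^sub>R h) \<bullet> (h - e))"
      using i by (intro integrable_inner_left Bochner_Integration.integrable_diff integrable_scaleR_left)
    then show ?thesis using i z by (simp add: dens_def del: inner_scaleR_left)
  qed
  also have "\<dots> \<le> smear w (\<lambda>\<xi>. (norm (f \<xi> - e))\<^sup>2) l x"
    unfolding smear_def
  proof (rule integral_mono)
    show "integrable w (\<lambda>\<xi>. pk l (gmult (- x) \<xi>) * (norm (h - e))\<^sup>2 + 2 * ((pk l (gmult (- x) \<xi>) *\<^sub>R f \<xi> - pk l (gmult (- x) \<xi>) *\<^sub>R h) \<bullet> (h - e)))"
      using i by (intro Bochner_Integration.integrable_add integrable_mult_right integrable_mult_left integrable_inner_left Bochner_Integration.integrable_diff integrable_scaleR_left)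
    show "integrable w (\<lambda>\<xi>. pk l (gmult (- x) \<xi>) * (norm (f \<xi> - e))\<^sup>2)"
      by (rule smear_integrand[OF w _ b]) measurable
    fix \<xi>
    let ?p = "pk l (gmult (- x) \<xi>)"
    have "(norm (f \<xi> - e))\<^sup>2 = (norm (h - e))\<^sup>2 + 2 * ((f \<xi> - h) \<bullet> (h - e)) + (norm (f \<xi> - h))\<^sup>2"
      by (simp add: power2_norm_eq_inner inner_diff_left inner_diff_right inner_commute)
    then have "?p * ((norm (h - e))\<^sup>2 + 2 * ((f \<xi> - h) \<bullet> (h - e))) \<le> ?p * (norm (f \<xi> - e))\<^sup>2"
      using pk_nonneg by (intro mult_left_mono) auto
    then show "?p * (norm (h - e))\<^sup>2 + 2 * ((?p *\<^sub>R f \<xi> - ?p *\<^sub>R h) \<bullet> (h - e)) \<le> ?p * (norm (f \<xi> - e))\<^sup>2"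
      by (simp add: algebra_simps inner_diff_left)
  qed
  finally show ?thesis by (simp add: h_def)
qed

lemma deviation_bounds:
  assumes "density1 f"
  shows "(\<lambda>\<xi>. (norm (f \<xi> - e))\<^sup>2) \<in> borel_measurable borel" "\<bar>(norm (f \<xi> - e))\<^sup>2\<bar> \<le> (1 + norm e)\<^sup>2"
proof -
  have [measurable]: "f \<in> borel_measurable borel" and f1: "norm (f \<xi>) \<le> 1" using assms by (auto simp: density1_def)
  show "(\<lambda>\<xi>. (norm (f \<xi> - e))\<^sup>2) \<in> borel_measurable borel" by measurable
  show "\<bar>(norm (f \<xi> - e))\<^sup>2\<bar> \<le> (1 + norm e)\<^sup>2"
    using norm_triangle_ineq4[of "f \<xi>" e] f1 by (simp add: power_mono)
qed

text \<open>\<open>damp c\<close> loses at most \<open>c\<close> of the density, and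
  \<open>psi_perturb\<close> compares the directions at scale \<open>l\<close> with the fixed
  vectors \<open>r0 j\<close>. The cutoff \<open>ch\<close> makes the loss integrable: it costs
  \<open>c\<close> times the volume seen by \<open>ch\<close>, times the number of
  directions.\<close>

lemma Phi_lower:
  assumes adm: "admissible w I r" and c: "c > (0 :: real)"
    and ch: "continuous_on UNIV ch" "\<And>x. norm x > R \<Longrightarrow> ch x = 0" "\<And>x. 0 \<le> ch x" "\<And>x. ch x \<le> (1 :: real)"
  shows "psi I r0 / 2 * (\<integral>x. ch x * smear w (\<lambda>_. 1) l x \<partial>lborel) -
      (\<Sum>j\<in>I. \<integral>x. ch x * smear w (\<lambda>\<xi>. (norm (r j \<xi> - r0 j))\<^sup>2) l x \<partial>lborel) - c * card I * (\<integral>x. ch x \<partial>lborel) \<le> Phi w I r c l"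
proof -
  have w: "fin_borel w" and r: "\<And>j. j \<in> I \<Longrightarrow> density1 (r j)" using adm by (auto simp: admissible_def)
  let ?X = "\<lambda>j. smear w (\<lambda>\<xi>. (norm (r j \<xi> - r0 j))\<^sup>2) l"
  have T1: "smear w (\<lambda>_. 1) l x = dens w l x" for x by (simp add: smear_def dens_def)
  have i1: "integrable lborel (\<lambda>x. ch x * smear w (\<lambda>_. 1) l x)"
    by (rule smear_integrable[OF w _ _ ch, where G = 1]) auto
  have iX: "integrable lborel (\<lambda>x. ch x * ?X j x)" if "j \<in> I" for j
    by (rule smear_integrable[OF w deviation_bounds[OF r[OF that]] ch])
  have ic: "integrable lborel ch" by (rule integrable_compact_support[OF ch(1,2)])
  have "psi I r0 / 2 * (\<integral>x. ch x * smear w (\<lambda>_. 1) l x \<partial>lborel) - (\<Sum>j\<in>I. \<integral>x. ch x * ?X j x \<partial>lborel) - c * card I * (\<integral>x. ch x \<partial>lborel) =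
      (\<integral>x. psi I r0 / 2 * (ch x * smear w (\<lambda>_. 1) l x) - (\<Sum>j\<in>I. ch x * ?X j x) - c * card I * ch x \<partial>lborel)"
    using i1 iX ic by (simp add: Bochner_Integration.integral_sum)
  also have "\<dots> \<le> Phi w I r c l"
    unfolding Phi_def
  proof (rule integral_mono)
    show "integrable lborel (\<lambda>x. psi I r0 / 2 * (ch x * smear w (\<lambda>_. 1) l x) - (\<Sum>j\<in>I. ch x * ?X j x) - c * card I * ch x)"
      using i1 iX ic by (intro Bochner_Integration.integrable_diff integrable_mult_right Bochner_Integration.integrable_sum)
    show "integrable lborel (\<lambda>x. damp c (dens w l x) * psi I (\<lambda>j. mdir w (r j) l x))" by (rule Phi_integrable[OF adm c])
    fix x
    define u where "u = dens w l x"
    define p where "p = psi I (\<lambda>j. mdir w (r j) l x)"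
    have u0: "u \<ge> 0" and p0: "p \<ge> 0" and p1: "p \<le> card I" by (simp_all add: u_def p_def dens_nonneg psi_nonneg hpsi_le[OF adm])
    have "psi I r0 \<le> 2 * p + 2 * (\<Sum>j\<in>I. (norm (mdir w (r j) l x - r0 j))\<^sup>2)"
      using psi_perturb[of I r0 "\<lambda>j. mdir w (r j) l x"] by (simp add: p_def norm_minus_commute)
    from mult_left_mono[OF this u0]
    have "u * psi I r0 \<le> 2 * (u * p) + 2 * (\<Sum>j\<in>I. u * (norm (mdir w (r j) l x - r0 j))\<^sup>2)"
      by (simp add: algebra_simps sum_distrib_left)
    also have "(\<Sum>j\<in>I. u * (norm (mdir w (r j) l x - r0 j))\<^sup>2) \<le> (\<Sum>j\<in>I. ?X j x)"
      unfolding u_def by (intro sum_mono freeze_average w r)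
    finally have 1: "psi I r0 / 2 * u - (\<Sum>j\<in>I. ?X j x) \<le> u * p" by (simp add: mult.commute)
    have "u * p - c * p \<le> damp c u * p" using mult_right_mono[OF damp_ge[OF c u0] p0] by (simp add: algebra_simps)
    moreover have "c * p \<le> c * card I" using c p1 by (intro mult_left_mono) auto
    ultimately have "psi I r0 / 2 * u - (\<Sum>j\<in>I. ?X j x) - c * card I \<le> damp c u * p" using 1 by linarith
    from mult_left_mono[OF this ch(3)[of x]]
    have "psi I r0 / 2 * (ch x * u) - (\<Sum>j\<in>I. ch x * ?X j x) - c * card I * ch x \<le> ch x * (damp c u * p)"
      by (simp add: algebra_simps sum_distrib_left)
    also have "\<dots> \<le> damp c u * p"
      using ch(3,4)[of x] damp_nonneg[OF c u0] p0 by (intro mult_left_le_one_le) auto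
    finally show "psi I r0 / 2 * (ch x * smear w (\<lambda>_. 1) l x) - (\<Sum>j\<in>I. ch x * ?X j x) - c * card I * ch x \<le>
        damp c (dens w l x) * psi I (\<lambda>j. mdir w (r j) l x)"
      by (simp add: T1 u_def p_def)
  qed
  finally show ?thesis .
qed

text \<open>The order of the limits matters. First \<open>l\<close> tends to infinity, with
  \<open>Phi\<close> bounded by its value at scale \<open>K + 1\<close> plus a tail; then the
  cutoffs shrink to \<open>E\<close>, whose volume 0 removes the loss for fixed \<open>c\<close>;
  then \<open>c\<close> tends to infinity and kills \<open>Phi\<close> at the fixed scale; last, the
  tail vanishes with \<open>K\<close>.\<close>

lemma compact_null:
  assumes adm: "admissible w I r" and E: "compact E" "emeasure lborel E = 0"
  shows "psi I r0 / 2 * measure w E \<le> (\<Sum>j\<in>I. \<integral>x. indicator E x * (norm (r j x - r0 j))\<^sup>2 \<partial>w)"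
proof (cases "E = {}")
  case False
  have w: "fin_borel w" and r: "\<And>j. j \<in> I \<Longrightarrow> density1 (r j)" using adm by (auto simp: admissible_def)
  have sw [measurable_cong]: "sets w = sets borel" and fw: "finite_measure w" using w by (auto simp: fin_borel_def)
  obtain e where e: "\<And>i. 0 \<le> e i" "summable e" "\<And>c i. c > 0 \<Longrightarrow> Phi w I r c (Suc (Suc i)) \<le> Phi w I r c (Suc i) + e i"
    by (rule functional_decay[OF adm]) (rule that)
  define t where "t = (\<lambda>K. \<Sum>i. e (i + K))"
  have decay: "Phi w I r c (Suc (m + K)) \<le> Phi w I r c (Suc K) + t K" if c: "c > 0" for c m K
  proof -
    have "Phi w I r c (Suc (m + K)) \<le> Phi w I r c (Suc K) + (\<Sum>i<m. e (i + K))"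
    proof (induction m)
      case (Suc m)
      then show ?case using e(3)[OF c, of "m + K"] by simp
    qed simp
    moreover have "(\<Sum>i<m. e (i + K)) \<le> t K"
      unfolding t_def using e by (intro sum_le_suminf) (auto simp: summable_iff_shift)
    ultimately show ?thesis by linarith
  qed
  define ch where "ch = (\<lambda>n x. max 0 (1 - real (Suc n) * infdist x E))"
  obtain R where R: "\<And>x. x \<in> E \<Longrightarrow> norm x \<le> R" using compact_imp_bounded[OF E(1)] bounded_iff by metis
  have chc: "continuous_on UNIV (ch n)" for n unfolding ch_def by (intro continuous_intros)
  have chR: "ch n x = 0" if "norm x > R + 1" for n x
  proof -
    obtain y where y: "y \<in> E" "infdist x E = dist x y"
      using infdist_attains_inf[OF compact_imp_closed[OF E(1)] False] by metis
    have "dist x y \<ge> norm x - norm y" by (metis dist_norm norm_triangle_ineq2)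
    then have "1 \<le> infdist x E" using R[OF y(1)] that y(2) by linarith
    then have "1 * 1 \<le> real (Suc n) * infdist x E" by (intro mult_mono) auto
    then show ?thesis by (simp add: ch_def)
  qed
  have ch0: "0 \<le> ch n x" and ch1: "ch n x \<le> 1" for n x by (auto simp: ch_def infdist_nonneg)
  note ch = chc chR ch0 ch1
  note [measurable] = borel_measurable_continuous_onI[OF chc]
  have Em [measurable]: "E \<in> sets borel" using E(1) by (simp add: borel_compact)
  have chlim: "(\<lambda>n. ch n x) \<longlonglongrightarrow> indicator E x" for x
  proof (cases "x \<in> E")
    case True
    then show ?thesis by (simp add: ch_def)
  next
    case False
    then have d: "infdist x E > 0"
      using in_closed_iff_infdist_zero[OF compact_imp_closed[OF E(1)] \<open>E \<noteq> {}\<close>, of x] infdist_nonneg[of x E] by linarith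
    obtain N where N: "1 / infdist x E < real N" using reals_Archimedean2 by blast
    have "eventually (\<lambda>n. ch n x = 0) sequentially"
      using eventually_ge_at_top[of N]
    proof eventually_elim
      case (elim n)
      have "1 < real N * infdist x E" using N d by (simp add: pos_divide_less_eq)
      also have "\<dots> \<le> real (Suc n) * infdist x E" using elim d by (intro mult_right_mono) auto
      finally show ?case by (simp add: ch_def)
    qed
    then show ?thesis using False by (simp add: tendsto_eventually)
  qed
  let ?dev = "\<lambda>j \<xi>. (norm (r j \<xi> - r0 j))\<^sup>2"
  have 1: "psi I r0 / 2 * (\<integral>x. ch n x * 1 \<partial>w) - (\<Sum>j\<in>I. \<integral>x. ch n x * ?dev j x \<partial>w) - c * card I * (\<integral>x. ch n x \<partial>lborel) \<le>
      Phi w I r c (Suc K) + t K" if c: "c > 0" for c :: real and n K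
  proof (rule LIMSEQ_le_const2)
    let ?Y = "\<lambda>l. psi I r0 / 2 * (\<integral>x. ch n x * smear w (\<lambda>_. 1) l x \<partial>lborel) -
      (\<Sum>j\<in>I. \<integral>x. ch n x * smear w (?dev j) l x \<partial>lborel) - c * card I * (\<integral>x. ch n x \<partial>lborel)"
    show "?Y \<longlonglongrightarrow> psi I r0 / 2 * (\<integral>x. ch n x * 1 \<partial>w) - (\<Sum>j\<in>I. \<integral>x. ch n x * ?dev j x \<partial>w) - c * card I * (\<integral>x. ch n x \<partial>lborel)"
      by (intro tendsto_intros smear_limit[OF w _ _ ch, where G = 1] smear_limit[OF w deviation_bounds[OF r] ch]) auto
    show "\<exists>N. \<forall>l\<ge>N. ?Y l \<le> Phi w I r c (Suc K) + t K"
    proof (intro exI[of _ "Suc K"] allI impI)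
      fix l assume "l \<ge> Suc K"
      then have l: "l = Suc ((l - Suc K) + K)" by simp
      have "?Y l \<le> Phi w I r c l" by (rule Phi_lower[OF adm c ch])
      also have "\<dots> \<le> Phi w I r c (Suc K) + t K" using decay[OF c, of "l - Suc K" K] l by simp
      finally show "?Y l \<le> Phi w I r c (Suc K) + t K" .
    qed
  qed
  have limw: "(\<lambda>n. \<integral>x. ch n x * g x \<partial>w) \<longlonglongrightarrow> (\<integral>x. indicator E x * g x \<partial>w)"
    if [measurable]: "g \<in> borel_measurable borel" and G: "\<And>x. \<bar>g x\<bar> \<le> G" for g :: "real ^ 'n \<Rightarrow> real" and G
  proof (rule integral_dominated_convergence[where w = "\<lambda>_. G"])
    show "integrable w (\<lambda>_. G)" by (rule finite_measure.integrable_const[OF fw])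
    show "AE x in w. (\<lambda>n. ch n x * g x) \<longlonglongrightarrow> indicator E x * g x" by (intro AE_I2 tendsto_mult_right chlim)
    show "AE x in w. norm (ch n x * g x) \<le> G" for n
    proof (rule AE_I2)
      fix x show "norm (ch n x * g x) \<le> G"
        using mult_mono[OF ch1[of n x] G[of x]] ch0[of n x] by (simp add: abs_mult)
    qed
  qed measurable
  have liml: "(\<lambda>n. \<integral>x. ch n x \<partial>lborel) \<longlonglongrightarrow> (\<integral>x. indicator E x \<partial>lborel)"
  proof (rule integral_dominated_convergence[where w = "\<lambda>x. indicator (cball 0 (R + 1)) x * 1"])
    show "integrable lborel (\<lambda>x :: real ^ 'n. indicator (cball 0 (R + 1)) x * 1 :: real)" by (rule integrable_cball)
    show "AE x in lborel. (\<lambda>n. ch n x) \<longlonglongrightarrow> indicator E x" by (intro AE_I2 chlim)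
    show "AE x in lborel. norm (ch n x) \<le> indicator (cball 0 (R + 1)) x * 1" for n
    proof (rule AE_I2)
      fix x show "norm (ch n x) \<le> indicator (cball 0 (R + 1)) x * 1"
        using chR[of x n] ch0[of n x] ch1[of n x] by (cases "norm x \<le> R + 1") auto
    qed
  qed measurable
  let ?L = "psi I r0 / 2 * (\<integral>x. indicator E x * 1 \<partial>w) - (\<Sum>j\<in>I. \<integral>x. indicator E x * ?dev j x \<partial>w)"
  have 2: "?L \<le> Phi w I r c (Suc K) + t K" if c: "c > 0" for c :: real and K
  proof (rule LIMSEQ_le_const2)
    have "(\<lambda>n. psi I r0 / 2 * (\<integral>x. ch n x * 1 \<partial>w) - (\<Sum>j\<in>I. \<integral>x. ch n x * ?dev j x \<partial>w) - c * card I * (\<integral>x. ch n x \<partial>lborel)) \<longlonglongrightarrow>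
        ?L - c * card I * 0"
    proof (intro tendsto_intros limw[OF deviation_bounds[OF r]] limw[of "\<lambda>_. 1" 1])
      show "(\<lambda>n. \<integral>x. ch n x \<partial>lborel) \<longlonglongrightarrow> 0" using liml E(2) by (simp add: measure_def)
    qed auto
    then show "(\<lambda>n. psi I r0 / 2 * (\<integral>x. ch n x * 1 \<partial>w) - (\<Sum>j\<in>I. \<integral>x. ch n x * ?dev j x \<partial>w) - c * card I * (\<integral>x. ch n x \<partial>lborel)) \<longlonglongrightarrow> ?L" by simp
  qed (use 1[OF c] in auto)
  have 3: "?L \<le> t K" for K
  proof (rule field_le_epsilon)
    fix \<epsilon> :: real assume \<epsilon>: "\<epsilon> > 0"
    obtain B where B: "\<And>c. c > 0 \<Longrightarrow> Phi w I r c (Suc K) \<le> B / c" using Phi_le[OF adm] by blast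
    define c where "c = (\<bar>B\<bar> + 1) / \<epsilon>"
    have c: "c > 0" using \<epsilon> by (simp add: c_def add_pos_nonneg)
    have "B \<le> \<epsilon> * c" using \<epsilon> abs_ge_self[of B] by (simp add: c_def)
    then have "B / c \<le> \<epsilon>" using c by (simp add: pos_divide_le_eq)
    then show "?L \<le> t K + \<epsilon>" using 2[OF c, of K] B[OF c] by linarith
  qed
  have "?L \<le> 0"
  proof (rule field_le_epsilon)
    fix \<epsilon> :: real assume \<epsilon>: "\<epsilon> > 0"
    obtain K where "norm (\<Sum>i. e (i + K)) < \<epsilon>" using suminf_exist_split[OF \<epsilon> e(2)] by blast
    then show "?L \<le> 0 + \<epsilon>" using 3[of K] by (simp add: t_def)
  qed
  then show ?thesis by simp
qed simp

end

section \<open>From compact null sets to Borel null sets, and the geometry of horizontal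
  vectors\<close>

context carnot
begin

text \<open>The set is covered by countably many pieces on which each \<open>r j\<close> is within
  \<open>\<epsilon>\<close> of a constant. On a compact piece of positive mass,
  \<open>compact_null\<close> makes \<open>psi\<close> of these constants of order
  \<open>\<epsilon>\<^sup>2\<close>, whereas \<open>psi\<close> of the directions exceeds
  \<open>\<delta>\<close>. Inner regularity passes from compact to Borel pieces.\<close>

theorem elliptic_part_not_null:
  assumes adm: "admissible w I r" and N: "N \<in> sets borel" "emeasure lborel N = 0"
  shows "emeasure w {x \<in> N. psi I (\<lambda>j. r j x) > 0} = 0"
proof -
  have w: "fin_borel w" and fI: "finite I" and r: "\<And>j. j \<in> I \<Longrightarrow> density1 (r j)" using adm by (auto simp: admissible_def)
  have sw [measurable_cong]: "sets w = sets borel" and fw: "finite_measure w" using w by (auto simp: fin_borel_def)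
  interpret finite_measure w by (rule fw)
  have rm [measurable]: "r j \<in> borel_measurable borel" if "j \<in> I" for j using r[OF that] by (simp add: density1_def)
  have [measurable]: "(\<lambda>x. psi I (\<lambda>j. r j x)) \<in> borel_measurable borel" by (rule psi_borel[OF rm])
  note [measurable] = N(1)
  obtain D :: "(real ^ 'n) set" where D: "countable D" "\<And>X. open X \<Longrightarrow> X \<noteq> {} \<Longrightarrow> \<exists>d\<in>D. d \<in> X"
    by (rule countable_dense_setE) blast
  have level: "{x \<in> N. psi I (\<lambda>j. r j x) > \<delta>} \<in> null_sets w" if \<delta>: "\<delta> > 0" for \<delta>
  proof -
    \<comment> \<open>\<open>compact_null\<close> will give
      \<open>psi I r0 \<le> 2 * card I * \<epsilon>\<^sup>2\<close>, and \<open>psi_perturb\<close>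
      raises this to \<open>6 * card I * \<epsilon>\<^sup>2\<close>, which must not exceed
      \<open>\<delta>\<close>. The additional 6 covers an empty \<open>I\<close>.\<close>
    define \<epsilon> where "\<epsilon> = sqrt (\<delta> / (6 * card I + 6))"
    have \<epsilon>: "\<epsilon> > 0" using \<delta> by (simp add: \<epsilon>_def)
    have \<epsilon>2: "6 * card I * \<epsilon>\<^sup>2 \<le> \<delta>" using \<delta> by (simp add: \<epsilon>_def divide_simps)
    define C where "C = (\<lambda>r0. {x \<in> N. psi I (\<lambda>j. r j x) > \<delta> \<and> (\<forall>j\<in>I. norm (r j x - r0 j) < \<epsilon>)})"
    have Cm [measurable]: "C r0 \<in> sets borel" for r0
    proof -
      have Qm: "{x \<in> N. psi I (\<lambda>j. r j x) > \<delta>} \<in> sets borel" by measurable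
      have "C r0 = {x \<in> N. psi I (\<lambda>j. r j x) > \<delta>} \<inter> (\<Inter>j\<in>I. {x. norm (r j x - r0 j) < \<epsilon>}) \<inter> UNIV" by (auto simp: C_def)
      also have "\<dots> \<in> sets borel"
      proof (cases "I = {}")
        case False
        then show ?thesis using fI by (intro sets.Int sets.finite_INT) measurable
      qed (use Qm in simp)
      finally show ?thesis .
    qed
    have "emeasure w (C r0) = 0" for r0
    proof -
      have "emeasure w E = 0" if E: "E \<subseteq> C r0" "compact E" for E
      proof (rule ccontr)
        assume "emeasure w E \<noteq> 0"
        then have pos: "measure w E > 0" by (simp add: emeasure_eq_measure zero_less_measure_iff)
        then obtain x where x: "x \<in> E" by (cases "E = {}") auto
        have le: "norm (r j y - r0 j) \<le> \<epsilon>" if "y \<in> E" "j \<in> I" for y j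
        proof -
          have "y \<in> C r0" using E(1) that(1) by blast
          then show ?thesis using that(2) by (simp add: C_def less_imp_le)
        qed
        have [measurable]: "E \<in> sets borel" using E(2) by (simp add: borel_compact)
        have "emeasure lborel E \<le> emeasure lborel N" using E(1) by (intro emeasure_mono) (auto simp: C_def)
        then have "psi I r0 / 2 * measure w E \<le> (\<Sum>j\<in>I. \<integral>x. indicator E x * (norm (r j x - r0 j))\<^sup>2 \<partial>w)"
          using N(2) by (intro compact_null[OF adm E(2)]) simp
        also have "\<dots> \<le> (\<Sum>j\<in>I. \<epsilon>\<^sup>2 * measure w E)"
        proof (rule sum_mono)
          fix j assume j: "j \<in> I"
          have "(\<integral>x. indicator E x * (norm (r j x - r0 j))\<^sup>2 \<partial>w) \<le> (\<integral>x. indicator E x * \<epsilon>\<^sup>2 \<partial>w)"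
          proof (rule Bochner_Integration.integral_mono')
            show "integrable w (\<lambda>x. indicator E x * \<epsilon>\<^sup>2)" by (intro integrable_mult_left integrable_real_indicator) (auto simp: sw emeasure_eq_measure)
            show "indicator E x * (norm (r j x - r0 j))\<^sup>2 \<le> indicator E x * \<epsilon>\<^sup>2" for x
              using le[OF _ j, of x] by (auto simp: indicator_def intro!: power_mono)
          qed (use \<epsilon> in simp)
          then show "(\<integral>x. indicator E x * (norm (r j x - r0 j))\<^sup>2 \<partial>w) \<le> \<epsilon>\<^sup>2 * measure w E" by (simp add: sw mult.commute)
        qed
        finally have "psi I r0 * measure w E \<le> (2 * card I * \<epsilon>\<^sup>2) * measure w E" by (simp add: mult_ac)
        then have p0: "psi I r0 \<le> 2 * card I * \<epsilon>\<^sup>2" using pos by simp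
        have "psi I (\<lambda>j. r j x) \<le> 2 * psi I r0 + 2 * (\<Sum>j\<in>I. (norm (r j x - r0 j))\<^sup>2)" by (rule psi_perturb)
        also have "(\<Sum>j\<in>I. (norm (r j x - r0 j))\<^sup>2) \<le> (\<Sum>j\<in>I. \<epsilon>\<^sup>2)"
          using le[OF x] by (intro sum_mono power_mono) auto
        finally have "psi I (\<lambda>j. r j x) \<le> \<delta>" using p0 \<epsilon>2 by simp
        then show False using E(1) x by (auto simp: C_def)
      qed
      then have "(SUP K \<in> {K. K \<subseteq> C r0 \<and> compact K}. emeasure w K) \<le> 0" by (intro SUP_least) simp
      moreover have "emeasure w (C r0) = (SUP K \<in> {K. K \<subseteq> C r0 \<and> compact K}. emeasure w K)"
        by (rule inner_regular) (use sw in auto)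
      ultimately show ?thesis by simp
    qed
    then have null: "(\<Union>r0\<in>PiE I (\<lambda>_. D). C r0) \<in> null_sets w"
      by (intro null_sets_UN' countable_PiE fI D(1)) (auto simp: null_sets_def sw)
    have sub: "{x \<in> N. psi I (\<lambda>j. r j x) > \<delta>} \<subseteq> (\<Union>r0\<in>PiE I (\<lambda>_. D). C r0)"
    proof
      fix x assume x: "x \<in> {x \<in> N. psi I (\<lambda>j. r j x) > \<delta>}"
      have "\<exists>d\<in>D. d \<in> ball (r j x) \<epsilon>" for j by (rule D(2)) (use \<epsilon> in auto)
      then obtain d where d: "\<And>j. d j \<in> D" "\<And>j. dist (r j x) (d j) < \<epsilon>" by (metis mem_ball)
      have "restrict d I \<in> PiE I (\<lambda>_. D)" using d(1) by auto
      moreover have "x \<in> C (restrict d I)" using x d(2) by (auto simp: C_def dist_norm)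
      ultimately show "x \<in> (\<Union>r0\<in>PiE I (\<lambda>_. D). C r0)" by blast
    qed
    show ?thesis by (rule null_sets_subset[OF null _ sub]) (simp add: sw)
  qed
  have null: "(\<Union>n. {x \<in> N. psi I (\<lambda>j. r j x) > 1 / real (Suc n)}) \<in> null_sets w"
    by (intro null_sets_UN level) simp
  have sub: "{x \<in> N. psi I (\<lambda>j. r j x) > 0} \<subseteq> (\<Union>n. {x \<in> N. psi I (\<lambda>j. r j x) > 1 / real (Suc n)})"
  proof clarify
    fix x assume "x \<in> N" "psi I (\<lambda>j. r j x) > 0"
    moreover from this(2) obtain n where "1 / real (Suc n) < psi I (\<lambda>j. r j x)" by (metis nat_approx_posE)
    ultimately show "x \<in> (\<Union>n. {x \<in> N. psi I (\<lambda>j. r j x) > 1 / real (Suc n)})" by auto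
  qed
  have "{x \<in> N. psi I (\<lambda>j. r j x) > 0} \<in> null_sets w" by (rule null_sets_subset[OF null _ sub]) (simp add: sw)
  then show ?thesis by blast
qed

text \<open>By homogeneity the first-layer component is the same at \<open>x\<close> and at
  \<open>dil t x\<close> for nonzero \<open>t\<close>. As \<open>t\<close> tends to 0 it becomes the
  value at the neutral element, which is \<open>a\<close>.\<close>

lemma part_left_field:
  assumes a: "a \<in> V 1" shows "part (left_field gmult a x) 1 = a"
proof -
  have one: "(1 :: nat) \<in> {1..s}" using step_pos by simp
  have sg: "smooth (\<lambda>z. gmult y z)" for y by (intro smooth_gmult smooth_const smooth_ident)
  have fd: "frechet_derivative (dil t) (at z) v = dil t v" for t z v
    using frechet_derivative_at[OF bounded_linear_imp_has_derivative[OF bounded_linear_dil, of t "at z"]] by metis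
  have eq: "part (left_field gmult a (dil t x)) 1 = part (left_field gmult a x) 1" if t: "t \<noteq> 0" for t
  proof -
    have at: "dil t a = t *\<^sub>R a" using dil_layer[of a 1 t] a step_pos by (simp add: layer_def)
    have "frechet_derivative (\<lambda>z. gmult (dil t x) (dil t z)) (at 0) a = left_field gmult (dil t a) (dil t x)"
      by (subst frechet_derivative_chain[OF sg smooth_bounded_linear[OF bounded_linear_dil]])
        (simp add: fd left_field_def)
    moreover have "frechet_derivative (\<lambda>z. dil t (gmult x z)) (at 0) a = dil t (left_field gmult a x)"
      by (subst frechet_derivative_chain[OF smooth_bounded_linear[OF bounded_linear_dil] sg])
        (simp add: fd left_field_def)
    ultimately have "t *\<^sub>R left_field gmult a (dil t x) = dil t (left_field gmult a x)"
      using linear_scale[OF left_field_linear, of t a "dil t x"] by (simp add: gmult_dil at)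
    then have "t *\<^sub>R part (left_field gmult a (dil t x)) 1 = part (dil t (left_field gmult a x)) 1"
      by (metis linear_scale[OF linear_part[OF one]])
    then show ?thesis using t part_dil[OF one] by simp
  qed
  have "continuous_on UNIV (\<lambda>t. part (left_field gmult a (dil t x)) 1)"
    by (intro continuous_on_compose2[OF linear_continuous_on[OF linear_part[OF one, unfolded linear_conv_bounded_linear], of UNIV]]
        continuous_on_compose2[OF smooth_continuous_on[OF smooth_left_field]] continuous_on_dil continuous_intros) auto
  then have "isCont (\<lambda>t. part (left_field gmult a (dil t x)) 1) 0"
    by (simp add: continuous_on_eq_continuous_at)
  then have "((\<lambda>t. part (left_field gmult a (dil t x)) 1) \<longlongrightarrow> part (left_field gmult a (dil 0 x)) 1) (at 0)"
    by (simp only: isCont_def)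
  moreover have "((\<lambda>t. part (left_field gmult a (dil t x)) 1) \<longlongrightarrow> part (left_field gmult a x) 1) (at 0)"
    by (rule tendsto_eventually) (use eq in \<open>auto simp: eventually_at_filter\<close>)
  ultimately have "part (left_field gmult a x) 1 = part (left_field gmult a (dil 0 x)) 1"
    by (rule LIM_unique[symmetric])
  also have "dil 0 x = 0" by (auto simp: dil_def intro!: sum.neutral)
  also have "left_field gmult a 0 = a" using left_field_unique by blast
  also have "part a 1 = a" using part_of_layer[OF a one one] by simp
  finally show ?thesis .
qed

text \<open>A horizontal vector is determined by its first-layer component, so a horizontal current
  can be recorded as a density with values in \<open>V 1\<close>.\<close>

lemma horizontal_part:
  assumes "orthonormal_basis_of (V 1) m e" "v \<in> horizontal_space gmult m e x"
  shows "v = left_field gmult (part v 1) x"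
proof -
  have "(\<lambda>i. left_field gmult (e i) x) ` {1..m} = (\<lambda>a. left_field gmult a x) ` e ` {1..m}" by auto
  then have "v \<in> (\<lambda>a. left_field gmult a x) ` span (e ` {1..m})"
    using assms(2) unfolding horizontal_space_def by (simp add: linear_span_image[OF left_field_linear])
  then obtain a where "a \<in> V 1" "v = left_field gmult a x"
    using assms(1) by (auto simp: orthonormal_basis_of_def)
  then show ?thesis using part_left_field by simp
qed

lemma orthonormal_parseval:
  assumes "orthonormal_basis_of W m e" "v \<in> W"
  shows "(\<Sum>j\<in>{1..m}. (e j \<bullet> v)\<^sup>2) = (norm v)\<^sup>2"
proof -
  have on: "\<And>i j. i \<in> {1..m} \<Longrightarrow> j \<in> {1..m} \<Longrightarrow> e i \<bullet> e j = (if i = j then 1 else 0)" and W: "v \<in> span (e ` {1..m})"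
    using assms by (auto simp: orthonormal_basis_of_def)
  define v' where "v' = (\<Sum>j\<in>{1..m}. (e j \<bullet> v) *\<^sub>R e j)"
  have v'e: "v' \<bullet> e i = v \<bullet> e i" if i: "i \<in> {1..m}" for i
  proof -
    have "v' \<bullet> e i = (\<Sum>j\<in>{1..m}. (e j \<bullet> v) * (e j \<bullet> e i))" by (simp add: v'_def inner_sum_left)
    also have "\<dots> = (\<Sum>j\<in>{1..m}. if j = i then e i \<bullet> v else 0)" using on i by (intro sum.cong) auto
    finally show ?thesis using i by (simp add: inner_commute)
  qed
  have v's: "v' \<in> span (e ` {1..m})" unfolding v'_def by (intro span_sum span_scale span_base) auto
  have "orthogonal (v - v') z" if "z \<in> span (e ` {1..m})" for z
    using that by (rule orthogonal_to_span) (auto simp: orthogonal_def inner_diff_left v'e)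
  from this[OF span_diff[OF W v's]] have "v = v'" by (simp add: orthogonal_def)
  then have "(norm v)\<^sup>2 = v \<bullet> v'" by (simp add: power2_norm_eq_inner)
  also have "\<dots> = (\<Sum>j\<in>{1..m}. (e j \<bullet> v)\<^sup>2)" by (simp add: v'_def inner_sum_right power2_eq_square inner_commute)
  finally show ?thesis ..
qed

lemma psi_basis_pos:
  assumes e: "orthonormal_basis_of (V 1) m e" and l: "\<And>j. j \<in> {1..m} \<Longrightarrow> l j > 0"
  shows "psi {1..m} (\<lambda>j. l j *\<^sub>R e j) > 0"
proof -
  define k where "k = Min (insert 1 (l ` {1..m}))"
  have k: "k > 0" using l by (auto simp: k_def)
  have kl: "k \<le> l j" if "j \<in> {1..m}" for j unfolding k_def using that by (intro Min_le) auto
  have "k\<^sup>2 \<le> psi {1..m} (\<lambda>j. l j *\<^sub>R e j)"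
    unfolding psi_def
  proof (rule cINF_greatest[OF V1_unit_exists])
    fix v assume v: "v \<in> {v \<in> V 1. norm v = 1}"
    have "k\<^sup>2 = (\<Sum>j\<in>{1..m}. k\<^sup>2 * (e j \<bullet> v)\<^sup>2)"
      using orthonormal_parseval[OF e, of v] v by (simp flip: sum_distrib_left)
    also have "\<dots> \<le> (\<Sum>j\<in>{1..m}. ((l j *\<^sub>R e j) \<bullet> v)\<^sup>2)"
      using k kl by (intro sum_mono) (auto simp: power_mult_distrib intro!: mult_right_mono power_mono)
    finally show "k\<^sup>2 \<le> (\<Sum>j\<in>{1..m}. ((l j *\<^sub>R e j) \<bullet> v)\<^sup>2)" .
  qed
  then show ?thesis using k by (meson less_le_trans zero_less_power)
qed

end

subsection \<open>From currents to a common measure\<close>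

text \<open>A finite sum of measures, which dominates each of them.\<close>

definition msum :: "nat set \<Rightarrow> (nat \<Rightarrow> 'a::topological_space measure) \<Rightarrow> 'a measure" where
  "msum I \<eta> = measure_of UNIV (sets borel) (\<lambda>A. \<Sum>j\<in>I. emeasure (\<eta> j) A)"

lemma sets_msum [simp]: "sets (msum I \<eta>) = sets borel" and space_msum [simp]: "space (msum I \<eta>) = UNIV"
  unfolding msum_def using sets.sigma_sets_eq[of "borel :: 'a measure"] by (auto simp: sets_measure_of_conv space_measure_of_conv)

lemma emeasure_msum:
  assumes "\<And>j. j \<in> I \<Longrightarrow> sets (\<eta> j) = sets borel" and A: "A \<in> sets borel"
  shows "emeasure (msum I \<eta>) A = (\<Sum>j\<in>I. emeasure (\<eta> j) A)"
proof (rule emeasure_measure_of[OF msum_def])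
  show "countably_additive (sets (msum I \<eta>)) (\<lambda>A. \<Sum>j\<in>I. emeasure (\<eta> j) A)"
    unfolding countably_additive_def
  proof (intro allI impI)
    fix A :: "nat \<Rightarrow> 'a set" assume A: "range A \<subseteq> sets (msum I \<eta>)" "disjoint_family A"
    have "(\<Sum>i. \<Sum>j\<in>I. emeasure (\<eta> j) (A i)) = (\<Sum>j\<in>I. \<Sum>i. emeasure (\<eta> j) (A i))"
      by (rule suminf_sum) (rule summableI)
    also have "\<dots> = (\<Sum>j\<in>I. emeasure (\<eta> j) (\<Union>i. A i))"
      using A assms(1) by (intro sum.cong refl suminf_emeasure) auto
    finally show "(\<Sum>i. \<Sum>j\<in>I. emeasure (\<eta> j) (A i)) = (\<Sum>j\<in>I. emeasure (\<eta> j) (\<Union>i. A i))" .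
  qed
qed (use A in \<open>auto simp: positive_def\<close>)

context carnot
begin

text \<open>\<open>H\<close> dominates all \<open>\<eta> j\<close>, with densities
  \<open>D j\<close>. Weighting by the sum \<open>S\<close> of the lengths of the
  \<open>D j x *\<^sub>R a j x\<close> gives a finite measure \<open>w\<close> relative to which the
  vector densities have norm at most 1. A measure dominated by all \<open>\<eta> j\<close>, on which
  the \<open>a j\<close> are nonzero constants, lives where \<open>S\<close> is positive, so null
  sets of \<open>w\<close> are null for it.\<close>

lemma common_density:
  assumes I: "finite I" "I \<noteq> {}" and \<eta>: "\<And>j. j \<in> I \<Longrightarrow> finite_measure (\<eta> j)" "\<And>j. j \<in> I \<Longrightarrow> sets (\<eta> j) = sets borel"
    and a: "\<And>j. j \<in> I \<Longrightarrow> integrable (\<eta> j) (a j)" "\<And>j x. j \<in> I \<Longrightarrow> a j x \<in> V 1"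
    and con: "\<And>j \<theta>. j \<in> I \<Longrightarrow> \<theta> \<in> test_functions \<Longrightarrow> (\<integral>x. LX (a j x) \<theta> x \<partial>\<eta> j) = 0"
  obtains w r where "admissible w I r"
    "\<And>(\<nu> :: (real ^ 'n) measure) e A. sets \<nu> = sets borel \<Longrightarrow> (\<And>j. j \<in> I \<Longrightarrow> absolutely_continuous (\<eta> j) \<nu>) \<Longrightarrow>
      (\<And>j. j \<in> I \<Longrightarrow> AE x in \<nu>. a j x = e j) \<Longrightarrow> (\<And>j. j \<in> I \<Longrightarrow> e j \<noteq> 0) \<Longrightarrow>
      A \<in> sets borel \<Longrightarrow> emeasure w A = 0 \<Longrightarrow>
      AE x in \<nu>. x \<notin> A \<and> (\<exists>l. (\<forall>j\<in>I. l j > 0 \<and> r j x = l j *\<^sub>R e j))"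
proof -
  define H where "H = msum I \<eta>"
  have sH [measurable_cong, simp]: "sets H = sets borel" and spH [simp]: "space H = UNIV" by (simp_all add: H_def)
  have eH: "emeasure H A = (\<Sum>j\<in>I. emeasure (\<eta> j) A)" if "A \<in> sets borel" for A
    unfolding H_def by (rule emeasure_msum[OF \<eta>(2) that])
  have sp: "space (\<eta> j) = UNIV" if "j \<in> I" for j using sets_eq_imp_space_eq[OF \<eta>(2)[OF that]] by simp
  have fH: "finite_measure H"
  proof (rule finite_measureI)
    have "emeasure (\<eta> j) UNIV < \<infinity>" if "j \<in> I" for j
      using finite_measure.emeasure_finite[OF \<eta>(1)[OF that], of UNIV] by (simp add: top.not_eq_extremum)
    then have "(\<Sum>j\<in>I. emeasure (\<eta> j) UNIV) < \<infinity>" using I(1) by simp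
    then show "emeasure H (space H) \<noteq> \<infinity>" by (simp add: eH)
  qed
  interpret H: finite_measure H by (rule fH)
  have ac: "absolutely_continuous H (\<eta> j)" if j: "j \<in> I" for j
    unfolding absolutely_continuous_def
  proof
    fix A assume "A \<in> null_sets H"
    then have "A \<in> sets borel" "(\<Sum>j\<in>I. emeasure (\<eta> j) A) = 0" using eH by (auto simp: null_sets_def)
    then show "A \<in> null_sets (\<eta> j)" using j I(1) \<eta>(2)[OF j] by (auto simp: null_sets_def)
  qed
  have "\<exists>D. D \<in> borel_measurable borel \<and> (\<forall>x. 0 \<le> D x) \<and> (AE x in \<eta> j. 0 < D x) \<and> density H (\<lambda>x. ennreal (D x)) = \<eta> j"
    if j: "j \<in> I" for j
  proof -
    obtain D where D: "D \<in> borel_measurable H" "AE x in H. RN_deriv H (\<eta> j) x = ennreal (D x)" "AE x in \<eta> j. 0 < D x" "\<And>x. 0 \<le> D x"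
      by (rule H.real_RN_deriv[OF \<eta>(1)[OF j] ac[OF j]]) (use \<eta>(2)[OF j] in auto)
    have "density H (\<lambda>x. ennreal (D x)) = density H (RN_deriv H (\<eta> j))"
      using D(1,2) by (intro density_cong) auto
    also have "\<dots> = \<eta> j" by (rule H.density_RN_deriv[OF ac[OF j]]) (simp add: \<eta>(2)[OF j])
    finally show ?thesis using D by (intro exI[of _ D]) simp
  qed
  then obtain D where Dm: "\<And>j. j \<in> I \<Longrightarrow> D j \<in> borel_measurable borel" and D0: "\<And>j x. j \<in> I \<Longrightarrow> 0 \<le> D j x"
    and Dpos: "\<And>j. j \<in> I \<Longrightarrow> AE x in \<eta> j. 0 < D j x" and Dd: "\<And>j. j \<in> I \<Longrightarrow> density H (\<lambda>x. ennreal (D j x)) = \<eta> j"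
    by metis
  have am: "a j \<in> borel_measurable borel" if "j \<in> I" for j
    using borel_measurable_integrable[OF a(1)[OF that]] measurable_cong_sets[OF \<eta>(2)[OF that] refl] by blast
  define S where "S = (\<lambda>x. \<Sum>j\<in>I. norm (a j x) * D j x)"
  have Sm [measurable]: "S \<in> borel_measurable borel" unfolding S_def using am Dm by measurable
  have S0: "S x \<ge> 0" for x unfolding S_def using D0 by (intro sum_nonneg) simp
  have Sj: "norm (a j x) * D j x \<le> S x" if "j \<in> I" for j x
    unfolding S_def using that D0 I(1) by (intro member_le_sum) auto
  have iS: "integrable H S"
    unfolding S_def
  proof (rule Bochner_Integration.integrable_sum)
    fix j assume j: "j \<in> I"
    have "integrable (density H (\<lambda>x. ennreal (D j x))) (\<lambda>x. norm (a j x))"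
      unfolding Dd[OF j] by (intro integrable_norm a j)
    then have "integrable H (\<lambda>x. D j x *\<^sub>R norm (a j x))"
      by (subst (asm) integrable_density) (use am[OF j] Dm[OF j] D0[OF j] in auto)
    then show "integrable H (\<lambda>x. norm (a j x) * D j x)" by (simp add: mult.commute)
  qed
  define w where "w = density H (\<lambda>x. ennreal (S x))"
  \<comment> \<open>Where \<open>S x = 0\<close>, division gives \<open>r j x = 0\<close>; there
    \<open>D j x *\<^sub>R a j x\<close> is zero as well, so \<open>Sr\<close> holds
    everywhere.\<close>
  define r where "r = (\<lambda>j x. (D j x / S x) *\<^sub>R a j x)"
  have Sr: "S x *\<^sub>R r j x = D j x *\<^sub>R a j x" if "j \<in> I" for j x
  proof (cases "S x = 0")
    case True
    then have "norm (a j x) * D j x = 0" using Sj[OF that, of x] D0[OF that, of x] by (intro antisym) auto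
    then show ?thesis using True by auto
  qed (simp add: r_def)
  have rm: "r j \<in> borel_measurable borel" if "j \<in> I" for j
    unfolding r_def using am[OF that] Dm[OF that] by measurable
  have w: "fin_borel w"
    unfolding fin_borel_def
  proof
    have "emeasure w UNIV = (\<integral>\<^sup>+x. ennreal (S x) \<partial>H)" by (simp add: w_def emeasure_density)
    also have "\<dots> < \<infinity>" using iS S0 by (subst nn_integral_eq_integral) auto
    finally show "finite_measure w" by (intro finite_measureI) (auto simp: w_def)
  qed (simp add: w_def)
  have LXm: "(\<lambda>x. LX (f x) \<theta> x) \<in> borel_measurable borel" if "\<theta> \<in> test_functions" "f \<in> borel_measurable borel" for \<theta> f
  proof -
    have sm: "smooth \<theta>" by (rule test_smooth[OF that(1)])
    have [measurable]: "LX b \<theta> \<in> borel_measurable borel" for b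
      by (intro borel_measurable_continuous_onI smooth_continuous_on smooth_LX sm)
    have "(\<lambda>x. LX (f x) \<theta> x) = (\<lambda>x. \<Sum>b\<in>Basis. (f x \<bullet> b) * LX b \<theta> x)"
      by (intro ext, subst linear_euclidean_expansion[OF LX_linear[OF sm]]) simp
    then show ?thesis using that(2) by simp
  qed
  have adm: "admissible w I r"
    unfolding admissible_def density1_def
  proof (intro conjI ballI allI w I rm)
    fix j assume j: "j \<in> I"
    show "norm (r j x) \<le> 1" for x
      using Sj[OF j, of x] S0[of x] D0[OF j, of x] by (cases "S x = 0") (auto simp: r_def divide_simps mult.commute)
    show "r j x \<in> V 1" for x unfolding r_def by (rule subspace_scale[OF subspace_V1 a(2)[OF j]])
    fix \<theta> :: "real ^ 'n \<Rightarrow> real" assume \<theta>: "\<theta> \<in> test_functions"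
    have sm: "smooth \<theta>" by (rule test_smooth[OF \<theta>])
    have "(\<integral>x. LX (r j x) \<theta> x \<partial>w) = (\<integral>x. S x *\<^sub>R LX (r j x) \<theta> x \<partial>H)"
      unfolding w_def using LXm[OF \<theta> rm[OF j]] S0 by (intro integral_density) auto
    also have "\<dots> = (\<integral>x. LX (S x *\<^sub>R r j x) \<theta> x \<partial>H)" by (simp only: linear_scale[OF LX_linear[OF sm]])
    also have "\<dots> = (\<integral>x. D j x *\<^sub>R LX (a j x) \<theta> x \<partial>H)"
      unfolding Sr[OF j] by (simp only: linear_scale[OF LX_linear[OF sm]])
    also have "\<dots> = (\<integral>x. LX (a j x) \<theta> x \<partial>density H (\<lambda>x. ennreal (D j x)))"
      using LXm[OF \<theta> am[OF j]] Dm[OF j] D0[OF j] by (intro integral_density[symmetric]) auto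
    also have "\<dots> = 0" unfolding Dd[OF j] by (rule con[OF j \<theta>])
    finally show "(\<integral>x. LX (r j x) \<theta> x \<partial>w) = 0" .
  qed
  show ?thesis
  proof (rule that[OF adm])
    fix \<nu> :: "(real ^ 'n) measure" and e A
    assume \<nu>: "sets \<nu> = sets borel" "\<And>j. j \<in> I \<Longrightarrow> absolutely_continuous (\<eta> j) \<nu>"
      and e: "\<And>j. j \<in> I \<Longrightarrow> AE x in \<nu>. a j x = e j" "\<And>j. j \<in> I \<Longrightarrow> e j \<noteq> 0"
      and A: "A \<in> sets borel" "emeasure w A = 0"
    have tr: "AE x in \<nu>. P x" if "j \<in> I" "AE x in \<eta> j. P x" for j P
      by (rule absolutely_continuous_AE[OF _ \<nu>(2)[OF that(1)] that(2)]) (simp add: \<nu>(1) \<eta>(2)[OF that(1)])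
    have Dnu: "AE x in \<nu>. \<forall>j\<in>I. 0 < D j x" using I(1) tr[OF _ Dpos] by (simp add: AE_finite_all)
    have enu: "AE x in \<nu>. \<forall>j\<in>I. a j x = e j" using I(1) e(1) by (simp add: AE_finite_all)
    obtain k where k: "k \<in> I" using I(2) by blast
    have "AE x in w. x \<notin> A" by (rule AE_not_in) (use A in \<open>simp add: null_sets_def w_def\<close>)
    then have "AE x in H. 0 < S x \<longrightarrow> x \<notin> A" unfolding w_def by (subst (asm) AE_density) (auto simp: ennreal_less_zero_iff)
    then have "AE x in \<eta> k. 0 < S x \<longrightarrow> x \<notin> A"
      by (rule absolutely_continuous_AE[OF _ ac[OF k], rotated]) (simp add: \<eta>(2)[OF k])
    then have "AE x in \<nu>. 0 < S x \<longrightarrow> x \<notin> A" by (rule tr[OF k])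
    then show "AE x in \<nu>. x \<notin> A \<and> (\<exists>l. (\<forall>j\<in>I. l j > 0 \<and> r j x = l j *\<^sub>R e j))"
      using Dnu enu
    proof eventually_elim
      case (elim x)
      have "0 < norm (a k x) * D k x" using elim k e(2)[OF k] by simp
      then have S: "0 < S x" using Sj[OF k, of x] by linarith
      then have "\<forall>j\<in>I. D j x / S x > 0 \<and> r j x = (D j x / S x) *\<^sub>R e j" using elim by (simp add: r_def)
      moreover have "x \<notin> A" using elim S by simp
      ultimately show ?case by (intro conjI exI[of _ "\<lambda>j. D j x / S x"])
    qed
  qed
qed

text \<open>The differential of \<open>\<theta>\<close> along a horizontal \<open>\<tau>\<close> is
  the left-invariant derivative along its first-layer component, so a vanishing boundary becomes the
  divergence constraint of \<open>admissible\<close>.\<close>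

lemma boundary_LX:
  assumes e: "orthonormal_basis_of (V 1) m e" and cur: "finite_mass_current \<tau> \<eta>"
    and hor: "horizontal_current gmult m e \<tau> \<eta>" and \<theta>: "\<theta> \<in> test_functions"
  shows "(\<integral>x. LX (part (\<tau> x) 1) \<theta> x \<partial>\<eta>) = boundary (current \<tau> \<eta>) \<theta>"
proof -
  have sm: "smooth \<theta>" by (rule test_smooth[OF \<theta>])
  have one: "(1 :: nat) \<in> {1..s}" using step_pos by simp
  have s\<eta>: "sets \<eta> = sets borel" and i\<tau>: "integrable \<eta> \<tau>" using cur by (auto simp: finite_mass_current_def)
  have \<tau>m [measurable]: "\<tau> \<in> borel_measurable borel"
    using borel_measurable_integrable[OF i\<tau>] measurable_cong_sets[OF s\<eta> refl] by blast
  have pm [measurable]: "(\<lambda>x. part x 1) \<in> borel_measurable borel"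
    using linear_part[OF one] by (intro borel_measurable_continuous_onI linear_continuous_on) (simp add: linear_conv_bounded_linear)
  have [measurable]: "LX b \<theta> \<in> borel_measurable borel" for b
    by (intro borel_measurable_continuous_onI smooth_continuous_on smooth_LX sm)
  have [measurable]: "(\<lambda>x. frechet_derivative \<theta> (at x) b) \<in> borel_measurable borel" for b
    by (intro borel_measurable_continuous_onI smooth_continuous_on smooth_frechet_apply[OF sm]) auto
  have eq1: "LX (part (\<tau> x) 1) \<theta> x = (\<Sum>b\<in>Basis. (part (\<tau> x) 1 \<bullet> b) * LX b \<theta> x)" for x
    by (subst linear_euclidean_expansion[OF LX_linear[OF sm]]) simp
  have eq2: "frechet_derivative \<theta> (at x) (\<tau> x) = (\<Sum>b\<in>Basis. (\<tau> x \<bullet> b) * frechet_derivative \<theta> (at x) b)" for x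
    by (subst linear_euclidean_expansion[OF frechet_derivative_linear[OF sm]]) simp
  have m1: "(\<lambda>x. LX (part (\<tau> x) 1) \<theta> x) \<in> borel_measurable borel"
    unfolding eq1 by measurable
  have m2: "(\<lambda>x. frechet_derivative \<theta> (at x) (\<tau> x)) \<in> borel_measurable borel"
    unfolding eq2 by measurable
  have "(\<integral>x. LX (part (\<tau> x) 1) \<theta> x \<partial>\<eta>) = (\<integral>x. frechet_derivative \<theta> (at x) (\<tau> x) \<partial>\<eta>)"
  proof (rule integral_cong_AE)
    show "AE x in \<eta>. LX (part (\<tau> x) 1) \<theta> x = frechet_derivative \<theta> (at x) (\<tau> x)"
      using hor unfolding horizontal_current_def
    proof eventually_elim
      case (elim x)
      show ?case using horizontal_part[OF e elim] LX_eq[OF sm, of "part (\<tau> x) 1" x] by simp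
    qed
  qed (use m1 m2 measurable_cong_sets[OF s\<eta> refl] in blast)+
  also have "\<dots> = boundary (current \<tau> \<eta>) \<theta>"
    unfolding boundary_def current_def exterior_derivative_def
    using frechet_derivative_linear[OF sm] by (simp add: bounded_linear_Blinfun_apply linear_conv_bounded_linear)
  finally show ?thesis .
qed

end

theorem proposition7p4:
  fixes br gmult :: "real ^ 'n \<Rightarrow> real ^ 'n \<Rightarrow> real ^ 'n"
    and V :: "nat \<Rightarrow> (real ^ 'n) set"
    and s n1 :: nat
    and e :: "nat \<Rightarrow> real ^ 'n"
    and \<mu> :: "(real ^ 'n) measure"
    and U :: "nat \<Rightarrow> (real ^ 'n) set"
    and \<tau> :: "nat \<Rightarrow> nat \<Rightarrow> real ^ 'n \<Rightarrow> real ^ 'n"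
    and \<eta> :: "nat \<Rightarrow> nat \<Rightarrow> (real ^ 'n) measure"
  assumes "carnot_group br gmult V s"
    and "n1 = dim (V 1)"
    and "orthonormal_basis_of (V 1) n1 e"
    and "radon_measure \<mu>"
    and "\<And>i. U i \<in> sets borel"
    and "disjoint_family U"
    and "AE x in \<mu>. x \<in> (\<Union>i. U i)"
    and "\<And>i j. j \<in> {1..n1} \<Longrightarrow> normal_current (\<tau> i j) (\<eta> i j)"
    and "\<And>i j. j \<in> {1..n1} \<Longrightarrow> horizontal_current gmult n1 e (\<tau> i j) (\<eta> i j)"
    and "\<And>i j. j \<in> {1..n1} \<Longrightarrow> \<forall>\<phi>\<in>test_functions. boundary (current (\<tau> i j) (\<eta> i j)) \<phi> = 0"
    and "\<And>i j. j \<in> {1..n1} \<Longrightarrow> absolutely_continuous (\<eta> i j) (measure_restr \<mu> (U i))"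
    and "\<And>i j. j \<in> {1..n1} \<Longrightarrow>
           AE x in \<mu>. x \<in> U i \<longrightarrow> \<tau> i j x = horizontal_map gmult n1 e x (e j)"
  shows "absolutely_continuous lborel \<mu>"
proof -
  interpret carnot br gmult V s using assms(1) by (simp add: carnot_def)
  note e = assms(3)
  have one: "(1 :: nat) \<in> {1..s}" using step_pos by simp
  have \<mu>: "sets \<mu> = sets borel" using assms(4) by (simp add: radon_measure_def)
  have n1: "{1..n1} \<noteq> {}"
  proof
    assume "{1..n1} = {}"
    then have "V 1 = span {}" using e unfolding orthonormal_basis_of_def by simp
    then show False using V1_unit_exists by auto
  qed
  have eV: "e j \<in> V 1" and e0: "e j \<noteq> 0" if "j \<in> {1..n1}" for j
  proof -
    have "e j \<in> span (e ` {1..n1})" using that by (intro span_base imageI)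
    then show "e j \<in> V 1" using e by (simp add: orthonormal_basis_of_def)
    have "e j \<bullet> e j = 1" using e that by (simp add: orthonormal_basis_of_def)
    then show "e j \<noteq> 0" by auto
  qed
  \<comment> \<open>Each cell is treated with a measure \<open>w\<close> of its own, since the
    currents of different cells are unrelated; countably many cells can be combined at the
    end.\<close>
  have cell: "AE x in \<mu>. x \<in> U i \<longrightarrow> x \<notin> N" if N: "N \<in> sets borel" "emeasure lborel N = 0" for N i
  proof -
    define \<nu> where "\<nu> = measure_restr \<mu> (U i)"
    have \<nu>: "sets \<nu> = sets borel" by (simp add: \<nu>_def measure_restr_def \<mu>)
    have AE\<nu>: "(AE x in \<nu>. P x) \<longleftrightarrow> (AE x in \<mu>. x \<in> U i \<longrightarrow> P x)" for P
    proof -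
      have "(indicator (U i) :: _ \<Rightarrow> ennreal) \<in> borel_measurable \<mu>" using assms(5)[of i] \<mu> by simp
      then show ?thesis unfolding \<nu>_def measure_restr_def by (simp add: AE_density indicator_def)
    qed
    have fm: "finite_mass_current (\<tau> i j) (\<eta> i j)" if "j \<in> {1..n1}" for j
      using assms(8)[OF that] by (simp add: normal_current_def)
    have bl: "bounded_linear (\<lambda>x. part x 1)" using linear_part[OF one] by (simp add: linear_conv_bounded_linear)
    obtain w r where adm: "admissible w {1..n1} r" and
      trans: "\<And>(\<nu> :: (real ^ 'n) measure) e A. sets \<nu> = sets borel \<Longrightarrow> (\<And>j. j \<in> {1..n1} \<Longrightarrow> absolutely_continuous (\<eta> i j) \<nu>) \<Longrightarrow>
        (\<And>j. j \<in> {1..n1} \<Longrightarrow> AE x in \<nu>. part (\<tau> i j x) 1 = e j) \<Longrightarrow> (\<And>j. j \<in> {1..n1} \<Longrightarrow> e j \<noteq> 0) \<Longrightarrow>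
        A \<in> sets borel \<Longrightarrow> emeasure w A = 0 \<Longrightarrow>
        AE x in \<nu>. x \<notin> A \<and> (\<exists>l. (\<forall>j\<in>{1..n1}. l j > 0 \<and> r j x = l j *\<^sub>R e j))"
    proof (rule common_density[of "{1..n1}" "\<eta> i" "\<lambda>j x. part (\<tau> i j x) 1"])
      fix j assume j: "j \<in> {1..n1}"
      show "finite_measure (\<eta> i j)" "sets (\<eta> i j) = sets borel" using fm[OF j] by (auto simp: finite_mass_current_def)
      show "integrable (\<eta> i j) (\<lambda>x. part (\<tau> i j x) 1)"
        using fm[OF j] by (intro integrable_bounded_linear[OF bl]) (simp add: finite_mass_current_def)
      show "part (\<tau> i j x) 1 \<in> V 1" for x by (rule part_layer[OF one])
      fix \<theta> :: "real ^ 'n \<Rightarrow> real" assume \<theta>: "\<theta> \<in> test_functions"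
      show "(\<integral>x. LX (part (\<tau> i j x) 1) \<theta> x \<partial>\<eta> i j) = 0"
        using boundary_LX[OF e fm[OF j] assms(9)[OF j] \<theta>] assms(10)[OF j] \<theta> by simp
    qed (use n1 in auto)
    \<comment> \<open>\<open>w\<close> does not charge \<open>A\<close>, and \<open>trans\<close>
      carries this over to \<open>\<nu>\<close>. At \<open>\<nu>\<close>-almost every point the
      directions are positive multiples of the basis, so \<open>psi\<close> is positive and a point
      of \<open>N\<close> would lie in \<open>A\<close>.\<close>
    define A where "A = {x \<in> N. psi {1..n1} (\<lambda>j. r j x) > 0}"
    have A: "emeasure w A = 0" unfolding A_def by (rule elliptic_part_not_null[OF adm N])
    have [measurable]: "(\<lambda>x. psi {1..n1} (\<lambda>j. r j x)) \<in> borel_measurable borel"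
      using adm by (intro psi_borel) (auto simp: admissible_def density1_def)
    have Am: "A \<in> sets borel" unfolding A_def using N(1) by measurable
    have dir: "AE x in \<nu>. part (\<tau> i j x) 1 = e j" if j: "j \<in> {1..n1}" for j
      unfolding AE\<nu> using assms(12)[OF j, of i]
    proof eventually_elim
      case (elim x)
      then show ?case using part_left_field[OF eV[OF j], of x] by (simp add: horizontal_map_basis[OF e j])
    qed
    have "AE x in \<nu>. x \<notin> A \<and> (\<exists>l. (\<forall>j\<in>{1..n1}. l j > 0 \<and> r j x = l j *\<^sub>R e j))"
      by (rule trans[OF \<nu> _ dir e0 Am A]) (use assms(11) in \<open>auto simp: \<nu>_def\<close>)
    then have "AE x in \<nu>. x \<notin> N"
    proof eventually_elim
      case (elim x)
      then obtain l where l: "\<And>j. j \<in> {1..n1} \<Longrightarrow> l j > 0" "\<And>j. j \<in> {1..n1} \<Longrightarrow> r j x = l j *\<^sub>R e j" by blast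
      have "psi {1..n1} (\<lambda>j. r j x) = psi {1..n1} (\<lambda>j. l j *\<^sub>R e j)"
        unfolding psi_def by (intro INF_cong refl sum.cong) (simp_all only: l(2))
      then have "psi {1..n1} (\<lambda>j. r j x) > 0" using psi_basis_pos[of n1 e l, OF e l(1)] by simp
      then show ?case using elim by (simp add: A_def)
    qed
    then show ?thesis unfolding AE\<nu> .
  qed
  show ?thesis
    unfolding absolutely_continuous_def
  proof
    fix N :: "(real ^ 'n) set" assume "N \<in> null_sets lborel"
    then have N: "N \<in> sets borel" "emeasure lborel N = 0" by (auto simp: null_sets_def)
    have "AE x in \<mu>. \<forall>i. x \<in> U i \<longrightarrow> x \<notin> N" unfolding AE_all_countable using cell[OF N] by blast
    then have "AE x in \<mu>. x \<notin> N" using assms(7) by eventually_elim blast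
    then show "N \<in> null_sets \<mu>" using N(1) \<mu> by (simp add: AE_iff_null_sets)
  qed
qed

end
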